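(* Assume the standing assumptions and condition (B), with the $B_\ell$ defined for $y_0$ in an open set containing $B_R=B(x_0,R)$, $0<R\le1$, and assume $[\delta]_1<\infty$ and $[\delta]_{1+\rho}<\infty$ for some $\rho>0$. Suppose there is $N\ge1$ such that $$\Big(\frac{\varepsilon_{k+1}}{\varepsilon_k}\Big)^N\le\frac{\varepsilon_{i+1}}{\varepsilon_i}\le\Big(\frac{\varepsilon_{k+1}}{\varepsilon_k}\Big)^{1/N}\quad\text{for all }k>i\ge0.$$ Let $u_\varepsilon$ be a weak solution of $-\mathrm{div}(A^\varepsilon\nabla u_\varepsilon)=f$ in $B_R$ with $f\in L^p(B_R)$, $p>d$. Then (with no smallness assumption on $\varepsilon_1$) $$\|\nabla u_\varepsilon\|_{L^\infty(B_{R/2})}\le C\Big\{\Big(\fint_{B_R}|\nabla u_\varepsilon|^2\Big)^{1/2}+R\Big(\fint_{B_R}|f|^p\Big)^{1/p}\Big\},$$ where $C$ depends only on $d,\mu,p,N,\rho,[\delta]_0,[\delta]_1,[\delta]_{1+\rho}$.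
   Context: Setting. For each integer $\ell\ge0$ let $B_\ell=B_\ell(y_0,y_1,\dots,y_\ell)$ be a continuous real $d\times d$ matrix-valued function of $y_0$ in an open set $\Omega_0\subseteq\mathbb{R}^d$ and $y_1,\dots,y_\ell\in\mathbb{R}^d$, and $A_n=\sum_{\ell=0}^nB_\ell$. Standing assumptions: (ellipticity) there is $\mu>0$ with $\xi\cdot A_n\xi\ge\mu|\xi|^2$ for all $n$, all arguments, all $\xi$; (boundedness) $\sum_\ell\|B_\ell\|_{L^\infty}\le\mu^{-1}$; (periodicity) $A_n$ is invariant under $(y_1,\dots,y_n)\mapsto(y_1+z_1,\dots,y_n+z_n)$, $z_i\in\mathbb{Z}^d$. Scales $1=\varepsilon_0>\varepsilon_1>\varepsilon_2>\cdots>0$, $\varepsilon_n\to0$; $A_n^\varepsilon(x)=A_n(x,x/\varepsilon_1,\dots,x/\varepsilon_n)$, $A^\varepsilon=\lim_nA^\varepsilon_n$ uniformly. Condition (B): there is $\delta=(\delta_0,\delta_1,\dots)$, $\delta_\ell\ge0$, with $\max\{\|B_\ell\|_{L^\infty},\max_{0\le j\le\ell}\|\nabla_{y_j}B_\ell\|_{L^\infty}\}\le\delta_\ell$ and $[\delta]_0:=\sum_{\ell\ge0}\delta_\ell<\infty$; for $\alpha>0$, $[\delta]_\alpha:=\sum_{\ell\ge1}\ell^\alpha\delta_\ell$. *)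

theory Defs
  imports "HOL-Analysis.Analysis"
begin

definition mat_opnorm :: "real^'d^'d \<Rightarrow> real" where
  "mat_opnorm M = onorm (\<lambda>v. M *v v)"

text \<open>The argument (y_0, y_1, y_2, ...) is a sequence of points of R^d;
  B l is required to depend on y_0, ..., y_l only.\<close>
definition An :: "(nat \<Rightarrow> (nat \<Rightarrow> real^'d) \<Rightarrow> real^'d^'d) \<Rightarrow> nat \<Rightarrow> (nat \<Rightarrow> real^'d) \<Rightarrow> real^'d^'d" where
  "An B n y = (\<Sum>l\<le>n. B l y)"

definition scaled_args :: "(nat \<Rightarrow> real) \<Rightarrow> real^'d \<Rightarrow> nat \<Rightarrow> real^'d" where
  "scaled_args eps x j = (if j = 0 then x else (1 / eps j) *\<^sub>R x)"

definition Aeps :: "(nat \<Rightarrow> (nat \<Rightarrow> real^'d) \<Rightarrow> real^'d^'d) \<Rightarrow> (nat \<Rightarrow> real) \<Rightarrow> real^'d \<Rightarrow> real^'d^'d" where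
  "Aeps B eps x = (\<Sum>l. B l (scaled_args eps x))"

definition int_vec :: "real^'d \<Rightarrow> bool" where
  "int_vec z \<longleftrightarrow> (\<forall>i. z $ i \<in> \<int>)"

definition standing_B ::
  "(nat \<Rightarrow> (nat \<Rightarrow> real^'d) \<Rightarrow> real^'d^'d) \<Rightarrow> (real^'d) set \<Rightarrow> real \<Rightarrow> (nat \<Rightarrow> real) \<Rightarrow> bool" where
  "standing_B B Om \<mu> \<delta> \<longleftrightarrow>
     open Om \<and>
     \<comment> \<open>B l depends only on y_0,...,y_l\<close>
     (\<forall>l y y'. (\<forall>j\<le>l. y j = y' j) \<longrightarrow> B l y = B l y') \<and>
     \<comment> \<open>continuity\<close>
     (\<forall>l. continuous_on {y. y 0 \<in> Om} (B l)) \<and>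
     \<comment> \<open>ellipticity\<close>
     (\<forall>n y \<xi>. y 0 \<in> Om \<longrightarrow> \<xi> \<bullet> (An B n y *v \<xi>) \<ge> \<mu> * (norm \<xi>)\<^sup>2) \<and>
     \<comment> \<open>boundedness: sum_l ||B_l||_infty <= 1/mu\<close>
     summable (\<lambda>l. SUP y\<in>{y. y 0 \<in> Om}. mat_opnorm (B l y)) \<and>
     (\<Sum>l. SUP y\<in>{y. y 0 \<in> Om}. mat_opnorm (B l y)) \<le> 1 / \<mu> \<and>
     \<comment> \<open>periodicity of A_n in y_1, ..., y_n\<close>
     (\<forall>n y z. y 0 \<in> Om \<longrightarrow> z 0 = 0 \<longrightarrow> (\<forall>j. int_vec (z j)) \<longrightarrow>
        An B n (\<lambda>j. y j + z j) = An B n y) \<and>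
     \<comment> \<open>condition (B)\<close>
     (\<forall>l. \<delta> l \<ge> 0) \<and> summable \<delta> \<and>
     (\<forall>l y. y 0 \<in> Om \<longrightarrow> mat_opnorm (B l y) \<le> \<delta> l) \<and>
     \<comment> \<open>||grad_{y_0} B_l||_infty <= delta_l (Lipschitz along segments in Om)\<close>
     (\<forall>l y t. y 0 \<in> Om \<longrightarrow> closed_segment (y 0) t \<subseteq> Om \<longrightarrow>
        mat_opnorm (B l (y(0 := t)) - B l y) \<le> \<delta> l * norm (t - y 0)) \<and>
     \<comment> \<open>||grad_{y_j} B_l||_infty <= delta_l for 1 <= j <= l\<close>
     (\<forall>l j y t. 1 \<le> j \<longrightarrow> j \<le> l \<longrightarrow> y 0 \<in> Om \<longrightarrow>
        mat_opnorm (B l (y(j := t)) - B l y) \<le> \<delta> l * norm (t - y j))"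

definition scales :: "(nat \<Rightarrow> real) \<Rightarrow> bool" where
  "scales eps \<longleftrightarrow> eps 0 = 1 \<and> (\<forall>n. eps n > 0) \<and> (\<forall>n. eps (Suc n) < eps n) \<and> eps \<longlonglongrightarrow> 0"

definition ratio_cond :: "(nat \<Rightarrow> real) \<Rightarrow> real \<Rightarrow> bool" where
  "ratio_cond eps N \<longleftrightarrow>
     (\<forall>i k. i < k \<longrightarrow>
        (eps (Suc k) / eps k) powr N \<le> eps (Suc i) / eps i \<and>
        eps (Suc i) / eps i \<le> (eps (Suc k) / eps k) powr (1 / N))"

definition partial :: "'d \<Rightarrow> (real^'d \<Rightarrow> real) \<Rightarrow> real^'d \<Rightarrow> real" where
  "partial i f x = deriv (\<lambda>t. f (x + t *\<^sub>R axis i 1)) 0"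

fun ipartial :: "'d list \<Rightarrow> (real^'d \<Rightarrow> real) \<Rightarrow> real^'d \<Rightarrow> real" where
  "ipartial [] f = f"
| "ipartial (i # is) f = partial i (ipartial is f)"

definition smooth_fun :: "(real^'d \<Rightarrow> real) \<Rightarrow> bool" where
  "smooth_fun f \<longleftrightarrow>
     (\<forall>is. continuous_on UNIV (ipartial is f) \<and>
       (\<forall>i x. (\<lambda>t. ipartial is f (x + t *\<^sub>R axis i 1)) differentiable (at 0)))"

definition tsupport :: "(real^'d \<Rightarrow> real) \<Rightarrow> (real^'d) set" where
  "tsupport f = closure {x. f x \<noteq> 0}"

definition test_fun :: "(real^'d) set \<Rightarrow> (real^'d \<Rightarrow> real) \<Rightarrow> bool" where
  "test_fun U \<phi> \<longleftrightarrow> smooth_fun \<phi> \<and> compact (tsupport \<phi>) \<and> tsupport \<phi> \<subseteq> U"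

definition grad :: "(real^'d \<Rightarrow> real) \<Rightarrow> real^'d \<Rightarrow> real^'d" where
  "grad f x = (\<chi> i. partial i f x)"

definition H1_with_grad :: "(real^'d) set \<Rightarrow> (real^'d \<Rightarrow> real) \<Rightarrow> (real^'d \<Rightarrow> real^'d) \<Rightarrow> bool" where
  "H1_with_grad U u G \<longleftrightarrow>
     set_borel_measurable lebesgue U u \<and> set_integrable lebesgue U (\<lambda>x. (u x)\<^sup>2) \<and>
     set_borel_measurable lebesgue U G \<and> set_integrable lebesgue U (\<lambda>x. (norm (G x))\<^sup>2) \<and>
     (\<forall>\<phi> i. test_fun U \<phi> \<longrightarrow>
        (LINT x:U|lebesgue. u x * partial i \<phi> x) = - (LINT x:U|lebesgue. G x $ i * \<phi> x))"

definition weak_solution ::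
  "(real^'d \<Rightarrow> real^'d^'d) \<Rightarrow> (real^'d \<Rightarrow> real) \<Rightarrow> (real^'d) set \<Rightarrow> (real^'d \<Rightarrow> real) \<Rightarrow> (real^'d \<Rightarrow> real^'d) \<Rightarrow> bool" where
  "weak_solution A f U u G \<longleftrightarrow>
     H1_with_grad U u G \<and>
     (\<forall>\<phi>. test_fun U \<phi> \<longrightarrow>
        (LINT x:U|lebesgue. (A x *v G x) \<bullet> grad \<phi> x) = (LINT x:U|lebesgue. f x * \<phi> x))"

definition Lp_on :: "real \<Rightarrow> (real^'d) set \<Rightarrow> (real^'d \<Rightarrow> real) \<Rightarrow> bool" where
  "Lp_on p U f \<longleftrightarrow> set_borel_measurable lebesgue U f \<and> set_integrable lebesgue U (\<lambda>x. \<bar>f x\<bar> powr p)"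

definition avg_int :: "(real^'d) set \<Rightarrow> (real^'d \<Rightarrow> real) \<Rightarrow> real" where
  "avg_int U g = (LINT x:U|lebesgue. g x) / measure lebesgue U"

end

theory Submission
  imports Defs "HOL-Computational_Algebra.Polynomial"
begin

text \<open>No homogenised equation is used. At radius \<open>t\<close> each shift of size comparable to \<open>t\<close> is within \<open>e\<close> of a vector
  \<open>\<tau>\<close> under which the coefficients change by at most \<open>\<omega>\<close>, so \<open>u(x + \<tau>) - u(x)\<close> is again almost a solution. Applying
  this to a difference of \<open>u\<close> along a small almost period, written as the average of a long difference minus second
  differences, shows that the second differences of \<open>u\<close>, normalised by \<open>t\<close>, are halved when the radius shrinks by a
  fixed factor, up to \<open>\<omega> + e / t\<close> times the size of the gradient. As the first differences grow by at most the
  second ones, a discrete Gronwall argument over the radii \<open>t\<^sub>i = R / (16 m\<^sup>i)\<close> bounds averages of the gradient on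
  arbitrarily small balls by \<open>exp (C \<Sum>\<^sub>i (\<omega>\<^sub>i + e\<^sub>i / t\<^sub>i))\<close> times the right-hand side. All this needs only the
  Caccioppoli inequality and is carried out for mollified solutions.

  For \<open>\<epsilon>\<^bsub>k+1\<^esub> < t \<le> \<epsilon>\<^sub>k\<close>, scales up to \<open>\<epsilon>\<^sub>k\<close> contribute \<open>t / \<epsilon>\<^sub>j\<close> per level, a geometric series in \<open>t\<close>. The finer
  scales are either ignored, at the price of the tail \<open>\<Sum>\<^bsub>l > k\<^esub> \<delta>\<^sub>l\<close>, or the shift is rounded successively to the
  lattices of periods \<open>\<epsilon>\<^bsub>k+1\<^esub>, \<epsilon>\<^bsub>k+2\<^esub>, \<dots>\<close>, at the price of \<open>\<epsilon>\<^bsub>k+1\<^esub> / t\<close> and of the small ratios of consecutive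
  scales. The smaller of the two costs is summable: the ratio condition bounds the number of radii per scale by a
  logarithm of \<open>1 / \<epsilon>\<^sub>1\<close>, which a power of the ratio absorbs, and the weighted sums of \<open>\<delta>\<close> control the rest.\<close>

subsection \<open>Normalised mean-square norms on balls\<close>

text \<open>The short difference is a mean of \<open>n\<close> terms, which saves
  \<open>1 / n\<close>; but its gradient is needed on a ball smaller by the factor \<open>n\<close>,
  where plain averaging loses \<open>n powr (d / 2)\<close>. From \<open>d = 2\<close> on nothing
  would be left, so the gradient must first be shown to grow with an exponent below 1 when the
  radius shrinks. The same differences provide this: one improvement turns an admissible exponent
  \<beta> into \<open>\<beta> * d / (d + 2)\<close>, and finitely many steps lead from
  \<open>d / 2\<close> to \<open>1 / 2\<close>. What remains is \<open>1 / sqrt n\<close>, and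
  \<open>n\<close> is then taken large.

  Large and small \<open>eps 1\<close> are treated separately, divided at
  \<open>r = eps 1 powr (1 / N)\<close>, an upper bound for all ratios of consecutive scales. For
  \<open>r \<ge> 1 / 2\<close> boundedly many radii fall between two scales, and ignoring the fast
  levels throughout is summable. For \<open>r < 1 / 2\<close> rounding to finer and finer lattices
  converges geometrically.

  For mollification only uniform continuity of the coefficients is at hand. This is enough, because
  for each target radius only finitely many commutators occur and the kernel width is chosen
  afterwards.\<close>

definition sq_int :: "'a::euclidean_space \<Rightarrow> real \<Rightarrow> ('a \<Rightarrow> 'b::real_normed_vector) \<Rightarrow> real" where
  "sq_int y t F = (LINT x:cball y t|lborel. (norm (F x))\<^sup>2)"

text \<open>The power of \<open>t\<close> replaces the volume of the ball, so that changes of radius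
  cost pure powers of the ratio; the volume of the unit ball returns only when such norms are
  compared with true averages.\<close>

definition L2n :: "'a::euclidean_space \<Rightarrow> real \<Rightarrow> ('a \<Rightarrow> 'b::real_normed_vector) \<Rightarrow> real" where
  "L2n y t F = sqrt (sq_int y t F / t ^ DIM('a))"

lemma set_integrable_cball_continuous:
  fixes F :: "'a::euclidean_space \<Rightarrow> 'b::{banach,second_countable_topology}"
  assumes "continuous_on UNIV F"
  shows "set_integrable lborel (cball y t) F"
  unfolding set_integrable_def
  by (rule borel_integrable_compact) (auto intro: continuous_on_subset[OF assms])

lemma continuous_norm_sq: "continuous_on S F \<Longrightarrow> continuous_on S (\<lambda>x. (norm (F x :: 'b::real_normed_vector))\<^sup>2)"
  by (intro continuous_intros)

lemma set_integral_nonneg':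
  fixes f :: "'a \<Rightarrow> real" shows "(\<And>x. x \<in> A \<Longrightarrow> 0 \<le> f x) \<Longrightarrow> 0 \<le> (LINT x:A|M. f x)"
  unfolding set_lebesgue_integral_def
  by (rule Bochner_Integration.integral_nonneg) (auto simp: indicator_def)

lemma sq_int_nonneg: "0 \<le> sq_int y t F"
  unfolding sq_int_def by (rule set_integral_nonneg') auto

lemma L2n_nonneg: "0 \<le> t \<Longrightarrow> 0 \<le> L2n y t F"
  unfolding L2n_def by (simp add: sq_int_nonneg)

lemma L2n_sq: "0 < t \<Longrightarrow> (L2n (y::'a::euclidean_space) t F)\<^sup>2 = sq_int y t F / t ^ DIM('a)"
  unfolding L2n_def by (simp add: sq_int_nonneg)

lemma sq_int_eq: "0 < t \<Longrightarrow> sq_int (y::'a::euclidean_space) t F = t ^ DIM('a) * (L2n y t F)\<^sup>2"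
  by (simp add: L2n_sq)

lemma sq_int_mono:
  assumes "continuous_on UNIV F" "continuous_on UNIV G" "\<And>x. x \<in> cball y t \<Longrightarrow> norm (F x) \<le> norm (G x)"
  shows "sq_int y t F \<le> sq_int y t G"
  unfolding sq_int_def
  by (rule set_integral_mono)
     (auto intro!: set_integrable_cball_continuous continuous_norm_sq assms power_mono)

lemma L2n_mono:
  assumes "continuous_on UNIV F" "continuous_on UNIV G" "0 < t" "\<And>x. x \<in> cball y t \<Longrightarrow> norm (F x) \<le> norm (G x)"
  shows "L2n y t F \<le> L2n y t G"
  unfolding L2n_def using sq_int_mono[OF assms(1,2,4)] assms(3) by (simp add: divide_right_mono)

lemma L2n_cong: "(\<And>x. x \<in> cball y t \<Longrightarrow> norm (F x) = norm (G x)) \<Longrightarrow> L2n y t F = L2n y t G"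
  unfolding L2n_def sq_int_def by (auto intro!: arg_cong[where f=sqrt] arg_cong2[where f="(/)"] set_lebesgue_integral_cong)

lemma L2n_norm: "L2n y t (\<lambda>x. norm (F x)) = L2n y t F"
  by (rule L2n_cong) simp

lemma L2n_minus: "L2n y t (\<lambda>x. - F x) = L2n y t F"
  by (rule L2n_cong) simp

lemma L2n_scaleR: assumes "0 < t" shows "L2n y t (\<lambda>x. c *\<^sub>R F x) = \<bar>c\<bar> * L2n y t F"
proof -
  have "sq_int y t (\<lambda>x. c *\<^sub>R F x) = c\<^sup>2 * sq_int y t F"
    unfolding sq_int_def by (simp add: power_mult_distrib)
  then show ?thesis unfolding L2n_def
    by (metis real_sqrt_abs real_sqrt_mult times_divide_eq_right)
qed

text \<open>Cauchy--Schwarz is obtained from the discriminant of the nonnegative quadratic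
  \<open>\<lambda> \<mapsto> \<integral> (f - \<lambda> g)\<^sup>2\<close>.\<close>

lemma set_integral_Cauchy_Schwarz:
  fixes f g :: "'a \<Rightarrow> real"
  assumes int: "set_integrable M A (\<lambda>x. (f x)\<^sup>2)" "set_integrable M A (\<lambda>x. (g x)\<^sup>2)" "set_integrable M A (\<lambda>x. f x * g x)"
  shows "(LINT x:A|M. f x * g x)\<^sup>2 \<le> (LINT x:A|M. (f x)\<^sup>2) * (LINT x:A|M. (g x)\<^sup>2)"
proof -
  let ?A = "LINT x:A|M. (f x)\<^sup>2" and ?B = "LINT x:A|M. f x * g x" and ?C = "LINT x:A|M. (g x)\<^sup>2"
  have q: "0 \<le> ?A - 2 * l * ?B + l\<^sup>2 * ?C" for l
  proof -
    have "0 \<le> (LINT x:A|M. (f x - l * g x)\<^sup>2)"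
      by (rule set_integral_nonneg') auto
    also have "(\<lambda>x. (f x - l * g x)\<^sup>2) = (\<lambda>x. (f x)\<^sup>2 - 2 * l * (f x * g x) + l\<^sup>2 * (g x)\<^sup>2)"
      by (auto simp: power2_eq_square algebra_simps)
    also have "(LINT x:A|M. (f x)\<^sup>2 - 2 * l * (f x * g x) + l\<^sup>2 * (g x)\<^sup>2)
      = ?A - (LINT x:A|M. 2 * l * (f x * g x)) + (LINT x:A|M. l\<^sup>2 * (g x)\<^sup>2)"
      by (subst set_integral_add set_integral_diff, (intro set_integral_diff set_integrable_mult_right int)+)+ simp
    finally show ?thesis by simp
  qed
  have C0: "0 \<le> ?C" by (rule set_integral_nonneg') auto
  show ?thesis
  proof (cases "?C = 0")
    case True
    have "?B = 0"
    proof (rule ccontr)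
      assume B: "?B \<noteq> 0"
      \<comment> \<open>With \<open>?C = 0\<close> the quadratic is affine in the parameter, and
        this value would bring it down to -1.\<close>
      have "0 \<le> ?A - 2 * ((?A + 1) / (2 * ?B)) * ?B + ((?A + 1) / (2 * ?B))\<^sup>2 * ?C" by (rule q)
      also have "\<dots> = -1" using True B by (simp add: field_simps)
      finally show False by simp
    qed
    then show ?thesis using True by simp
  next
    case False
    then have C: "?C > 0" using C0 by linarith
    have "0 \<le> ?A - 2 * (?B / ?C) * ?B + (?B / ?C)\<^sup>2 * ?C" by (rule q)
    also have "\<dots> = ?A - ?B\<^sup>2 / ?C" using C by (simp add: field_simps power2_eq_square)
    finally show ?thesis using C by (simp add: field_simps)
  qed
qed

lemma L2n_Cauchy_Schwarz:
  fixes f g :: "'a::euclidean_space \<Rightarrow> real"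
  assumes f: "continuous_on UNIV f" and g: "continuous_on UNIV g" and t: "0 < t"
  shows "\<bar>LINT x:cball y t|lborel. f x * g x\<bar> \<le> t ^ DIM('a) * L2n y t f * L2n y t g"
proof -
  have "(LINT x:cball y t|lborel. f x * g x)\<^sup>2 \<le> (LINT x:cball y t|lborel. (f x)\<^sup>2) * (LINT x:cball y t|lborel. (g x)\<^sup>2)"
    by (rule set_integral_Cauchy_Schwarz) (auto intro!: set_integrable_cball_continuous continuous_intros f g)
  then have "\<bar>LINT x:cball y t|lborel. f x * g x\<bar> \<le> sqrt (sq_int y t f * sq_int y t g)"
    unfolding sq_int_def by (simp add: real_le_rsqrt)
  also have "\<dots> = t ^ DIM('a) * L2n y t f * L2n y t g"
    using t sq_int_nonneg[of y t f] sq_int_nonneg[of y t g]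
    by (simp add: L2n_def real_sqrt_divide real_sqrt_mult field_simps)
  finally show ?thesis .
qed

lemma L2n_triangle:
  fixes F G :: "'a::euclidean_space \<Rightarrow> 'b::real_normed_vector"
  assumes F: "continuous_on UNIV F" and G: "continuous_on UNIV G" and t: "0 < t"
  shows "L2n y t (\<lambda>x. F x + G x) \<le> L2n y t F + L2n y t G"
proof -
  let ?f = "\<lambda>x. norm (F x)" and ?g = "\<lambda>x. norm (G x)"
  have c: "continuous_on UNIV ?f" "continuous_on UNIV ?g" by (intro continuous_intros F G)+
  have int: "set_integrable lborel (cball y t) (\<lambda>x. (?f x)\<^sup>2)" "set_integrable lborel (cball y t) (\<lambda>x. (?g x)\<^sup>2)"
      "set_integrable lborel (cball y t) (\<lambda>x. 2 * (?f x * ?g x))"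
    by (auto intro!: set_integrable_cball_continuous continuous_intros F G)
  have "sq_int y t (\<lambda>x. F x + G x) \<le> (LINT x:cball y t|lborel. (?f x)\<^sup>2 + (?g x)\<^sup>2 + 2 * (?f x * ?g x))"
    unfolding sq_int_def
  proof (rule set_integral_mono)
    show "set_integrable lborel (cball y t) (\<lambda>x. (norm (F x + G x))\<^sup>2)"
      by (auto intro!: set_integrable_cball_continuous continuous_intros F G)
    show "set_integrable lborel (cball y t) (\<lambda>x. (?f x)\<^sup>2 + (?g x)\<^sup>2 + 2 * (?f x * ?g x))"
      by (intro set_integral_add int)
    show "(norm (F x + G x))\<^sup>2 \<le> (?f x)\<^sup>2 + (?g x)\<^sup>2 + 2 * (?f x * ?g x)" for x
      using power_mono[OF norm_triangle_ineq[of "F x" "G x"], of 2] by (simp add: power2_sum)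
  qed
  also have "\<dots> = sq_int y t F + sq_int y t G + 2 * (LINT x:cball y t|lborel. ?f x * ?g x)"
    unfolding sq_int_def by (subst set_integral_add, intro set_integral_add int, rule int)
       (subst set_integral_add, intro int, rule int, simp)
  also have "\<dots> \<le> t ^ DIM('a) * (L2n y t F)\<^sup>2 + t ^ DIM('a) * (L2n y t G)\<^sup>2 + 2 * (t ^ DIM('a) * L2n y t F * L2n y t G)"
    using L2n_Cauchy_Schwarz[OF c t, of y] by (simp add: sq_int_eq[OF t] L2n_norm)
  also have "\<dots> = t ^ DIM('a) * (L2n y t F + L2n y t G)\<^sup>2" by (simp add: power2_sum algebra_simps)
  finally have "(L2n y t (\<lambda>x. F x + G x))\<^sup>2 \<le> (L2n y t F + L2n y t G)\<^sup>2"
    using t by (simp add: sq_int_eq[OF t])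
  then show ?thesis
    using L2n_nonneg[of t y F] L2n_nonneg[of t y G] t by (meson add_nonneg_nonneg less_imp_le power2_le_imp_le)
qed

lemma L2n_triangle_diff:
  fixes F G :: "'a::euclidean_space \<Rightarrow> 'b::real_normed_vector"
  assumes F: "continuous_on UNIV F" and G: "continuous_on UNIV G" and t: "0 < t"
  shows "L2n y t (\<lambda>x. F x - G x) \<le> L2n y t F + L2n y t G"
  using L2n_triangle[OF F continuous_on_minus[OF G] t, of y] L2n_minus[of y t G] by simp

lemma L2n_sum:
  fixes F :: "'i \<Rightarrow> 'a::euclidean_space \<Rightarrow> 'b::real_normed_vector"
  assumes "finite I" "\<And>i. i \<in> I \<Longrightarrow> continuous_on UNIV (F i)" and t: "0 < t"
  shows "L2n y t (\<lambda>x. \<Sum>i\<in>I. F i x) \<le> (\<Sum>i\<in>I. L2n y t (F i))"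
  using assms(1,2)
proof (induction I rule: finite_induct)
  case empty
  show ?case by (simp add: L2n_def sq_int_def)
next
  case (insert i I)
  have "L2n y t (\<lambda>x. F i x + (\<Sum>i\<in>I. F i x)) \<le> L2n y t (F i) + L2n y t (\<lambda>x. \<Sum>i\<in>I. F i x)"
    by (intro L2n_triangle continuous_on_sum t) (auto intro: insert)
  then show ?case using insert by (fastforce simp: )
qed

text \<open>The centres may differ. The factor is the loss of plain averaging and the origin of the
  exponent \<open>d / 2\<close> in \<open>grad_decay_base\<close>.\<close>

lemma L2n_ball_mono:
  fixes F :: "'a::euclidean_space \<Rightarrow> 'b::real_normed_vector"
  assumes F: "continuous_on UNIV F" and s: "0 < s" and t: "0 < t" and sub: "cball y s \<subseteq> cball y' t"
  shows "L2n y s F \<le> sqrt ((t / s) ^ DIM('a)) * L2n y' t F"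
proof -
  have "sq_int y s F \<le> sq_int y' t F"
    unfolding sq_int_def
    unfolding set_lebesgue_integral_def
  proof (rule Bochner_Integration.integral_mono)
    show "integrable lborel (\<lambda>x. indicat_real (cball y s) x *\<^sub>R (norm (F x))\<^sup>2)"
         "integrable lborel (\<lambda>x. indicat_real (cball y' t) x *\<^sub>R (norm (F x))\<^sup>2)"
      using set_integrable_cball_continuous[OF continuous_norm_sq[OF F]] unfolding set_integrable_def by auto
  qed (use sub in \<open>auto simp: indicator_def\<close>)
  then have "L2n y s F \<le> sqrt (sq_int y' t F / s ^ DIM('a))"
    unfolding L2n_def using s by (simp add: divide_right_mono)
  also have "\<dots> = sqrt ((t / s) ^ DIM('a)) * L2n y' t F"
    unfolding L2n_def using s t by (simp add: power_divide real_sqrt_mult[symmetric])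
  finally show ?thesis .
qed

lemma set_integral_shift:
  fixes f :: "'a::euclidean_space \<Rightarrow> 'b::{banach,second_countable_topology}"
  shows "(LINT x:cball y t|lborel. f (x + z)) = (LINT x:cball (y + z) t|lborel. f x)"
proof -
  have "(LINT x:cball (y + z) t|lborel. f x) = (LINT x|distr lborel borel ((+) z). indicator (cball (y + z) t) x *\<^sub>R f x)"
    unfolding set_lebesgue_integral_def by (simp only: lborel_distr_plus)
  also have "\<dots> = (LINT x|lborel. indicator (cball (y + z) t) (z + x) *\<^sub>R f (z + x))"
  proof (cases "(\<lambda>x. indicator (cball (y + z) t) x *\<^sub>R f x) \<in> borel_measurable borel")
    case True
    then show ?thesis by (subst integral_distr) auto
  next
    \<comment> \<open>Without measurability neither integrand is integrable, and both integrals take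
      the default value 0.\<close>
    case False
    have 1: "\<not> integrable (distr lborel borel ((+) z)) (\<lambda>x. indicator (cball (y + z) t) x *\<^sub>R f x)"
      using False borel_measurable_integrable by fastforce
    have 2: "\<not> integrable lborel (\<lambda>x. indicator (cball (y + z) t) (z + x) *\<^sub>R f (z + x))"
    proof
      assume "integrable lborel (\<lambda>x. indicator (cball (y + z) t) (z + x) *\<^sub>R f (z + x))"
      then have "(\<lambda>x. indicator (cball (y + z) t) (z + x) *\<^sub>R f (z + x)) \<in> borel_measurable borel"
        using borel_measurable_integrable by fastforce
      then have "(\<lambda>x. indicator (cball (y + z) t) (z + (-z + x)) *\<^sub>R f (z + (-z + x))) \<in> borel_measurable borel"
        by (rule measurable_compose[rotated]) measurable
      with False show False by simp
    qed
    show ?thesis using 1 2 by (simp add: not_integrable_integral_eq)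
  qed
  also have "\<dots> = (LINT x:cball y t|lborel. f (x + z))"
    unfolding set_lebesgue_integral_def
    by (rule Bochner_Integration.integral_cong) (auto simp: indicator_def dist_norm algebra_simps)
  finally show ?thesis by simp
qed

lemma L2n_shift: "L2n y t (\<lambda>x. F (x + z)) = L2n (y + z) t F"
  unfolding L2n_def sq_int_def using set_integral_shift[of y t "\<lambda>x. (norm (F x))\<^sup>2" z] by simp

subsection \<open>Continuously differentiable functions and finite differences\<close>

lemma unit_ball_vol_nonzero: "unit_ball_vol (real n) \<noteq> 0"
  by (metis of_nat_0_le_iff less_irrefl unit_ball_vol_pos)

lemma measure_cball: "0 \<le> r \<Longrightarrow> measure lborel (cball (c::'a::euclidean_space) r) = unit_ball_vol (real DIM('a)) * r ^ DIM('a)"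
  using content_cball[of r c] by simp

lemma set_integral_const_cball:
  "0 \<le> r \<Longrightarrow> (LINT x:cball (y::'a::euclidean_space) r|lborel. (c::real)) = c * (unit_ball_vol (real DIM('a)) * r ^ DIM('a))"
  unfolding set_lebesgue_integral_def
  using emeasure_lborel_cball_finite[of y r] by (simp add: measure_cball less_top)

lemma square_set_integral_le:
  fixes f :: "'a \<Rightarrow> real"
  assumes f: "set_integrable M A f" and f2: "set_integrable M A (\<lambda>x. (f x)\<^sup>2)"
    and A: "A \<in> sets M" "emeasure M A < \<infinity>"
  shows "(LINT x:A|M. f x)\<^sup>2 \<le> measure M A * (LINT x:A|M. (f x)\<^sup>2)"
proof -
  have 1: "set_integrable M A (\<lambda>_. 1::real)" using A unfolding set_integrable_def by simp
  have "(LINT x:A|M. f x * 1)\<^sup>2 \<le> (LINT x:A|M. (f x)\<^sup>2) * (LINT x:A|M. 1\<^sup>2)"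
    by (rule set_integral_Cauchy_Schwarz) (use f f2 1 in simp_all)
  moreover have "(LINT x:A|M. (1::real)) = measure M A" using A unfolding set_lebesgue_integral_def by simp
  ultimately show ?thesis by (simp add: mult.commute)
qed

lemma integrable_pair_compact:
  fixes h :: "'a::euclidean_space \<Rightarrow> 'b::euclidean_space \<Rightarrow> 'c::{banach,second_countable_topology}"
  assumes "compact A" "compact B" and h: "continuous_on (A \<times> B) (\<lambda>(x, y). h x y)"
  shows "integrable (lborel \<Otimes>\<^sub>M lborel) (\<lambda>(x, y). indicator A x *\<^sub>R indicator B y *\<^sub>R h x y)"
proof -
  have "integrable lborel (\<lambda>p. indicator (A \<times> B) p *\<^sub>R (case p of (x, y) \<Rightarrow> h x y))"
    by (rule borel_integrable_compact) (auto intro: assms compact_Times)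
  also have "(\<lambda>p. indicator (A \<times> B) p *\<^sub>R (case p of (x, y) \<Rightarrow> h x y)) = (\<lambda>(x, y). indicator A x *\<^sub>R indicator B y *\<^sub>R h x y)"
    by (auto simp: indicator_def)
  finally show ?thesis by (simp add: lborel_prod)
qed

lemma set_integral_swap:
  fixes h :: "'a::euclidean_space \<Rightarrow> 'b::euclidean_space \<Rightarrow> 'c::{banach,second_countable_topology}"
  assumes "compact A" "compact B" and h: "continuous_on (A \<times> B) (\<lambda>(x, y). h x y)"
  shows "(LINT x:A|lborel. LINT y:B|lborel. h x y) = (LINT y:B|lborel. LINT x:A|lborel. h x y)"
    and "set_integrable lborel A (\<lambda>x. LINT y:B|lborel. h x y)"
    and "set_integrable lborel B (\<lambda>y. LINT x:A|lborel. h x y)"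
proof -
  note i = integrable_pair_compact[OF assms]
  have e': "(LINT y|lborel. indicator A x *\<^sub>R indicator B y *\<^sub>R h x y) = indicator A x *\<^sub>R (LINT y:B|lborel. h x y)" for x
    by (simp only: set_lebesgue_integral_def Bochner_Integration.integral_scaleR_right)
  have e: "(\<lambda>y. LINT x|lborel. indicator A x *\<^sub>R indicator B y *\<^sub>R h x y) = (\<lambda>y. indicator B y *\<^sub>R (LINT x:A|lborel. h x y))"
  proof
    fix y
    have "(LINT x|lborel. indicator A x *\<^sub>R indicator B y *\<^sub>R h x y) = (LINT x|lborel. indicator B y *\<^sub>R (indicator A x *\<^sub>R h x y))"
      by (intro Bochner_Integration.integral_cong) (auto simp: indicator_def)
    then show "(LINT x|lborel. indicator A x *\<^sub>R indicator B y *\<^sub>R h x y) = indicator B y *\<^sub>R (LINT x:A|lborel. h x y)"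
      by (simp only: set_lebesgue_integral_def Bochner_Integration.integral_scaleR_right)
  qed
  show "(LINT x:A|lborel. LINT y:B|lborel. h x y) = (LINT y:B|lborel. LINT x:A|lborel. h x y)"
    using lborel_pair.Fubini_integral[OF i]
    by (simp only: prod.case e e') (simp only: set_lebesgue_integral_def)
  show "set_integrable lborel A (\<lambda>x. LINT y:B|lborel. h x y)"
    using lborel_pair.integrable_fst[OF i] by (simp only: prod.case e' set_integrable_def)
  show "set_integrable lborel B (\<lambda>y. LINT x:A|lborel. h x y)"
    using lborel_pair.integrable_snd[OF i] by (simp only: prod.case e set_integrable_def)
qed

text \<open>The gradient is carried along as a second function, since it has to be shifted,
  subtracted and convolved together with \<open>w\<close>.\<close>

definition C1 :: "('a::euclidean_space \<Rightarrow> real) \<Rightarrow> ('a \<Rightarrow> 'a) \<Rightarrow> bool" where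
  "C1 w Dw \<longleftrightarrow> (\<forall>x. (w has_derivative (\<lambda>k. Dw x \<bullet> k)) (at x)) \<and> continuous_on UNIV Dw"

lemma C1_continuous: "C1 w Dw \<Longrightarrow> continuous_on S w" "C1 w Dw \<Longrightarrow> continuous_on S Dw"
  unfolding C1_def
  by (meson continuous_at_imp_continuous_on has_derivative_continuous)
     (metis continuous_on_subset subset_UNIV)

lemma C1_const: "C1 (\<lambda>_. c) (\<lambda>_. 0)"
  unfolding C1_def by (auto intro!: derivative_eq_intros)

lemma C1_diff: "C1 v Dv \<Longrightarrow> C1 w Dw \<Longrightarrow> C1 (\<lambda>x. v x - w x) (\<lambda>x. Dv x - Dw x)"
  unfolding C1_def by (auto intro!: derivative_eq_intros continuous_intros simp: inner_diff_left)

lemma C1_mult: "C1 v Dv \<Longrightarrow> C1 w Dw \<Longrightarrow> C1 (\<lambda>x. v x * w x) (\<lambda>x. v x *\<^sub>R Dw x + w x *\<^sub>R Dv x)"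
  by (auto simp: C1_def inner_add_left intro!: derivative_eq_intros continuous_intros C1_continuous[of v Dv] C1_continuous[of w Dw])

lemma C1_shift: "C1 w Dw \<Longrightarrow> C1 (\<lambda>x. w (x + z)) (\<lambda>x. Dw (x + z))"
proof -
  assume w: "C1 w Dw"
  have "((\<lambda>x. w (x + z)) has_derivative (\<lambda>k. Dw (x + z) \<bullet> k)) (at x)" for x
  proof -
    have "((w \<circ> (\<lambda>x. x + z)) has_derivative (\<lambda>k. Dw (x + z) \<bullet> k) \<circ> (\<lambda>k. k)) (at x)"
      by (rule diff_chain_at) (use w in \<open>auto simp: C1_def intro!: derivative_eq_intros\<close>)
    then show ?thesis by (simp add: o_def)
  qed
  moreover have "continuous_on UNIV (\<lambda>x. Dw (x + z))"
    by (rule continuous_on_compose2[OF C1_continuous(2)[OF w, of UNIV]]) (auto intro!: continuous_intros)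
  ultimately show ?thesis unfolding C1_def by blast
qed

text \<open>Fundamental theorem of calculus on the segment from \<open>x\<close> to
  \<open>x + z\<close>, then Cauchy-Schwarz in the parameter of the segment.\<close>

lemma C1_increment_sq_le:
  fixes w :: "'a::euclidean_space \<Rightarrow> real"
  assumes w: "C1 w Dw"
  shows "(w (x + z) - w x)\<^sup>2 \<le> (norm z)\<^sup>2 * (LINT l:{0..1::real}|lborel. (norm (Dw (x + l *\<^sub>R z)))\<^sup>2)"
proof -
  have cDw: "continuous_on S (\<lambda>l::real. Dw (x + l *\<^sub>R z))" for S
    by (rule continuous_on_compose2[OF C1_continuous(2)[OF w, of UNIV]]) (auto intro!: continuous_intros)
  have c: "continuous_on S (\<lambda>l::real. Dw (x + l *\<^sub>R z) \<bullet> z)" for S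
    by (intro continuous_intros cDw)
  have "LBINT l=ereal 0..ereal 1. (Dw (x + l *\<^sub>R z) \<bullet> z) = w (x + 1 *\<^sub>R z) - w (x + 0 *\<^sub>R z)"
  proof (rule interval_integral_FTC_finite)
    show "continuous_on {min 0 1..max 0 1} (\<lambda>l. Dw (x + l *\<^sub>R z) \<bullet> z)" by (rule c)
    fix l :: real
    have "((w \<circ> (\<lambda>l. x + l *\<^sub>R z)) has_derivative (\<lambda>k. Dw (x + l *\<^sub>R z) \<bullet> k) \<circ> (\<lambda>h. h *\<^sub>R z)) (at l)"
      by (rule diff_chain_at) (use w in \<open>auto simp: C1_def intro!: derivative_eq_intros\<close>)
    then show "((\<lambda>l. w (x + l *\<^sub>R z)) has_vector_derivative Dw (x + l *\<^sub>R z) \<bullet> z) (at l within {min 0 1..max 0 1})"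
      unfolding has_vector_derivative_def o_def
      by (auto intro: has_derivative_at_withinI simp: mult.commute)
  qed
  then have eq: "w (x + z) - w x = (LINT l:{0..1::real}|lborel. Dw (x + l *\<^sub>R z) \<bullet> z)"
    by (simp add: interval_integral_Icc)
  have int: "set_integrable lborel {0..1::real} f" if "continuous_on UNIV f" for f :: "real \<Rightarrow> real"
    unfolding set_integrable_def by (rule borel_integrable_compact) (auto intro: continuous_on_subset[OF that])
  have "(LINT l:{0..1::real}|lborel. Dw (x + l *\<^sub>R z) \<bullet> z)\<^sup>2 \<le> measure lborel {0..1::real} * (LINT l:{0..1::real}|lborel. (Dw (x + l *\<^sub>R z) \<bullet> z)\<^sup>2)"
    by (rule square_set_integral_le) (auto intro!: int c continuous_intros cDw)
  also have "\<dots> \<le> (LINT l:{0..1::real}|lborel. (norm z)\<^sup>2 * (norm (Dw (x + l *\<^sub>R z)))\<^sup>2)"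
  proof -
    have "(Dw (x + l *\<^sub>R z) \<bullet> z)\<^sup>2 \<le> (norm z)\<^sup>2 * (norm (Dw (x + l *\<^sub>R z)))\<^sup>2" for l
      using Cauchy_Schwarz_ineq2[of "Dw (x + l *\<^sub>R z)" z]
      by (metis abs_le_square_iff abs_mult_self_eq abs_norm_cancel mult.commute norm_mult power_mult_distrib real_norm_def)
    then have "(LINT l:{0..1::real}|lborel. (Dw (x + l *\<^sub>R z) \<bullet> z)\<^sup>2) \<le> (LINT l:{0..1::real}|lborel. (norm z)\<^sup>2 * (norm (Dw (x + l *\<^sub>R z)))\<^sup>2)"
      by (intro set_integral_mono int) (auto intro!: continuous_intros cDw)
    then show ?thesis by simp
  qed
  finally show ?thesis by (simp add: eq)
qed

text \<open>Integrate \<open>C1_increment_sq_le\<close> over the ball and exchange the integrals: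
  each translate of the ball by \<open>l *\<^sub>R z\<close>, with \<open>l\<close> between 0 and 1,
  stays in the ball of radius \<open>s + norm z\<close>.\<close>

lemma L2n_increment_le:
  fixes w :: "'a::euclidean_space \<Rightarrow> real"
  assumes w: "C1 w Dw" and s: "0 < s"
  shows "L2n y s (\<lambda>x. w (x + z) - w x) \<le> norm z * (sqrt (((s + norm z) / s) ^ DIM('a)) * L2n y (s + norm z) Dw)"
proof -
  let ?t = "s + norm z"
  have t: "0 < ?t" using s by (simp add: add_pos_nonneg)
  note cDw = C1_continuous(2)[OF w, of UNIV]
  have cw: "continuous_on UNIV (\<lambda>x. w (x + z) - w x)"
    using C1_continuous(1)[OF C1_diff[OF C1_shift[OF w, of z] w]] .
  have ch: "continuous_on S (\<lambda>(x, l::real). (norm (Dw (x + l *\<^sub>R z)))\<^sup>2)" for S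
    unfolding case_prod_unfold
    by (intro continuous_intros continuous_on_compose2[OF cDw]) auto
  note sw = set_integral_swap[OF compact_cball[of y s] compact_Icc[of 0 "1::real"] ch]
  have "sq_int y s (\<lambda>x. w (x + z) - w x) \<le> (LINT x:cball y s|lborel. (norm z)\<^sup>2 * (LINT l:{0..1::real}|lborel. (norm (Dw (x + l *\<^sub>R z)))\<^sup>2))"
    unfolding sq_int_def
    by (intro set_integral_mono set_integrable_cball_continuous set_integrable_mult_right sw continuous_norm_sq cw)
       (use C1_increment_sq_le[OF w] in auto)
  also have "\<dots> = (norm z)\<^sup>2 * (LINT l:{0..1::real}|lborel. LINT x:cball y s|lborel. (norm (Dw (x + l *\<^sub>R z)))\<^sup>2)"
    by (simp add: sw(1))
  also have "(LINT l:{0..1::real}|lborel. LINT x:cball y s|lborel. (norm (Dw (x + l *\<^sub>R z)))\<^sup>2) \<le> (LINT l:{0..1::real}|lborel. sq_int y ?t Dw)"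
  proof (rule set_integral_mono)
    show "set_integrable lborel {0..1::real} (\<lambda>l. LINT x:cball y s|lborel. (norm (Dw (x + l *\<^sub>R z)))\<^sup>2)" by (rule sw)
    show "set_integrable lborel {0..1::real} (\<lambda>l. sq_int y ?t Dw)" unfolding set_integrable_def by simp
    fix l :: real assume l: "l \<in> {0..1}"
    have "(LINT x:cball y s|lborel. (norm (Dw (x + l *\<^sub>R z)))\<^sup>2) = sq_int (y + l *\<^sub>R z) s Dw"
      unfolding sq_int_def by (rule set_integral_shift)
    also have "\<dots> = s ^ DIM('a) * (L2n (y + l *\<^sub>R z) s Dw)\<^sup>2" by (rule sq_int_eq[OF s])
    also have "\<dots> \<le> s ^ DIM('a) * (sqrt ((?t / s) ^ DIM('a)) * L2n y ?t Dw)\<^sup>2"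
    proof -
      have "cball (y + l *\<^sub>R z) s \<subseteq> cball y ?t"
      proof
        fix x assume x: "x \<in> cball (y + l *\<^sub>R z) s"
        have "dist y x \<le> dist y (y + l *\<^sub>R z) + dist (y + l *\<^sub>R z) x" by (rule dist_triangle)
        also have "dist y (y + l *\<^sub>R z) \<le> norm z" using l by (simp add: dist_norm mult_left_le_one_le)
        finally show "x \<in> cball y ?t" using x by simp
      qed
      from L2n_ball_mono[OF cDw s t this] show ?thesis
        using s by (intro mult_left_mono power_mono L2n_nonneg) auto
    qed
    also have "\<dots> = ?t ^ DIM('a) * (L2n y ?t Dw)\<^sup>2"
      using s t by (simp add: power_mult_distrib power_divide)
    also have "\<dots> = sq_int y ?t Dw" by (rule sq_int_eq[OF t, symmetric])
    finally show "(LINT x:cball y s|lborel. (norm (Dw (x + l *\<^sub>R z)))\<^sup>2) \<le> sq_int y ?t Dw" .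
  qed
  also have "(LINT l:{0..1::real}|lborel. sq_int y ?t Dw) = sq_int y ?t Dw" unfolding set_lebesgue_integral_def by simp
  finally have "sq_int y s (\<lambda>x. w (x + z) - w x) \<le> (norm z)\<^sup>2 * sq_int y ?t Dw"
    by (simp add: mult_left_mono)
  then have "L2n y s (\<lambda>x. w (x + z) - w x) \<le> sqrt ((norm z)\<^sup>2 * sq_int y ?t Dw / s ^ DIM('a))"
    unfolding L2n_def using s by (simp add: divide_right_mono)
  also have "\<dots> = norm z * (sqrt ((?t / s) ^ DIM('a)) * L2n y ?t Dw)"
    unfolding L2n_def using s t by (simp add: power_divide real_sqrt_mult real_sqrt_divide)
  finally show ?thesis .
qed

section \<open>Averages over balls, Poincare inequality by differences, good translates\<close>

definition avg :: "'a::euclidean_space \<Rightarrow> real \<Rightarrow> ('a \<Rightarrow> real) \<Rightarrow> real" where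
  "avg y s v = (LINT x:cball y s|lborel. v x) / measure lborel (cball y s)"

lemma measure_cball_pos: "0 < r \<Longrightarrow> 0 < measure lborel (cball (c::'a::euclidean_space) r)"
  by (simp add: measure_cball)

lemma avg_sq_le:
  fixes v :: "'a::euclidean_space \<Rightarrow> real"
  assumes v: "continuous_on UNIV v" and s: "0 < s"
  shows "(avg y s v)\<^sup>2 \<le> sq_int y s v / measure lborel (cball y s)"
proof -
  have "(LINT x:cball y s|lborel. v x)\<^sup>2 \<le> measure lborel (cball y s) * (LINT x:cball y s|lborel. (v x)\<^sup>2)"
    by (rule square_set_integral_le)
       (use emeasure_lborel_cball_finite[of y s] in \<open>auto intro!: set_integrable_cball_continuous v continuous_intros simp: less_top\<close>)
  then show ?thesis unfolding avg_def sq_int_def using measure_cball_pos[OF s, of y]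
    by (simp add: power_divide field_simps power2_eq_square)
qed

text \<open>Jensen, together with the fact that a constant has the same normalised norm on every
  ball. The factor one on the right is what keeps the coefficient one in
  \<open>first_diff_le_step\<close>.\<close>

lemma L2n_avg_le:
  fixes v :: "'a::euclidean_space \<Rightarrow> real"
  assumes v: "continuous_on UNIV v" and s: "0 < s" and r: "0 < r"
  shows "L2n (y'::'a) r (\<lambda>_. avg y s v) \<le> L2n y s v"
proof -
  have "sq_int y' r (\<lambda>_. avg y s v) / r ^ DIM('a) = (avg y s v)\<^sup>2 * unit_ball_vol (real DIM('a))"
    using r unfolding sq_int_def by (simp add: set_integral_const_cball)
  also have "\<dots> \<le> sq_int y s v / measure lborel (cball y s) * unit_ball_vol (real DIM('a))"
    by (intro mult_right_mono avg_sq_le v s) auto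
  also have "\<dots> = sq_int y s v / s ^ DIM('a)"
    using s unit_ball_vol_nonzero[of "DIM('a)"] by (simp add: measure_cball)
  finally show ?thesis unfolding L2n_def by simp
qed

text \<open>A Poincare inequality in which the gradient is replaced by finite differences; it needs no
  regularity of \<open>v\<close> beyond continuity.\<close>

lemma L2n_minus_avg_le:
  fixes v :: "'a::euclidean_space \<Rightarrow> real"
  assumes v: "continuous_on UNIV v" and s: "0 < s"
    and X: "\<And>z. norm z \<le> 2 * s \<Longrightarrow> L2n y s (\<lambda>x. v (x + z) - v x) \<le> X"
  shows "L2n y s (\<lambda>x. v x - avg y s v) \<le> sqrt (2 ^ DIM('a)) * X"
proof -
  let ?m = "measure lborel (cball y s)" and ?d = "DIM('a)"
  have m: "?m > 0" by (rule measure_cball_pos[OF s])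
  have X0: "0 \<le> X" using X[of 0] L2n_nonneg[of s y] s by (force intro: order_trans)
  have cv: "continuous_on UNIV (\<lambda>z. v (x + z) - v x)" "continuous_on UNIV (\<lambda>z. v (z + x) - v z)"  "continuous_on UNIV (\<lambda>z. v z - v x)" for x
    by (intro continuous_intros continuous_on_compose2[OF v] v; simp)+
  have ch: "continuous_on S (\<lambda>(x, z). (v (x + z) - v x)\<^sup>2)" for S
    unfolding case_prod_unfold
    by (intro continuous_intros continuous_on_compose2[OF v]) auto
  note sw = set_integral_swap[OF compact_cball[of y s] compact_cball[of 0 "2 * s"] ch]
  \<comment> \<open>Jensen for the average, then enlargement to the ball of radius
    \<open>2 * s\<close> around \<open>x\<close>: its points are \<open>x + z\<close> with
    \<open>z\<close> in a set that does not depend on \<open>x\<close>, so the integrals can be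
    exchanged. The ratio of the two volumes gives \<open>2 ^ d\<close>.\<close>
  have pt: "?m * (v x - avg y s v)\<^sup>2 \<le> (LINT z:cball 0 (2 * s)|lborel. (v (x + z) - v x)\<^sup>2)" if x: "x \<in> cball y s" for x
  proof -
    have "avg y s (\<lambda>x'. v x' - v x) = avg y s v - v x"
      unfolding avg_def using m s unit_ball_vol_nonzero[of "DIM('a)"]
      by (subst set_integral_diff)
         (auto intro!: set_integrable_cball_continuous v simp: set_integral_const_cball measure_cball field_simps)
    then have "(v x - avg y s v)\<^sup>2 \<le> sq_int y s (\<lambda>x'. v x' - v x) / ?m"
      using avg_sq_le[OF cv(3) s, of y x] by (simp add: power2_commute)
    then have "?m * (v x - avg y s v)\<^sup>2 \<le> sq_int y s (\<lambda>x'. v x' - v x)"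
      using m by (simp add: field_simps)
    also have "\<dots> \<le> sq_int x (2 * s) (\<lambda>x'. v x' - v x)"
    proof -
      have sub: "cball y s \<subseteq> cball x (2 * s)"
      proof
        fix q assume "q \<in> cball y s"
        then show "q \<in> cball x (2 * s)" using x dist_triangle[of x q y] by (auto simp: dist_commute)
      qed
      show ?thesis unfolding sq_int_def set_lebesgue_integral_def
      proof (rule Bochner_Integration.integral_mono)
        show "integrable lborel (\<lambda>x'. indicat_real (cball y s) x' *\<^sub>R (norm (v x' - v x))\<^sup>2)"
             "integrable lborel (\<lambda>x'. indicat_real (cball x (2 * s)) x' *\<^sub>R (norm (v x' - v x))\<^sup>2)"
          using set_integrable_cball_continuous[OF continuous_norm_sq[OF cv(3)]] unfolding set_integrable_def by auto
      qed (use sub in \<open>auto simp: indicator_def\<close>)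
    qed
    also have "\<dots> = (LINT z:cball 0 (2 * s)|lborel. (v (x + z) - v x)\<^sup>2)"
      unfolding sq_int_def using set_integral_shift[of 0 "2 * s" "\<lambda>x'. (v x' - v x)\<^sup>2" x] by (simp add: add.commute)
    finally show ?thesis .
  qed
  have "?m * sq_int y s (\<lambda>x. v x - avg y s v) = (LINT x:cball y s|lborel. ?m * (v x - avg y s v)\<^sup>2)"
    unfolding sq_int_def by simp
  also have "\<dots> \<le> (LINT x:cball y s|lborel. LINT z:cball 0 (2 * s)|lborel. (v (x + z) - v x)\<^sup>2)"
    by (rule set_integral_mono) (auto intro!: sw set_integrable_cball_continuous continuous_intros v pt)
  also have "\<dots> = (LINT z:cball 0 (2 * s)|lborel. sq_int y s (\<lambda>x. v (x + z) - v x))"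
    unfolding sq_int_def by (simp add: sw(1))
  also have "\<dots> \<le> (LINT z:cball (0::'a) (2 * s)|lborel. s ^ ?d * X\<^sup>2)"
  proof (rule set_integral_mono)
    show "set_integrable lborel (cball 0 (2 * s)) (\<lambda>z. sq_int y s (\<lambda>x. v (x + z) - v x))"
      unfolding sq_int_def using sw(3) by simp
    show "set_integrable lborel (cball (0::'a) (2 * s)) (\<lambda>z. s ^ ?d * X\<^sup>2)"
      by (intro set_integrable_cball_continuous continuous_intros)
    fix z :: 'a assume "z \<in> cball 0 (2 * s)"
    then have "L2n y s (\<lambda>x. v (x + z) - v x) \<le> X" by (intro X) auto
    then show "sq_int y s (\<lambda>x. v (x + z) - v x) \<le> s ^ ?d * X\<^sup>2"
      unfolding sq_int_eq[OF s] using s by (intro mult_left_mono power_mono L2n_nonneg) auto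
  qed
  also have "\<dots> = ?m * (2 ^ ?d * s ^ ?d * X\<^sup>2)"
    using s by (simp add: set_integral_const_cball measure_cball power_mult_distrib)
  finally have "sq_int y s (\<lambda>x. v x - avg y s v) / s ^ ?d \<le> 2 ^ ?d * X\<^sup>2"
    using m s by (simp add: field_simps)
  then have "L2n y s (\<lambda>x. v x - avg y s v) \<le> sqrt (2 ^ ?d * X\<^sup>2)"
    unfolding L2n_def by (rule real_sqrt_le_mono)
  then show ?thesis using X0 by (simp add: real_sqrt_mult)
qed

text \<open>If all translates by vectors of length at most \<open>k\<close> were bad, integrating
  over these vectors would count the mass of the large ball twice. The constant stays bounded when
  \<open>s\<close> shrinks and \<open>k\<close> is kept, which is the advantage over
  \<open>L2n_ball_mono\<close>.\<close>

lemma exists_good_translate: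
  fixes F :: "'a::euclidean_space \<Rightarrow> 'b::real_normed_vector"
  assumes F: "continuous_on UNIV F" and s: "0 < s" and k: "0 < k"
  shows "\<exists>z. norm z \<le> k \<and> L2n (y + z) s F \<le> sqrt (2 * ((k + s) / k) ^ DIM('a)) * L2n y (k + s) F"
proof (rule ccontr)
  let ?d = "DIM('a)" let ?I = "sq_int y (k + s) F"
  assume neg: "\<not> ?thesis"
  have ks: "0 < k + s" using s k by simp
  \<comment> \<open>The strict positivity excludes the degenerate case of zero mass in the final
    contradiction \<open>2 * ?I \<le> ?I\<close>.\<close>
  have big: "2 * (s / k) ^ ?d * ?I \<le> sq_int (y + z) s F \<and> sq_int (y + z) s F > 0" if z: "norm z \<le> k" for z
  proof -
    have "sqrt (2 * ((k + s) / k) ^ ?d) * L2n y (k + s) F < L2n (y + z) s F" using neg z by force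
    moreover have "0 \<le> sqrt (2 * ((k + s) / k) ^ ?d) * L2n y (k + s) F"
      using k s by (intro mult_nonneg_nonneg L2n_nonneg) auto
    ultimately have "(sqrt (2 * ((k + s) / k) ^ ?d) * L2n y (k + s) F)\<^sup>2 < (L2n (y + z) s F)\<^sup>2" 
      by (intro power_strict_mono) auto
    then have *: "2 * ((k + s) / k) ^ ?d * (?I / (k + s) ^ ?d) < sq_int (y + z) s F / s ^ ?d"
      using k s ks by (simp add: power_mult_distrib L2n_sq)
    then have "2 * (s / k) ^ ?d * ?I < sq_int (y + z) s F"
      using k s ks by (simp add: field_simps power_divide)
    moreover have "0 \<le> 2 * (s / k) ^ ?d * ?I" using k s by (intro mult_nonneg_nonneg sq_int_nonneg) auto
    ultimately show ?thesis by linarith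
  qed
  have ch: "continuous_on S (\<lambda>(x, z). (norm (F (x + z)))\<^sup>2)" for S
    unfolding case_prod_unfold
    by (intro continuous_intros continuous_on_compose2[OF F]) auto
  have cF: "continuous_on UNIV (\<lambda>x. (norm (F x))\<^sup>2)" by (rule continuous_norm_sq[OF F])
  note sw = set_integral_swap[OF compact_cball[of y s] compact_cball[of 0 k] ch]
  have eq: "sq_int (y + z) s F = (LINT x:cball y s|lborel. (norm (F (x + z)))\<^sup>2)" for z
    unfolding sq_int_def by (rule set_integral_shift[symmetric])
  have mono: "sq_int p r F \<le> ?I" if "cball p r \<subseteq> cball y (k + s)" for p r
    unfolding sq_int_def set_lebesgue_integral_def
  proof (rule Bochner_Integration.integral_mono)
    show "integrable lborel (\<lambda>x. indicat_real (cball p r) x *\<^sub>R (norm (F x))\<^sup>2)"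
         "integrable lborel (\<lambda>x. indicat_real (cball y (k + s)) x *\<^sub>R (norm (F x))\<^sup>2)"
      using set_integrable_cball_continuous[OF cF] unfolding set_integrable_def by auto
  qed (use that in \<open>auto simp: indicator_def\<close>)
  have "unit_ball_vol ?d * k ^ ?d * (2 * (s / k) ^ ?d * ?I) = (LINT z:cball (0::'a) k|lborel. 2 * (s / k) ^ ?d * ?I)"
    using k by (simp add: set_integral_const_cball)
  also have "\<dots> \<le> (LINT z:cball 0 k|lborel. LINT x:cball y s|lborel. (norm (F (x + z)))\<^sup>2)"
    by (rule set_integral_mono) (use big eq in \<open>auto intro!: sw(3) set_integrable_cball_continuous\<close>)
  also have "\<dots> = (LINT x:cball y s|lborel. LINT z:cball 0 k|lborel. (norm (F (x + z)))\<^sup>2)"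
    by (rule sw(1)[symmetric])
  also have "\<dots> \<le> (LINT x:cball y s|lborel. ?I)"
  proof (rule set_integral_mono[OF sw(2)])
    show "set_integrable lborel (cball y s) (\<lambda>x. ?I)"
      by (intro set_integrable_cball_continuous continuous_intros)
    fix x assume x: "x \<in> cball y s"
    have "(LINT z:cball 0 k|lborel. (norm (F (x + z)))\<^sup>2) = sq_int x k F"
      unfolding sq_int_def using set_integral_shift[of 0 k "\<lambda>z. (norm (F z))\<^sup>2" x] by (simp add: add.commute)
    also have "\<dots> \<le> ?I"
    proof (rule mono, rule)
      fix q assume "q \<in> cball x k"
      then show "q \<in> cball y (k + s)" using x dist_triangle[of y q x] by (auto simp: dist_commute)
    qed
    finally show "(LINT z:cball 0 k|lborel. (norm (F (x + z)))\<^sup>2) \<le> ?I" .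
  qed
  also have "\<dots> = unit_ball_vol ?d * s ^ ?d * ?I" using s by (simp add: set_integral_const_cball)
  finally have "unit_ball_vol ?d * s ^ ?d * (2 * ?I) \<le> unit_ball_vol ?d * s ^ ?d * ?I"
    using k by (simp add: power_divide field_simps)
  then have "2 * ?I \<le> ?I" using s by (subst (asm) mult_le_cancel_left_pos) auto
  moreover have "sq_int (y + 0) s F \<le> ?I" by (rule mono) (use k in auto)
  ultimately show False using big[of 0] k by force
qed

subsection \<open>Almost solutions and the Caccioppoli inequality\<close>

text \<open>A field of linear maps on the whole space instead of matrices on a domain: shifted
  coefficients make sense everywhere, and no coordinates are needed until mollifiers appear.\<close>

definition elliptic :: "('a::euclidean_space \<Rightarrow> 'a \<Rightarrow> 'a) \<Rightarrow> real \<Rightarrow> real \<Rightarrow> bool" where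
  "elliptic a \<mu> \<Lambda> \<longleftrightarrow> continuous_on UNIV (\<lambda>(x, \<xi>). a x \<xi>) \<and>
     (\<forall>x. linear (a x)) \<and>
     (\<forall>x \<xi>. \<mu> * (norm \<xi>)\<^sup>2 \<le> a x \<xi> \<bullet> \<xi>) \<and> (\<forall>x \<xi>. norm (a x \<xi>) \<le> \<Lambda> * norm \<xi>)"

text \<open>\<open>Sol a y t K Dw\<close> says that the weak divergence of \<open>a Dw\<close> on the ball has normalised
  \<open>H\<^sup>-\<^sup>1\<close> norm at most \<open>K\<close>; this is how all right-hand sides are recorded.\<close>

definition Sol :: "('a::euclidean_space \<Rightarrow> 'a \<Rightarrow> 'a) \<Rightarrow> 'a \<Rightarrow> real \<Rightarrow> real \<Rightarrow> ('a \<Rightarrow> 'a) \<Rightarrow> bool" where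
  "Sol a y t K Dw \<longleftrightarrow> (\<forall>v Dv. C1 v Dv \<longrightarrow> (\<forall>x. x \<notin> cball y t \<longrightarrow> v x = 0) \<longrightarrow>
     \<bar>LINT x:cball y t|lborel. a x (Dw x) \<bullet> Dv x\<bar> \<le> t ^ DIM('a) * K * L2n y t Dv)"

lemma SolD: "Sol a (y::'a::euclidean_space) t K Dw \<Longrightarrow> C1 v Dv \<Longrightarrow> (\<And>x. x \<notin> cball y t \<Longrightarrow> v x = 0) \<Longrightarrow>
     \<bar>LINT x:cball y t|lborel. a x (Dw x) \<bullet> Dv x\<bar> \<le> t ^ DIM('a) * K * L2n y t Dv"
  unfolding Sol_def by blast

lemma elliptic_continuous:
  assumes "elliptic a \<mu> \<Lambda>" "continuous_on S F"
  shows "continuous_on S (\<lambda>x. a x (F x))"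
proof -
  have "continuous_on UNIV (\<lambda>p. case p of (x, \<xi>) \<Rightarrow> a x \<xi>)" using assms unfolding elliptic_def by auto
  then have "continuous_on S (\<lambda>x. case (x, F x) of (x, \<xi>) \<Rightarrow> a x \<xi>)"
    by (rule continuous_on_compose2) (auto intro!: continuous_intros assms)
  then show ?thesis by simp
qed

lemma elliptic_simps:
  assumes "elliptic a \<mu> \<Lambda>"
  shows "a x (\<xi> + \<eta>) = a x \<xi> + a x \<eta>" "a x (\<xi> - \<eta>) = a x \<xi> - a x \<eta>"
    "\<mu> * (norm \<xi>)\<^sup>2 \<le> a x \<xi> \<bullet> \<xi>" "norm (a x \<xi>) \<le> \<Lambda> * norm \<xi>"
  using assms unfolding elliptic_def by (auto simp: linear_add linear_diff)

lemma C1_zero_outside: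
  assumes v: "C1 v Dv" and z: "\<And>x. x \<notin> cball y t \<Longrightarrow> v x = 0" and x: "x \<notin> cball y t"
  shows "Dv x = 0"
proof -
  have "((\<lambda>_. 0) has_derivative (\<lambda>k. Dv x \<bullet> k)) (at x)"
  proof (rule has_derivative_transform_within_open)
    show "(v has_derivative (\<lambda>k. Dv x \<bullet> k)) (at x)" using v unfolding C1_def by blast
    show "open (- cball y t)" "x \<in> - cball y t" using x by auto
  qed (use z in auto)
  then have "(\<lambda>k. Dv x \<bullet> k) = (\<lambda>k. 0)"
    using has_derivative_unique has_derivative_const by metis
  then have "Dv x \<bullet> Dv x = 0" by (rule fun_cong)
  then show ?thesis by simp
qed

lemma set_integral_cball_support:
  fixes f :: "'a::euclidean_space \<Rightarrow> 'b::{banach,second_countable_topology}"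
  assumes "cball y' s \<subseteq> cball y t" "\<And>x. x \<notin> cball y' s \<Longrightarrow> f x = 0"
  shows "(LINT x:cball y t|lborel. f x) = (LINT x:cball y' s|lborel. f x)"
  unfolding set_lebesgue_integral_def
  by (rule Bochner_Integration.integral_cong) (use assms in \<open>auto simp: indicator_def\<close>)

text \<open>A test function of the small ball is one of the large ball, and its integrals over both
  agree; only the normalising powers of the radius change.\<close>

lemma Sol_test_small:
  fixes y :: "'a::euclidean_space"
  assumes sol: "Sol a y t K Dw" and v: "C1 v Dv" and z: "\<And>x. x \<notin> cball y' s \<Longrightarrow> v x = 0"
    and sub: "cball y' s \<subseteq> cball y t" and s: "0 < s" and t: "0 < t"
  shows "\<bar>LINT x:cball y' s|lborel. a x (Dw x) \<bullet> Dv x\<bar> \<le> s ^ DIM('a) * (sqrt ((t / s) ^ DIM('a)) * K) * L2n y' s Dv"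
proof -
  have Dv0: "Dv x = 0" if "x \<notin> cball y' s" for x
    by (rule C1_zero_outside[OF v z that])
  have "\<bar>LINT x:cball y t|lborel. a x (Dw x) \<bullet> Dv x\<bar> \<le> t ^ DIM('a) * K * L2n y t Dv"
    by (rule SolD[OF sol v]) (use z sub in blast)
  also have "(LINT x:cball y t|lborel. a x (Dw x) \<bullet> Dv x) = (LINT x:cball y' s|lborel. a x (Dw x) \<bullet> Dv x)"
    by (rule set_integral_cball_support[OF sub]) (use Dv0 in simp)
  also have "L2n y t Dv = L2n y' s Dv / sqrt ((t / s) ^ DIM('a))"
  proof -
    have "sq_int y t Dv = sq_int y' s Dv"
      unfolding sq_int_def by (rule set_integral_cball_support[OF sub]) (use Dv0 in simp)
    then show ?thesis unfolding L2n_def using s t by (simp add: real_sqrt_divide power_divide)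
  qed
  also have "t ^ DIM('a) * K * (L2n y' s Dv / sqrt ((t / s) ^ DIM('a))) = s ^ DIM('a) * (sqrt ((t / s) ^ DIM('a)) * K) * L2n y' s Dv"
  proof -
    have "t ^ DIM('a) = s ^ DIM('a) * (sqrt ((t / s) ^ DIM('a)) * sqrt ((t / s) ^ DIM('a)))"
      using s t by (simp add: power_divide)
    moreover have "sqrt ((t / s) ^ DIM('a)) \<noteq> 0" using s t by simp
    ultimately show ?thesis by (simp add: field_simps)
  qed
  finally show ?thesis .
qed

lemma Sol_mono:
  fixes y :: "'a::euclidean_space"
  assumes sol: "Sol a y t K Dw" and sub: "cball y' s \<subseteq> cball y t" and s: "0 < s" and t: "0 < t"
  shows "Sol a y' s (sqrt ((t / s) ^ DIM('a)) * K) Dw"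
  unfolding Sol_def using Sol_test_small[OF sol _ _ sub s t] by blast

lemma Sol_weaken:
  fixes y :: "'a::euclidean_space"
  assumes sol: "Sol a y t K Dw" and K: "K \<le> K'" and t: "0 < t"
  shows "Sol a y t K' Dw"
  unfolding Sol_def
proof (intro allI impI)
  fix v Dv assume v: "C1 v Dv" "\<forall>x. x \<notin> cball y t \<longrightarrow> v x = 0"
  have "\<bar>LINT x:cball y t|lborel. a x (Dw x) \<bullet> Dv x\<bar> \<le> t ^ DIM('a) * K * L2n y t Dv"
    using SolD[OF sol v(1)] v(2) by blast
  also have "\<dots> \<le> t ^ DIM('a) * K' * L2n y t Dv"
    by (intro mult_right_mono mult_left_mono K L2n_nonneg) (use t in auto)
  finally show "\<bar>LINT x:cball y t|lborel. a x (Dw x) \<bullet> Dv x\<bar> \<le> t ^ DIM('a) * K' * L2n y t Dv" .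
qed

lemma set_integral_inner_le:
  fixes F G :: "'a::euclidean_space \<Rightarrow> 'a"
  assumes F: "continuous_on UNIV F" and G: "continuous_on UNIV G" and t: "0 < t"
  shows "\<bar>LINT x:cball y t|lborel. F x \<bullet> G x\<bar> \<le> t ^ DIM('a) * L2n y t F * L2n y t G"
proof -
  have "\<bar>LINT x:cball y t|lborel. F x \<bullet> G x\<bar> \<le> (LINT x:cball y t|lborel. \<bar>F x \<bullet> G x\<bar>)"
    using set_integral_norm_bound[OF set_integrable_cball_continuous, of "\<lambda>x. F x \<bullet> G x" y t]
    by (auto intro!: continuous_intros F G)
  also have "\<dots> \<le> (LINT x:cball y t|lborel. norm (F x) * norm (G x))"
    by (rule set_integral_mono)
       (auto intro!: set_integrable_cball_continuous continuous_intros F G Cauchy_Schwarz_ineq2)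
  also have "\<dots> \<le> t ^ DIM('a) * L2n y t (\<lambda>x. norm (F x)) * L2n y t (\<lambda>x. norm (G x))"
    by (rule order_trans[OF abs_ge_self L2n_Cauchy_Schwarz]) (intro continuous_intros F G t)+
  finally show ?thesis by (simp add: L2n_norm)
qed

text \<open>If \<open>\<tau>\<close> is an almost period of the coefficients, differences of solutions along \<open>\<tau>\<close> are again
  almost solutions.\<close>

lemma Sol_increment:
  fixes y :: "'a::euclidean_space"
  assumes ell: "elliptic a \<mu> \<Lambda>" and sol: "Sol a y t K Dw" and Dw: "continuous_on UNIV Dw"
    and s: "0 < s" and st: "s + norm \<tau> \<le> t" and om: "0 \<le> \<omega>"
    and per: "\<And>x \<xi>. x \<in> cball y s \<Longrightarrow> norm (a (x + \<tau>) \<xi> - a x \<xi>) \<le> \<omega> * norm \<xi>"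
  shows "Sol a y s (sqrt ((t / s) ^ DIM('a)) * (2 * K + \<omega> * L2n y t Dw)) (\<lambda>x. Dw (x + \<tau>) - Dw x)"
  unfolding Sol_def
proof (intro allI impI)
  fix v Dv assume v: "C1 v Dv" and vz': "\<forall>x. x \<notin> cball y s \<longrightarrow> v x = 0"
  then have vz: "\<And>x. x \<notin> cball y s \<Longrightarrow> v x = 0" by blast
  let ?d = "DIM('a)" let ?q = "sqrt ((t / s) ^ ?d)"
  have t: "0 < t" using s st norm_ge_zero[of \<tau>] by linarith
  note cDv = C1_continuous(2)[OF v, of UNIV]
  have cDw': "continuous_on UNIV (\<lambda>x. Dw (x + z))" for z
    by (rule continuous_on_compose2[OF Dw]) (auto intro!: continuous_intros)
  have ca: "continuous_on UNIV (\<lambda>x. a (x + \<tau>) (Dw (x + \<tau>)))"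
    by (rule continuous_on_compose2[OF elliptic_continuous[OF ell Dw]]) (auto intro!: continuous_intros)
  have ca': "continuous_on UNIV (\<lambda>x. a x (Dw (x + \<tau>)))" by (rule elliptic_continuous[OF ell cDw'])
  note int = set_integrable_cball_continuous
  have sub1: "cball y s \<subseteq> cball y t" using st norm_ge_zero[of \<tau>] by (intro subset_cball) linarith
  have sub2: "cball (y + \<tau>) s \<subseteq> cball y t"
  proof
    fix q assume "q \<in> cball (y + \<tau>) s"
    then show "q \<in> cball y t" using st dist_triangle[of y q "y + \<tau>"] by (simp add: dist_norm)
  qed
  have 1: "\<bar>LINT x:cball y s|lborel. a x (Dw x) \<bullet> Dv x\<bar> \<le> s ^ ?d * (?q * K) * L2n y s Dv"
    by (rule Sol_test_small[OF sol v vz sub1 s t])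
  \<comment> \<open>The equation on the ball around \<open>y + \<tau>\<close>, tested with the
    translate of \<open>v\<close> and shifted back to \<open>y\<close>.\<close>
  have 2: "\<bar>LINT x:cball y s|lborel. a (x + \<tau>) (Dw (x + \<tau>)) \<bullet> Dv x\<bar> \<le> s ^ ?d * (?q * K) * L2n y s Dv"
  proof -
    have "\<bar>LINT x:cball (y + \<tau>) s|lborel. a x (Dw x) \<bullet> Dv (x + (-\<tau>))\<bar> \<le> s ^ ?d * (?q * K) * L2n (y + \<tau>) s (\<lambda>x. Dv (x + (-\<tau>)))"
    proof (rule Sol_test_small[OF sol C1_shift[OF v] _ sub2 s t])
      fix x assume "x \<notin> cball (y + \<tau>) s"
      then have "x + (-\<tau>) \<notin> cball y s" by (simp add: dist_norm algebra_simps)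
      then show "v (x + (-\<tau>)) = 0" by (rule vz)
    qed
    also have "L2n (y + \<tau>) s (\<lambda>x. Dv (x + (-\<tau>))) = L2n y s Dv"
      by (subst L2n_shift) simp
    also have "(LINT x:cball (y + \<tau>) s|lborel. a x (Dw x) \<bullet> Dv (x + (-\<tau>))) = (LINT x:cball y s|lborel. a (x + \<tau>) (Dw (x + \<tau>)) \<bullet> Dv x)"
      using set_integral_shift[of y s "\<lambda>x. a x (Dw x) \<bullet> Dv (x + (-\<tau>))" \<tau>] by simp
    finally show ?thesis .
  qed
  \<comment> \<open>The commutator: the shifted gradient under unshifted and under shifted
    coefficients. It is the only place where the almost period enters.\<close>
  have 3: "\<bar>LINT x:cball y s|lborel. (a x (Dw (x + \<tau>)) - a (x + \<tau>) (Dw (x + \<tau>))) \<bullet> Dv x\<bar> \<le> s ^ ?d * (?q * (\<omega> * L2n y t Dw)) * L2n y s Dv"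
  proof -
    have "\<bar>LINT x:cball y s|lborel. (a x (Dw (x + \<tau>)) - a (x + \<tau>) (Dw (x + \<tau>))) \<bullet> Dv x\<bar>
      \<le> s ^ ?d * L2n y s (\<lambda>x. a x (Dw (x + \<tau>)) - a (x + \<tau>) (Dw (x + \<tau>))) * L2n y s Dv"
      by (intro set_integral_inner_le continuous_intros ca ca' cDv s)
    also have "L2n y s (\<lambda>x. a x (Dw (x + \<tau>)) - a (x + \<tau>) (Dw (x + \<tau>))) \<le> L2n y s (\<lambda>x. \<omega> *\<^sub>R Dw (x + \<tau>))"
    proof (rule L2n_mono)
      fix x assume "x \<in> cball y s"
      then show "norm (a x (Dw (x + \<tau>)) - a (x + \<tau>) (Dw (x + \<tau>))) \<le> norm (\<omega> *\<^sub>R Dw (x + \<tau>))"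
        using per[of x "Dw (x + \<tau>)"] om by (simp add: norm_minus_commute)
    qed (intro continuous_intros ca ca' cDw' s)+
    also have "\<dots> = \<omega> * L2n (y + \<tau>) s Dw" using s om by (simp add: L2n_scaleR L2n_shift)
    also have "\<dots> \<le> \<omega> * (?q * L2n y t Dw)"
      by (intro mult_left_mono L2n_ball_mono Dw s t sub2 om)
    finally show ?thesis using s L2n_nonneg[of s y Dv] by (simp add: mult_left_mono mult_right_mono algebra_simps)
  qed
  have "(LINT x:cball y s|lborel. a x (Dw (x + \<tau>) - Dw x) \<bullet> Dv x)
     = (LINT x:cball y s|lborel. (a (x + \<tau>) (Dw (x + \<tau>)) \<bullet> Dv x + (a x (Dw (x + \<tau>)) - a (x + \<tau>) (Dw (x + \<tau>))) \<bullet> Dv x) - a x (Dw x) \<bullet> Dv x)"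
    by (simp add: elliptic_simps[OF ell] algebra_simps inner_simps)
  also have "\<dots> = (LINT x:cball y s|lborel. a (x + \<tau>) (Dw (x + \<tau>)) \<bullet> Dv x) +
      (LINT x:cball y s|lborel. (a x (Dw (x + \<tau>)) - a (x + \<tau>) (Dw (x + \<tau>))) \<bullet> Dv x) - (LINT x:cball y s|lborel. a x (Dw x) \<bullet> Dv x)"
    by (subst set_integral_diff set_integral_add, (intro set_integral_add int continuous_intros ca ca' cDv elliptic_continuous[OF ell] Dw)+)+ simp
  finally show "\<bar>LINT x:cball y s|lborel. a x (Dw (x + \<tau>) - Dw x) \<bullet> Dv x\<bar> \<le> s ^ ?d * (?q * (2 * K + \<omega> * L2n y t Dw)) * L2n y s Dv"
    using 1 2 3 by (simp add: algebra_simps)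
qed

section \<open>Cutoff functions and the Caccioppoli inequality\<close>

lemma DERIV_max_0_sq: "((\<lambda>s::real. (max 0 s)\<^sup>2) has_real_derivative 2 * max 0 s) (at s)"
proof (cases "s = 0")
  case True
  have "((\<lambda>h::real. ((max 0 (0 + h))\<^sup>2 - (max 0 0)\<^sup>2) / h) \<longlongrightarrow> 0) (at 0)"
  proof (rule Lim_null_comparison)
    show "\<forall>\<^sub>F h in at 0. norm (((max 0 (0 + h))\<^sup>2 - (max 0 0)\<^sup>2) / h) \<le> \<bar>h\<bar>"
      by (rule always_eventually) (auto simp: max_def power2_eq_square)
    show "((\<lambda>h::real. \<bar>h\<bar>) \<longlongrightarrow> 0) (at 0)" by (rule tendsto_rabs_zero) (rule tendsto_ident_at)
  qed
  then show ?thesis using True by (simp add: DERIV_def)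
next
  case False
  show ?thesis
  proof (cases "s > 0")
    case True
    have "((\<lambda>s::real. s\<^sup>2) has_real_derivative 2 * max 0 s) (at s)"
      using True by (auto intro!: derivative_eq_intros)
    then show ?thesis
      by (rule DERIV_cong_ev[THEN iffD1, rotated -1])
         (use True in \<open>auto intro!: eventually_mono[OF eventually_nhds_in_open[of "{0<..}"]] simp: max_def\<close>)
  next
    case 2: False
    then have s: "s < 0" using False by simp
    have "((\<lambda>s::real. 0) has_real_derivative 2 * max 0 s) (at s)"
      using s by (auto intro!: derivative_eq_intros)
    then show ?thesis
      by (rule DERIV_cong_ev[THEN iffD1, rotated -1])
         (use s in \<open>auto intro!: eventually_mono[OF eventually_nhds_in_open[of "{..<0}"]] simp: max_def\<close>)
  qed
qed

text \<open>Squaring makes the positive part continuously differentiable and leaves one factor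
  \<open>m x\<close> in the gradient; in \<open>caccioppoli\<close> this factor is paired with
  \<open>Dw\<close>, so that the error can be absorbed.\<close>

lemma C1_cutoff:
  fixes y :: "'a::euclidean_space"
  assumes t: "0 < t"
  defines "m \<equiv> \<lambda>x. max 0 (1 - (norm (x - y))\<^sup>2 / t\<^sup>2)"
  shows "C1 (\<lambda>x. (m x)\<^sup>2) (\<lambda>x. (- (4 * m x / t\<^sup>2)) *\<^sub>R (x - y))"
proof -
  have "((\<lambda>x. (m x)\<^sup>2) has_derivative (\<lambda>k. ((- (4 * m x / t\<^sup>2)) *\<^sub>R (x - y)) \<bullet> k)) (at x)" for x
  proof -
    have g: "((\<lambda>x. 1 - ((x - y) \<bullet> (x - y)) / t\<^sup>2) has_derivative (\<lambda>k. - (2 / t\<^sup>2) * ((x - y) \<bullet> k))) (at x)"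
      using t by (auto intro!: derivative_eq_intros simp: inner_commute field_simps eval_nat_numeral)
    have "((\<lambda>s::real. (max 0 s)\<^sup>2) has_derivative (*) (2 * max 0 (1 - ((x - y) \<bullet> (x - y)) / t\<^sup>2))) (at (1 - ((x - y) \<bullet> (x - y)) / t\<^sup>2))"
      using DERIV_max_0_sq by (simp add: has_field_derivative_def)
    from diff_chain_at[OF g this]
    have "((\<lambda>x. (m x)\<^sup>2) has_derivative (\<lambda>k. 2 * m x * (- (2 / t\<^sup>2) * ((x - y) \<bullet> k)))) (at x)"
      unfolding o_def m_def power2_norm_eq_inner .
    moreover have "(\<lambda>k. 2 * m x * (- (2 / t\<^sup>2) * ((x - y) \<bullet> k))) = (\<lambda>k. ((- (4 * m x / t\<^sup>2)) *\<^sub>R (x - y)) \<bullet> k)"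
      by (simp only: inner_scaleR_left) (simp add: fun_eq_iff)
    ultimately show ?thesis by simp
  qed
  moreover have "continuous_on UNIV (\<lambda>x. (- (4 * m x / t\<^sup>2)) *\<^sub>R (x - y))"
    unfolding m_def using t by (intro continuous_intros) auto
  ultimately show ?thesis unfolding C1_def by blast
qed

text \<open>Absorption: if \<open>X\<close> exceeds \<open>Z\<close>, the last term is at most
  \<open>4 * X * Z\<close>, and one factor \<open>X\<close> cancels.\<close>

lemma quadratic_bound:
  fixes X Z :: real
  assumes "0 < \<mu>" "0 \<le> X" "0 \<le> Z" "0 \<le> \<Lambda>" "\<mu> * X\<^sup>2 \<le> (1 + 4 * \<Lambda>) * X * Z + 4 * Z\<^sup>2"
  shows "X \<le> (1 + (5 + 4 * \<Lambda>) / \<mu>) * Z"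
proof (cases "X \<le> Z")
  case True
  have "X \<le> 1 * Z" using True by simp
  also have "\<dots> \<le> (1 + (5 + 4 * \<Lambda>) / \<mu>) * Z" by (rule mult_right_mono) (use assms in auto)
  finally show ?thesis .
next
  case False
  then have "Z\<^sup>2 \<le> X * Z" using assms by (simp add: power2_eq_square mult_right_mono)
  then have "\<mu> * X * X \<le> ((5 + 4 * \<Lambda>) * Z) * X" using assms by (simp add: power2_eq_square algebra_simps)
  then have "\<mu> * X \<le> (5 + 4 * \<Lambda>) * Z" using False assms by (auto simp: mult_le_cancel_right)
  then have "X \<le> (5 + 4 * \<Lambda>) / \<mu> * Z" using assms by (simp add: field_simps)
  then show ?thesis using assms by (simp add: algebra_simps)
qed

text \<open>Test with \<open>(m x)\<^sup>2 * (w x - c)\<close>; every error term keeps a factor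
  \<open>m\<close> with the gradient, so a quadratic inequality for the norm of
  \<open>m x *\<^sub>R Dw x\<close> remains. In the applications \<open>c\<close> is an average
  where only differences of \<open>w\<close> are controlled, and 0 where \<open>w\<close> itself
  is.\<close>

lemma caccioppoli:
  fixes y :: "'a::euclidean_space" and \<mu> \<Lambda> :: real
  assumes mu: "0 < \<mu>" and La: "0 \<le> \<Lambda>" and ell: "elliptic a \<mu> \<Lambda>" and w: "C1 w Dw"
    and sol: "Sol a y t K Dw" and t: "0 < t" and K: "0 \<le> K"
  shows "L2n y (t / 2) Dw \<le> 4 / 3 * sqrt (2 ^ DIM('a)) * (1 + (5 + 4 * \<Lambda>) / \<mu>) * (L2n y t (\<lambda>x. w x - c) / t + K)"
proof -
  let ?d = "DIM('a)"
  define m where "m = (\<lambda>x. max 0 (1 - (norm (x - y))\<^sup>2 / t\<^sup>2))"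
  have m01: "0 \<le> m x" "m x \<le> 1" for x unfolding m_def by auto
  have cm: "continuous_on UNIV m" unfolding m_def using t by (intro continuous_intros) auto
  have C1m: "C1 (\<lambda>x. (m x)\<^sup>2) (\<lambda>x. (- (4 * m x / t\<^sup>2)) *\<^sub>R (x - y))"
    unfolding m_def by (rule C1_cutoff[OF t])
  have C1w: "C1 (\<lambda>x. w x - c) Dw" using C1_diff[OF w C1_const[of c]] by simp
  note cw = C1_continuous(1)[OF C1w, of UNIV] and cDw = C1_continuous(2)[OF w, of UNIV]
  note cDm = C1_continuous(2)[OF C1m, of UNIV]
  define v Dv where "v = (\<lambda>x. (m x)\<^sup>2 * (w x - c))"
    and "Dv = (\<lambda>x. (m x)\<^sup>2 *\<^sub>R Dw x + (w x - c) *\<^sub>R ((- (4 * m x / t\<^sup>2)) *\<^sub>R (x - y)))"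
  have C1v: "C1 v Dv" unfolding v_def Dv_def by (rule C1_mult[OF C1m C1w])
  have vz: "v x = 0" if "x \<notin> cball y t" for x
  proof -
    have "t < norm (x - y)" using that by (simp add: dist_norm norm_minus_commute)
    then have "t\<^sup>2 \<le> (norm (x - y))\<^sup>2" using t by (intro power_mono) auto
    then have "m x = 0" unfolding m_def using t by (simp add: field_simps)
    then show ?thesis unfolding v_def by simp
  qed
  define X Y where "X = L2n y t (\<lambda>x. m x *\<^sub>R Dw x)" and "Y = L2n y t (\<lambda>x. w x - c)"
  have X0: "0 \<le> X" and Y0: "0 \<le> Y" unfolding X_def Y_def using t by (auto intro: L2n_nonneg)
  have grad: "norm ((- (4 * m x / t\<^sup>2)) *\<^sub>R (x - y)) \<le> 4 / t * m x" if "x \<in> cball y t" for x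
  proof -
    have "norm ((- (4 * m x / t\<^sup>2)) *\<^sub>R (x - y)) = 4 * m x / t\<^sup>2 * norm (x - y)" using m01[of x] by simp
    also have "\<dots> \<le> 4 * m x / t\<^sup>2 * t"
      by (rule mult_left_mono) (use that m01[of x] in \<open>auto simp: dist_norm norm_minus_commute\<close>)
    also have "\<dots> = 4 / t * m x" using t by (simp add: power2_eq_square)
    finally show ?thesis .
  qed
  have LnDv: "L2n y t Dv \<le> X + 4 / t * Y"
  proof -
    have "L2n y t Dv \<le> L2n y t (\<lambda>x. (m x)\<^sup>2 *\<^sub>R Dw x) + L2n y t (\<lambda>x. (w x - c) *\<^sub>R ((- (4 * m x / t\<^sup>2)) *\<^sub>R (x - y)))"
      unfolding Dv_def by (intro L2n_triangle continuous_intros cm cw cDw cDm t) (use t in auto)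
    also have "L2n y t (\<lambda>x. (m x)\<^sup>2 *\<^sub>R Dw x) \<le> X"
      unfolding X_def
    proof (rule L2n_mono)
      fix x show "norm ((m x)\<^sup>2 *\<^sub>R Dw x) \<le> norm (m x *\<^sub>R Dw x)"
        using m01[of x] by (auto simp: power2_eq_square intro!: mult_right_mono mult_left_le)
    qed (intro continuous_intros cm cDw t)+
    also have "L2n y t (\<lambda>x. (w x - c) *\<^sub>R ((- (4 * m x / t\<^sup>2)) *\<^sub>R (x - y))) \<le> L2n y t (\<lambda>x. (4 / t) *\<^sub>R (w x - c))"
    proof (rule L2n_mono)
      fix x assume x: "x \<in> cball y t"
      have "norm ((w x - c) *\<^sub>R ((- (4 * m x / t\<^sup>2)) *\<^sub>R (x - y))) = \<bar>w x - c\<bar> * norm ((- (4 * m x / t\<^sup>2)) *\<^sub>R (x - y))"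
        by (simp only: norm_scaleR)
      also have "\<dots> \<le> \<bar>w x - c\<bar> * (4 / t * m x)" by (rule mult_left_mono[OF grad[OF x]]) simp
      also have "\<dots> \<le> \<bar>w x - c\<bar> * (4 / t * 1)"
        by (intro mult_left_mono) (use m01[of x] t in auto)
      also have "\<dots> = norm ((4 / t) *\<^sub>R (w x - c))"
        unfolding real_scaleR_def real_norm_def abs_mult using t by simp
      finally show "norm ((w x - c) *\<^sub>R ((- (4 * m x / t\<^sup>2)) *\<^sub>R (x - y))) \<le> norm ((4 / t) *\<^sub>R (w x - c))"
        .
    qed (intro continuous_intros cm cw cDm t)+
    also have "\<dots> = 4 / t * Y" unfolding Y_def using t L2n_scaleR[OF t, of y "4 / t" "\<lambda>x. w x - c"] by simp
    finally show ?thesis by simp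
  qed
  have ca: "continuous_on UNIV (\<lambda>x. a x (Dw x))" by (rule elliptic_continuous[OF ell cDw])
  note int = set_integrable_cball_continuous
  have cDv: "continuous_on UNIV Dv" by (rule C1_continuous(2)[OF C1v])
  have "\<mu> * sq_int y t (\<lambda>x. m x *\<^sub>R Dw x) = (LINT x:cball y t|lborel. \<mu> * (norm (m x *\<^sub>R Dw x))\<^sup>2)"
    unfolding sq_int_def by simp
  also have "\<dots> \<le> (LINT x:cball y t|lborel. a x (Dw x) \<bullet> Dv x + (4 * \<Lambda> / t) * (norm (m x *\<^sub>R Dw x) * \<bar>w x - c\<bar>))"
  proof (rule set_integral_mono)
    fix x assume x: "x \<in> cball y t"
    have "\<mu> * (norm (m x *\<^sub>R Dw x))\<^sup>2 = (m x)\<^sup>2 * (\<mu> * (norm (Dw x))\<^sup>2)"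
      by (simp add: power_mult_distrib)
    also have "\<dots> \<le> (m x)\<^sup>2 * (a x (Dw x) \<bullet> Dw x)"
      by (intro mult_left_mono elliptic_simps(3)[OF ell]) auto
    also have "\<dots> = a x (Dw x) \<bullet> Dv x - (w x - c) * (a x (Dw x) \<bullet> ((- (4 * m x / t\<^sup>2)) *\<^sub>R (x - y)))"
      unfolding Dv_def by (simp only: inner_add_right inner_scaleR_right)
    also have "\<dots> \<le> a x (Dw x) \<bullet> Dv x + \<bar>w x - c\<bar> * ((\<Lambda> * norm (Dw x)) * (4 / t * m x))"
    proof -
      have "- ((w x - c) * (a x (Dw x) \<bullet> ((- (4 * m x / t\<^sup>2)) *\<^sub>R (x - y)))) \<le> \<bar>w x - c\<bar> * ((\<Lambda> * norm (Dw x)) * (4 / t * m x))"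
      proof -
      have "\<bar>a x (Dw x) \<bullet> ((- (4 * m x / t\<^sup>2)) *\<^sub>R (x - y))\<bar> \<le> norm (a x (Dw x)) * norm ((- (4 * m x / t\<^sup>2)) *\<^sub>R (x - y))"
        by (rule Cauchy_Schwarz_ineq2)
      also have "\<dots> \<le> (\<Lambda> * norm (Dw x)) * (4 / t * m x)"
        by (intro mult_mono grad[OF x] elliptic_simps(4)[OF ell]) (use La in auto)
      finally have "\<bar>(w x - c) * (a x (Dw x) \<bullet> ((- (4 * m x / t\<^sup>2)) *\<^sub>R (x - y)))\<bar> \<le> \<bar>w x - c\<bar> * ((\<Lambda> * norm (Dw x)) * (4 / t * m x))"
        unfolding abs_mult by (rule mult_left_mono) simp
      then show ?thesis by linarith
      qed
      then show ?thesis by linarith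
    qed
    finally show "\<mu> * (norm (m x *\<^sub>R Dw x))\<^sup>2 \<le> a x (Dw x) \<bullet> Dv x + (4 * \<Lambda> / t) * (norm (m x *\<^sub>R Dw x) * \<bar>w x - c\<bar>)"
      using m01[of x] by (simp add: algebra_simps)
  qed (use t in \<open>auto intro!: int continuous_intros cm cw cDw ca cDv\<close>)
  also have "\<dots> = (LINT x:cball y t|lborel. a x (Dw x) \<bullet> Dv x) + (4 * \<Lambda> / t) * (LINT x:cball y t|lborel. norm (m x *\<^sub>R Dw x) * \<bar>w x - c\<bar>)"
    using t by (subst set_integral_add) (auto intro!: int continuous_intros cm cw cDw ca cDv)
  also have "\<dots> \<le> t ^ ?d * K * L2n y t Dv + (4 * \<Lambda> / t) * (t ^ ?d * X * Y)"
  proof (intro add_mono mult_left_mono)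
    show "(LINT x:cball y t|lborel. a x (Dw x) \<bullet> Dv x) \<le> t ^ ?d * K * L2n y t Dv"
      using SolD[OF sol C1v vz] by linarith
    have "\<bar>LINT x:cball y t|lborel. norm (m x *\<^sub>R Dw x) * \<bar>w x - c\<bar>\<bar> \<le> t ^ ?d * L2n y t (\<lambda>x. norm (m x *\<^sub>R Dw x)) * L2n y t (\<lambda>x. \<bar>w x - c\<bar>)"
      by (intro L2n_Cauchy_Schwarz continuous_intros cm cw cDw t)
    also have "L2n y t (\<lambda>x. \<bar>w x - c\<bar>) = Y" unfolding Y_def by (rule L2n_cong) simp
    also have "L2n y t (\<lambda>x. norm (m x *\<^sub>R Dw x)) = X" unfolding X_def by (rule L2n_norm)
    finally show "(LINT x:cball y t|lborel. norm (m x *\<^sub>R Dw x) * \<bar>w x - c\<bar>) \<le> t ^ ?d * X * Y" by linarith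
    show "0 \<le> 4 * \<Lambda> / t" using La t by simp
  qed
  also have "\<dots> \<le> t ^ ?d * K * (X + 4 / t * Y) + (4 * \<Lambda> / t) * (t ^ ?d * X * Y)"
    using LnDv K t by (intro add_right_mono mult_left_mono) auto
  also have "sq_int y t (\<lambda>x. m x *\<^sub>R Dw x) = t ^ ?d * X\<^sup>2" unfolding X_def by (rule sq_int_eq[OF t])
  finally have "t ^ ?d * (\<mu> * X\<^sup>2) \<le> t ^ ?d * (K * (X + 4 / t * Y) + (4 * \<Lambda> / t) * (X * Y))"
    by (simp add: algebra_simps)
  then have "\<mu> * X\<^sup>2 \<le> K * (X + 4 / t * Y) + (4 * \<Lambda> / t) * (X * Y)" using t by simp
  also have "\<dots> = K * X + 4 * K * (Y / t) + 4 * \<Lambda> * X * (Y / t)" using t by (simp add: field_simps)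
  also have "\<dots> \<le> (1 + 4 * \<Lambda>) * X * (Y / t + K) + 4 * (Y / t + K)\<^sup>2"
  proof -
    define q where "q = Y / t"
    have q0: "0 \<le> q" unfolding q_def using Y0 t by simp
    have "0 \<le> X * q" "0 \<le> \<Lambda> * X * K" "0 \<le> K * q" "0 \<le> q * q" "0 \<le> K * K" using X0 q0 La K by auto
    then have "K * X + 4 * K * q + 4 * \<Lambda> * X * q \<le> (1 + 4 * \<Lambda>) * X * (q + K) + 4 * (q + K)\<^sup>2"
      by (simp add: power2_eq_square algebra_simps)
    then show ?thesis unfolding q_def .
  qed
  finally have Xle: "X \<le> (1 + (5 + 4 * \<Lambda>) / \<mu>) * (Y / t + K)"
    by (intro quadratic_bound) (use mu X0 Y0 t K La in auto)
  \<comment> \<open>On the half ball the cutoff is at least \<open>1 - 1 / 4\<close>, whence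
    \<open>4 / 3\<close>.\<close>
  have "L2n y (t / 2) Dw \<le> L2n y (t / 2) (\<lambda>x. (4 / 3) *\<^sub>R (m x *\<^sub>R Dw x))"
  proof (rule L2n_mono)
    fix x assume "x \<in> cball y (t / 2)"
    then have "(norm (x - y))\<^sup>2 \<le> (t / 2)\<^sup>2" by (intro power_mono) (auto simp: dist_norm norm_minus_commute)
    then have "(norm (x - y))\<^sup>2 / t\<^sup>2 \<le> 1 / 4" using t by (simp add: power2_eq_square field_simps)
    then have "3 / 4 \<le> m x" unfolding m_def by (intro max.coboundedI2) linarith
    then show "norm (Dw x) \<le> norm ((4 / 3) *\<^sub>R (m x *\<^sub>R Dw x))"
      using mult_right_mono[of 1 "4 / 3 * m x" "norm (Dw x)"] m01[of x] by simp
  qed (use t in \<open>intro continuous_intros cm cDw | simp\<close>)+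
  also have "\<dots> = 4 / 3 * L2n y (t / 2) (\<lambda>x. m x *\<^sub>R Dw x)" using t by (subst L2n_scaleR) auto
  also have "L2n y (t / 2) (\<lambda>x. m x *\<^sub>R Dw x) \<le> sqrt ((t / (t / 2)) ^ ?d) * L2n y t (\<lambda>x. m x *\<^sub>R Dw x)"
    by (rule L2n_ball_mono) (use t in \<open>auto intro!: continuous_intros cm cDw subset_cball\<close>)
  finally have "L2n y (t / 2) Dw \<le> 4 / 3 * (sqrt (2 ^ ?d) * X)" using t unfolding X_def by simp
  also have "\<dots> \<le> 4 / 3 * (sqrt (2 ^ ?d) * ((1 + (5 + 4 * \<Lambda>) / \<mu>) * (Y / t + K)))"
    by (intro mult_left_mono Xle) auto
  finally show ?thesis unfolding Y_def by (simp only: mult.assoc)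
qed

subsection \<open>Almost periods and decay of the gradient\<close>

text \<open>Both points are asked to lie in the ball, because the oscillating structure of the
  coefficients is available only inside the domain of the problem.\<close>

definition near_period :: "('a::euclidean_space \<Rightarrow> 'a \<Rightarrow> 'a) \<Rightarrow> 'a \<Rightarrow> real \<Rightarrow> real \<Rightarrow> 'a \<Rightarrow> bool" where
  "near_period a y t \<omega> \<tau> \<longleftrightarrow>
     (\<forall>x \<xi>. x \<in> cball y t \<longrightarrow> x + \<tau> \<in> cball y t \<longrightarrow> norm (a (x + \<tau>) \<xi> - a x \<xi>) \<le> \<omega> * norm \<xi>)"

text \<open>\<open>\<omega>\<close> is the price in the coefficients and \<open>e\<close> the price
  in the shift; they enter the iteration together as \<open>\<omega> + e / t\<close>.\<close>

definition almost_periodic :: "('a::euclidean_space \<Rightarrow> 'a \<Rightarrow> 'a) \<Rightarrow> 'a \<Rightarrow> real \<Rightarrow> real \<Rightarrow> real \<Rightarrow> bool" where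
  "almost_periodic a y t \<omega> e \<longleftrightarrow> (\<forall>z. norm z \<le> t / 2 \<longrightarrow> (\<exists>\<tau>. norm (\<tau> - z) \<le> e \<and> near_period a y t \<omega> \<tau>))"

lemma near_period_subset: "near_period a y t \<omega> \<tau> \<Longrightarrow> s \<le> t \<Longrightarrow> near_period a y s \<omega> \<tau>"
  unfolding near_period_def using subset_cball[of s t y] by blast

lemma almost_periodic_subset:
  fixes y :: "'a::euclidean_space"
  shows "almost_periodic a y t \<omega> e \<Longrightarrow> s \<le> t \<Longrightarrow> almost_periodic a y s \<omega> e"
  unfolding almost_periodic_def
proof (intro allI impI)
  fix z :: 'a assume *: "\<forall>z. norm z \<le> t / 2 \<longrightarrow> (\<exists>\<tau>. norm (\<tau> - z) \<le> e \<and> near_period a y t \<omega> \<tau>)" "s \<le> t" "norm z \<le> s / 2"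
  then have "norm z \<le> t / 2" by linarith
  with * show "\<exists>\<tau>. norm (\<tau> - z) \<le> e \<and> near_period a y s \<omega> \<tau>"
    using near_period_subset by blast
qed

text \<open>The errors add up along the chain; its intermediate points lie on the segment between
  the end points and so in the convex ball.\<close>

lemma near_period_multiple:
  fixes y :: "'a::euclidean_space"
  assumes np: "near_period a y t \<omega> \<tau>"
  shows "near_period a y t (real i * \<omega>) (real i *\<^sub>R \<tau>)"
proof (induction i)
  case 0
  show ?case by (simp add: near_period_def)
next
  case (Suc i)
  show ?case unfolding near_period_def
  proof (intro allI impI)
    fix x \<xi> assume x: "x \<in> cball y t" and x': "x + real (Suc i) *\<^sub>R \<tau> \<in> cball y t"
    have mid: "x + real i *\<^sub>R \<tau> \<in> cball y t"
    proof -
      have "x + real i *\<^sub>R \<tau> = (1 - real i / real (Suc i)) *\<^sub>R x + (real i / real (Suc i)) *\<^sub>R (x + real (Suc i) *\<^sub>R \<tau>)"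
      proof -
        have "(1 - l) *\<^sub>R x + l *\<^sub>R (x + S *\<^sub>R \<tau>) = x + (l * S) *\<^sub>R \<tau>" for l S
          by (simp add: algebra_simps)
        then show ?thesis by simp
      qed
      also have "\<dots> \<in> cball y t" using x x' by (intro convexD_alt) (auto simp: convex_cball)
      finally show ?thesis .
    qed
    have "x + real (Suc i) *\<^sub>R \<tau> = (x + real i *\<^sub>R \<tau>) + \<tau>" by (simp add: algebra_simps)
    then have "norm (a (x + real (Suc i) *\<^sub>R \<tau>) \<xi> - a (x + real i *\<^sub>R \<tau>) \<xi>) \<le> \<omega> * norm \<xi>"
      using np mid x' unfolding near_period_def by metis
    moreover have "norm (a (x + real i *\<^sub>R \<tau>) \<xi> - a x \<xi>) \<le> real i * \<omega> * norm \<xi>"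
      using Suc.IH x mid unfolding near_period_def by blast
    moreover have "norm (a (x + real (Suc i) *\<^sub>R \<tau>) \<xi> - a x \<xi>) \<le> norm (a (x + real (Suc i) *\<^sub>R \<tau>) \<xi> - a (x + real i *\<^sub>R \<tau>) \<xi>) + norm (a (x + real i *\<^sub>R \<tau>) \<xi> - a x \<xi>)"
      using norm_triangle_ineq[of "a (x + real (Suc i) *\<^sub>R \<tau>) \<xi> - a (x + real i *\<^sub>R \<tau>) \<xi>" "a (x + real i *\<^sub>R \<tau>) \<xi> - a x \<xi>"] by simp
    ultimately show "norm (a (x + real (Suc i) *\<^sub>R \<tau>) \<xi> - a x \<xi>) \<le> real (Suc i) * \<omega> * norm \<xi>"
      by (simp add: algebra_simps)
  qed
qed

lemma cball_shift_subset: "s + norm \<tau> \<le> t \<Longrightarrow> cball (y + \<tau>) s \<subseteq> cball (y::'a::euclidean_space) t"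
proof
  fix q assume "s + norm \<tau> \<le> t" "q \<in> cball (y + \<tau>) s"
  then show "q \<in> cball y t" using dist_triangle[of y q "y + \<tau>"] by (simp add: dist_norm)
qed

lemma Sol_increment':
  fixes y :: "'a::euclidean_space"
  assumes "elliptic a \<mu> \<Lambda>" "Sol a y t K Dw" "continuous_on UNIV Dw" "0 < s" and st: "s + norm \<tau> \<le> t" and "0 \<le> \<omega>"
    and np: "near_period a y t \<omega> \<tau>"
  shows "Sol a y s (sqrt ((t / s) ^ DIM('a)) * (2 * K + \<omega> * L2n y t Dw)) (\<lambda>x. Dw (x + \<tau>) - Dw x)"
proof (rule Sol_increment[OF assms(1-6)])
  fix x \<xi> assume x: "x \<in> cball y s"
  have "x + \<tau> \<in> cball (y + \<tau>) s" using x by (simp add: dist_norm)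
  then have "x + \<tau> \<in> cball y t" using cball_shift_subset[OF st, of y] by blast
  moreover have "x \<in> cball y t" using x st norm_ge_zero[of \<tau>] by (simp del: norm_ge_zero)
  ultimately show "norm (a (x + \<tau>) \<xi> - a x \<xi>) \<le> \<omega> * norm \<xi>" using np unfolding near_period_def by blast
qed

lemma L2n_increment_le':
  fixes w :: "'a::euclidean_space \<Rightarrow> real"
  assumes w: "C1 w Dw" and s: "0 < s" and st: "s + norm z \<le> t"
  shows "L2n y s (\<lambda>x. w (x + z) - w x) \<le> norm z * (sqrt ((t / s) ^ DIM('a)) * L2n y t Dw)"
proof -
  have sz: "0 < s + norm z" using s by (simp add: add_pos_nonneg)
  have t: "0 < t" using sz st by linarith
  have "L2n y s (\<lambda>x. w (x + z) - w x) \<le> norm z * (sqrt (((s + norm z) / s) ^ DIM('a)) * L2n y (s + norm z) Dw)"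
    by (rule L2n_increment_le[OF w s])
  also have "\<dots> \<le> norm z * (sqrt (((s + norm z) / s) ^ DIM('a)) * (sqrt ((t / (s + norm z)) ^ DIM('a)) * L2n y t Dw))"
    by (intro mult_left_mono L2n_ball_mono C1_continuous(2)[OF w] subset_cball sz t st) (use s in auto)
  also have "sqrt (((s + norm z) / s) ^ DIM('a)) * (sqrt ((t / (s + norm z)) ^ DIM('a)) * L2n y t Dw) = sqrt ((t / s) ^ DIM('a)) * L2n y t Dw"
    using s sz by (simp add: real_sqrt_mult[symmetric] power_mult_distrib[symmetric] mult.assoc[symmetric])
  finally show ?thesis .
qed

lemma L2n_shift_diff_le:
  fixes F :: "'a::euclidean_space \<Rightarrow> 'b::real_normed_vector"
  assumes F: "continuous_on UNIV F" and s: "0 < s" and st: "s + norm \<tau> \<le> t"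
  shows "L2n y s (\<lambda>x. F (x + \<tau>) - F x) \<le> 2 * sqrt ((t / s) ^ DIM('a)) * L2n y t F"
proof -
  have t: "0 < t" using s st norm_ge_zero[of \<tau>] by linarith
  have "L2n y s (\<lambda>x. F (x + \<tau>) - F x) \<le> L2n y s (\<lambda>x. F (x + \<tau>)) + L2n y s F"
    by (intro L2n_triangle_diff F s continuous_on_compose2[OF F]) (auto intro!: continuous_intros)
  also have "L2n y s (\<lambda>x. F (x + \<tau>)) = L2n (y + \<tau>) s F" by (rule L2n_shift)
  also have "\<dots> \<le> sqrt ((t / s) ^ DIM('a)) * L2n y t F"
    by (intro L2n_ball_mono F s t cball_shift_subset st)
  also have "L2n y s F \<le> sqrt ((t / s) ^ DIM('a)) * L2n y t F"
    by (intro L2n_ball_mono F s t subset_cball) (use st norm_ge_zero[of \<tau>] in linarith)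
  finally show ?thesis by (simp add: algebra_simps)
qed

text \<open>The difference of \<open>w\<close> along an almost period is an almost solution of size
  \<open>norm \<tau>\<close> times the gradient. By Caccioppoli its gradient is smaller than that of
  \<open>w\<close> by the factor \<open>norm \<tau> / t\<close>, up to errors.\<close>

lemma L2n_grad_increment_le:
  fixes \<mu> \<Lambda> :: real
  assumes mu: "0 < \<mu>" and La: "0 \<le> \<Lambda>"
  shows "\<exists>C>0. \<forall>a (y::'a::euclidean_space) t w Dw K \<omega> \<tau>. elliptic a \<mu> \<Lambda> \<longrightarrow> C1 w Dw \<longrightarrow> Sol a y t K Dw \<longrightarrow>
     near_period a y t \<omega> \<tau> \<longrightarrow> 0 < t \<longrightarrow> 0 \<le> K \<longrightarrow> 0 \<le> \<omega> \<longrightarrow> norm \<tau> \<le> t / 2 \<longrightarrow>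
     L2n y (t / 4) (\<lambda>x. Dw (x + \<tau>) - Dw x) \<le> C * (norm \<tau> / t * L2n y t Dw + \<omega> * L2n y t Dw + K)"
proof -
  let ?d = "DIM('a)"
  define Cc where "Cc = 4 / 3 * sqrt (2 ^ ?d) * (1 + (5 + 4 * \<Lambda>) / \<mu>)"
  have Cc: "Cc > 0" unfolding Cc_def using mu La by (intro mult_pos_pos) (auto intro!: add_pos_nonneg)
  let ?C = "Cc * (2 * sqrt (2 ^ ?d))"
  have "L2n y (t / 4) (\<lambda>x. Dw (x + \<tau>) - Dw x) \<le> ?C * (norm \<tau> / t * L2n y t Dw + \<omega> * L2n y t Dw + K)"
    if ell: "elliptic a \<mu> \<Lambda>" and w: "C1 w Dw" and sol: "Sol a y t K Dw" and np: "near_period a y t \<omega> \<tau>"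
      and t: "0 < t" and K: "0 \<le> K" and om: "0 \<le> \<omega>" and tau: "norm \<tau> \<le> t / 2" for a and y :: 'a and t w Dw K \<omega> \<tau>
  proof -
    note cDw = C1_continuous(2)[OF w, of UNIV]
    have tt: "t / (t / 2) = 2" using t by simp
    have M: "0 \<le> L2n y t Dw" using t by (intro L2n_nonneg) simp
    have S: "Sol a y (t / 2) (sqrt (2 ^ ?d) * (2 * K + \<omega> * L2n y t Dw)) (\<lambda>x. Dw (x + \<tau>) - Dw x)"
      using Sol_increment'[OF ell sol cDw _ _ om np, of "t / 2"] t tau by (simp add: tt)
    have "L2n y ((t / 2) / 2) (\<lambda>x. Dw (x + \<tau>) - Dw x) \<le> Cc * (L2n y (t / 2) (\<lambda>x. (w (x + \<tau>) - w x) - 0) / (t / 2) + sqrt (2 ^ ?d) * (2 * K + \<omega> * L2n y t Dw))"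
      unfolding Cc_def
      by (rule caccioppoli[OF mu La ell C1_diff[OF C1_shift[OF w] w] S]) (use t K om M in auto)
    also have "\<dots> \<le> Cc * ((norm \<tau> * (sqrt (2 ^ ?d) * L2n y t Dw)) / (t / 2) + sqrt (2 ^ ?d) * (2 * K + \<omega> * L2n y t Dw))"
      using L2n_increment_le'[OF w, of "t / 2" \<tau> t y] t tau Cc
      by (intro mult_left_mono add_right_mono divide_right_mono) (auto simp: tt)
    also have "\<dots> = Cc * sqrt (2 ^ ?d) * (2 * (norm \<tau> / t * L2n y t Dw) + 2 * K + \<omega> * L2n y t Dw)"
      using t by (simp add: field_simps)
    also have "\<dots> \<le> Cc * sqrt (2 ^ ?d) * (2 * (norm \<tau> / t * L2n y t Dw) + 2 * K + 2 * (\<omega> * L2n y t Dw))"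
      using Cc om M by (intro mult_left_mono add_left_mono) auto
    finally show ?thesis by (simp add: algebra_simps)
  qed
  moreover have "?C > 0" using Cc by simp
  ultimately show ?thesis by blast
qed

text \<open>Rate at which the average of the gradient may grow when the radius shrinks. Averaging alone gives
  the exponent \<open>d / 2\<close>.\<close>

definition grad_decay_at :: "'a::euclidean_space itself \<Rightarrow> real \<Rightarrow> real \<Rightarrow> real \<Rightarrow> real \<Rightarrow> real \<Rightarrow> real \<Rightarrow> bool" where
  "grad_decay_at _ \<mu> \<Lambda> \<theta> A C c \<longleftrightarrow> (\<forall>a (y::'a) t w Dw K \<omega> e.
     elliptic a \<mu> \<Lambda> \<longrightarrow> C1 w Dw \<longrightarrow> Sol a y t K Dw \<longrightarrow> almost_periodic a y t \<omega> e \<longrightarrow> 0 < t \<longrightarrow> 0 \<le> K \<longrightarrow> 0 \<le> \<omega> \<longrightarrow> e \<le> c * t \<longrightarrow>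
     L2n y (\<theta> * t) Dw \<le> A * L2n y t Dw + C * (\<omega> * L2n y t Dw + K))"

text \<open>The order of quantifiers matters: \<open>A\<close> is uniform in
  \<open>\<theta>\<close>, whereas the weight \<open>C\<close> of the errors and the admissible size
  \<open>c\<close> of \<open>e / t\<close> may depend on it. So a ratio can be selected afterwards
  against \<open>A\<close> alone.\<close>

definition grad_decay :: "'a::euclidean_space itself \<Rightarrow> real \<Rightarrow> real \<Rightarrow> real \<Rightarrow> bool" where
  "grad_decay T \<mu> \<Lambda> \<beta> \<longleftrightarrow> (\<exists>A>0. \<forall>\<theta>. 0 < \<theta> \<and> \<theta> \<le> 1 \<longrightarrow>
     (\<exists>C>0. \<exists>c>0. grad_decay_at T \<mu> \<Lambda> \<theta> (A * \<theta> powr (-\<beta>)) C c))"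

lemma grad_decay_atI:
  assumes "\<And>a (y::'a::euclidean_space) t w Dw K \<omega> e.
     elliptic a \<mu> \<Lambda> \<Longrightarrow> C1 w Dw \<Longrightarrow> Sol a y t K Dw \<Longrightarrow> almost_periodic a y t \<omega> e \<Longrightarrow> 0 < t \<Longrightarrow> 0 \<le> K \<Longrightarrow> 0 \<le> \<omega> \<Longrightarrow> e \<le> c * t \<Longrightarrow>
     L2n y (\<theta> * t) Dw \<le> A * L2n y t Dw + C * (\<omega> * L2n y t Dw + K)"
  shows "grad_decay_at TYPE('a) \<mu> \<Lambda> \<theta> A C c"
  unfolding grad_decay_at_def using assms by blast

lemma grad_decay_atD:
  fixes y :: "'a::euclidean_space"
  assumes "grad_decay_at TYPE('a) \<mu> \<Lambda> \<theta> A C c"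
    "elliptic a \<mu> \<Lambda>" "C1 w Dw" "Sol a y t K Dw" "almost_periodic a y t \<omega> e" "0 < t" "0 \<le> K" "0 \<le> \<omega>" "e \<le> c * t"
  shows "L2n y (\<theta> * t) Dw \<le> A * L2n y t Dw + C * (\<omega> * L2n y t Dw + K)"
  using assms unfolding grad_decay_at_def by blast

lemma sqrt_power_eq_powr: "0 < x \<Longrightarrow> sqrt (x ^ n) = x powr (real n / 2)"
  by (simp add: powr_half_sqrt[symmetric] powr_realpow[symmetric] powr_powr)

lemma grad_decay_base: "grad_decay TYPE('a::euclidean_space) \<mu> \<Lambda> (real DIM('a) / 2)"
proof -
  have "grad_decay_at TYPE('a) \<mu> \<Lambda> \<theta> (1 * \<theta> powr (- (real DIM('a) / 2))) 1 1"
    if th: "0 < \<theta>" "\<theta> \<le> 1" for \<theta>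
  proof (rule grad_decay_atI)
    fix y :: 'a and w :: "'a \<Rightarrow> real" and Dw :: "'a \<Rightarrow> 'a" and t K \<omega> :: real
    assume w: "C1 w Dw" and *: "0 < t" "0 \<le> K" "0 \<le> \<omega>"
    have "L2n y (\<theta> * t) Dw \<le> sqrt ((t / (\<theta> * t)) ^ DIM('a)) * L2n y t Dw"
      by (intro L2n_ball_mono C1_continuous(2)[OF w] subset_cball) (use * th in \<open>auto simp: mult_left_le_one_le\<close>)
    also have "sqrt ((t / (\<theta> * t)) ^ DIM('a)) = \<theta> powr (- (real DIM('a) / 2))"
    proof -
      have "sqrt ((t / (\<theta> * t)) ^ DIM('a)) = (1 / \<theta>) powr (real DIM('a) / 2)"
        using * th sqrt_power_eq_powr[of "1 / \<theta>"] by simp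
      then show ?thesis using th by (simp add: powr_minus_divide powr_divide)
    qed
    finally show "L2n y (\<theta> * t) Dw \<le> 1 * \<theta> powr (- (real DIM('a) / 2)) * L2n y t Dw + 1 * (\<omega> * L2n y t Dw + K)"
      using * L2n_nonneg[of t y Dw] by (simp add: add_increasing2)
  qed
  then show ?thesis unfolding grad_decay_def by (meson zero_less_one)
qed

lemma grad_decay_mono:
  assumes g: "grad_decay TYPE('a::euclidean_space) \<mu> \<Lambda> \<beta>" and b: "\<beta> \<le> \<beta>'"
  shows "grad_decay TYPE('a) \<mu> \<Lambda> \<beta>'"
proof -
  from g obtain A where A: "A > 0" and H: "\<And>\<theta>. 0 < \<theta> \<Longrightarrow> \<theta> \<le> 1 \<Longrightarrow> \<exists>C>0. \<exists>c>0. grad_decay_at TYPE('a) \<mu> \<Lambda> \<theta> (A * \<theta> powr (-\<beta>)) C c"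
    unfolding grad_decay_def by blast
  have "\<exists>C>0. \<exists>c>0. grad_decay_at TYPE('a) \<mu> \<Lambda> \<theta> (A * \<theta> powr (-\<beta>')) C c" if th: "0 < \<theta>" "\<theta> \<le> 1" for \<theta>
  proof -
    obtain C c where C: "C > 0" "c > 0" and g: "grad_decay_at TYPE('a) \<mu> \<Lambda> \<theta> (A * \<theta> powr (-\<beta>)) C c"
      using H[OF th] by blast
    have "grad_decay_at TYPE('a) \<mu> \<Lambda> \<theta> (A * \<theta> powr (-\<beta>')) C c"
    proof (rule grad_decay_atI)
      fix a :: "'a \<Rightarrow> 'a \<Rightarrow> 'a" and y :: 'a and w :: "'a \<Rightarrow> real" and Dw :: "'a \<Rightarrow> 'a" and t K \<omega> e :: real
      assume *: "elliptic a \<mu> \<Lambda>" "C1 w Dw" "Sol a y t K Dw" "almost_periodic a y t \<omega> e" "0 < t" "0 \<le> K" "0 \<le> \<omega>" "e \<le> c * t"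
      have "A * \<theta> powr (-\<beta>) * L2n y t Dw \<le> A * \<theta> powr (-\<beta>') * L2n y t Dw"
        using * th b A by (intro mult_right_mono mult_left_mono powr_mono' L2n_nonneg) auto
      then show "L2n y (\<theta> * t) Dw \<le> A * \<theta> powr (-\<beta>') * L2n y t Dw + C * (\<omega> * L2n y t Dw + K)"
        using grad_decay_atD[OF g *] by linarith
    qed
    then show ?thesis using C by blast
  qed
  then show ?thesis unfolding grad_decay_def using A by blast
qed

text \<open>Among translates of the small ball by vectors of length at most \<open>\<kappa> t\<close>, a good one carries at most the
  average of the gradient; an almost period near that translation brings it back to the centre, at the
  price of the gradient of a difference, to which the previous exponent applies with a gain \<open>\<kappa>\<close>.
  The choice \<open>\<kappa> = \<theta> powr (2 \<beta> / (d + 2))\<close> balances the two contributions.\<close>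

lemma grad_decay_improve:
  assumes mu: "0 < \<mu>" and La: "0 \<le> \<Lambda>" and g: "grad_decay TYPE('a::euclidean_space) \<mu> \<Lambda> \<beta>"
    and b0: "0 \<le> \<beta>" and b1: "\<beta> \<le> real DIM('a) / 2"
  shows "grad_decay TYPE('a) \<mu> \<Lambda> (\<beta> * (real DIM('a) / (real DIM('a) + 2)))"
proof -
  let ?d = "DIM('a)"
  define b where "b = 2 * \<beta> / (real ?d + 2)"
  define \<beta>' where "\<beta>' = \<beta> * (real ?d / (real ?d + 2))"
  \<comment> \<open>With \<open>k = \<theta> powr b\<close>, a good translate within distance of
    order \<open>k * t\<close> costs \<open>k powr (- d / 2)\<close>, while the gradient of the
    difference gains one factor \<open>k\<close> over the old exponent. These two identities say
    that both end at \<open>\<beta>'\<close>.\<close>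
  have bd: "b * (real ?d / 2) = \<beta>'" unfolding b_def \<beta>'_def by (simp add: field_simps)
  have bb: "\<beta> - b = \<beta>'" unfolding b_def \<beta>'_def by (simp add: field_simps)
  have b_0: "0 \<le> b" unfolding b_def using b0 by simp
  \<comment> \<open>This gives \<open>\<theta> \<le> k\<close> below: the small radius does not
    exceed \<open>k * t\<close>.\<close>
  have b_1: "b \<le> 1" unfolding b_def using b1 by (simp add: field_simps)
  from g obtain C where C: "C > 0" and H: "\<And>\<theta>. 0 < \<theta> \<Longrightarrow> \<theta> \<le> 1 \<Longrightarrow> \<exists>D>0. \<exists>c>0. grad_decay_at TYPE('a) \<mu> \<Lambda> \<theta> (C * \<theta> powr (-\<beta>)) D c"
    unfolding grad_decay_def by blast
  obtain C4 where C4: "C4 > 0" and I: "\<And>a (y::'a) t w Dw K \<omega> \<tau>. elliptic a \<mu> \<Lambda> \<Longrightarrow> C1 w Dw \<Longrightarrow> Sol a y t K Dw \<Longrightarrow>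
     near_period a y t \<omega> \<tau> \<Longrightarrow> 0 < t \<Longrightarrow> 0 \<le> K \<Longrightarrow> 0 \<le> \<omega> \<Longrightarrow> norm \<tau> \<le> t / 2 \<Longrightarrow>
     L2n y (t / 4) (\<lambda>x. Dw (x + \<tau>) - Dw x) \<le> C4 * (norm \<tau> / t * L2n y t Dw + \<omega> * L2n y t Dw + K)"
    using L2n_grad_increment_le[OF mu La, where 'a='a] by blast
  define P where "P = sqrt (2 ^ ?d) * sqrt (2 * 17 ^ ?d) * sqrt (8 ^ ?d)"
  define Cn where "Cn = P + C * C4 * 2 + sqrt (16 ^ ?d)"
  have P0: "0 \<le> P" unfolding P_def by simp
  have Cn: "Cn > 0" unfolding Cn_def using C C4 P0 by (intro add_nonneg_pos add_nonneg_nonneg) auto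
  have "\<exists>D>0. \<exists>c>0. grad_decay_at TYPE('a) \<mu> \<Lambda> \<theta> (Cn * \<theta> powr (-\<beta>')) D c" if th: "0 < \<theta> \<and> \<theta> \<le> 1" for \<theta>
  proof -
    have pw1: "1 \<le> \<theta> powr (- \<beta>')" using th b0 powr_mono'[of "-\<beta>'" 0 \<theta>] by (simp add: \<beta>'_def)
    show ?thesis
    proof (cases "\<theta> \<le> 1 / 16")
      \<comment> \<open>For ratios bounded from below averaging alone is enough; its constant is the
        last summand of \<open>Cn\<close>.\<close>
      case False
      have "grad_decay_at TYPE('a) \<mu> \<Lambda> \<theta> (Cn * \<theta> powr (-\<beta>')) 1 1"
      proof (rule grad_decay_atI)
        fix y :: 'a and w :: "'a \<Rightarrow> real" and Dw :: "'a \<Rightarrow> 'a" and t K \<omega> :: real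
        assume w: "C1 w Dw" and *: "0 < t" "0 \<le> K" "0 \<le> \<omega>"
        have M: "0 \<le> L2n y t Dw" using * by (intro L2n_nonneg) simp
        have "L2n y (\<theta> * t) Dw \<le> sqrt ((t / (\<theta> * t)) ^ ?d) * L2n y t Dw"
          by (intro L2n_ball_mono C1_continuous(2)[OF w] subset_cball) (use * th in \<open>auto simp: mult_left_le_one_le\<close>)
        also have "\<dots> \<le> sqrt (16 ^ ?d) * L2n y t Dw"
          by (intro mult_right_mono real_sqrt_le_mono power_mono M) (use False * th in \<open>auto simp: field_simps\<close>)
        also have "\<dots> \<le> (Cn * \<theta> powr (-\<beta>')) * L2n y t Dw"
        proof (rule mult_right_mono[OF _ M])
          have "sqrt (16 ^ ?d) \<le> Cn * 1" unfolding Cn_def using P0 C C4 by simp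
          also have "\<dots> \<le> Cn * \<theta> powr (-\<beta>')" using Cn pw1 by (intro mult_left_mono) auto
          finally show "sqrt (16 ^ ?d) \<le> Cn * \<theta> powr (-\<beta>')" .
        qed
        finally show "L2n y (\<theta> * t) Dw \<le> Cn * \<theta> powr (-\<beta>') * L2n y t Dw + 1 * (\<omega> * L2n y t Dw + K)"
          using * M by (simp add: add_increasing2)
      qed
      then show ?thesis by (meson zero_less_one)
    next
      case True
      \<comment> \<open>The ratio is \<open>4 * \<theta>\<close> because the old exponent is applied
        on the ball of radius \<open>t / 4\<close>, where the difference is an almost
        solution.\<close>
      obtain D c4 where D: "D > 0" and c4: "c4 > 0" and H': "grad_decay_at TYPE('a) \<mu> \<Lambda> (4 * \<theta>) (C * (4 * \<theta>) powr (-\<beta>)) D c4"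
        using H[of "4 * \<theta>"] th True by auto
      \<comment> \<open>The first bound keeps \<open>\<tau>\<close> so close to \<open>z\<close>
        that the ball around \<open>y + \<tau>\<close> lies in the doubled ball around
        \<open>y + z\<close>; the second makes \<open>e\<close> admissible for the old exponent at
        radius \<open>t / 4\<close>.\<close>
      define c where "c = min \<theta> (c4 / 4)"
      define C' where "C' = C * \<theta> powr (-\<beta>) * C4 + D * (4 * sqrt (4 ^ ?d))"
      have C': "C' > 0" unfolding C'_def using C C4 D th by (intro add_pos_pos mult_pos_pos) auto
      define k where "k = \<theta> powr b"
      have k01: "0 < k" "k \<le> 1" unfolding k_def using th b_0 by (auto simp: powr_le1)
      have thk: "\<theta> \<le> k" unfolding k_def using th b_1 powr_mono'[of b 1 \<theta>] by simp
      have "grad_decay_at TYPE('a) \<mu> \<Lambda> \<theta> (Cn * \<theta> powr (-\<beta>')) C' c"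
      proof (rule grad_decay_atI)
        fix a :: "'a \<Rightarrow> 'a \<Rightarrow> 'a" and y :: 'a and w :: "'a \<Rightarrow> real" and Dw :: "'a \<Rightarrow> 'a" and t K \<omega> e :: real
        assume ell: "elliptic a \<mu> \<Lambda>" and w: "C1 w Dw" and sol: "Sol a y t K Dw" and ap: "almost_periodic a y t \<omega> e"
          and t: "0 < t" and K: "0 \<le> K" and om: "0 \<le> \<omega>" and e: "e \<le> c * t"
        define M where "M = L2n y t Dw"
        have M: "0 \<le> M" unfolding M_def using t by (intro L2n_nonneg) simp
        note cDw = C1_continuous(2)[OF w, of UNIV]
        have tht: "0 < \<theta> * t" using th t by simp
        have thkt: "\<theta> * t \<le> k * t" using thk t by simp
        have kt: "k * t \<le> t" using k01 t by simp
        have et: "e \<le> \<theta> * t" "e \<le> c4 * (t / 4)"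
        proof -
          have "c * t \<le> \<theta> * t" "c * t \<le> (c4 / 4) * t" unfolding c_def using t by (intro mult_right_mono; simp)+
          then show "e \<le> \<theta> * t" "e \<le> c4 * (t / 4)" using e by auto
        qed
        have th16: "\<theta> * t \<le> t / 16" using True t by (simp add: field_simps)
        obtain z where z: "norm z \<le> k * t / 8" and zL: "L2n (y + z) (2 * (\<theta> * t)) Dw \<le> sqrt (2 * ((k * t / 8 + 2 * (\<theta> * t)) / (k * t / 8)) ^ ?d) * L2n y (k * t / 8 + 2 * (\<theta> * t)) Dw"
          using exists_good_translate[OF cDw, of "2 * (\<theta> * t)" "k * t / 8" y] tht k01 t by auto
        have "norm z \<le> t / 2" using z kt t by linarith
        then obtain \<tau> where tau: "norm (\<tau> - z) \<le> e" and np: "near_period a y t \<omega> \<tau>"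
          using ap unfolding almost_periodic_def by blast
        have ntau: "norm \<tau> \<le> k * t / 8 + \<theta> * t"
          using norm_triangle_ineq[of "\<tau> - z" z] tau z et by simp
        have ntau2: "norm \<tau> \<le> t / 4" using ntau kt th16 t by linarith
        have A: "L2n y (\<theta> * t) (\<lambda>x. Dw (x + \<tau>)) \<le> P * \<theta> powr (-\<beta>') * M"
        proof -
          have "L2n y (\<theta> * t) (\<lambda>x. Dw (x + \<tau>)) = L2n (y + \<tau>) (\<theta> * t) Dw" by (rule L2n_shift)
          also have "\<dots> \<le> sqrt (((2 * (\<theta> * t)) / (\<theta> * t)) ^ ?d) * L2n (y + z) (2 * (\<theta> * t)) Dw"
          proof (rule L2n_ball_mono[OF cDw])
            have "cball ((y + z) + (\<tau> - z)) (\<theta> * t) \<subseteq> cball (y + z) (2 * (\<theta> * t))"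
              by (rule cball_shift_subset) (use tau et in linarith)
            then show "cball (y + \<tau>) (\<theta> * t) \<subseteq> cball (y + z) (2 * (\<theta> * t))" by simp
          qed (use tht in auto)
          also have "\<dots> \<le> sqrt (2 ^ ?d) * (sqrt (2 * 17 ^ ?d) * (sqrt ((8 / k) ^ ?d) * M))"
          proof -
            have "(k * t / 8 + 2 * (\<theta> * t)) / (k * t / 8) \<le> 17"
              using thkt k01 t by (simp add: field_simps)
            then have 1: "sqrt (2 * ((k * t / 8 + 2 * (\<theta> * t)) / (k * t / 8)) ^ ?d) \<le> sqrt (2 * 17 ^ ?d)"
              using k01 t tht by (intro real_sqrt_le_mono mult_left_mono power_mono) auto
            have kt8: "0 < k * t / 8 + 2 * (\<theta> * t)" using k01 t tht by (simp add: add_pos_pos)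
            have "L2n y (k * t / 8 + 2 * (\<theta> * t)) Dw \<le> sqrt ((t / (k * t / 8 + 2 * (\<theta> * t))) ^ ?d) * M"
              unfolding M_def by (intro L2n_ball_mono cDw subset_cball kt8 t) (use kt th16 t in linarith)
            also have "\<dots> \<le> sqrt ((8 / k) ^ ?d) * M"
            proof (intro mult_right_mono M real_sqrt_le_mono power_mono)
              have "t / (k * t / 8 + 2 * (\<theta> * t)) \<le> t / (k * t / 8)"
                using k01 t tht by (intro divide_left_mono) (auto intro!: mult_pos_pos add_pos_pos)
              then show "t / (k * t / 8 + 2 * (\<theta> * t)) \<le> 8 / k" using k01 t by simp
              show "0 \<le> t / (k * t / 8 + 2 * (\<theta> * t))" using t kt8 by simp
            qed
            finally have 2: "L2n y (k * t / 8 + 2 * (\<theta> * t)) Dw \<le> sqrt ((8 / k) ^ ?d) * M" .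
            have "L2n (y + z) (2 * (\<theta> * t)) Dw \<le> sqrt (2 * 17 ^ ?d) * (sqrt ((8 / k) ^ ?d) * M)"
              by (rule order_trans[OF zL], rule mult_mono[OF 1 2]) (use kt8 in \<open>auto intro!: L2n_nonneg\<close>)
            then show ?thesis using tht by (intro mult_mono) (auto intro!: L2n_nonneg)
          qed
          also have "sqrt ((8 / k) ^ ?d) = sqrt (8 ^ ?d) * \<theta> powr (-\<beta>')"
          proof -
            have "sqrt (k ^ ?d) = \<theta> powr \<beta>'"
              using sqrt_power_eq_powr[OF k01(1), of ?d] by (simp add: k_def powr_powr bd[symmetric])
            then show ?thesis using k01 by (simp add: power_divide real_sqrt_divide powr_minus_divide)
          qed
          finally show ?thesis unfolding P_def by (simp add: mult_ac)
        qed
        have C1W: "C1 (\<lambda>x. w (x + \<tau>) - w x) (\<lambda>x. Dw (x + \<tau>) - Dw x)" by (intro C1_diff C1_shift w)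
        have G: "L2n y (t / 4) (\<lambda>x. Dw (x + \<tau>) - Dw x) \<le> C4 * (2 * k * M + (\<omega> * M + K))"
        proof -
          have "L2n y (t / 4) (\<lambda>x. Dw (x + \<tau>) - Dw x) \<le> C4 * (norm \<tau> / t * M + \<omega> * M + K)"
            unfolding M_def by (rule I[OF ell w sol np t K om]) (use ntau2 t in linarith)
          also have "\<dots> \<le> C4 * (2 * k * M + \<omega> * M + K)"
          proof -
            have "0 < k * t" using k01 t by simp
            then have "norm \<tau> \<le> 2 * k * t" using ntau thkt by linarith
            then have "norm \<tau> / t \<le> 2 * k" using t by (simp add: field_simps)
            then show ?thesis using C4 M by (intro mult_left_mono add_right_mono mult_right_mono) auto
          qed
          finally show ?thesis by (simp add: algebra_simps)
        qed
        have t4: "t / (t / 4) = 4" using t by simp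
        have S: "Sol a y (t / 4) (sqrt (4 ^ ?d) * (2 * K + \<omega> * M)) (\<lambda>x. Dw (x + \<tau>) - Dw x)"
          using Sol_increment'[OF ell sol cDw _ _ om np, of "t / 4"] t ntau2 by (simp add: t4 M_def)
        have ap4: "almost_periodic a y (t / 4) \<omega> e" using almost_periodic_subset[OF ap] t by simp
        \<comment> \<open>No gain is required here: this bound is used only in a term that carries
          the factor \<open>\<omega>\<close>.\<close>
        have crude: "L2n y (t / 4) (\<lambda>x. Dw (x + \<tau>) - Dw x) \<le> 2 * sqrt (4 ^ ?d) * M"
          using L2n_shift_diff_le[OF cDw, of "t / 4" \<tau> t y] t ntau2 by (simp add: t4 M_def)
        have "L2n y ((4 * \<theta>) * (t / 4)) (\<lambda>x. Dw (x + \<tau>) - Dw x) \<le> C * (4 * \<theta>) powr (-\<beta>) * L2n y (t / 4) (\<lambda>x. Dw (x + \<tau>) - Dw x)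
              + D * (\<omega> * L2n y (t / 4) (\<lambda>x. Dw (x + \<tau>) - Dw x) + sqrt (4 ^ ?d) * (2 * K + \<omega> * M))"
          by (rule grad_decay_atD[OF H' ell C1W S ap4]) (use t K om M et in auto)
        also have "\<dots> \<le> C * \<theta> powr (-\<beta>) * (C4 * (2 * k * M + (\<omega> * M + K))) + D * (\<omega> * (2 * sqrt (4 ^ ?d) * M) + sqrt (4 ^ ?d) * (2 * K + \<omega> * M))"
        proof (intro add_mono mult_mono mult_left_mono G crude om order_refl)
          show "(4 * \<theta>) powr (-\<beta>) \<le> \<theta> powr (-\<beta>)" using th b0 by (intro powr_mono2') auto
        qed (use C D th t K M om in \<open>auto intro!: L2n_nonneg mult_nonneg_nonneg add_nonneg_nonneg\<close>)
        also have "\<dots> = C * C4 * 2 * (\<theta> powr (-\<beta>) * k) * M + C * \<theta> powr (-\<beta>) * C4 * (\<omega> * M + K) + D * sqrt (4 ^ ?d) * (3 * (\<omega> * M) + 2 * K)"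
          by (simp add: algebra_simps)
        also have "\<theta> powr (-\<beta>) * k = \<theta> powr (-\<beta>')"
          unfolding k_def using th bb by (simp add: powr_add[symmetric] algebra_simps)
        also have "C * C4 * 2 * \<theta> powr (-\<beta>') * M + C * \<theta> powr (-\<beta>) * C4 * (\<omega> * M + K) + D * sqrt (4 ^ ?d) * (3 * (\<omega> * M) + 2 * K)
            \<le> C * C4 * 2 * \<theta> powr (-\<beta>') * M + C * \<theta> powr (-\<beta>) * C4 * (\<omega> * M + K) + D * sqrt (4 ^ ?d) * (4 * (\<omega> * M) + 4 * K)"
          using D om M K by (intro add_left_mono mult_left_mono) auto
        also have "\<dots> = C * C4 * 2 * \<theta> powr (-\<beta>') * M + C' * (\<omega> * M + K)" unfolding C'_def by (simp add: algebra_simps)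
        finally have B: "L2n y (\<theta> * t) (\<lambda>x. Dw (x + \<tau>) - Dw x) \<le> C * C4 * 2 * \<theta> powr (-\<beta>') * M + C' * (\<omega> * M + K)" by simp
        have "L2n y (\<theta> * t) Dw = L2n y (\<theta> * t) (\<lambda>x. Dw (x + \<tau>) - (Dw (x + \<tau>) - Dw x))" by simp
        also have "\<dots> \<le> L2n y (\<theta> * t) (\<lambda>x. Dw (x + \<tau>)) + L2n y (\<theta> * t) (\<lambda>x. Dw (x + \<tau>) - Dw x)"
          by (intro L2n_triangle_diff C1_continuous(2)[OF C1_shift[OF w]] C1_continuous(2)[OF C1W] tht)
        also have "\<dots> \<le> P * \<theta> powr (-\<beta>') * M + (C * C4 * 2 * \<theta> powr (-\<beta>') * M + C' * (\<omega> * M + K))"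
          by (intro add_mono A B)
        also have "\<dots> \<le> Cn * \<theta> powr (-\<beta>') * M + C' * (\<omega> * M + K)"
        proof -
          have "0 \<le> sqrt (16 ^ ?d) * \<theta> powr (-\<beta>') * M" using M by simp
          then show ?thesis unfolding Cn_def by (simp add: algebra_simps)
        qed
        finally show "L2n y (\<theta> * t) Dw \<le> Cn * \<theta> powr (-\<beta>') * L2n y t Dw + C' * (\<omega> * L2n y t Dw + K)" unfolding M_def .
      qed
      moreover have "c > 0" unfolding c_def using th c4 by simp
      ultimately show ?thesis using C' by blast
    qed
  qed
  then show ?thesis unfolding grad_decay_def \<beta>'_def[symmetric] using Cn by blast
qed

text \<open>Since \<open>d / (d + 2)\<close> is below 1, finitely many improvements push the
  exponent below any positive number. For the averaging over \<open>n\<close> terms any value below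
  1 would serve.\<close>

lemma grad_decay_half:
  assumes mu: "0 < \<mu>" and La: "0 \<le> \<Lambda>"
  shows "grad_decay TYPE('a::euclidean_space) \<mu> \<Lambda> (1 / 2)"
proof -
  let ?d = "real DIM('a)" let ?q = "?d / (?d + 2)"
  have q: "0 \<le> ?q" "?q < 1" by auto
  have *: "grad_decay TYPE('a) \<mu> \<Lambda> (?d / 2 * ?q ^ j)" for j
  proof (induction j)
    case 0
    show ?case using grad_decay_base by simp
  next
    case (Suc j)
    have "?d / 2 * ?q ^ j \<le> ?d / 2 * 1" using q by (intro mult_left_mono power_le_one) auto
    then show ?case using grad_decay_improve[OF mu La Suc] by (simp add: mult_ac)
  qed
  have "(\<lambda>j. ?d / 2 * ?q ^ j) \<longlonglongrightarrow> ?d / 2 * 0"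
    by (intro tendsto_mult_left LIMSEQ_realpow_zero q)
  then have lim: "(\<lambda>j. ?d / 2 * ?q ^ j) \<longlonglongrightarrow> 0" by simp
  have "\<forall>\<^sub>F j in sequentially. ?d / 2 * ?q ^ j < 1 / 2" by (rule order_tendstoD(2)[OF lim]) simp
  then obtain j where "?d / 2 * ?q ^ j < 1 / 2" unfolding eventually_sequentially by blast
  then show ?thesis using grad_decay_mono[OF *, of j] by simp
qed

subsection \<open>Second differences as excess\<close>

text \<open>Through the factor \<open>t\<close>, \<open>X\<close> has the size of a gradient. Shifts
  range up to \<open>t / 4\<close>, twice the radius \<open>t / 8\<close>, as
  \<open>L2n_minus_avg_le\<close> requires, and two successive shifts still stay in the ball of
  radius \<open>t\<close>.\<close>

definition first_diff_le :: "'a::euclidean_space \<Rightarrow> real \<Rightarrow> ('a \<Rightarrow> real) \<Rightarrow> real \<Rightarrow> bool" where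
  "first_diff_le y t u X \<longleftrightarrow> (\<forall>z. norm z \<le> t / 4 \<longrightarrow> L2n y (t / 8) (\<lambda>x. u (x + z) - u x) \<le> X * t)"

text \<open>The second differences play the role of the excess: they vanish exactly on functions whose
  increments are constant.\<close>

definition second_diff_le :: "'a::euclidean_space \<Rightarrow> real \<Rightarrow> ('a \<Rightarrow> real) \<Rightarrow> real \<Rightarrow> bool" where
  "second_diff_le y t u X \<longleftrightarrow> (\<forall>z z'. norm z \<le> t / 4 \<longrightarrow> norm z' \<le> t / 4 \<longrightarrow>
     L2n y (t / 8) (\<lambda>x. (u (x + z' + z) - u (x + z')) - (u (x + z) - u x)) \<le> X * t)"

lemma second_diff_le_weaken: "second_diff_le y t u X \<Longrightarrow> X \<le> X' \<Longrightarrow> 0 < t \<Longrightarrow> second_diff_le y t u X'"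
  unfolding second_diff_le_def by (meson mult_right_mono less_imp_le order_trans)

lemma powr_minus_half_le_sqrt:
  assumes "1 \<le> c" "0 < n" shows "(c / n) powr (- (1 / 2)) \<le> sqrt n"
proof -
  have "(c / n) powr (- (1 / 2)) = 1 / sqrt (c / n)"
    using assms by (simp add: powr_minus_divide powr_half_sqrt)
  also have "\<dots> = sqrt (n / c)" using assms by (simp add: real_sqrt_divide)
  also have "\<dots> \<le> sqrt n" using assms by (simp add: field_simps mult_left_le)
  finally show ?thesis .
qed

lemma telescope_multiple:
  fixes u :: "'a::real_vector \<Rightarrow> 'b::ab_group_add"
  shows "u (x + real n *\<^sub>R z) - u x = (\<Sum>i<n. u (x + real i *\<^sub>R z + z) - u (x + real i *\<^sub>R z))"
proof -
  have "(\<Sum>i<n. u (x + real i *\<^sub>R z + z) - u (x + real i *\<^sub>R z)) = (\<Sum>i<n. u (x + real (Suc i) *\<^sub>R z) - u (x + real i *\<^sub>R z))"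
    by (intro sum.cong refl) (simp add: algebra_simps)
  also have "\<dots> = u (x + real n *\<^sub>R z) - u (x + real 0 *\<^sub>R z)" by (rule sum_lessThan_telescope)
  finally show ?thesis by simp
qed

text \<open>For an almost period \<open>\<tau>\<close>, \<open>\<Delta>\<^sub>\<tau> u = (1/n) (\<Delta>\<^bsub>n\<tau>\<^esub> u - \<Sum>\<^sub>i \<Delta>\<^sub>\<tau> \<Delta>\<^bsub>i\<tau>\<^esub> u)\<close>. Each term on the right is an
  almost solution controlled by the second differences of \<open>u\<close>, and \<open>grad_decay\<close> with exponent
  \<open>1/2 < 1\<close> leaves the small factor \<open>n powr (-1/2)\<close>.\<close>

lemma grad_increment_small:
  assumes mu: "0 < \<mu>" and La: "0 \<le> \<Lambda>"
  shows "\<exists>A>0. \<forall>n::nat\<ge>32. \<exists>C>0. \<exists>c>0. \<forall>a (y::'a::euclidean_space) t u Du K \<omega> e X \<tau>.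
    elliptic a \<mu> \<Lambda> \<longrightarrow> C1 u Du \<longrightarrow> Sol a y t K Du \<longrightarrow> almost_periodic a y t \<omega> e \<longrightarrow> second_diff_le y t u X \<longrightarrow>
    near_period a y t \<omega> \<tau> \<longrightarrow> norm \<tau> \<le> t / (4 * real n) \<longrightarrow> 0 < t \<longrightarrow> 0 \<le> K \<longrightarrow> 0 \<le> \<omega> \<longrightarrow> 0 \<le> X \<longrightarrow> e \<le> c * t \<longrightarrow>
    L2n y (t / (2 * real n)) (\<lambda>x. Du (x + \<tau>) - Du x) \<le> A / sqrt (real n) * X + C * (K + \<omega> * L2n y t Du)"
proof -
  let ?d = "DIM('a)"
  obtain AS where AS: "AS > 0" and H: "\<And>\<theta>. 0 < \<theta> \<Longrightarrow> \<theta> \<le> 1 \<Longrightarrow> \<exists>C>0. \<exists>c>0. grad_decay_at TYPE('a) \<mu> \<Lambda> \<theta> (AS * \<theta> powr (- (1 / 2))) C c"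
    using grad_decay_half[OF mu La, where 'a='a] unfolding grad_decay_def by blast
  obtain C4 where C4: "C4 > 0" and I: "\<And>a (y::'a) t w Dw K \<omega> \<tau>. elliptic a \<mu> \<Lambda> \<Longrightarrow> C1 w Dw \<Longrightarrow> Sol a y t K Dw \<Longrightarrow>
     near_period a y t \<omega> \<tau> \<Longrightarrow> 0 < t \<Longrightarrow> 0 \<le> K \<Longrightarrow> 0 \<le> \<omega> \<Longrightarrow> norm \<tau> \<le> t / 2 \<Longrightarrow>
     L2n y (t / 4) (\<lambda>x. Dw (x + \<tau>) - Dw x) \<le> C4 * (norm \<tau> / t * L2n y t Dw + \<omega> * L2n y t Dw + K)"
    using L2n_grad_increment_le[OF mu La, where 'a='a] by blast
  define Cc where "Cc = 4 / 3 * sqrt (2 ^ ?d) * (1 + (5 + 4 * \<Lambda>) / \<mu>)"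
  have Cc: "Cc > 0" unfolding Cc_def using mu La by (intro mult_pos_pos) (auto intro!: add_pos_nonneg)
  define q2 q4 q8 q16 where "q2 = sqrt (2 ^ ?d)" and "q4 = sqrt (4 ^ ?d)" and "q8 = sqrt (8 ^ ?d)" and "q16 = sqrt (16 ^ ?d)"
  have q: "1 \<le> q2" "q2 \<le> q8" "1 \<le> q4" "1 \<le> q8" "1 \<le> q16"
    unfolding q2_def q4_def q8_def q16_def by (auto intro: power_mono)
  define Ca where "Ca = Cc * 8 * q8"
  have Ca: "Ca > 0" unfolding Ca_def using Cc q by simp
  define A where "A = AS * Ca * (1 + 4 * C4)"
  have A: "A > 0" unfolding A_def using AS Ca C4 by simp
  have "\<exists>C>0. \<exists>c>0. \<forall>a (y::'a) t u Du K \<omega> e X \<tau>.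
    elliptic a \<mu> \<Lambda> \<longrightarrow> C1 u Du \<longrightarrow> Sol a y t K Du \<longrightarrow> almost_periodic a y t \<omega> e \<longrightarrow> second_diff_le y t u X \<longrightarrow>
    near_period a y t \<omega> \<tau> \<longrightarrow> norm \<tau> \<le> t / (4 * real n) \<longrightarrow> 0 < t \<longrightarrow> 0 \<le> K \<longrightarrow> 0 \<le> \<omega> \<longrightarrow> 0 \<le> X \<longrightarrow> e \<le> c * t \<longrightarrow>
    L2n y (t / (2 * real n)) (\<lambda>x. Du (x + \<tau>) - Du x) \<le> A / sqrt (real n) * X + C * (K + \<omega> * L2n y t Du)"
    if n: "32 \<le> n" for n :: nat
  proof -
    define N where "N = real n"
    have N: "32 \<le> N" unfolding N_def using n by simp
    have N0: "0 < N" "1 \<le> sqrt N" "sqrt N > 0" using N by auto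
    have sN: "sqrt N * sqrt N = N" using N by simp
    \<comment> \<open>The ratios \<open>8 / N\<close> from \<open>t / 16\<close> and
      \<open>32 / N\<close> from \<open>t / 64\<close> lead to the same radius
      \<open>t / (2 * N)\<close>; \<open>32 \<le> n\<close> keeps both at most 1.\<close>
    obtain D1 c1 where D1: "D1 > 0" "c1 > 0" and S1': "grad_decay_at TYPE('a) \<mu> \<Lambda> (8 / N) (AS * (8 / N) powr (- (1 / 2))) D1 c1"
      using H[of "8 / N"] N by auto
    obtain D2 c2 where D2: "D2 > 0" "c2 > 0" and S2': "grad_decay_at TYPE('a) \<mu> \<Lambda> (32 / N) (AS * (32 / N) powr (- (1 / 2))) D2 c2"
      using H[of "32 / N"] N by auto
    define c where "c = min (c1 / 16) (c2 / 64)"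
    have c: "c > 0" unfolding c_def using D1 D2 by simp
    define CJ where "CJ = A + 3 * D1 * q16 + 3 * AS * sqrt N * C4 * q16 + 8 * D2 * q4 * q16"
    define C where "C = CJ * (2 + N)"
    have CJ: "CJ > 0" unfolding CJ_def using A D1 D2 AS C4 q N0 by (intro add_pos_nonneg mult_nonneg_nonneg) auto
    have C: "C > 0" unfolding C_def using CJ N by simp
    have "L2n y (t / (2 * N)) (\<lambda>x. Du (x + \<tau>) - Du x) \<le> A / sqrt N * X + C * (K + \<omega> * L2n y t Du)"
      if ell: "elliptic a \<mu> \<Lambda>" and u: "C1 u Du" and sol: "Sol a y t K Du" and ap: "almost_periodic a y t \<omega> e"
        and sd: "second_diff_le y t u X" and np: "near_period a y t \<omega> \<tau>" and tau: "norm \<tau> \<le> t / (4 * N)"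
        and t: "0 < t" and K: "0 \<le> K" and om: "0 \<le> \<omega>" and X: "0 \<le> X" and e: "e \<le> c * t" for a and y :: 'a and t u Du K \<omega> e X \<tau>
    proof -
      define M where "M = L2n y t Du"
      have M: "0 \<le> M" unfolding M_def using t by (intro L2n_nonneg) simp
      \<comment> \<open>An error level common to all differences along
        \<open>real i *\<^sub>R \<tau>\<close> with \<open>i \<le> n\<close>: two copies of the
        equation, and a change of the coefficients by at most \<open>N * \<omega>\<close>.\<close>
      define J where "J = 2 * K + N * \<omega> * M"
      have oM: "0 \<le> \<omega> * M" using om M by simp
      have oMJ: "\<omega> * M \<le> J" unfolding J_def using mult_right_mono[of 1 N "\<omega> * M"] oM N K by (simp add: mult.assoc)
      have J: "0 \<le> J" using oMJ oM by linarith
      note cDu = C1_continuous(2)[OF u, of UNIV]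
      have tau128: "norm \<tau> \<le> t / 128"
        using tau divide_left_mono[of 128 "4 * N" t] N t by simp
      define v Dv where "v = (\<lambda>i::nat. \<lambda>x. u (x + real i *\<^sub>R \<tau>) - u x)" and "Dv = (\<lambda>i::nat. \<lambda>x. Du (x + real i *\<^sub>R \<tau>) - Du x)"
      have C1v: "C1 (v i) (Dv i)" for i unfolding v_def Dv_def by (intro C1_diff C1_shift u)
      note cDv = C1_continuous(2)[OF C1v, of UNIV]
      have itau: "norm (real i *\<^sub>R \<tau>) \<le> t / 4" if "i \<le> n" for i
      proof -
        have "norm (real i *\<^sub>R \<tau>) \<le> N * (t / (4 * N))"
          unfolding N_def norm_scaleR using that tau t by (intro mult_mono) (auto simp: N_def)
        then show ?thesis using N by simp
      qed
      have npi: "near_period a y t (N * \<omega>) (real i *\<^sub>R \<tau>)" if "i \<le> n" for i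
        using near_period_multiple[OF np, of i] that om unfolding near_period_def N_def
        by (meson mult_right_mono norm_ge_zero of_nat_mono order_trans)
      have SV: "Sol a y s (sqrt ((t / s) ^ ?d) * J) (Dv i)" if "i \<le> n" "0 < s" "s \<le> t / 2" for i s
        using Sol_increment'[OF ell sol cDu that(2) _ _ npi[OF that(1)]] itau[OF that(1)] that om N t
        unfolding Dv_def J_def M_def by (simp add: mult.assoc)
      define G where "G = (\<lambda>i. L2n y (t / 16) (Dv i))"
      have GL: "L2n y (t / 16) (Dv i) = G i" for i unfolding G_def ..
      have G0: "0 \<le> G i" for i unfolding G_def using t by (intro L2n_nonneg) simp
      \<comment> \<open>Increments of \<open>v i\<close> are second differences of \<open>u\<close>,
        so Poincare by differences and Caccioppoli bound its gradient by \<open>X\<close>, up to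
        \<open>J\<close>.\<close>
      have G: "G i \<le> Ca * (X + J)" if i: "i \<le> n" for i
      proof -
        have S8: "Sol a y (t / 8) (q8 * J) (Dv i)" using SV[OF i, of "t / 8"] t by (simp add: q8_def)
        have P: "L2n y (t / 8) (\<lambda>x. v i x - avg y (t / 8) (v i)) \<le> q2 * (X * t)"
          unfolding q2_def
        proof (rule L2n_minus_avg_le)
          show "continuous_on UNIV (v i)" by (rule C1_continuous(1)[OF C1v])
          show "0 < t / 8" using t by simp
          fix z :: 'a assume "norm z \<le> 2 * (t / 8)"
          then have z: "norm z \<le> t / 4" by simp
          then show "L2n y (t / 8) (\<lambda>x. v i (x + z) - v i x) \<le> X * t"
            using sd itau[OF i] unfolding second_diff_le_def v_def by blast
        qed
        have "L2n y ((t / 8) / 2) (Dv i) \<le> Cc * (L2n y (t / 8) (\<lambda>x. v i x - avg y (t / 8) (v i)) / (t / 8) + q8 * J)"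
          unfolding Cc_def by (rule caccioppoli[OF mu La ell C1v S8]) (use t q J in auto)
        also have "\<dots> \<le> Cc * (q2 * (X * t) / (t / 8) + q8 * J)"
          using Cc t by (intro mult_left_mono add_right_mono divide_right_mono P) auto
        also have "\<dots> = Cc * (8 * (q2 * X) + q8 * J)" using t by simp
        also have "\<dots> \<le> Cc * (8 * (q8 * X) + 8 * (q8 * J))"
          using Cc q X J by (intro mult_left_mono add_mono mult_right_mono) auto
        finally show ?thesis unfolding G_def Ca_def by (simp add: algebra_simps)
      qed
      have t16: "t / (t / 16) = 16" and t64: "(t / 16) / (t / 64) = 4" using t by auto
      have S16: "Sol a y (t / 16) (q16 * J) (Dv i)" if i: "i \<le> n" for i
        using SV[OF i, of "t / 16"] t by (simp add: q16_def)
      \<comment> \<open>Where \<open>\<omega>\<close> multiplies a gradient, the crude bound by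
        \<open>M\<close> replaces the one by \<open>X\<close>; thus only \<open>\<omega> * M\<close>
        and no product \<open>\<omega> * X\<close> reaches the conclusion.\<close>
      have oG: "\<omega> * G i \<le> 2 * q16 * J" if i: "i \<le> n" for i
      proof -
        have "G i \<le> 2 * q16 * M"
          using L2n_shift_diff_le[OF cDu, of "t / 16" "real i *\<^sub>R \<tau>" t y] itau[OF i] t
          unfolding G_def Dv_def M_def q16_def by (simp add: t16)
        then have "\<omega> * G i \<le> \<omega> * (2 * q16 * M)" using om by (rule mult_left_mono)
        also have "\<dots> = 2 * q16 * (\<omega> * M)" by simp
        also have "\<dots> \<le> 2 * q16 * J" using q oMJ by (intro mult_left_mono) auto
        finally show ?thesis .
      qed
      have et: "e \<le> c1 * (t / 16)" "e \<le> c2 * (t / 64)"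
      proof -
        have "c * t \<le> (c1 / 16) * t" "c * t \<le> (c2 / 64) * t" unfolding c_def using t by (intro mult_right_mono; simp)+
        then show "e \<le> c1 * (t / 16)" "e \<le> c2 * (t / 64)" using e by auto
      qed
      have Bn: "L2n y (t / (2 * N)) (Dv n) \<le> AS * sqrt N * G n + 3 * D1 * q16 * J"
      proof -
        have ap16: "almost_periodic a y (t / 16) \<omega> e" using almost_periodic_subset[OF ap] t by simp
        have "L2n y (8 / N * (t / 16)) (Dv n) \<le> AS * (8 / N) powr (- (1 / 2)) * L2n y (t / 16) (Dv n) + D1 * (\<omega> * L2n y (t / 16) (Dv n) + q16 * J)"
          by (rule grad_decay_atD[OF S1' ell C1v S16 ap16]) (use t om q J et in auto)
        also have "\<dots> \<le> AS * sqrt N * G n + D1 * (2 * q16 * J + q16 * J)"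
        proof (rule add_mono)
          show "AS * (8 / N) powr (- (1 / 2)) * L2n y (t / 16) (Dv n) \<le> AS * sqrt N * G n"
            unfolding GL using AS powr_minus_half_le_sqrt[of 8 N] N by (intro mult_right_mono[OF _ G0] mult_left_mono) auto
          show "D1 * (\<omega> * L2n y (t / 16) (Dv n) + q16 * J) \<le> D1 * (2 * q16 * J + q16 * J)"
            unfolding GL using D1 oG[of n] by (intro mult_left_mono add_right_mono) auto
        qed
        finally show ?thesis by (simp add: algebra_simps)
      qed
      define DW where "DW = (\<lambda>i x. Dv i (x + \<tau>) - Dv i x)"
      have C1W: "C1 (\<lambda>x. v i (x + \<tau>) - v i x) (DW i)" for i unfolding DW_def by (intro C1_diff C1_shift C1v)
      \<comment> \<open>The additional difference along \<open>\<tau>\<close> gains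
        \<open>norm \<tau> / t\<close>, of order \<open>1 / N\<close>, which compensates for the
        number of such terms.\<close>
      have Bi: "L2n y (t / (2 * N)) (DW i) \<le> AS * sqrt N * (C4 * (4 / N * G i + 3 * q16 * J)) + 8 * D2 * q4 * q16 * J" if i: "i \<le> n" for i
      proof -
        have np16: "near_period a y (t / 16) \<omega> \<tau>" using near_period_subset[OF np] t by simp
        have ap64: "almost_periodic a y (t / 64) \<omega> e" using almost_periodic_subset[OF ap] t by simp
        have "L2n y (t / 16 / 4) (DW i) \<le> C4 * (norm \<tau> / (t / 16) * G i + \<omega> * G i + q16 * J)"
          unfolding DW_def G_def by (rule I[OF ell C1v S16[OF i] np16]) (use t tau128 q J om in auto)
        also have "\<dots> \<le> C4 * (4 / N * G i + 2 * q16 * J + q16 * J)"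
        proof (intro mult_left_mono add_mono mult_right_mono oG i G0 order_refl)
          have "norm \<tau> * 16 / t \<le> (t / (4 * N)) * 16 / t" using tau t by (intro divide_right_mono mult_right_mono) auto
          then show "norm \<tau> / (t / 16) \<le> 4 / N" using t by (simp add: field_simps)
        qed (use C4 q in auto)
        finally have 1: "L2n y (t / 64) (DW i) \<le> C4 * (4 / N * G i + 3 * q16 * J)" by (simp add: algebra_simps)
        have S64: "Sol a y (t / 64) (4 * q4 * q16 * J) (DW i)"
        proof (rule Sol_weaken)
          show "Sol a y (t / 64) (sqrt (((t / 16) / (t / 64)) ^ ?d) * (2 * (q16 * J) + \<omega> * L2n y (t / 16) (Dv i))) (DW i)"
            unfolding DW_def by (rule Sol_increment'[OF ell S16[OF i] cDv _ _ om np16]) (use t tau128 in auto)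
          have "q4 * (2 * (q16 * J) + \<omega> * G i) \<le> q4 * (2 * (q16 * J) + 2 * q16 * J)"
            using q by (intro mult_left_mono add_left_mono oG[OF i]) auto
          then show "sqrt (((t / 16) / (t / 64)) ^ ?d) * (2 * (q16 * J) + \<omega> * L2n y (t / 16) (Dv i)) \<le> 4 * q4 * q16 * J"
            unfolding t64 q4_def[symmetric] GL by (simp add: algebra_simps)
        qed (use t in auto)
        have 2: "\<omega> * L2n y (t / 64) (DW i) \<le> 4 * q4 * q16 * J"
        proof -
          have "L2n y (t / 64) (DW i) \<le> 2 * q4 * G i"
            using L2n_shift_diff_le[OF cDv, of "t / 64" \<tau> "t / 16" y i] tau128 t
            unfolding G_def DW_def q4_def by (simp add: t64)
          then have "\<omega> * L2n y (t / 64) (DW i) \<le> \<omega> * (2 * q4 * G i)" using om by (rule mult_left_mono)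
          also have "\<dots> = 2 * q4 * (\<omega> * G i)" by simp
          also have "\<dots> \<le> 2 * q4 * (2 * q16 * J)" using q oG[OF i] by (intro mult_left_mono) auto
          finally show ?thesis by simp
        qed
        have "L2n y (32 / N * (t / 64)) (DW i) \<le> AS * (32 / N) powr (- (1 / 2)) * L2n y (t / 64) (DW i) + D2 * (\<omega> * L2n y (t / 64) (DW i) + 4 * q4 * q16 * J)"
          by (rule grad_decay_atD[OF S2' ell C1W S64 ap64]) (use t om q J et in auto)
        also have "\<dots> \<le> AS * sqrt N * (C4 * (4 / N * G i + 3 * q16 * J)) + D2 * (4 * q4 * q16 * J + 4 * q4 * q16 * J)"
        proof (rule add_mono)
          show "AS * (32 / N) powr (- (1 / 2)) * L2n y (t / 64) (DW i) \<le> AS * sqrt N * (C4 * (4 / N * G i + 3 * q16 * J))"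
            using AS 1 powr_minus_half_le_sqrt[of 32 N] N t by (intro mult_mono mult_left_mono) (auto intro!: L2n_nonneg)
          show "D2 * (\<omega> * L2n y (t / 64) (DW i) + 4 * q4 * q16 * J) \<le> D2 * (4 * q4 * q16 * J + 4 * q4 * q16 * J)"
            using D2 2 by (intro mult_left_mono add_right_mono) auto
        qed
        finally show ?thesis by (simp add: algebra_simps)
      qed
      define T where "T = AS * sqrt N * (C4 * (4 / N * (Ca * (X + J)) + 3 * q16 * J)) + 8 * D2 * q4 * q16 * J"
      have Bi': "L2n y (t / (2 * N)) (DW i) \<le> T" if i: "i \<le> n" for i
      proof (rule order_trans[OF Bi[OF i]])
        show "AS * sqrt N * (C4 * (4 / N * G i + 3 * q16 * J)) + 8 * D2 * q4 * q16 * J \<le> T"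
          unfolding T_def using AS N C4 by (intro add_right_mono mult_left_mono G i) auto
      qed
      have tn: "0 < t / (2 * N)" using t N by simp
      have id: "N *\<^sub>R (Du (x + \<tau>) - Du x) = Dv n x - (\<Sum>i<n. DW i x)" for x
      proof -
        have "Dv n x = (\<Sum>i<n. Du (x + real i *\<^sub>R \<tau> + \<tau>) - Du (x + real i *\<^sub>R \<tau>))"
          unfolding Dv_def by (rule telescope_multiple)
        also have "\<dots> = (\<Sum>i<n. DW i x + (Du (x + \<tau>) - Du x))"
          unfolding DW_def Dv_def by (intro sum.cong refl) (simp add: algebra_simps)
        also have "\<dots> = (\<Sum>i<n. DW i x) + N *\<^sub>R (Du (x + \<tau>) - Du x)" unfolding N_def by (simp add: sum.distrib sum_constant_scaleR)
        finally show ?thesis by simp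
      qed
      have "N * L2n y (t / (2 * N)) (\<lambda>x. Du (x + \<tau>) - Du x) = L2n y (t / (2 * N)) (\<lambda>x. N *\<^sub>R (Du (x + \<tau>) - Du x))"
        using N by (subst L2n_scaleR[OF tn]) auto
      also have "\<dots> = L2n y (t / (2 * N)) (\<lambda>x. Dv n x - (\<Sum>i<n. DW i x))" by (simp only: id)
      also have "\<dots> \<le> L2n y (t / (2 * N)) (Dv n) + L2n y (t / (2 * N)) (\<lambda>x. \<Sum>i<n. DW i x)"
        by (intro L2n_triangle_diff cDv continuous_on_sum C1_continuous(2)[OF C1W] tn)
      also have "L2n y (t / (2 * N)) (\<lambda>x. \<Sum>i<n. DW i x) \<le> (\<Sum>i<n. L2n y (t / (2 * N)) (DW i))"
        by (intro L2n_sum C1_continuous(2)[OF C1W] tn) auto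
      also have "\<dots> \<le> (\<Sum>i<n. T)" by (intro sum_mono Bi') auto
      also have "\<dots> = N * T" unfolding N_def by simp
      also have "L2n y (t / (2 * N)) (Dv n) \<le> AS * sqrt N * (Ca * (X + J)) + 3 * D1 * q16 * J"
        by (rule order_trans[OF Bn], intro add_right_mono mult_left_mono G) (use AS N in auto)
      finally have "N * L2n y (t / (2 * N)) (\<lambda>x. Du (x + \<tau>) - Du x) \<le> AS * sqrt N * (Ca * (X + J)) + 3 * D1 * q16 * J + N * T"
        by simp
      then have "L2n y (t / (2 * N)) (\<lambda>x. Du (x + \<tau>) - Du x) \<le> (AS * sqrt N * (Ca * (X + J)) + 3 * D1 * q16 * J + N * T) / N"
        using N by (simp add: field_simps)
      also have "\<dots> = A / sqrt N * (X + J) + 3 * D1 * q16 * J / N + 3 * AS * sqrt N * C4 * q16 * J + 8 * D2 * q4 * q16 * J"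
      proof -
        have sq: "sqrt N / N = 1 / sqrt N" using sN N0 by (simp add: field_simps)
        have 1: "(AS * sqrt N * (Ca * (X + J)) + 3 * D1 * q16 * J + N * T) / N
          = AS * (sqrt N / N) * (Ca * (X + J)) + 3 * D1 * q16 * J / N + T"
          using N0 by (simp add: add_divide_distrib)
        have 2: "T = AS * (sqrt N / N) * (C4 * 4 * (Ca * (X + J))) + 3 * AS * sqrt N * C4 * q16 * J + 8 * D2 * q4 * q16 * J"
          unfolding T_def by (simp add: algebra_simps)
        have "A / sqrt N * (X + J) = AS * (1 / sqrt N) * (Ca * (X + J)) + AS * (1 / sqrt N) * (C4 * 4 * (Ca * (X + J)))"
          unfolding A_def by (simp add: algebra_simps add_divide_distrib)
        then show ?thesis using 1[unfolded sq] 2[unfolded sq] by linarith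
      qed
      also have "\<dots> \<le> A / sqrt N * X + A * J + 3 * D1 * q16 * J + 3 * AS * sqrt N * C4 * q16 * J + 8 * D2 * q4 * q16 * J"
      proof -
        have "A / sqrt N * J \<le> A * J" using A N0 J by (intro mult_right_mono) (auto simp: field_simps mult_left_mono)
        moreover have "3 * D1 * q16 * J / N \<le> 3 * D1 * q16 * J"
        proof -
          have "0 \<le> 3 * D1 * q16 * J" using D1 q J by simp
          then show ?thesis using divide_left_mono[of 1 N "3 * D1 * q16 * J"] N by simp
        qed
        ultimately show ?thesis by (simp add: algebra_simps add_divide_distrib)
      qed
      also have "\<dots> = A / sqrt N * X + CJ * J" unfolding CJ_def by (simp add: algebra_simps)
      also have "\<dots> \<le> A / sqrt N * X + CJ * ((2 + N) * (K + \<omega> * M))"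
      proof -
        have "0 \<le> N * K" using N K by simp
        then have "J \<le> (2 + N) * (K + \<omega> * M)" unfolding J_def using oM by (simp add: algebra_simps)
        then show ?thesis using CJ by (intro add_left_mono mult_left_mono) auto
      qed
      finally show ?thesis unfolding C_def M_def by (simp add: mult.assoc)
    qed
    then show ?thesis using C c unfolding N_def by blast
  qed
  then show ?thesis using A by blast
qed

lemma first_diff_le_init:
  fixes y :: "'a::euclidean_space"
  assumes u: "C1 u Du" and t: "0 < t"
  shows "first_diff_le y t u (4 ^ DIM('a) * L2n y t Du)"
  unfolding first_diff_le_def
proof (intro allI impI)
  fix z :: 'a assume z: "norm z \<le> t / 4"
  have M: "0 \<le> L2n y t Du" using t by (intro L2n_nonneg) simp
  have "L2n y (t / 8) (\<lambda>x. u (x + z) - u x) \<le> norm z * (sqrt ((t / (t / 8)) ^ DIM('a)) * L2n y t Du)"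
    by (rule L2n_increment_le'[OF u]) (use t z in auto)
  also have "\<dots> \<le> t * (4 ^ DIM('a) * L2n y t Du)"
  proof (intro mult_mono mult_right_mono M)
    have "sqrt (8 ^ DIM('a)) \<le> sqrt ((4 ^ DIM('a))\<^sup>2)"
      unfolding power2_eq_square power_mult_distrib[symmetric] by (intro real_sqrt_le_mono power_mono) auto
    then show "sqrt ((t / (t / 8)) ^ DIM('a)) \<le> 4 ^ DIM('a)" using t by simp
  qed (use z t M in auto)
  finally show "L2n y (t / 8) (\<lambda>x. u (x + z) - u x) \<le> 4 ^ DIM('a) * L2n y t Du * t" by (simp add: mult_ac)
qed

lemma second_diff_le_init:
  fixes y :: "'a::euclidean_space"
  assumes u: "C1 u Du" and t: "0 < t"
  shows "second_diff_le y t u (2 * 4 ^ DIM('a) * L2n y t Du)"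
  unfolding second_diff_le_def
proof (intro allI impI)
  fix z z' :: 'a assume z: "norm z \<le> t / 4" "norm z' \<le> t / 4"
  let ?d = "DIM('a)"
  have M: "0 \<le> L2n y t Du" using t by (intro L2n_nonneg) simp
  have C1g: "C1 (\<lambda>x. u (x + z') - u x) (\<lambda>x. Du (x + z') - Du x)" by (intro C1_diff C1_shift u)
  have "L2n y (t / 8) (\<lambda>x. (u (x + z' + z) - u (x + z')) - (u (x + z) - u x))
      = L2n y (t / 8) (\<lambda>x. (u (x + z + z') - u (x + z)) - (u (x + z') - u x))"
    by (simp add: algebra_simps)
  also have "\<dots> \<le> norm z * (sqrt (((t / 2) / (t / 8)) ^ ?d) * L2n y (t / 2) (\<lambda>x. Du (x + z') - Du x))"
    by (rule L2n_increment_le'[OF C1g]) (use t z in auto)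
  also have "\<dots> \<le> t * (sqrt (4 ^ ?d) * (2 * sqrt (2 ^ ?d) * L2n y t Du))"
  proof (intro mult_mono)
    show "L2n y (t / 2) (\<lambda>x. Du (x + z') - Du x) \<le> 2 * sqrt (2 ^ ?d) * L2n y t Du"
      using L2n_shift_diff_le[OF C1_continuous(2)[OF u], of "t / 2" z' t y] t z by simp
  qed (use z t M in \<open>auto intro!: L2n_nonneg mult_nonneg_nonneg\<close>)
  also have "\<dots> \<le> t * (sqrt (4 ^ ?d) * (2 * sqrt (4 ^ ?d) * L2n y t Du))"
    using t M by (intro mult_left_mono mult_right_mono real_sqrt_le_mono power_mono) auto
  finally show "L2n y (t / 8) (\<lambda>x. (u (x + z' + z) - u (x + z')) - (u (x + z) - u x)) \<le> 2 * 4 ^ ?d * L2n y t Du * t"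
    by (simp add: mult_ac)
qed

text \<open>The way back from the increments followed by the iteration to the gradient: Poincare by
  differences, then Caccioppoli.\<close>

lemma grad_le_first_diff:
  fixes \<mu> \<Lambda> :: real
  assumes mu: "0 < \<mu>" and La: "0 \<le> \<Lambda>"
  shows "\<exists>C\<ge>1. \<forall>a (y::'a::euclidean_space) t u Du K X. elliptic a \<mu> \<Lambda> \<longrightarrow> C1 u Du \<longrightarrow> Sol a y t K Du \<longrightarrow>
     first_diff_le y t u X \<longrightarrow> 0 < t \<longrightarrow> 0 \<le> K \<longrightarrow> 0 \<le> X \<longrightarrow> L2n y (t / 16) Du \<le> C * (X + K)"
proof -
  let ?d = "DIM('a)"
  define Cc where "Cc = 4 / 3 * sqrt (2 ^ ?d) * (1 + (5 + 4 * \<Lambda>) / \<mu>)"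
  have Cc: "1 \<le> Cc"
  proof -
    have "1 * 1 * 1 \<le> 4 / 3 * sqrt (2 ^ ?d) * (1 + (5 + 4 * \<Lambda>) / \<mu>)"
      using mu La by (intro mult_mono) auto
    then show ?thesis unfolding Cc_def by simp
  qed
  define q8 where "q8 = sqrt (8 ^ ?d)"
  have q8: "1 \<le> q8" "sqrt (2 ^ ?d) \<le> q8" unfolding q8_def by (auto intro: power_mono)
  have "L2n y (t / 16) Du \<le> Cc * 8 * q8 * (X + K)"
    if ell: "elliptic a \<mu> \<Lambda>" and u: "C1 u Du" and sol: "Sol a y t K Du" and fd: "first_diff_le y t u X"
      and t: "0 < t" and K: "0 \<le> K" and X: "0 \<le> X" for a and y :: 'a and t u Du K X
  proof -
    have S8: "Sol a y (t / 8) (q8 * K) Du"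
      using Sol_mono[OF sol, of y "t / 8"] t by (simp add: q8_def subset_cball)
    have P: "L2n y (t / 8) (\<lambda>x. u x - avg y (t / 8) u) \<le> sqrt (2 ^ ?d) * (X * t)"
      by (rule L2n_minus_avg_le[OF C1_continuous(1)[OF u]]) (use fd t in \<open>auto simp: first_diff_le_def\<close>)
    have "L2n y ((t / 8) / 2) Du \<le> Cc * (L2n y (t / 8) (\<lambda>x. u x - avg y (t / 8) u) / (t / 8) + q8 * K)"
      unfolding Cc_def by (rule caccioppoli[OF mu La ell u S8]) (use t q8 K in auto)
    also have "\<dots> \<le> Cc * (sqrt (2 ^ ?d) * (X * t) / (t / 8) + q8 * K)"
      using Cc t by (intro mult_left_mono add_right_mono divide_right_mono P) auto
    also have "\<dots> = Cc * (8 * (sqrt (2 ^ ?d) * X) + q8 * K)" using t by simp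
    also have "\<dots> \<le> Cc * (8 * (q8 * X) + 8 * (q8 * K))"
      using Cc q8 X K by (intro mult_left_mono add_mono mult_right_mono) auto
    finally show ?thesis by (simp add: algebra_simps)
  qed
  moreover have "1 \<le> Cc * 8 * q8" using mult_mono[OF Cc q8(1)] Cc by simp
  ultimately show ?thesis by blast
qed

text \<open>The coefficient of \<open>X\<close> is exactly one; otherwise the bound would deteriorate geometrically along the scales.\<close>

lemma first_diff_le_step:
  fixes y :: "'a::euclidean_space"
  assumes u: "continuous_on UNIV u" and fd: "first_diff_le y t u X" and sd: "second_diff_le y t u Y"
    and t: "0 < t" and m: "1 \<le> m" and X: "0 \<le> X" and Y: "0 \<le> Y"
  shows "first_diff_le y (t / real m) u (X + (sqrt (2 ^ DIM('a)) + real m) * sqrt (real m ^ DIM('a)) * Y)"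
  unfolding first_diff_le_def
proof (intro allI impI)
  let ?d = "DIM('a)"
  define N where "N = real m"
  define q where "q = sqrt (N ^ ?d)"
  have N: "1 \<le> N" unfolding N_def using m by simp
  fix z :: 'a assume z: "norm z \<le> t / real m / 4"
  have iz: "norm (real i *\<^sub>R z) \<le> t / 4" if "i \<le> m" for i
  proof -
    have "norm (real i *\<^sub>R z) \<le> N * (t / N / 4)"
      unfolding norm_scaleR using that z t by (intro mult_mono) (auto simp: N_def)
    then show ?thesis using N by simp
  qed
  have z4: "norm z \<le> t / 4" using iz[of 1] m by simp
  define s where "s = t / N / 8"
  have s: "0 < s" "s \<le> t / 8" unfolding s_def using t N by (auto simp: field_simps mult_left_mono)
  define v where "v = (\<lambda>x. u (x + real m *\<^sub>R z) - u x)"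
  have cu: "continuous_on UNIV (\<lambda>x. u (x + p))" for p
    by (rule continuous_on_compose2[OF u]) (auto intro!: continuous_intros)
  have cu2: "continuous_on UNIV (\<lambda>x. u (x + p + r))" for p r
    by (rule continuous_on_compose2[OF u]) (auto intro!: continuous_intros)
  have cv: "continuous_on UNIV v" unfolding v_def by (intro continuous_intros cu u)
  define E where "E = (\<lambda>i x. (u (x + real i *\<^sub>R z + z) - u (x + real i *\<^sub>R z)) - (u (x + z) - u x))"
  have cE: "continuous_on UNIV (E i)" for i unfolding E_def by (intro continuous_intros cu cu2 u)
  have ball: "L2n y s F \<le> q * L2n y (t / 8) F" if "continuous_on UNIV F" for F :: "'a \<Rightarrow> real"
  proof -
    have "L2n y s F \<le> sqrt ((t / 8 / s) ^ ?d) * L2n y (t / 8) F"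
      using s t by (intro L2n_ball_mono that subset_cball) auto
    moreover have "t / 8 / s = N" unfolding s_def using t N by simp
    ultimately show ?thesis unfolding q_def by simp
  qed
  have E: "L2n y s (E i) \<le> q * (Y * t)" if "i \<le> m" for i
  proof -
    have "L2n y (t / 8) (E i) \<le> Y * t"
      using sd z4 iz[OF that] unfolding second_diff_le_def E_def by blast
    then show ?thesis using ball[OF cE[of i]] N unfolding q_def
      by (meson mult_left_mono order_trans real_sqrt_ge_zero zero_le_power order.trans zero_le_one)
  qed
  have V: "L2n y s v \<le> X * t + q * (sqrt (2 ^ ?d) * (Y * t))"
  proof -
    have P: "L2n y (t / 8) (\<lambda>x. v x - avg y (t / 8) v) \<le> sqrt (2 ^ ?d) * (Y * t)"
    proof (rule L2n_minus_avg_le[OF cv])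
      fix z' :: 'a assume "norm z' \<le> 2 * (t / 8)"
      then show "L2n y (t / 8) (\<lambda>x. v (x + z') - v x) \<le> Y * t"
        using sd iz[of m] unfolding second_diff_le_def v_def by auto
    qed (use t in auto)
    have "L2n y s v = L2n y s (\<lambda>x. avg y (t / 8) v + (v x - avg y (t / 8) v))" by simp
    also have "\<dots> \<le> L2n y s (\<lambda>x. avg y (t / 8) v) + L2n y s (\<lambda>x. v x - avg y (t / 8) v)"
      by (intro L2n_triangle continuous_intros cv s)
    \<comment> \<open>Only the average passes to the smaller ball, and a constant does so without
      loss. The deviation from it is measured by second differences, where the factor
      \<open>q\<close> is harmless.\<close>
    also have "L2n y s (\<lambda>x. avg y (t / 8) v) \<le> L2n y (t / 8) v"
      by (rule L2n_avg_le[OF cv]) (use t s in auto)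
    also have "\<dots> \<le> X * t" using fd iz[of m] unfolding first_diff_le_def v_def by blast
    also have "L2n y s (\<lambda>x. v x - avg y (t / 8) v) \<le> q * L2n y (t / 8) (\<lambda>x. v x - avg y (t / 8) v)"
      by (intro ball continuous_intros cv)
    also have "\<dots> \<le> q * (sqrt (2 ^ ?d) * (Y * t))" unfolding q_def using N by (intro mult_left_mono P) auto
    finally show ?thesis by simp
  qed
  have id: "N *\<^sub>R (u (x + z) - u x) = v x - (\<Sum>i<m. E i x)" for x
  proof -
    have "v x = (\<Sum>i<m. E i x + (u (x + z) - u x))"
      unfolding v_def E_def telescope_multiple by (intro sum.cong refl) simp
    then show ?thesis unfolding N_def by (simp add: sum.distrib)
  qed
  have "N * L2n y s (\<lambda>x. u (x + z) - u x) = L2n y s (\<lambda>x. N *\<^sub>R (u (x + z) - u x))"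
    using N by (subst L2n_scaleR[OF s(1)]) auto
  also have "\<dots> = L2n y s (\<lambda>x. v x - (\<Sum>i<m. E i x))" by (simp only: id)
  also have "\<dots> \<le> L2n y s v + L2n y s (\<lambda>x. \<Sum>i<m. E i x)"
    by (intro L2n_triangle_diff cv continuous_on_sum cE s)
  also have "L2n y s (\<lambda>x. \<Sum>i<m. E i x) \<le> (\<Sum>i<m. L2n y s (E i))"
    by (intro L2n_sum cE s) auto
  also have "\<dots> \<le> (\<Sum>i<m. q * (Y * t))" by (intro sum_mono E) auto
  also have "\<dots> = N * (q * (Y * t))" unfolding N_def by simp
  finally have "N * L2n y s (\<lambda>x. u (x + z) - u x) \<le> X * t + q * (sqrt (2 ^ ?d) * (Y * t)) + N * (q * (Y * t))" using V by linarith
  then have "L2n y s (\<lambda>x. u (x + z) - u x) \<le> (X * t + q * (sqrt (2 ^ ?d) * (Y * t)) + N * (q * (Y * t))) / N"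
    using N by (simp add: field_simps)
  also have "\<dots> = (X + (sqrt (2 ^ ?d) + N) * q * Y) * (t / N)" using N by (simp add: field_simps)
  finally show "L2n y (t / real m / 8) (\<lambda>x. u (x + z) - u x) \<le> (X + (sqrt (2 ^ ?d) + real m) * sqrt (real m ^ ?d) * Y) * (t / real m)"
    unfolding s_def q_def N_def .
qed

text \<open>The shift \<open>z\<close> is replaced by an almost period \<open>\<tau>\<close>. The
  differences along \<open>\<tau>\<close> and \<open>z'\<close> cost \<open>norm z'\<close> times
  the gradient estimated in \<open>grad_increment_small\<close>; the replacement costs
  \<open>e\<close> times the gradient of \<open>u\<close>. The contraction comes from taking
  \<open>n\<close> so large that \<open>sqrt n\<close> exceeds \<open>A\<close> times the geometric
  constant \<open>q8\<close>.\<close>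

lemma second_diff_le_step_small:
  assumes mu: "0 < \<mu>" and La: "0 \<le> \<Lambda>"
  shows "\<exists>n::nat\<ge>32. \<exists>C>0. \<exists>c>0. \<forall>a (y::'a::euclidean_space) t u Du K \<omega> e X.
    elliptic a \<mu> \<Lambda> \<longrightarrow> C1 u Du \<longrightarrow> Sol a y t K Du \<longrightarrow> almost_periodic a y t \<omega> e \<longrightarrow> second_diff_le y t u X \<longrightarrow>
    0 < t \<longrightarrow> 0 \<le> K \<longrightarrow> 0 \<le> \<omega> \<longrightarrow> 0 \<le> X \<longrightarrow> 0 \<le> e \<longrightarrow> e \<le> c * t \<longrightarrow>
    second_diff_le y (t / (2 * real n)) u (X / 2 + C * (K + (\<omega> + e / t) * L2n y t Du))"
proof -
  let ?d = "DIM('a)"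
  obtain A where A: "A > 0" and H: "\<And>n::nat. n \<ge> 32 \<Longrightarrow> \<exists>C>0. \<exists>c>0. \<forall>a (y::'a) t u Du K \<omega> e X \<tau>.
    elliptic a \<mu> \<Lambda> \<longrightarrow> C1 u Du \<longrightarrow> Sol a y t K Du \<longrightarrow> almost_periodic a y t \<omega> e \<longrightarrow> second_diff_le y t u X \<longrightarrow>
    near_period a y t \<omega> \<tau> \<longrightarrow> norm \<tau> \<le> t / (4 * real n) \<longrightarrow> 0 < t \<longrightarrow> 0 \<le> K \<longrightarrow> 0 \<le> \<omega> \<longrightarrow> 0 \<le> X \<longrightarrow> e \<le> c * t \<longrightarrow>
    L2n y (t / (2 * real n)) (\<lambda>x. Du (x + \<tau>) - Du x) \<le> A / sqrt (real n) * X + C * (K + \<omega> * L2n y t Du)"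
    using grad_increment_small[OF mu La, where 'a='a] by blast
  define q8 where "q8 = sqrt (8 ^ ?d)"
  have q8: "1 \<le> q8" unfolding q8_def by simp
  obtain n :: nat where n: "32 \<le> n" "(q8 * A)\<^sup>2 \<le> real n"
  proof -
    obtain n0 :: nat where "(q8 * A)\<^sup>2 \<le> real n0" using real_arch_simple by blast
    then show ?thesis using that[of "max 32 n0"] by (auto intro: order_trans)
  qed
  define N where "N = real n"
  have N: "32 \<le> N" "0 < N" unfolding N_def using n by auto
  have sN: "q8 * A \<le> sqrt N" using n(2) by (simp add: N_def real_le_rsqrt)
  obtain C1' c1 where C1': "C1' > 0" "c1 > 0" and H': "\<And>a (y::'a) t u Du K \<omega> e X \<tau>.
    elliptic a \<mu> \<Lambda> \<Longrightarrow> C1 u Du \<Longrightarrow> Sol a y t K Du \<Longrightarrow> almost_periodic a y t \<omega> e \<Longrightarrow> second_diff_le y t u X \<Longrightarrow>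
    near_period a y t \<omega> \<tau> \<Longrightarrow> norm \<tau> \<le> t / (4 * N) \<Longrightarrow> 0 < t \<Longrightarrow> 0 \<le> K \<Longrightarrow> 0 \<le> \<omega> \<Longrightarrow> 0 \<le> X \<Longrightarrow> e \<le> c1 * t \<Longrightarrow>
    L2n y (t / (2 * N)) (\<lambda>x. Du (x + \<tau>) - Du x) \<le> A / sqrt N * X + C1' * (K + \<omega> * L2n y t Du)"
    using H[OF n(1)] unfolding N_def by blast
  \<comment> \<open>The second bound keeps \<open>\<tau>\<close> in the range
    \<open>t / (4 * N)\<close> of the preceding estimate.\<close>
  define c where "c = min c1 (1 / (8 * N))"
  have c: "0 < c" unfolding c_def using C1' N by simp
  define q where "q = sqrt ((4 * N) ^ ?d)"
  have q: "0 \<le> q" unfolding q_def using N by simp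
  define C where "C = q8 * C1' + 2 * N * q * (2 * 2 ^ ?d)"
  have C: "0 < C" unfolding C_def using q8 C1' N q by (intro add_pos_nonneg) auto
  have "second_diff_le y (t / (2 * N)) u (X / 2 + C * (K + (\<omega> + e / t) * L2n y t Du))"
    if ell: "elliptic a \<mu> \<Lambda>" and u: "C1 u Du" and sol: "Sol a y t K Du" and ap: "almost_periodic a y t \<omega> e"
      and sd: "second_diff_le y t u X" and t: "0 < t" and K: "0 \<le> K" and om: "0 \<le> \<omega>" and X: "0 \<le> X"
      and e0: "0 \<le> e" and e: "e \<le> c * t" for a and y :: 'a and t u Du K \<omega> e X
    unfolding second_diff_le_def
  proof (intro allI impI)
    fix z z' :: 'a assume z0: "norm z \<le> t / (2 * N) / 4" "norm z' \<le> t / (2 * N) / 4"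
    define M where "M = L2n y t Du"
    have M: "0 \<le> M" unfolding M_def using t by (intro L2n_nonneg) simp
    have oM: "0 \<le> \<omega> * M" using om M by simp
    define s where "s = t / (16 * N)"
    have s: "0 < s" unfolding s_def using t N by simp
    have s512: "s \<le> t / 512" unfolding s_def using divide_left_mono[of 512 "16 * N" t] N t by simp
    have sN': "8 * s = t / (2 * N)" unfolding s_def by simp
    have z: "norm z \<le> 2 * s" "norm z' \<le> 2 * s" using z0 unfolding s_def by (simp_all add: field_simps)
    have e': "e \<le> c1 * t" "e \<le> 2 * s"
    proof -
      have "c * t \<le> c1 * t" "c * t \<le> (1 / (8 * N)) * t" unfolding c_def using t by (intro mult_right_mono; simp)+
      moreover have "2 * s = (1 / (8 * N)) * t" unfolding s_def by simp
      ultimately show "e \<le> c1 * t" "e \<le> 2 * s" using e by linarith+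
    qed
    have "norm z \<le> t / 2" using z s512 t by linarith
    then obtain \<tau> where tau: "norm (\<tau> - z) \<le> e" and np: "near_period a y t \<omega> \<tau>"
      using ap unfolding almost_periodic_def by blast
    have ntau: "norm \<tau> \<le> 4 * s" using norm_triangle_ineq[of "\<tau> - z" z] tau z e' by simp
    then have ntau': "norm \<tau> \<le> t / (4 * N)" unfolding s_def by simp
    note cDu = C1_continuous(2)[OF u, of UNIV]
    define g Dg where "g = (\<lambda>x. u (x + z') - u x)" and "Dg = (\<lambda>x. Du (x + z') - Du x)"
    have C1g: "C1 g Dg" unfolding g_def Dg_def by (intro C1_diff C1_shift u)
    have C1h: "C1 (\<lambda>x. u (x + \<tau>) - u x) (\<lambda>x. Du (x + \<tau>) - Du x)" by (intro C1_diff C1_shift u)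
    have cg: "continuous_on UNIV (\<lambda>x. g (x + p))" for p by (rule C1_continuous(1)[OF C1_shift[OF C1g]])
    have cg0: "continuous_on UNIV g" by (rule C1_continuous(1)[OF C1g])
    have G: "L2n y (8 * s) (\<lambda>x. Du (x + \<tau>) - Du x) \<le> A / sqrt N * X + C1' * (K + \<omega> * M)"
      unfolding sN' M_def by (rule H'[OF ell u sol ap sd np ntau' t K om X e'(1)])
    have 1: "L2n y s (\<lambda>x. g (x + \<tau>) - g x) \<le> 2 * s * (q8 * (A / sqrt N * X + C1' * (K + \<omega> * M)))"
    proof -
      have "L2n y s (\<lambda>x. g (x + \<tau>) - g x) = L2n y s (\<lambda>x. (u (x + z' + \<tau>) - u (x + z')) - (u (x + \<tau>) - u x))"
        unfolding g_def by (simp add: algebra_simps)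
      also have "\<dots> \<le> norm z' * (sqrt ((8 * s / s) ^ ?d) * L2n y (8 * s) (\<lambda>x. Du (x + \<tau>) - Du x))"
        by (rule L2n_increment_le'[OF C1h]) (use s z in auto)
      also have "\<dots> \<le> 2 * s * (q8 * (A / sqrt N * X + C1' * (K + \<omega> * M)))"
        using z s G unfolding q8_def by (intro mult_mono mult_left_mono) (auto intro!: mult_nonneg_nonneg L2n_nonneg)
      finally show ?thesis .
    qed
    have 2: "L2n y s (\<lambda>x. g (x + z) - g (x + \<tau>)) \<le> e * (q * (2 * 2 ^ ?d * M))"
    proof -
      have "L2n y s (\<lambda>x. g (x + z) - g (x + \<tau>)) = L2n y s (\<lambda>x. (\<lambda>x. g (x + (z - \<tau>)) - g x) (x + \<tau>))"
        by (simp add: algebra_simps)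
      also have "\<dots> = L2n (y + \<tau>) s (\<lambda>x. g (x + (z - \<tau>)) - g x)" by (rule L2n_shift)
      also have "\<dots> \<le> norm (z - \<tau>) * (sqrt (((t / 4) / s) ^ ?d) * L2n (y + \<tau>) (t / 4) Dg)"
        by (rule L2n_increment_le'[OF C1g s]) (use tau e' s512 t in \<open>simp add: norm_minus_commute\<close>)
      also have "\<dots> \<le> e * (q * (2 * 2 ^ ?d * M))"
      proof (intro mult_mono)
        show "norm (z - \<tau>) \<le> e" using tau by (simp add: norm_minus_commute)
        have "t / 4 / s = 4 * N" unfolding s_def using t N by (simp add: field_simps)
        then show "sqrt ((t / 4 / s) ^ ?d) \<le> q" unfolding q_def by simp
        have "L2n (y + \<tau>) (t / 4) Dg \<le> 2 * sqrt (((t / 2) / (t / 4)) ^ ?d) * L2n (y + \<tau>) (t / 2) Du"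
          unfolding Dg_def by (rule L2n_shift_diff_le[OF cDu]) (use z s512 t in auto)
        also have "\<dots> \<le> 2 * sqrt (((t / 2) / (t / 4)) ^ ?d) * (sqrt ((t / (t / 2)) ^ ?d) * M)"
          unfolding M_def by (intro mult_left_mono L2n_ball_mono cDu cball_shift_subset) (use t ntau s512 in auto)
        also have "\<dots> = 2 * 2 ^ ?d * M" using t by simp
        finally show "L2n (y + \<tau>) (t / 4) Dg \<le> 2 * 2 ^ ?d * M" .
      qed (use e0 q M t s in \<open>auto intro!: mult_nonneg_nonneg L2n_nonneg\<close>)
      finally show ?thesis .
    qed
    have "L2n y s (\<lambda>x. (u (x + z' + z) - u (x + z')) - (u (x + z) - u x)) = L2n y s (\<lambda>x. (g (x + z) - g (x + \<tau>)) + (g (x + \<tau>) - g x))"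
      unfolding g_def by (simp add: algebra_simps)
    also have "\<dots> \<le> L2n y s (\<lambda>x. g (x + z) - g (x + \<tau>)) + L2n y s (\<lambda>x. g (x + \<tau>) - g x)"
      by (intro L2n_triangle continuous_intros cg cg0 s)
    also have "\<dots> \<le> e * (q * (2 * 2 ^ ?d * M)) + 2 * s * (q8 * (A / sqrt N * X + C1' * (K + \<omega> * M)))"
      by (intro add_mono 1 2)
    also have "\<dots> \<le> (8 * s) * (X / 2 + C * (K + (\<omega> + e / t) * M))"
    proof -
      have a: "2 * s * (q8 * (A / sqrt N * X)) \<le> (8 * s) * (X / 2)"
      proof -
        have "q8 * A / sqrt N \<le> 1" using sN N by simp
        then have "(q8 * A / sqrt N) * X \<le> 1 * X" using X by (rule mult_right_mono)
        then have "(2 * s) * ((q8 * A / sqrt N) * X) \<le> (2 * s) * (1 * X)" using s by (intro mult_left_mono) auto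
        moreover have "2 * s * (q8 * (A / sqrt N * X)) = (2 * s) * ((q8 * A / sqrt N) * X)" by simp
        moreover have "(2 * s) * (1 * X) \<le> (8 * s) * (X / 2)" using s X by simp
        ultimately show ?thesis by linarith
      qed
      have b: "2 * s * (q8 * (C1' * (K + \<omega> * M))) \<le> (8 * s) * (q8 * C1' * (K + \<omega> * M))"
        using s q8 C1' K oM by (simp add: mult_ac)
      have ee: "e = (8 * s) * (2 * N * (e / t))" unfolding s_def using t N by simp
      have "e * (q * (2 * 2 ^ ?d * M)) = (8 * s) * (2 * N * (e / t)) * (q * (2 * 2 ^ ?d * M))"
        by (rule arg_cong[OF ee, of "\<lambda>x. x * (q * (2 * 2 ^ ?d * M))"])
      then have "e * (q * (2 * 2 ^ ?d * M)) = (8 * s) * (2 * N * q * (2 * 2 ^ ?d) * (e / t * M))" by (simp only: mult_ac)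
      moreover have "q8 * C1' * (K + \<omega> * M) + 2 * N * q * (2 * 2 ^ ?d) * (e / t * M) \<le> C * (K + (\<omega> + e / t) * M)"
      proof -
        have "0 \<le> q8 * C1' * (e / t * M)" "0 \<le> 2 * N * q * (2 * 2 ^ ?d) * (K + \<omega> * M)"
          using q8 C1' e0 t M N q K oM by auto
        then show ?thesis unfolding C_def by (simp add: algebra_simps)
      qed
      then have "(8 * s) * (q8 * C1' * (K + \<omega> * M) + 2 * N * q * (2 * 2 ^ ?d) * (e / t * M)) \<le> (8 * s) * (C * (K + (\<omega> + e / t) * M))"
        using s by (intro mult_left_mono) auto
      ultimately show ?thesis using a b by (simp add: algebra_simps)
    qed
    finally show "L2n y (t / (2 * N) / 8) (\<lambda>x. (u (x + z' + z) - u (x + z')) - (u (x + z) - u x)) \<le> (X / 2 + C * (K + (\<omega> + e / t) * L2n y t Du)) * (t / (2 * N))"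
      unfolding M_def sN' s_def by (simp add: mult.commute)
  qed
  then show ?thesis using n(1) C c unfolding N_def by blast
qed

text \<open>Here \<open>e\<close> is arbitrary: beyond \<open>c * t\<close> the error
  \<open>e / t\<close> is at least \<open>c\<close>, and the trivial bound of second differences by
  the gradient is already of that order.\<close>

lemma second_diff_le_step:
  assumes mu: "0 < \<mu>" and La: "0 \<le> \<Lambda>"
  shows "\<exists>m::nat\<ge>32. \<exists>C>0. \<forall>a (y::'a::euclidean_space) t u Du K \<omega> e X.
    elliptic a \<mu> \<Lambda> \<longrightarrow> C1 u Du \<longrightarrow> Sol a y t K Du \<longrightarrow> almost_periodic a y t \<omega> e \<longrightarrow> second_diff_le y t u X \<longrightarrow>
    0 < t \<longrightarrow> 0 \<le> K \<longrightarrow> 0 \<le> \<omega> \<longrightarrow> 0 \<le> X \<longrightarrow> 0 \<le> e \<longrightarrow>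
    second_diff_le y (t / real m) u (X / 2 + C * (K + (\<omega> + e / t) * L2n y t Du))"
proof -
  let ?d = "DIM('a)"
  obtain n :: nat and C c where n: "32 \<le> n" and C: "C > 0" "c > 0" and H: "\<And>a (y::'a) t u Du K \<omega> e X.
    elliptic a \<mu> \<Lambda> \<Longrightarrow> C1 u Du \<Longrightarrow> Sol a y t K Du \<Longrightarrow> almost_periodic a y t \<omega> e \<Longrightarrow> second_diff_le y t u X \<Longrightarrow>
    0 < t \<Longrightarrow> 0 \<le> K \<Longrightarrow> 0 \<le> \<omega> \<Longrightarrow> 0 \<le> X \<Longrightarrow> 0 \<le> e \<Longrightarrow> e \<le> c * t \<Longrightarrow>
    second_diff_le y (t / (2 * real n)) u (X / 2 + C * (K + (\<omega> + e / t) * L2n y t Du))"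
    using second_diff_le_step_small[OF mu La, where 'a='a] by blast
  define m where "m = 2 * n"
  have m: "32 \<le> m" "real m = 2 * real n" unfolding m_def using n by auto
  define B where "B = 2 * 4 ^ ?d * sqrt (real m ^ ?d)"
  have B: "0 \<le> B" unfolding B_def by simp
  define C' where "C' = C + B / c"
  have C': "0 < C'" "C \<le> C'" "B / c \<le> C'" unfolding C'_def using C B by (auto intro: add_pos_nonneg)
  have "second_diff_le y (t / real m) u (X / 2 + C' * (K + (\<omega> + e / t) * L2n y t Du))"
    if ell: "elliptic a \<mu> \<Lambda>" and u: "C1 u Du" and sol: "Sol a y t K Du" and ap: "almost_periodic a y t \<omega> e"
      and sd: "second_diff_le y t u X" and t: "0 < t" and K: "0 \<le> K" and om: "0 \<le> \<omega>" and X: "0 \<le> X"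
      and e0: "0 \<le> e" for a and y :: 'a and t u Du K \<omega> e X
  proof -
    have tm: "0 < t / real m" using t m by simp
    have M: "0 \<le> L2n y t Du" using t by (intro L2n_nonneg) simp
    have nn: "0 \<le> K + (\<omega> + e / t) * L2n y t Du" using K om e0 t M by simp
    show ?thesis
    proof (cases "e \<le> c * t")
      case True
      show ?thesis
        by (rule second_diff_le_weaken[OF H[OF ell u sol ap sd t K om X e0 True, folded m(2)] _ tm])
           (intro add_left_mono mult_right_mono C' nn)
    next
      case False
      then have et: "1 \<le> (e / t) / c" using C t by (simp add: field_simps)
      have "2 * 4 ^ ?d * L2n y (t / real m) Du \<le> B * L2n y t Du"
      proof -
        have "L2n y (t / real m) Du \<le> sqrt ((t / (t / real m)) ^ ?d) * L2n y t Du"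
          by (intro L2n_ball_mono C1_continuous(2)[OF u] subset_cball tm t) (use t m in \<open>simp add: field_simps mult_left_le\<close>)
        also have "t / (t / real m) = real m" using t m by simp
        finally show ?thesis unfolding B_def by simp
      qed
      also have "\<dots> \<le> (B * L2n y t Du) * ((e / t) / c)"
        using mult_left_mono[OF et, of "B * L2n y t Du"] B M by simp
      also have "\<dots> = B / c * ((e / t) * L2n y t Du)" by (simp add: mult_ac)
      also have "\<dots> \<le> C' * (K + (\<omega> + e / t) * L2n y t Du)"
      proof (rule mult_mono)
        show "e / t * L2n y t Du \<le> K + (\<omega> + e / t) * L2n y t Du"
          using K mult_nonneg_nonneg[OF om M] by (simp add: algebra_simps)
      qed (use C' e0 t M in auto)
      also have "\<dots> \<le> X / 2 + C' * (K + (\<omega> + e / t) * L2n y t Du)" using X by simp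
      finally show ?thesis by (intro second_diff_le_weaken[OF second_diff_le_init[OF u tm] _ tm])
    qed
  qed
  then show ?thesis using m C' by blast
qed

text \<open>Along the scales \<open>t\<^sub>0 / m\<^sup>k\<close>, first differences grow by at most a multiple of the second differences,
  which contract up to an error \<open>\<omega>\<^sub>k + e\<^sub>k / t\<^sub>k\<close>; the discrete Gronwall inequality applies to
  \<open>X\<^sub>k + 2 C Y\<^sub>k\<close>.\<close>

theorem lipschitz_iteration:
  assumes mu: "0 < \<mu>" and La: "0 \<le> \<Lambda>"
  shows "\<exists>m::nat\<ge>2. \<exists>C>0. \<forall>a (y::'a::euclidean_space) t0 u Du K \<omega> e L.
    elliptic a \<mu> \<Lambda> \<longrightarrow> C1 u Du \<longrightarrow> 0 < t0 \<longrightarrow>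
    (\<forall>k<L. Sol a y (t0 / real m ^ k) (K k) Du \<and> almost_periodic a y (t0 / real m ^ k) (\<omega> k) (e k) \<and> 0 \<le> K k \<and> 0 \<le> \<omega> k \<and> 0 \<le> e k) \<longrightarrow>
    L2n y (t0 / real m ^ L) Du \<le> C * exp (C * (\<Sum>k<L. \<omega> k + e k / (t0 / real m ^ k))) * (L2n y t0 Du + (\<Sum>k<L. K k))"
proof -
  let ?d = "DIM('a)"
  obtain m :: nat and CE where m: "32 \<le> m" and CE: "CE > 0" and HE: "\<And>a (y::'a) t u Du K \<omega> e X.
    elliptic a \<mu> \<Lambda> \<Longrightarrow> C1 u Du \<Longrightarrow> Sol a y t K Du \<Longrightarrow> almost_periodic a y t \<omega> e \<Longrightarrow> second_diff_le y t u X \<Longrightarrow>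
    0 < t \<Longrightarrow> 0 \<le> K \<Longrightarrow> 0 \<le> \<omega> \<Longrightarrow> 0 \<le> X \<Longrightarrow> 0 \<le> e \<Longrightarrow>
    second_diff_le y (t / real m) u (X / 2 + CE * (K + (\<omega> + e / t) * L2n y t Du))"
    using second_diff_le_step[OF mu La, where 'a='a] by blast
  obtain C0 where C0: "1 \<le> C0" and HM: "\<And>a (y::'a) t u Du K X. elliptic a \<mu> \<Lambda> \<Longrightarrow> C1 u Du \<Longrightarrow> Sol a y t K Du \<Longrightarrow>
     first_diff_le y t u X \<Longrightarrow> 0 < t \<Longrightarrow> 0 \<le> K \<Longrightarrow> 0 \<le> X \<Longrightarrow> L2n y (t / 16) Du \<le> C0 * (X + K)"
    using grad_le_first_diff[OF mu La, where 'a='a] by blast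
  define N where "N = real m"
  have N: "32 \<le> N" unfolding N_def using m by simp
  define CM where "CM = sqrt (N ^ ?d) * C0"
  have CM: "1 \<le> CM" unfolding CM_def using mult_mono[of 1 "sqrt (N ^ ?d)" 1 C0] C0 N by simp
  define CN where "CN = (sqrt (2 ^ ?d) + N) * sqrt (N ^ ?d)"
  have CN: "0 \<le> CN" unfolding CN_def using N by simp
  \<comment> \<open>In \<open>X + 2 * CN * Y\<close> the growth \<open>CN * Y\<close> of the first
    differences is exactly offset by the halving of \<open>Y\<close>; what is left is the error of
    \<open>Y\<close>, weighted by \<open>2 * CN * CE\<close>.\<close>
  define D where "D = 2 * CN * CE"
  have D: "0 \<le> D" unfolding D_def using CN CE by simp
  define A where "A = 4 ^ ?d + 2 * CN * (2 * 4 ^ ?d) + D"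
  have A: "1 \<le> A" "D \<le> A" unfolding A_def using CN D by (auto simp: add_increasing2)
  define C where "C = A * CM + D * CM"
  have C: "0 < C" "A * CM \<le> C" "D * CM \<le> C" unfolding C_def using A CM D by (auto intro: add_pos_nonneg)
  have "L2n y (t0 / N ^ L) Du \<le> C * exp (C * (\<Sum>k<L. \<omega> k + e k / (t0 / N ^ k))) * (L2n y t0 Du + (\<Sum>k<L. K k))"
    if ell: "elliptic a \<mu> \<Lambda>" and u: "C1 u Du" and t0: "0 < t0" and
      hyp: "\<forall>k<L. Sol a y (t0 / N ^ k) (K k) Du \<and> almost_periodic a y (t0 / N ^ k) (\<omega> k) (e k) \<and> 0 \<le> K k \<and> 0 \<le> \<omega> k \<and> 0 \<le> e k"
    for a and y :: 'a and t0 u Du K \<omega> e and L :: nat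
  proof -
    define t where "t = (\<lambda>k::nat. t0 / N ^ k)"
    have t: "0 < t k" for k unfolding t_def using t0 N by simp
    have tS: "t (Suc k) = t k / N" for k unfolding t_def by simp
    define F where "F = (\<lambda>k::nat. L2n y t0 Du + (\<Sum>i<k. K i))"
    define \<eta> where "\<eta> = (\<lambda>k. \<omega> k + e k / t k)"
    define E where "E = (\<lambda>k::nat. exp (C * (\<Sum>i<k. \<eta> i)))"
    have M0: "0 \<le> L2n y t0 Du" using t0 by (intro L2n_nonneg) simp
    have eta: "0 \<le> \<eta> k" if "k < L" for k unfolding \<eta>_def using hyp that t[of k] by auto
    have F0: "0 \<le> F k" if "k \<le> L" for k
      unfolding F_def using hyp that M0 by (intro add_nonneg_nonneg sum_nonneg) auto
    have E1: "1 \<le> E k" if "k \<le> L" for k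
      unfolding E_def using eta that C by (auto intro!: mult_nonneg_nonneg sum_nonneg)
    \<comment> \<open>The gradient bound belongs to the induction because the error of the next step
      is \<open>\<eta> k\<close> times the gradient at radius \<open>t k\<close>.\<close>
    have "k \<le> L \<Longrightarrow> \<exists>X Y. 0 \<le> X \<and> 0 \<le> Y \<and> first_diff_le y (t k) u X \<and> second_diff_le y (t k) u Y \<and>
        X + 2 * CN * Y \<le> A * F k * E k \<and> L2n y (t k) Du \<le> A * CM * F k * E k" for k
    proof (induction k)
      case 0
      let ?M = "L2n y t0 Du"
      have t00: "t 0 = t0" unfolding t_def by simp
      have FE: "F 0 = ?M" "E 0 = 1" unfolding F_def E_def by auto
      have "4 ^ ?d * ?M + 2 * CN * (2 * 4 ^ ?d * ?M) \<le> A * ?M"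
      proof -
        have "0 \<le> D * ?M" using D M0 by simp
        then show ?thesis unfolding A_def by (simp add: algebra_simps)
      qed
      moreover have "?M \<le> A * CM * ?M"
        using mult_right_mono[of 1 "A * CM" ?M] M0 mult_mono[of 1 A 1 CM] A CM by simp
      ultimately show ?case unfolding t00 FE
        using first_diff_le_init[OF u t0, of y] second_diff_le_init[OF u t0, of y] M0
        by (intro exI[of _ "4 ^ ?d * ?M"] exI[of _ "2 * 4 ^ ?d * ?M"]) auto
    next
      case (Suc k)
      then have kL: "k < L" "k \<le> L" by auto
      obtain X Y where X: "0 \<le> X" and Y: "0 \<le> Y" and fd: "first_diff_le y (t k) u X" and sd: "second_diff_le y (t k) u Y"
        and Z: "X + 2 * CN * Y \<le> A * F k * E k" and M: "L2n y (t k) Du \<le> A * CM * F k * E k"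
        using Suc.IH[OF kL(2)] by blast
      have sol: "Sol a y (t k) (K k) Du" and ap: "almost_periodic a y (t k) (\<omega> k) (e k)"
        and K: "0 \<le> K k" and om: "0 \<le> \<omega> k" and e0: "0 \<le> e k"
        using hyp kL unfolding t_def by auto
      define X' Y' where "X' = X + CN * Y" and "Y' = Y / 2 + CE * (K k + \<eta> k * L2n y (t k) Du)"
      have Mk: "0 \<le> L2n y (t k) Du" using t[of k] by (intro L2n_nonneg) simp
      have fd': "first_diff_le y (t (Suc k)) u X'"
        using first_diff_le_step[OF C1_continuous(1)[OF u] fd sd t _ X Y, of m] m
        unfolding tS X'_def CN_def N_def by simp
      have sd': "second_diff_le y (t (Suc k)) u Y'"
        using HE[OF ell u sol ap sd t K om Y e0] unfolding tS Y'_def N_def \<eta>_def .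
      have X'0: "0 \<le> X'" and Y'0: "0 \<le> Y'" unfolding X'_def Y'_def using X Y CN CE K eta[OF kL(1)] Mk by auto
      have EF0: "0 \<le> E k" "0 \<le> F k" using E1[OF kL(2)] F0[OF kL(2)] by auto
      have ES: "E (Suc k) = E k * exp (C * \<eta> k)" unfolding E_def by (simp add: algebra_simps exp_add)
      have EE: "E k * (1 + C * \<eta> k) \<le> E (Suc k)" unfolding ES using EF0 by (intro mult_left_mono exp_ge_add_one_self) auto
      have Ek: "E k \<le> E (Suc k)" using EE mult_left_mono[of 1 "1 + C * \<eta> k" "E k"] EF0 C eta[OF kL(1)] by simp
      have FS: "F (Suc k) = F k + K k" unfolding F_def by simp
      have "X' + 2 * CN * Y' = (X + 2 * CN * Y) + D * K k + D * \<eta> k * L2n y (t k) Du"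
        unfolding X'_def Y'_def D_def by (simp add: algebra_simps)
      also have "\<dots> \<le> A * F k * E k + A * K k * E (Suc k) + A * F k * E k * (C * \<eta> k)"
      proof (intro add_mono Z)
        have "D * K k \<le> A * K k" using A K by (intro mult_right_mono) auto
        also have "\<dots> \<le> A * K k * E (Suc k)" using mult_left_mono[of 1 "E (Suc k)" "A * K k"] E1[of "Suc k"] Suc.prems A K by simp
        finally show "D * K k \<le> A * K k * E (Suc k)" .
        have "D * \<eta> k * L2n y (t k) Du \<le> D * \<eta> k * (A * CM * F k * E k)"
          using D eta[OF kL(1)] by (intro mult_left_mono M) auto
        also have "\<dots> = A * F k * E k * ((D * CM) * \<eta> k)" by simp
        also have "\<dots> \<le> A * F k * E k * (C * \<eta> k)"
          using A EF0 C eta[OF kL(1)] by (intro mult_left_mono mult_right_mono) auto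
        finally show "D * \<eta> k * L2n y (t k) Du \<le> A * F k * E k * (C * \<eta> k)" .
      qed
      also have "\<dots> = A * F k * (E k * (1 + C * \<eta> k)) + A * K k * E (Suc k)" by (simp add: algebra_simps)
      also have "\<dots> \<le> A * F k * E (Suc k) + A * K k * E (Suc k)"
        using A EF0 by (intro add_right_mono mult_left_mono EE) auto
      also have "\<dots> = A * F (Suc k) * E (Suc k)" unfolding FS by (simp add: algebra_simps)
      finally have Z': "X' + 2 * CN * Y' \<le> A * F (Suc k) * E (Suc k)" .
      \<comment> \<open>The gradient is recovered at radius \<open>t k / 16\<close>; the next radius
        is smaller since \<open>m\<close> is at least 32.\<close>
      have tS16: "t (Suc k) \<le> t k / 16" unfolding tS using t[of k] N by (intro divide_left_mono) auto
      have "L2n y (t (Suc k)) Du \<le> sqrt ((t k / 16 / t (Suc k)) ^ ?d) * L2n y (t k / 16) Du"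
        by (intro L2n_ball_mono C1_continuous(2)[OF u] subset_cball t) (use t[of k] tS16 in auto)
      also have "\<dots> \<le> sqrt (N ^ ?d) * (C0 * (X + K k))"
      proof (intro mult_mono real_sqrt_le_mono power_mono)
        show "L2n y (t k / 16) Du \<le> C0 * (X + K k)" by (rule HM[OF ell u sol fd t K X])
        show "t k / 16 / t (Suc k) \<le> N" unfolding tS using t[of k] N by simp
      qed (use t[of k] t[of "Suc k"] N in \<open>auto intro!: L2n_nonneg\<close>)
      also have "\<dots> = CM * (X + K k)" unfolding CM_def by simp
      also have "\<dots> \<le> CM * (A * F k * E (Suc k) + A * K k * E (Suc k))"
      proof (intro mult_left_mono add_mono)
        have "X \<le> A * F k * E k" using Z CN Y by (smt (verit) mult_nonneg_nonneg)
        also have "\<dots> \<le> A * F k * E (Suc k)" using A EF0 Ek by (intro mult_left_mono) auto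
        finally show "X \<le> A * F k * E (Suc k)" .
        have "1 * K k * 1 \<le> A * K k * E (Suc k)" using A K E1[of "Suc k"] Suc.prems by (intro mult_mono) auto
        then show "K k \<le> A * K k * E (Suc k)" by simp
      qed (use CM in auto)
      also have "\<dots> = A * CM * F (Suc k) * E (Suc k)" unfolding FS by (simp add: algebra_simps)
      finally show ?case using X'0 Y'0 fd' sd' Z' by blast
    qed
    then have "L2n y (t L) Du \<le> A * CM * F L * E L" by blast
    also have "\<dots> \<le> C * F L * E L" using C F0[of L] E1[of L] by (intro mult_right_mono) auto
    finally show ?thesis unfolding t_def F_def E_def \<eta>_def by (simp add: mult_ac)
  qed
  then show ?thesis using m C unfolding N_def by (intro exI[of _ m] conjI exI[of _ C]) auto
qed

subsection \<open>Convolution\<close>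

definition conv :: "('a::euclidean_space \<Rightarrow> real) \<Rightarrow> ('a \<Rightarrow> 'b::euclidean_space) \<Rightarrow> 'a \<Rightarrow> 'b" where
  "conv \<kappa> F x = (LINT z|lborel. \<kappa> (x - z) *\<^sub>R F z)"

lemma lborel_distr_reflect: "distr lborel borel (\<lambda>x. t - x) = (lborel :: 'a::euclidean_space measure)"
proof -
  have "(lborel :: 'a measure) = density (distr lborel borel (\<lambda>x. t + (-1) *\<^sub>R x)) (\<lambda>_. ennreal (\<bar>-1\<bar> ^ DIM('a)))"
    by (rule lborel_affine) simp
  also have "\<dots> = distr lborel borel (\<lambda>x. t - x)" by (simp add: density_1 one_ennreal_def[symmetric])
  finally show ?thesis by simp
qed

lemma integral_reflect:
  fixes f :: "'a::euclidean_space \<Rightarrow> 'b::{banach,second_countable_topology}"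
  assumes "f \<in> borel_measurable borel"
  shows "(LINT x|lborel. f (t - x)) = (LINT x|lborel. f x)"
proof -
  have "(LINT x|lborel. f x) = (LINT x|distr lborel borel (\<lambda>x. t - x). f x)" by (simp only: lborel_distr_reflect)
  also have "\<dots> = (LINT x|lborel. f (t - x))" by (rule integral_distr) (use assms in auto)
  finally show ?thesis ..
qed

lemma integrable_reflect:
  fixes f :: "'a::euclidean_space \<Rightarrow> 'b::{banach,second_countable_topology}"
  assumes "integrable lborel f"
  shows "integrable lborel (\<lambda>x. f (t - x))"
proof -
  have "f \<in> borel_measurable borel" using borel_measurable_integrable[OF assms] by simp
  then show ?thesis
    using integrable_distr_eq[of "\<lambda>x. t - x" lborel borel f] assms by (simp add: lborel_distr_reflect)
qed

lemma integrable_translate: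
  fixes f :: "'a::euclidean_space \<Rightarrow> 'b::{banach,second_countable_topology}"
  assumes "integrable lborel f"
  shows "integrable lborel (\<lambda>x. f (x - z))" "(LINT x|lborel. f (x - z)) = (LINT x|lborel. f x)"
proof -
  have m: "f \<in> borel_measurable borel" using borel_measurable_integrable[OF assms] by simp
  have d: "distr lborel borel (\<lambda>x. x - z) = lborel"
  proof -
    have "(\<lambda>x. x - z) = (+) (- z)" by auto
    then show ?thesis by (simp only: lborel_distr_plus)
  qed
  show "integrable lborel (\<lambda>x. f (x - z))"
    using integrable_distr_eq[of "\<lambda>x. x - z" lborel borel f] assms m by (simp add: d)
  show "(LINT x|lborel. f (x - z)) = (LINT x|lborel. f x)"
    using integral_distr[of "\<lambda>x. x - z" lborel borel f] m by (simp add: d)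
qed

lemma integrable_conv_integrand:
  fixes F :: "'a::euclidean_space \<Rightarrow> 'b::euclidean_space"
  assumes k: "\<kappa> \<in> borel_measurable borel" and b: "\<And>x. norm (\<kappa> x) \<le> B" and F: "integrable lborel F"
  shows "integrable lborel (\<lambda>z. \<kappa> (x - z) *\<^sub>R F z)"
proof (rule Bochner_Integration.integrable_bound[OF integrable_scaleR_right[OF F, of B]])
  show "(\<lambda>z. \<kappa> (x - z) *\<^sub>R F z) \<in> borel_measurable lborel"
    using k borel_measurable_integrable[OF F] by measurable
  have "0 \<le> B" using b[of 0] norm_ge_zero order_trans by blast
  then show "AE z in lborel. norm (\<kappa> (x - z) *\<^sub>R F z) \<le> norm (B *\<^sub>R F z)"
    using b by (auto intro!: AE_I2 mult_right_mono)
qed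

lemma conv_commute:
  fixes v \<kappa> :: "'a::euclidean_space \<Rightarrow> real"
  assumes k: "\<kappa> \<in> borel_measurable borel" and v: "v \<in> borel_measurable borel"
  shows "conv \<kappa> v x = (LINT z|lborel. \<kappa> z *\<^sub>R v (x - z))"
  unfolding conv_def using integral_reflect[of "\<lambda>z. \<kappa> z *\<^sub>R v (x - z)" x] k v by simp

lemma conv_commute_vec:
  fixes F :: "'a::euclidean_space \<Rightarrow> 'b::euclidean_space"
  assumes k: "\<kappa> \<in> borel_measurable borel" and v: "F \<in> borel_measurable borel"
  shows "conv \<kappa> F x = (LINT z|lborel. \<kappa> z *\<^sub>R F (x - z))"
  unfolding conv_def using integral_reflect[of "\<lambda>z. \<kappa> z *\<^sub>R F (x - z)" x] k v by simp

lemma integrable_pair_conv: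
  fixes F :: "'a::euclidean_space \<Rightarrow> 'b::euclidean_space"
  assumes k: "integrable lborel \<kappa>" and F: "integrable lborel F"
  shows "integrable (lborel \<Otimes>\<^sub>M lborel) (\<lambda>(z, x). \<kappa> (x - z) *\<^sub>R F z)"
proof (rule lborel_pair.Fubini_integrable)
  have [measurable]: "\<kappa> \<in> borel_measurable borel" "F \<in> borel_measurable borel"
    using borel_measurable_integrable[OF k] borel_measurable_integrable[OF F] by auto
  show "(\<lambda>(z, x). \<kappa> (x - z) *\<^sub>R F z) \<in> borel_measurable (lborel \<Otimes>\<^sub>M lborel)" by measurable
  have eq: "(LINT x|lborel. norm (case (z, x) of (z, x) \<Rightarrow> \<kappa> (x - z) *\<^sub>R F z)) = (LINT x|lborel. \<bar>\<kappa> x\<bar>) * norm (F z)" for z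
    using integrable_translate(2)[OF integrable_abs[OF k], of z] by simp
  show "integrable lborel (\<lambda>z. LINT x|lborel. norm (case (z, x) of (z, x) \<Rightarrow> \<kappa> (x - z) *\<^sub>R F z))"
    unfolding eq using F by simp
  show "AE z in lborel. integrable lborel (\<lambda>x. case (z, x) of (z, x) \<Rightarrow> \<kappa> (x - z) *\<^sub>R F z)"
    using integrable_translate(1)[OF k] by (auto intro!: AE_I2)
qed

lemma integrable_conv:
  fixes F :: "'a::euclidean_space \<Rightarrow> 'b::euclidean_space"
  assumes k: "integrable lborel \<kappa>" and F: "integrable lborel F"
  shows "integrable lborel (conv \<kappa> F)"
  using lborel_pair.integrable_snd[of "\<lambda>z x. \<kappa> (x - z) *\<^sub>R F z"] integrable_pair_conv[OF assms]
  unfolding conv_def[abs_def] by simp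

lemma integral_conv:
  fixes F :: "'a::euclidean_space \<Rightarrow> 'b::euclidean_space"
  assumes k: "integrable lborel \<kappa>" and F: "integrable lborel F"
  shows "(LINT x|lborel. conv \<kappa> F x) = (LINT x|lborel. \<kappa> x) *\<^sub>R (LINT x|lborel. F x)"
proof -
  have "(LINT x|lborel. conv \<kappa> F x) = (LINT z|lborel. LINT x|lborel. \<kappa> (x - z) *\<^sub>R F z)"
    using lborel_pair.Fubini_integral[of "\<lambda>z x. \<kappa> (x - z) *\<^sub>R F z"] integrable_pair_conv[OF assms]
    unfolding conv_def by simp
  also have "\<dots> = (LINT z|lborel. (LINT x|lborel. \<kappa> x) *\<^sub>R F z)"
  proof (rule Bochner_Integration.integral_cong[OF refl])
    fix z show "(LINT x|lborel. \<kappa> (x - z) *\<^sub>R F z) = (LINT x|lborel. \<kappa> x) *\<^sub>R F z"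
      using integrable_translate[OF k, of z] by simp
  qed
  finally show ?thesis using F by simp
qed

text \<open>Convolution with an even kernel is self-adjoint. Boundedness of \<open>H\<close>
  provides the integrability for Fubini, \<open>F\<close> being merely integrable.\<close>

lemma integral_conv_inner:
  fixes F H :: "'a::euclidean_space \<Rightarrow> 'b::euclidean_space"
  assumes k: "integrable lborel \<kappa>" and kb: "\<And>x. norm (\<kappa> x) \<le> B'" and even: "\<And>x. \<kappa> (- x) = \<kappa> x" and F: "integrable lborel F"
    and H: "integrable lborel H" and b: "\<And>x. norm (H x) \<le> B"
  shows "(LINT x|lborel. conv \<kappa> F x \<bullet> H x) = (LINT x|lborel. F x \<bullet> conv \<kappa> H x)"
proof -
  have [measurable]: "\<kappa> \<in> borel_measurable borel" "F \<in> borel_measurable borel" "H \<in> borel_measurable borel"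
    using borel_measurable_integrable[OF k] borel_measurable_integrable[OF F] borel_measurable_integrable[OF H] by auto
  have B: "0 \<le> B" using b[of 0] norm_ge_zero order_trans by blast
  have int: "integrable (lborel \<Otimes>\<^sub>M lborel) (\<lambda>(z, x). (\<kappa> (x - z) *\<^sub>R F z) \<bullet> H x)"
  proof (rule Bochner_Integration.integrable_bound[OF integrable_scaleR_right[OF integrable_pair_conv[OF k F], of B]])
    show "AE p in lborel \<Otimes>\<^sub>M lborel. norm (case p of (z, x) \<Rightarrow> (\<kappa> (x - z) *\<^sub>R F z) \<bullet> H x) \<le> norm (B *\<^sub>R (case p of (z, x) \<Rightarrow> \<kappa> (x - z) *\<^sub>R F z))"
    proof (intro AE_I2, clarsimp)
      fix z x
      have "\<bar>F z \<bullet> H x\<bar> \<le> norm (F z) * B"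
        using Cauchy_Schwarz_ineq2[of "F z" "H x"] b[of x] by (meson mult_left_mono norm_ge_zero order_trans)
      then have "\<bar>\<kappa> (x - z)\<bar> * \<bar>F z \<bullet> H x\<bar> \<le> \<bar>\<kappa> (x - z)\<bar> * (norm (F z) * B)" by (rule mult_left_mono) simp
      then show "\<bar>\<kappa> (x - z) * (F z \<bullet> H x)\<bar> \<le> \<bar>B\<bar> * (\<bar>\<kappa> (x - z)\<bar> * norm (F z))"
        using B by (simp add: abs_mult mult_ac)
    qed
  qed measurable
  have "(LINT x|lborel. conv \<kappa> F x \<bullet> H x) = (LINT x|lborel. LINT z|lborel. (\<kappa> (x - z) *\<^sub>R F z) \<bullet> H x)"
  proof (rule Bochner_Integration.integral_cong[OF refl])
    fix x
    show "conv \<kappa> F x \<bullet> H x = (LINT z|lborel. (\<kappa> (x - z) *\<^sub>R F z) \<bullet> H x)"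
      unfolding conv_def by (rule integral_inner_left[symmetric]) (rule integrable_conv_integrand[OF _ kb F], measurable)
  qed
  also have "\<dots> = (LINT z|lborel. LINT x|lborel. (\<kappa> (x - z) *\<^sub>R F z) \<bullet> H x)"
    using lborel_pair.Fubini_integral[OF int] by simp
  also have "\<dots> = (LINT z|lborel. F z \<bullet> conv \<kappa> H z)"
  proof (rule Bochner_Integration.integral_cong[OF refl])
    fix z
    have "(LINT x|lborel. (\<kappa> (x - z) *\<^sub>R F z) \<bullet> H x) = (LINT x|lborel. F z \<bullet> (\<kappa> (z - x) *\<^sub>R H x))"
    proof (rule Bochner_Integration.integral_cong[OF refl])
      fix x show "(\<kappa> (x - z) *\<^sub>R F z) \<bullet> H x = F z \<bullet> (\<kappa> (z - x) *\<^sub>R H x)"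
        using even[of "x - z"] by simp
    qed
    also have "\<dots> = F z \<bullet> conv \<kappa> H z"
      unfolding conv_def by (rule integral_inner_right) (rule integrable_conv_integrand[OF _ kb H], measurable)
    finally show "(LINT x|lborel. (\<kappa> (x - z) *\<^sub>R F z) \<bullet> H x) = F z \<bullet> conv \<kappa> H z" .
  qed
  finally show ?thesis .
qed

lemma uniformly_continuous_compact_support:
  fixes \<psi> :: "'a::euclidean_space \<Rightarrow> 'b::real_normed_vector"
  assumes c: "continuous_on UNIV \<psi>" and z: "\<And>x. x \<notin> cball y h \<Longrightarrow> \<psi> x = 0" and e: "0 < e"
  shows "\<exists>d>0. \<forall>x k. norm k < d \<longrightarrow> norm (\<psi> (x + k) - \<psi> x) < e"
proof -
  have "uniformly_continuous_on (cball y (h + 2)) \<psi>"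
    by (intro compact_uniformly_continuous continuous_on_subset[OF c]) auto
  then obtain d where d: "d > 0" and D: "\<And>x x'. x \<in> cball y (h + 2) \<Longrightarrow> x' \<in> cball y (h + 2) \<Longrightarrow> dist x' x < d \<Longrightarrow> dist (\<psi> x') (\<psi> x) < e"
    using e unfolding uniformly_continuous_on_def by metis
  have "norm (\<psi> (x + k) - \<psi> x) < e" if k: "norm k < min d 1" for x k
  proof (cases "x \<in> cball y (h + 1)")
    case True
    have "dist y (x + k) \<le> dist y x + norm k" using dist_triangle[of y "x + k" x] by (simp add: dist_norm)
    then show ?thesis using D[of x "x + k"] True k by (simp add: dist_norm)
  next
    case False
    have "dist y x \<le> dist y (x + k) + norm k" using dist_triangle[of y x "x + k"] by (simp add: dist_norm)
    then show ?thesis using z[of x] z[of "x + k"] False k e by simp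
  qed
  then show ?thesis using d by (intro exI[of _ "min d 1"]) auto
qed

lemma bounded_compact_support:
  fixes \<psi> :: "'a::euclidean_space \<Rightarrow> 'b::real_normed_vector"
  assumes c: "continuous_on UNIV \<psi>" and z: "\<And>x. x \<notin> cball y h \<Longrightarrow> \<psi> x = 0"
  shows "\<exists>B. \<forall>x. norm (\<psi> x) \<le> B"
proof -
  have "bounded (\<psi> ` cball y h)"
    by (intro compact_imp_bounded compact_continuous_image continuous_on_subset[OF c]) auto
  then obtain B where B: "\<And>x. x \<in> cball y h \<Longrightarrow> norm (\<psi> x) \<le> B" unfolding bounded_iff by blast
  then have "norm (\<psi> x) \<le> max B 0" for x using z[of x] by (cases "x \<in> cball y h") (auto simp: le_max_iff_disj)
  then show ?thesis by blast
qed

lemma integrable_compact_support: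
  fixes \<psi> :: "'a::euclidean_space \<Rightarrow> 'b::{banach,second_countable_topology}"
  assumes c: "continuous_on UNIV \<psi>" and z: "\<And>x. x \<notin> cball y h \<Longrightarrow> \<psi> x = 0"
  shows "integrable lborel \<psi>"
proof -
  have "integrable lborel (\<lambda>x. indicator (cball y h) x *\<^sub>R \<psi> x)"
    by (rule borel_integrable_compact) (auto intro: continuous_on_subset[OF c])
  also have "(\<lambda>x. indicator (cball y h) x *\<^sub>R \<psi> x) = \<psi>" using z by (auto simp: indicator_def)
  finally show ?thesis .
qed

lemma continuous_conv:
  fixes F :: "'a::euclidean_space \<Rightarrow> 'b::euclidean_space"
  assumes c: "continuous_on UNIV \<psi>" and z: "\<And>x. x \<notin> cball y h \<Longrightarrow> \<psi> x = 0" and F: "integrable lborel F"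
  shows "continuous_on UNIV (conv \<psi> F)"
  unfolding continuous_on_iff
proof (intro ballI allI impI)
  fix x :: 'a and e :: real assume e: "0 < e"
  obtain B where B: "\<And>x. norm (\<psi> x) \<le> B" using bounded_compact_support[OF c z] by blast
  have m: "\<psi> \<in> borel_measurable borel" by (rule borel_measurable_continuous_onI[OF c])
  note int = integrable_conv_integrand[OF m B F]
  define I where "I = (LINT z|lborel. norm (F z))"
  have I: "0 \<le> I" unfolding I_def by (rule Bochner_Integration.integral_nonneg) simp
  define e' where "e' = e / (I + 1)"
  have e': "0 < e'" "e' * I < e" unfolding e'_def using e I by (auto simp: field_simps)
  obtain d where d: "d > 0" and D: "\<And>x k. norm k < d \<Longrightarrow> norm (\<psi> (x + k) - \<psi> x) < e'"
    using uniformly_continuous_compact_support[OF c z e'(1)] by blast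
  have "dist (conv \<psi> F x') (conv \<psi> F x) < e" if x': "dist x' x < d" for x'
  proof -
    have "conv \<psi> F x' - conv \<psi> F x = (LINT z|lborel. \<psi> (x' - z) *\<^sub>R F z - \<psi> (x - z) *\<^sub>R F z)"
      unfolding conv_def by (rule Bochner_Integration.integral_diff[symmetric]) (rule int)+
    also have "norm \<dots> \<le> (LINT z|lborel. e' * norm (F z))"
    proof (rule Bochner_Integration.integral_norm_bound_integral)
      fix z
      have "norm (\<psi> ((x - z) + (x' - x)) - \<psi> (x - z)) < e'" by (rule D) (use x' in \<open>simp add: dist_norm\<close>)
      then have "\<bar>\<psi> (x' - z) - \<psi> (x - z)\<bar> \<le> e'" by simp
      then show "norm (\<psi> (x' - z) *\<^sub>R F z - \<psi> (x - z) *\<^sub>R F z) \<le> e' * norm (F z)"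
        unfolding scaleR_left_diff_distrib[symmetric] norm_scaleR by (intro mult_right_mono) auto
    qed (use F in \<open>auto intro!: Bochner_Integration.integrable_diff int\<close>)
    also have "\<dots> = e' * I" unfolding I_def by simp
    finally show ?thesis using e'(2) by (simp add: dist_norm)
  qed
  then show "\<exists>d>0. \<forall>x'\<in>UNIV. dist x' x < d \<longrightarrow> dist (conv \<psi> F x') (conv \<psi> F x) < e" using d by blast
qed

text \<open>Here \<open>Dconv \<psi>' w\<close>, the convolution with a vector-valued kernel, is the gradient of the convolution.\<close>

definition Dconv :: "('a::euclidean_space \<Rightarrow> 'a) \<Rightarrow> ('a \<Rightarrow> real) \<Rightarrow> 'a \<Rightarrow> 'a" where
  "Dconv D w x = (LINT z|lborel. w z *\<^sub>R D (x - z))"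

text \<open>The gradient of the kernel is uniformly continuous, so the first-order remainder of
  \<open>\<psi>\<close> is small uniformly in the base point and can be integrated against
  \<open>w\<close>.\<close>

lemma C1_conv:
  fixes w :: "'a::euclidean_space \<Rightarrow> real"
  assumes p: "C1 \<psi> D\<psi>" and z: "\<And>x. x \<notin> cball y h \<Longrightarrow> \<psi> x = 0" and w: "integrable lborel w"
  shows "C1 (conv \<psi> w) (Dconv D\<psi> w)"
proof -
  have cD: "continuous_on UNIV D\<psi>" by (rule C1_continuous(2)[OF p])
  have zD: "D\<psi> x = 0" if "x \<notin> cball y h" for x by (rule C1_zero_outside[OF p z that])
  obtain B where B: "\<And>x. norm (\<psi> x) \<le> B" using bounded_compact_support[OF C1_continuous(1)[OF p] z] by blast
  obtain B' where B': "\<And>x. norm (D\<psi> x) \<le> B'" using bounded_compact_support[OF cD zD] by blast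
  have m: "\<psi> \<in> borel_measurable borel" by (rule borel_measurable_continuous_onI[OF C1_continuous(1)[OF p]])
  have mD: "D\<psi> \<in> borel_measurable borel" by (rule borel_measurable_continuous_onI[OF cD])
  note int = integrable_conv_integrand[OF m B w]
  have mw: "w \<in> borel_measurable borel" using borel_measurable_integrable[OF w] by simp
  have intD: "integrable lborel (\<lambda>z. w z *\<^sub>R D\<psi> (x - z))" for x
  proof (rule Bochner_Integration.integrable_bound[OF integrable_scaleR_right[OF w, of B']])
    show "(\<lambda>z. w z *\<^sub>R D\<psi> (x - z)) \<in> borel_measurable lborel" using mD mw by measurable
    have "0 \<le> B'" using B'[of 0] norm_ge_zero order_trans by blast
    then have "\<bar>w z\<bar> * norm (D\<psi> (x - z)) \<le> \<bar>w z\<bar> * B'" for z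
      using B' by (intro mult_left_mono) auto
    then show "AE z in lborel. norm (w z *\<^sub>R D\<psi> (x - z)) \<le> norm (B' *\<^sub>R w z)"
      using \<open>0 \<le> B'\<close> by (auto intro!: AE_I2 simp: abs_mult mult.commute)
  qed
  define I where "I = (LINT z|lborel. \<bar>w z\<bar>)"
  have I: "0 \<le> I" unfolding I_def by (rule Bochner_Integration.integral_nonneg) simp
  have lin: "\<bar>\<psi> (q + k) - \<psi> q - D\<psi> q \<bullet> k\<bar> \<le> norm k * e"
    if e: "0 < e" and d: "\<And>x k. norm k < d \<Longrightarrow> norm (D\<psi> (x + k) - D\<psi> x) < e" and k: "norm k < d" for q k e d
  proof -
    have "norm (\<psi> (q + k) - \<psi> q - D\<psi> q \<bullet> ((q + k) - q)) \<le> norm ((q + k) - q) * e"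
    proof (rule differentiable_bound_linearization[where S = "{q'. norm (q' - q) \<le> norm k}" and f' = "\<lambda>x k. D\<psi> x \<bullet> k"])
      fix t :: real assume "t \<in> {0..1}"
      then show "q + t *\<^sub>R (q + k - q) \<in> {q'. norm (q' - q) \<le> norm k}" by (simp add: mult_left_le_one_le)
    next
      fix x show "(\<psi> has_derivative (\<lambda>k. D\<psi> x \<bullet> k)) (at x within {q'. norm (q' - q) \<le> norm k})"
        using p unfolding C1_def by (auto intro: has_derivative_at_withinI)
    next
      fix x assume "x \<in> {q'. norm (q' - q) \<le> norm k}"
      then have "norm (D\<psi> x - D\<psi> q) \<le> e" using d[of "x - q" q] k by (simp add: less_imp_le)
      then have "norm ((D\<psi> x - D\<psi> q) \<bullet> k') \<le> e * norm k'" for k'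
        using Cauchy_Schwarz_ineq2[of "D\<psi> x - D\<psi> q" k'] by (metis mult_right_mono norm_ge_zero order_trans real_norm_def)
      then show "onorm ((\<lambda>k. D\<psi> x \<bullet> k) - (\<lambda>k. D\<psi> q \<bullet> k)) \<le> e"
        using e by (intro onorm_bound) (auto simp: inner_diff_left[symmetric])
    qed simp
    then show ?thesis by simp
  qed
  have "(conv \<psi> w has_derivative (\<lambda>k. Dconv D\<psi> w x \<bullet> k)) (at x)" for x
    unfolding has_derivative_at_alt
  proof (intro conjI allI impI)
    show "bounded_linear (\<lambda>k. Dconv D\<psi> w x \<bullet> k)" by (rule bounded_linear_inner_right)
    fix e :: real assume e: "0 < e"
    define e' where "e' = e / (I + 1)"
    have e': "0 < e'" "e' * I \<le> e" unfolding e'_def using e I by (auto simp: field_simps)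
    obtain d where d: "d > 0" and D: "\<And>x k. norm k < d \<Longrightarrow> norm (D\<psi> (x + k) - D\<psi> x) < e'"
      using uniformly_continuous_compact_support[OF cD zD e'(1)] by blast
    have "norm (conv \<psi> w x' - conv \<psi> w x - Dconv D\<psi> w x \<bullet> (x' - x)) \<le> e * norm (x' - x)" if x': "norm (x' - x) < d" for x'
    proof -
      have "Dconv D\<psi> w x \<bullet> (x' - x) = (LINT z|lborel. (w z *\<^sub>R D\<psi> (x - z)) \<bullet> (x' - x))"
        unfolding Dconv_def by (rule integral_inner_left[symmetric]) (rule intD)
      then have "conv \<psi> w x' - conv \<psi> w x - Dconv D\<psi> w x \<bullet> (x' - x)
         = (LINT z|lborel. \<psi> (x' - z) *\<^sub>R w z - \<psi> (x - z) *\<^sub>R w z - (w z *\<^sub>R D\<psi> (x - z)) \<bullet> (x' - x))"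
        unfolding conv_def
        by (simp only: Bochner_Integration.integral_diff[OF Bochner_Integration.integrable_diff[OF int int] integrable_inner_left[OF intD]]
             Bochner_Integration.integral_diff[OF int int])
      also have "norm \<dots> \<le> (LINT z|lborel. (norm (x' - x) * e') * \<bar>w z\<bar>)"
      proof (rule Bochner_Integration.integral_norm_bound_integral)
        fix z
        have "\<bar>\<psi> ((x - z) + (x' - x)) - \<psi> (x - z) - D\<psi> (x - z) \<bullet> (x' - x)\<bar> \<le> norm (x' - x) * e'"
          by (rule lin[OF e'(1) D x'])
        then have "\<bar>\<psi> (x' - z) - \<psi> (x - z) - D\<psi> (x - z) \<bullet> (x' - x)\<bar> * \<bar>w z\<bar> \<le> (norm (x' - x) * e') * \<bar>w z\<bar>"
          by (intro mult_right_mono) auto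
        then show "norm (\<psi> (x' - z) *\<^sub>R w z - \<psi> (x - z) *\<^sub>R w z - (w z *\<^sub>R D\<psi> (x - z)) \<bullet> (x' - x)) \<le> (norm (x' - x) * e') * \<bar>w z\<bar>"
          by (simp add: abs_mult[symmetric] algebra_simps)
      qed (intro Bochner_Integration.integrable_diff int integrable_inner_left intD integrable_mult_right integrable_abs w)+
      also have "\<dots> = (e' * I) * norm (x' - x)" unfolding I_def by simp
      also have "\<dots> \<le> e * norm (x' - x)" by (intro mult_right_mono e') auto
      finally show ?thesis .
    qed
    then show "\<exists>d>0. \<forall>x'. norm (x' - x) < d \<longrightarrow> norm (conv \<psi> w x' - conv \<psi> w x - Dconv D\<psi> w x \<bullet> (x' - x)) \<le> e * norm (x' - x)"
      using d by blast
  qed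
  moreover have "continuous_on UNIV (Dconv D\<psi> w)"
    unfolding continuous_on_iff
  proof (intro ballI allI impI)
    fix x :: 'a and e :: real assume e: "0 < e"
    define e' where "e' = e / (I + 1)"
    have e': "0 < e'" "e' * I < e" unfolding e'_def using e I by (auto simp: field_simps)
    obtain d where d: "d > 0" and D: "\<And>x k. norm k < d \<Longrightarrow> norm (D\<psi> (x + k) - D\<psi> x) < e'"
      using uniformly_continuous_compact_support[OF cD zD e'(1)] by blast
    have "dist (Dconv D\<psi> w x') (Dconv D\<psi> w x) < e" if x': "dist x' x < d" for x'
    proof -
      have "Dconv D\<psi> w x' - Dconv D\<psi> w x = (LINT z|lborel. w z *\<^sub>R D\<psi> (x' - z) - w z *\<^sub>R D\<psi> (x - z))"
        unfolding Dconv_def by (rule Bochner_Integration.integral_diff[symmetric]) (rule intD)+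
      also have "norm \<dots> \<le> (LINT z|lborel. e' * \<bar>w z\<bar>)"
      proof (rule Bochner_Integration.integral_norm_bound_integral)
        fix z
        have "norm (D\<psi> ((x - z) + (x' - x)) - D\<psi> (x - z)) < e'" by (rule D) (use x' in \<open>simp add: dist_norm\<close>)
        then have "norm (D\<psi> (x' - z) - D\<psi> (x - z)) \<le> e'" by simp
        then show "norm (w z *\<^sub>R D\<psi> (x' - z) - w z *\<^sub>R D\<psi> (x - z)) \<le> e' * \<bar>w z\<bar>"
          unfolding scaleR_diff_right[symmetric] norm_scaleR by (metis abs_ge_zero mult.commute mult_right_mono)
      qed (use w in \<open>auto intro!: Bochner_Integration.integrable_diff intD\<close>)
      also have "\<dots> = e' * I" unfolding I_def by simp
      finally show ?thesis using e'(2) by (simp add: dist_norm)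
    qed
    then show "\<exists>d>0. \<forall>x'\<in>UNIV. dist x' x < d \<longrightarrow> dist (Dconv D\<psi> w x') (Dconv D\<psi> w x) < e" using d by blast
  qed
  ultimately show ?thesis unfolding C1_def by blast
qed

subsection \<open>Mollifiers\<close>

text \<open>The polynomial factors, in \<open>y = 1 / x\<close>, of the derivatives of
  \<open>exp (- (1 / x))\<close>: by the chain rule P becomes y^2 (P - P').\<close>

primrec flat_poly :: "nat \<Rightarrow> real poly" where
  "flat_poly 0 = 1"
| "flat_poly (Suc n) = [:0, 0, 1:] * (flat_poly n - pderiv (flat_poly n))"

definition flat :: "nat \<Rightarrow> real \<Rightarrow> real" where
  "flat n x = (if x \<le> 0 then 0 else poly (flat_poly n) (1 / x) * exp (- (1 / x)))"

lemma poly_exp_tendsto_0: "((\<lambda>y::real. poly p y * exp (- y)) \<longlongrightarrow> 0) at_top"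
proof (induction p)
  case 0
  show ?case by simp
next
  case (pCons a p)
  have 1: "((\<lambda>y::real. a * exp (- y)) \<longlongrightarrow> a * 0) at_top"
    by (intro tendsto_intros filterlim_compose[OF exp_at_bot] filterlim_uminus_at_bot_at_top)
  have *: "((\<lambda>y::real. y ^ k * exp (- y)) \<longlongrightarrow> 0) at_top" for k
    using tendsto_power_div_exp_0[of k] by (simp add: exp_minus divide_inverse)
  have "((\<lambda>y::real. (\<Sum>i\<le>degree p. coeff p i * (y ^ Suc i * exp (- y)))) \<longlongrightarrow> (\<Sum>i\<le>degree p. coeff p i * 0)) at_top"
    by (intro tendsto_intros *)
  then have 2: "((\<lambda>y::real. y * poly p y * exp (- y)) \<longlongrightarrow> 0) at_top"
    by (simp add: poly_altdef sum_distrib_left sum_distrib_right mult_ac)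
  show ?case using tendsto_add[OF 1 2] by (simp add: algebra_simps)
qed

lemma DERIV_flat: "(flat n has_real_derivative flat (Suc n) x) (at x)"
proof -
  consider "x < 0" | "x = 0" | "x > 0" by linarith
  then show ?thesis
  proof cases
    case 1
    have "((\<lambda>_. 0) has_real_derivative flat (Suc n) x) (at x)" using 1 by (simp add: flat_def)
    then show ?thesis
      by (rule DERIV_cong_ev[THEN iffD1, rotated -1])
         (use 1 in \<open>auto intro!: eventually_mono[OF eventually_nhds_in_open[of "{..<0}"]] simp: flat_def\<close>)
  next
    case 3
    have i: "((\<lambda>x. 1 / x) has_real_derivative - (1 / (x * x))) (at x)"
      using 3 by (auto intro!: derivative_eq_intros)
    have p: "((\<lambda>x. poly (flat_poly n) (1 / x)) has_real_derivative poly (pderiv (flat_poly n)) (1 / x) * - (1 / (x * x))) (at x)"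
      by (rule DERIV_chain2[OF poly_DERIV i])
    have e: "((\<lambda>x. exp (- (1 / x))) has_real_derivative exp (- (1 / x)) * - (- (1 / (x * x)))) (at x)"
      by (rule DERIV_chain2[OF DERIV_exp DERIV_minus[OF i]])
    have "((\<lambda>x. poly (flat_poly n) (1 / x) * exp (- (1 / x))) has_real_derivative flat (Suc n) x) (at x)"
      by (rule DERIV_cong[OF DERIV_mult[OF p e]]) (use 3 in \<open>simp add: flat_def algebra_simps\<close>)
    then show ?thesis
      by (rule DERIV_cong_ev[THEN iffD1, rotated -1])
         (use 3 in \<open>auto intro!: eventually_mono[OF eventually_nhds_in_open[of "{0<..}"]] simp: flat_def\<close>)
  next
    \<comment> \<open>At 0 the difference quotient vanishes from the left; from the right it is a
      polynomial times an exponential in the reciprocal of the increment.\<close>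
    case 2
    have "((\<lambda>h. flat n h / h) \<longlongrightarrow> 0) (at 0)"
    proof (rule filterlim_split_at)
      have "((\<lambda>h::real. 0) \<longlongrightarrow> 0) (at_left 0)" by simp
      then show "((\<lambda>h. flat n h / h) \<longlongrightarrow> 0) (at_left 0)"
        by (rule Lim_transform_eventually)
           (auto simp: flat_def eventually_at_filter)
      have "((\<lambda>h::real. poly (pCons 0 (flat_poly n)) (inverse h) * exp (- inverse h)) \<longlongrightarrow> 0) (at_right 0)"
        by (rule filterlim_compose[OF poly_exp_tendsto_0 filterlim_inverse_at_top_right])
      then show "((\<lambda>h. flat n h / h) \<longlongrightarrow> 0) (at_right 0)"
        by (rule Lim_transform_eventually)
           (auto simp: flat_def eventually_at_filter divide_inverse)
    qed
    then show ?thesis unfolding 2 DERIV_def by (simp add: flat_def)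
  qed
qed

text \<open>A class closed under differentiation that contains the bump
  \<open>flat 0 (1 - x) * flat 0 (1 + x)\<close>; it takes the place of formulas for the higher
  derivatives, and its members all vanish where \<open>1 \<le> \<bar>x\<bar>\<close>.\<close>

inductive_set bump_derivs :: "(real \<Rightarrow> real) set" where
  prod: "(\<lambda>x. c * (flat n (1 - x) * flat m (1 + x))) \<in> bump_derivs"
| add: "f \<in> bump_derivs \<Longrightarrow> g \<in> bump_derivs \<Longrightarrow> (\<lambda>x. f x + g x) \<in> bump_derivs"

lemma bump_derivs_DERIV: "f \<in> bump_derivs \<Longrightarrow> \<exists>g\<in>bump_derivs. \<forall>x. (f has_real_derivative g x) (at x)"
proof (induction rule: bump_derivs.induct)
  case (prod c n m)
  define g where "g = (\<lambda>x. (- c) * (flat (Suc n) (1 - x) * flat m (1 + x)) + c * (flat n (1 - x) * flat (Suc m) (1 + x)))"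
  have "g \<in> bump_derivs" unfolding g_def by (intro bump_derivs.intros)
  moreover have "((\<lambda>x. c * (flat n (1 - x) * flat m (1 + x))) has_real_derivative g x) (at x)" for x
  proof -
    have 1: "((\<lambda>x. flat n (1 - x)) has_real_derivative flat (Suc n) (1 - x) * (- 1)) (at x)"
      by (rule DERIV_chain2[OF DERIV_flat]) (auto intro!: derivative_eq_intros)
    have 2: "((\<lambda>x. flat m (1 + x)) has_real_derivative flat (Suc m) (1 + x) * 1) (at x)"
      by (rule DERIV_chain2[OF DERIV_flat]) (auto intro!: derivative_eq_intros)
    show ?thesis unfolding g_def
      by (rule DERIV_cong[OF DERIV_cmult[OF DERIV_mult[OF 1 2]]]) (simp add: algebra_simps)
  qed
  ultimately show ?case by blast
next
  case (add f g)
  then obtain f' g' where "f' \<in> bump_derivs" "g' \<in> bump_derivs" and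
    d: "\<And>x. (f has_real_derivative f' x) (at x)" "\<And>x. (g has_real_derivative g' x) (at x)" by blast
  then show ?case by (intro bexI[of _ "\<lambda>x. f' x + g' x"] allI DERIV_add bump_derivs.add) auto
qed

lemma bump_derivs_zero: "f \<in> bump_derivs \<Longrightarrow> 1 \<le> \<bar>x\<bar> \<Longrightarrow> f x = 0"
  by (induction rule: bump_derivs.induct) (auto simp: flat_def abs_real_def split: if_splits)

lemma bump_exists:
  assumes h: "0 < h"
  shows "\<exists>b :: nat \<Rightarrow> real \<Rightarrow> real. (\<forall>n x. (b n has_real_derivative b (Suc n) x) (at x)) \<and> (\<forall>n x. h \<le> \<bar>x\<bar> \<longrightarrow> b n x = 0) \<and>
     (\<forall>x. 0 \<le> b 0 x) \<and> 0 < b 0 0 \<and> (\<forall>x. b 0 (- x) = b 0 x)"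
proof -
  define b0 where "b0 = (\<lambda>x. 1 * (flat 0 (1 - x) * flat 0 (1 + x)))"
  \<comment> \<open>A derivative inside the class, selected by choice; iterating it from
    \<open>b0\<close> yields all derivatives as one sequence.\<close>
  define D where "D = (\<lambda>f. SOME g. g \<in> bump_derivs \<and> (\<forall>x. (f has_real_derivative g x) (at x)))"
  have D: "D f \<in> bump_derivs \<and> (\<forall>x. (f has_real_derivative D f x) (at x))" if "f \<in> bump_derivs" for f
  proof -
    have "\<exists>g. g \<in> bump_derivs \<and> (\<forall>x. (f has_real_derivative g x) (at x))" using bump_derivs_DERIV[OF that] by blast
    from someI_ex[OF this] show ?thesis unfolding D_def .
  qed
  define F where "F = (\<lambda>n. (D ^^ n) b0)"
  have F: "F n \<in> bump_derivs" for n
    by (induction n) (use bump_derivs.prod[of 1 0 0] in \<open>auto simp: F_def b0_def D\<close>)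
  have FD: "(F n has_real_derivative F (Suc n) x) (at x)" for n x
    using D[OF F[of n]] by (simp add: F_def)
  define b where "b = (\<lambda>n x. F n (x / h) / h ^ n)"
  have "(b n has_real_derivative b (Suc n) x) (at x)" for n x
  proof -
    have "((\<lambda>x. F n (x / h)) has_real_derivative F (Suc n) (x / h) * (1 / h)) (at x)"
      by (rule DERIV_chain2[OF FD]) (use h in \<open>auto intro!: derivative_eq_intros\<close>)
    from DERIV_cdivide[OF this, of "h ^ n"] show ?thesis unfolding b_def by (simp add: field_simps)
  qed
  moreover have "b n x = 0" if "h \<le> \<bar>x\<bar>" for n x
    unfolding b_def using bump_derivs_zero[OF F, of "x / h" n] that h by (simp add: abs_divide)
  moreover have "0 \<le> b 0 x" for x unfolding b_def F_def b0_def flat_def using h by simp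
  moreover have "0 < b 0 0" unfolding b_def F_def b0_def flat_def using h by simp
  moreover have "b 0 (- x) = b 0 x" for x unfolding b_def F_def b0_def using h by (simp add: mult.commute)
  ultimately show ?thesis by blast
qed

text \<open>All iterated partial derivatives of a function are recorded in a family indexed by multi-indices.\<close>

definition smooth_family :: "(('d::finite \<Rightarrow> nat) \<Rightarrow> real^'d \<Rightarrow> real) \<Rightarrow> bool" where
  "smooth_family \<Phi> \<longleftrightarrow> (\<forall>n. C1 (\<Phi> n) (\<lambda>x. \<chi> i. \<Phi> (n(i := Suc (n i))) x))"

lemma C1_partial:
  fixes v :: "real^'d \<Rightarrow> real"
  assumes "C1 v Dv"
  shows "((\<lambda>t. v (x + t *\<^sub>R axis i 1)) has_real_derivative Dv x $ i) (at 0)" "partial i v x = Dv x $ i"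
proof -
  have "((v \<circ> (\<lambda>t. x + t *\<^sub>R axis i 1)) has_derivative ((\<lambda>k. Dv (x + 0 *\<^sub>R axis i 1) \<bullet> k) \<circ> (\<lambda>h. h *\<^sub>R axis i 1))) (at (0::real))"
    by (rule diff_chain_at) (use assms in \<open>auto simp: C1_def intro!: derivative_eq_intros\<close>)
  then show *: "((\<lambda>t. v (x + t *\<^sub>R axis i 1)) has_real_derivative Dv x $ i) (at 0)"
    by (simp add: o_def has_field_derivative_def inner_axis mult_commute_abs)
  show "partial i v x = Dv x $ i" unfolding partial_def by (rule DERIV_imp_deriv[OF *])
qed

lemma C1_grad: "C1 v Dv \<Longrightarrow> grad v x = Dv x"
  unfolding grad_def by (simp add: C1_partial(2) vec_eq_iff)

text \<open>Partial differentiation only raises the multi-index, so every iterated partial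
  derivative is again a member of the family.\<close>

lemma smooth_family_smooth_fun:
  fixes \<Phi> :: "('d::finite \<Rightarrow> nat) \<Rightarrow> real^'d \<Rightarrow> real"
  assumes s: "smooth_family \<Phi>"
  shows "smooth_fun (\<Phi> n)"
proof -
  have C: "C1 (\<Phi> n) (\<lambda>x. \<chi> i. \<Phi> (n(i := Suc (n i))) x)" for n using s unfolding smooth_family_def by blast
  have p: "partial i (\<Phi> n) = \<Phi> (n(i := Suc (n i)))" for i n
    using C1_partial(2)[OF C[of n]] by (auto simp: fun_eq_iff)
  have ip: "\<exists>n'. ipartial is (\<Phi> n) = \<Phi> n'" for "is"
  proof (induction "is")
    case (Cons i "is")
    then obtain n' where "ipartial is (\<Phi> n) = \<Phi> n'" by blast
    then show ?case using p[of i n'] by auto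
  qed auto
  show ?thesis unfolding smooth_fun_def
  proof (intro allI conjI)
    fix "is" :: "'d list"
    obtain n' where n': "ipartial is (\<Phi> n) = \<Phi> n'" using ip by blast
    show "continuous_on UNIV (ipartial is (\<Phi> n))" unfolding n' by (rule C1_continuous(1)[OF C])
    show "(\<lambda>t. ipartial is (\<Phi> n) (x + t *\<^sub>R axis i 1)) differentiable at 0" for i x
      unfolding n' using C1_partial(1)[OF C[of n'], of x i] real_differentiable_def by blast
  qed
qed

lemma test_funI:
  assumes "smooth_fun \<phi>" "\<And>x. x \<notin> cball y t \<Longrightarrow> \<phi> x = 0" "cball y t \<subseteq> U"
  shows "test_fun U \<phi>"
proof -
  have sub: "tsupport \<phi> \<subseteq> cball y t" unfolding tsupport_def 
  proof (rule closure_minimal)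
    show "{x. \<phi> x \<noteq> 0} \<subseteq> cball y t" using assms(2) by blast
  qed simp
  moreover have "compact (tsupport \<phi>)" using sub unfolding tsupport_def
    by (meson bounded_cball bounded_subset closed_closure compact_eq_bounded_closed)
  ultimately show ?thesis unfolding test_fun_def using assms by blast
qed

lemma smooth_family_shift: "smooth_family \<Phi> \<Longrightarrow> smooth_family (\<lambda>n z. \<Phi> n (z + x))"
  unfolding smooth_family_def using C1_shift by blast

lemma smooth_family_conv:
  fixes \<Phi> :: "('d::finite \<Rightarrow> nat) \<Rightarrow> real^'d \<Rightarrow> real"
  assumes s: "smooth_family \<Phi>" and z: "\<And>n x. x \<notin> cball y h \<Longrightarrow> \<Phi> n x = 0" and w: "integrable lborel w"
  shows "smooth_family (\<lambda>n. conv (\<Phi> n) w)"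
  unfolding smooth_family_def
proof
  fix n
  have C: "C1 (\<Phi> n) (\<lambda>x. \<chi> i. \<Phi> (n(i := Suc (n i))) x)" for n using s unfolding smooth_family_def by blast
  have int: "integrable lborel (\<lambda>z. w z *\<^sub>R \<Phi> n (x - z))" for n x
  proof -
    obtain B where "\<And>x. norm (\<Phi> n x) \<le> B" using bounded_compact_support[OF C1_continuous(1)[OF C] z] by blast
    from integrable_conv_integrand[OF borel_measurable_continuous_onI[OF C1_continuous(1)[OF C]] this w]
    show ?thesis by (simp add: mult.commute)
  qed
  have "Dconv (\<lambda>x. \<chi> i. \<Phi> (n(i := Suc (n i))) x) w = (\<lambda>x. \<chi> i. conv (\<Phi> (n(i := Suc (n i)))) w x)"
  proof
    fix x
    let ?f = "\<lambda>z. w z *\<^sub>R (\<chi> i. \<Phi> (n(i := Suc (n i))) (x - z))"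
    have "integrable lborel ?f"
    proof -
      have "?f = (\<lambda>z. \<Sum>i\<in>UNIV. (w z *\<^sub>R \<Phi> (n(i := Suc (n i))) (x - z)) *\<^sub>R axis i 1)"
        by (auto simp: fun_eq_iff vec_eq_iff axis_def if_distrib cong: if_cong)
      then show ?thesis using int by (auto intro!: Bochner_Integration.integrable_sum integrable_scaleR_left)
    qed
    then have "(LINT z|lborel. ?f z) $ i = (LINT z|lborel. ?f z $ i)" for i
      using integral_bounded_linear[OF bounded_linear_vec_nth[of i], of lborel ?f] by simp
    then show "Dconv (\<lambda>x. \<chi> i. \<Phi> (n(i := Suc (n i))) x) w x = (\<chi> i. conv (\<Phi> (n(i := Suc (n i)))) w x)"
      unfolding Dconv_def conv_def by (simp add: vec_eq_iff mult.commute)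
  qed
  then show "C1 (conv (\<Phi> n) w) (\<lambda>x. \<chi> i. conv (\<Phi> (n(i := Suc (n i)))) w x)"
    using C1_conv[OF C[of n] z w] by simp
qed

lemma mollifier_exists:
  assumes h: "0 < h"
  shows "\<exists>\<Phi> :: ('d::finite \<Rightarrow> nat) \<Rightarrow> real^'d \<Rightarrow> real. smooth_family \<Phi> \<and> (\<forall>n x. x \<notin> cball 0 h \<longrightarrow> \<Phi> n x = 0) \<and>
     (\<forall>x. 0 \<le> \<Phi> (\<lambda>_. 0) x) \<and> (\<forall>x. \<Phi> (\<lambda>_. 0) (- x) = \<Phi> (\<lambda>_. 0) x) \<and> (LINT x|lborel. \<Phi> (\<lambda>_. 0) x) = 1"
proof -
  \<comment> \<open>Where all coordinates are below \<open>h'\<close> in modulus, the l1 norm and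
    hence the Euclidean norm is at most \<open>h\<close>: the product of one-dimensional bumps is
    supported in the ball.\<close>
  define h' where "h' = h / real CARD('d)"
  have h': "0 < h'" unfolding h'_def using h by simp
  obtain b where D: "\<And>n x. (b n has_real_derivative b (Suc n) x) (at x)" and z: "\<And>n x. h' \<le> \<bar>x\<bar> \<Longrightarrow> b n x = 0"
    and pos: "\<And>x. 0 \<le> b 0 x" "0 < b 0 0" and even: "\<And>x. b 0 (- x) = b 0 x"
    using bump_exists[OF h'] by auto
  define \<Psi> :: "('d \<Rightarrow> nat) \<Rightarrow> real^'d \<Rightarrow> real" where "\<Psi> = (\<lambda>n x. \<Prod>i\<in>UNIV. b (n i) (x $ i))"
  have der: "(\<Psi> n has_derivative (\<lambda>k. (\<chi> i. \<Psi> (n(i := Suc (n i))) x) \<bullet> k)) (at x)" for n x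
  proof -
    have bi: "((\<lambda>x::real^'d. b (n i) (x $ i)) has_derivative (\<lambda>k. b (Suc (n i)) (x $ i) * k $ i)) (at x)" for i
    proof -
      have "((b (n i) \<circ> (\<lambda>x::real^'d. x $ i)) has_derivative ((*) (b (Suc (n i)) (x $ i)) \<circ> (\<lambda>k. k $ i))) (at x)"
        by (rule diff_chain_at) (use D in \<open>auto simp: has_field_derivative_def intro!: bounded_linear_imp_has_derivative bounded_linear_vec_nth\<close>)
      then show ?thesis by (simp add: o_def)
    qed
    have "((\<lambda>x. \<Prod>i\<in>UNIV. b (n i) (x $ i)) has_derivative (\<lambda>k. \<Sum>i\<in>UNIV. (b (Suc (n i)) (x $ i) * k $ i) * (\<Prod>j\<in>UNIV - {i}. b (n j) (x $ j)))) (at x)"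
      by (rule has_derivative_prod) (rule bi)
    moreover have "(\<Sum>i\<in>UNIV. (b (Suc (n i)) (x $ i) * k $ i) * (\<Prod>j\<in>UNIV - {i}. b (n j) (x $ j))) = (\<chi> i. \<Psi> (n(i := Suc (n i))) x) \<bullet> k" for k :: "real^'d"
    proof -
      have "\<Psi> (n(i := Suc (n i))) x = b (Suc (n i)) (x $ i) * (\<Prod>j\<in>UNIV - {i}. b (n j) (x $ j))" for i
        unfolding \<Psi>_def by (subst prod.remove[of UNIV i]) (auto intro!: prod.cong)
      then show ?thesis by (simp add: inner_vec_def mult_ac)
    qed
    ultimately show ?thesis unfolding \<Psi>_def by simp
  qed
  have cPsi: "continuous_on UNIV (\<Psi> n)" for n
    using der by (meson continuous_at_imp_continuous_on has_derivative_continuous)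
  have zPsi: "\<Psi> n x = 0" if x: "x \<notin> cball 0 h" for n x
  proof -
    have "\<exists>i. h' \<le> \<bar>x $ i\<bar>"
    proof (rule ccontr)
      assume "\<nexists>i. h' \<le> \<bar>x $ i\<bar>"
      then have "(\<Sum>i\<in>UNIV. \<bar>x $ i\<bar>) \<le> (\<Sum>i\<in>(UNIV::'d set). h')" by (intro sum_mono) (auto simp: not_le less_imp_le)
      also have "\<dots> = h" unfolding h'_def by simp
      finally have "norm x \<le> h" using norm_le_l1_cart[of x] by linarith
      then show False using x by simp
    qed
    then obtain i where "b (n i) (x $ i) = 0" using z by blast
    then show ?thesis unfolding \<Psi>_def by (auto intro!: prod_zero)
  qed
  have intP: "integrable lborel (\<Psi> n)" for n
    by (rule integrable_compact_support[OF cPsi zPsi])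
  have P0: "0 \<le> \<Psi> (\<lambda>_. 0) x" for x unfolding \<Psi>_def by (intro prod_nonneg pos ballI)
  define I where "I = (LINT x|lborel. \<Psi> (\<lambda>_. 0) x)"
  have I: "0 < I"
  proof -
    have p0: "0 < \<Psi> (\<lambda>_. 0) 0" unfolding \<Psi>_def using pos(2) by (intro prod_pos) auto
    obtain r where r: "0 < r" and R: "\<And>x. norm (x - 0) < r \<Longrightarrow> norm (\<Psi> (\<lambda>_. 0) x - \<Psi> (\<lambda>_. 0) 0) < \<Psi> (\<lambda>_. 0) 0 / 2"
      using cPsi[of "\<lambda>_. 0"] p0 unfolding continuous_on_iff dist_norm by (metis UNIV_I half_gt_zero)
    have "0 < \<Psi> (\<lambda>_. 0) 0 / 2 * measure lborel (cball (0::real^'d) (r / 2))"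
      using p0 r by (intro mult_pos_pos measure_cball_pos) auto
    also have "\<dots> = (LINT x|lborel. \<Psi> (\<lambda>_. 0) 0 / 2 * indicator (cball (0::real^'d) (r / 2)) x)"
      using emeasure_lborel_cball_finite[of "0::real^'d" "r / 2"] by simp
    also have "\<dots> \<le> I" unfolding I_def
    proof (rule Bochner_Integration.integral_mono[OF _ intP])
      show "integrable lborel (\<lambda>x. \<Psi> (\<lambda>_. 0) 0 / 2 * indicator (cball (0::real^'d) (r / 2)) x)"
        using emeasure_lborel_cball_finite[of "0::real^'d" "r / 2"] by (intro integrable_mult_right) (auto simp: less_top)
      fix x :: "real^'d"
      show "\<Psi> (\<lambda>_. 0) 0 / 2 * indicator (cball 0 (r / 2)) x \<le> \<Psi> (\<lambda>_. 0) x"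
      proof (cases "x \<in> cball 0 (r / 2)")
        case True
        then have "norm (x - 0) < r" using r by simp
        from R[OF this] show ?thesis using True by (simp add: abs_real_def split: if_splits)
      qed (use P0[of x] in simp)
    qed
    finally show ?thesis .
  qed
  define \<Phi> where "\<Phi> = (\<lambda>n x. \<Psi> n x / I)"
  have "smooth_family \<Phi>"
    unfolding smooth_family_def C1_def
  proof (intro allI conjI)
    fix n x
    have "((\<lambda>x. (1 / I) * \<Psi> n x) has_derivative (\<lambda>k. (1 / I) * ((\<chi> i. \<Psi> (n(i := Suc (n i))) x) \<bullet> k))) (at x)"
      by (rule has_derivative_mult_right[OF der])
    moreover have "(1 / I) * ((\<chi> i. \<Psi> (n(i := Suc (n i))) x) \<bullet> k) = (\<chi> i. \<Phi> (n(i := Suc (n i))) x) \<bullet> k" for k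
      unfolding \<Phi>_def by (simp add: inner_vec_def sum_divide_distrib)
    ultimately show "(\<Phi> n has_derivative (\<lambda>k. (\<chi> i. \<Phi> (n(i := Suc (n i))) x) \<bullet> k)) (at x)" by (simp add: \<Phi>_def)
    show "continuous_on UNIV (\<lambda>x. \<chi> i. \<Phi> (n(i := Suc (n i))) x)"
      unfolding \<Phi>_def using I by (intro continuous_on_vec_lambda continuous_intros cPsi) auto
  qed
  moreover have "\<Psi> (\<lambda>_. 0) (- x) = \<Psi> (\<lambda>_. 0) x" for x unfolding \<Psi>_def using even by simp
  ultimately show ?thesis using zPsi P0 I by (intro exI[of _ \<Phi>]) (auto simp: \<Phi>_def I_def)
qed

subsection \<open>Integrable right-hand sides\<close>

lemma conv_zero_outside:
  fixes F :: "'a::euclidean_space \<Rightarrow> 'b::euclidean_space"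
  assumes k: "\<And>x. x \<notin> cball 0 h \<Longrightarrow> \<kappa> x = 0" and F: "\<And>x. x \<notin> cball y t \<Longrightarrow> F x = 0" and x: "x \<notin> cball y (t + h)"
  shows "conv \<kappa> F x = 0"
proof -
  have "\<kappa> (x - z) *\<^sub>R F z = 0" for z
  proof (cases "z \<in> cball y t")
    case True
    have "x - z \<notin> cball 0 h"
    proof
      assume "x - z \<in> cball 0 h"
      then have "dist y x \<le> t + h" using True dist_triangle[of y x z] by (simp add: dist_norm norm_minus_commute)
      then show False using x by simp
    qed
    then show ?thesis using k by simp
  qed (use F in simp)
  then show ?thesis unfolding conv_def by (simp only: Bochner_Integration.integral_zero)
qed

text \<open>Exchanging the roles of kernel and function moves the derivative onto \<open>v\<close>;
  the mollified test function is thus differentiated through \<open>Dv\<close>.\<close>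

lemma C1_conv_grad:
  fixes v :: "'a::euclidean_space \<Rightarrow> real"
  assumes v: "C1 v Dv" and z: "\<And>x. x \<notin> cball y t \<Longrightarrow> v x = 0" and k: "integrable lborel \<kappa>"
  shows "C1 (conv \<kappa> v) (conv \<kappa> Dv)"
proof -
  have m: "\<kappa> \<in> borel_measurable borel" using borel_measurable_integrable[OF k] by simp
  have mv: "v \<in> borel_measurable borel" "Dv \<in> borel_measurable borel"
    by (intro borel_measurable_continuous_onI C1_continuous[OF v])+
  have "conv \<kappa> v = conv v \<kappa>"
    using conv_commute[OF m mv(1)] by (auto simp: fun_eq_iff conv_def mult.commute)
  moreover have "conv \<kappa> Dv = Dconv Dv \<kappa>"
    using conv_commute_vec[OF m mv(2)] by (auto simp: fun_eq_iff Dconv_def)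
  ultimately show ?thesis using C1_conv[OF v z k] by simp
qed

text \<open>Jensen for the probability density \<open>\<kappa> (x - z)\<close>, from nonnegativity
  of the variance of \<open>norm (F z)\<close>.\<close>

lemma norm_conv_sq_le:
  fixes F :: "'a::euclidean_space \<Rightarrow> 'b::euclidean_space"
  assumes k: "integrable lborel \<kappa>" and b: "\<And>x. norm (\<kappa> x) \<le> B" and k0: "\<And>x. 0 \<le> \<kappa> x" and k1: "(LINT x|lborel. \<kappa> x) = 1"
    and F: "integrable lborel F" and F2: "integrable lborel (\<lambda>x. (norm (F x))\<^sup>2)"
  shows "norm (conv \<kappa> F x) \<le> conv \<kappa> (\<lambda>z. norm (F z)) x" "(conv \<kappa> (\<lambda>z. norm (F z)) x)\<^sup>2 \<le> conv \<kappa> (\<lambda>z. (norm (F z))\<^sup>2) x"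
proof -
  have m: "\<kappa> \<in> borel_measurable borel" using borel_measurable_integrable[OF k] by simp
  note i = integrable_conv_integrand[OF m b]
  note i1 = i[OF integrable_norm[OF F], of x] and i2 = i[OF F2, of x]
  have "norm (conv \<kappa> F x) \<le> (LINT z|lborel. norm (\<kappa> (x - z) *\<^sub>R F z))"
    unfolding conv_def by (rule integral_norm_bound)
  also have "\<dots> = conv \<kappa> (\<lambda>z. norm (F z)) x" unfolding conv_def using k0 by simp
  finally show "norm (conv \<kappa> F x) \<le> conv \<kappa> (\<lambda>z. norm (F z)) x" .
  define c where "c = conv \<kappa> (\<lambda>z. norm (F z)) x"
  have k': "integrable lborel (\<lambda>z. \<kappa> (x - z))" by (rule integrable_reflect[OF k])
  have "0 \<le> (LINT z|lborel. \<kappa> (x - z) * (norm (F z) - c)\<^sup>2)"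
    using k0 by (intro Bochner_Integration.integral_nonneg) simp
  also have "\<dots> = (LINT z|lborel. \<kappa> (x - z) *\<^sub>R (norm (F z))\<^sup>2 - (2 * c) * (\<kappa> (x - z) *\<^sub>R norm (F z)) + c\<^sup>2 * \<kappa> (x - z))"
    by (rule Bochner_Integration.integral_cong) (auto simp: power2_eq_square algebra_simps)
  also have "\<dots> = conv \<kappa> (\<lambda>z. (norm (F z))\<^sup>2) x - 2 * c * c + c\<^sup>2 * (LINT z|lborel. \<kappa> (x - z))"
    unfolding conv_def c_def using i1 i2 k' by simp
  also have "(LINT z|lborel. \<kappa> (x - z)) = 1" using integral_reflect[OF m, of x] k1 by simp
  finally show "(conv \<kappa> (\<lambda>z. norm (F z)) x)\<^sup>2 \<le> conv \<kappa> (\<lambda>z. (norm (F z))\<^sup>2) x"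
    unfolding c_def by (simp add: power2_eq_square)
qed

lemma sq_int_conv_le:
  fixes F :: "'a::euclidean_space \<Rightarrow> 'b::euclidean_space"
  assumes c: "continuous_on UNIV \<kappa>" and z: "\<And>x. x \<notin> cball 0 h \<Longrightarrow> \<kappa> x = 0" and k0: "\<And>x. 0 \<le> \<kappa> x" and k1: "(LINT x|lborel. \<kappa> x) = 1"
    and F: "integrable lborel F" and F2: "integrable lborel (\<lambda>x. (norm (F x))\<^sup>2)"
  shows "sq_int y t (conv \<kappa> (\<lambda>z. norm (F z))) \<le> (LINT x|lborel. (norm (F x))\<^sup>2)"
    "sq_int y t (conv \<kappa> F) \<le> (LINT x|lborel. (norm (F x))\<^sup>2)"
proof -
  have k: "integrable lborel \<kappa>" by (rule integrable_compact_support[OF c z])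
  obtain B where b: "\<And>x. norm (\<kappa> x) \<le> B" using bounded_compact_support[OF c z] by blast
  have cN: "continuous_on UNIV (conv \<kappa> (\<lambda>z. norm (F z)))" by (rule continuous_conv[OF c z integrable_norm[OF F]])
  have cF: "continuous_on UNIV (conv \<kappa> F)" by (rule continuous_conv[OF c z F])
  note n = norm_conv_sq_le[OF k b k0 k1 F F2]
  have "sq_int y t (conv \<kappa> (\<lambda>z. norm (F z))) \<le> (LINT x|lborel. conv \<kappa> (\<lambda>z. (norm (F z))\<^sup>2) x)"
    unfolding sq_int_def set_lebesgue_integral_def
  proof (rule Bochner_Integration.integral_mono)
    show "integrable lborel (\<lambda>x. indicat_real (cball y t) x *\<^sub>R (norm (conv \<kappa> (\<lambda>z. norm (F z)) x))\<^sup>2)"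
      using set_integrable_cball_continuous[OF continuous_norm_sq[OF cN]] unfolding set_integrable_def .
    show "integrable lborel (conv \<kappa> (\<lambda>z. (norm (F z))\<^sup>2))" by (rule integrable_conv[OF k F2])
    show "indicat_real (cball y t) x *\<^sub>R (norm (conv \<kappa> (\<lambda>z. norm (F z)) x))\<^sup>2 \<le> conv \<kappa> (\<lambda>z. (norm (F z))\<^sup>2) x" for x
    proof -
      have "0 \<le> conv \<kappa> (\<lambda>z. (norm (F z))\<^sup>2) x" by (rule order_trans[OF zero_le_power2 n(2)])
      then show ?thesis using n(2)[of x] by (simp add: indicator_def)
    qed
  qed
  also have "\<dots> = (LINT x|lborel. (norm (F x))\<^sup>2)" using integral_conv[OF k F2] k1 by simp
  finally show 1: "sq_int y t (conv \<kappa> (\<lambda>z. norm (F z))) \<le> (LINT x|lborel. (norm (F x))\<^sup>2)" .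
  have "sq_int y t (conv \<kappa> F) \<le> sq_int y t (conv \<kappa> (\<lambda>z. norm (F z)))"
    by (rule sq_int_mono[OF cF cN]) (use n(1) abs_ge_self order_trans in fastforce)
  then show "sq_int y t (conv \<kappa> F) \<le> (LINT x|lborel. (norm (F x))\<^sup>2)" using 1 by linarith
qed

text \<open>Poincare for compactly supported functions: translating by a vector of length three times the radius moves
  the support off the ball.\<close>

lemma L2n_le_gradient:
  fixes y :: "'a::euclidean_space"
  assumes v: "C1 v Dv" and z: "\<And>x. x \<notin> cball y s \<Longrightarrow> v x = 0" and s: "0 < s"
  shows "L2n y s v \<le> 3 * s * L2n y s Dv"
proof -
  obtain b :: 'a where b: "norm b = 1" using vector_choose_size[of 1] by auto
  have zD: "Dv x = 0" if "x \<notin> cball y s" for x by (rule C1_zero_outside[OF v z that])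
  have far: "v (x + (3 * s) *\<^sub>R b) = 0" if "x \<in> cball y s" for x
  proof (rule z)
    have "norm ((3 * s) *\<^sub>R b) = 3 * s" using b s by simp
    then have "3 * s \<le> dist y (x + (3 * s) *\<^sub>R b) + dist y x"
      using norm_triangle_ineq4[of "x + (3 * s) *\<^sub>R b - y" "x - y"] by (simp add: dist_norm norm_minus_commute)
    then show "x + (3 * s) *\<^sub>R b \<notin> cball y s" using that s by auto
  qed
  have "L2n y s v = L2n y s (\<lambda>x. v (x + (3 * s) *\<^sub>R b) - v x)"
    by (rule L2n_cong) (use far in simp)
  also have "\<dots> \<le> norm ((3 * s) *\<^sub>R b) * (sqrt ((4 * s / s) ^ DIM('a)) * L2n y (4 * s) Dv)"
    by (rule L2n_increment_le'[OF v s]) (use b s in auto)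
  also have "sqrt ((4 * s / s) ^ DIM('a)) * L2n y (4 * s) Dv = L2n y s Dv"
  proof -
    have "sq_int y (4 * s) Dv = sq_int y s Dv"
      unfolding sq_int_def by (rule set_integral_cball_support) (use zD s in \<open>auto simp: subset_cball\<close>)
    then show ?thesis unfolding L2n_def using s by (simp add: real_sqrt_mult[symmetric] power_mult_distrib)
  qed
  finally show ?thesis using b s by simp
qed

text \<open>A Euclidean space of dimension one need not be the type \<open>real\<close>; through
  this identification an integral along a line becomes an integral over the space.\<close>

lemma lborel_one_dim:
  assumes b: "Basis = {b :: 'a::euclidean_space}"
  shows "lborel = distr lborel borel (\<lambda>t::real. t *\<^sub>R b)"
proof (rule lborel_eqI)
  have bb: "b \<bullet> b = 1" using b by (metis insertI1 inner_same_Basis)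
  have rep: "(t *\<^sub>R b \<in> box l u) = (l \<bullet> b < t \<and> t < u \<bullet> b)" for t l u
    unfolding box_def b using bb by simp
  fix l u :: 'a assume lu: "\<And>b. b \<in> Basis \<Longrightarrow> l \<bullet> b \<le> u \<bullet> b"
  have "emeasure (distr lborel borel (\<lambda>t::real. t *\<^sub>R b)) (box l u) = emeasure lborel ((\<lambda>t. t *\<^sub>R b) -` box l u \<inter> space lborel)"
    by (rule emeasure_distr) auto
  also have "(\<lambda>t. t *\<^sub>R b) -` box l u \<inter> space lborel = {l \<bullet> b <..< u \<bullet> b}" using rep by auto
  also have "emeasure lborel {l \<bullet> b <..< u \<bullet> b} = ennreal (u \<bullet> b - l \<bullet> b)" using lu[of b] by (simp add: b)
  finally show "emeasure (distr lborel borel (\<lambda>t::real. t *\<^sub>R b)) (box l u) = ennreal (\<Prod>b\<in>Basis. (u - l) \<bullet> b)"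
    unfolding b by (simp add: inner_diff_left)
qed simp

text \<open>A shift by \<open>3 * s\<close> exceeds the diameter of the support, so
  \<open>v x\<close> is an increment. Its bound is an integral of the gradient along a line, and in
  dimension one that line is the whole space.\<close>

lemma sup_le_gradient_one_dim:
  fixes y :: "'a::euclidean_space"
  assumes d: "DIM('a) = 1" and v: "C1 v Dv" and z: "\<And>x. x \<notin> cball y s \<Longrightarrow> v x = 0" and s: "0 < s"
  shows "\<bar>v x\<bar> \<le> 2 * s * L2n y s Dv"
proof (cases "x \<in> cball y s")
  case False
  then show ?thesis using z L2n_nonneg[of s y Dv] s by simp
next
  case True
  obtain b :: 'a where b: "Basis = {b}" using d card_1_singletonE by metis
  have nb: "norm b = 1" using b by (metis insertI1 norm_Basis)
  have rep: "x = (x \<bullet> b) *\<^sub>R b" for x :: 'a using euclidean_representation[of x, symmetric] unfolding b by simp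
  have zD: "Dv x = 0" if "x \<notin> cball y s" for x by (rule C1_zero_outside[OF v z that])
  have cD: "continuous_on UNIV Dv" by (rule C1_continuous(2)[OF v])
  have far: "v (x + (3 * s) *\<^sub>R b) = 0"
  proof (rule z)
    have "norm ((3 * s) *\<^sub>R b) = 3 * s" using nb s by simp
    then have "3 * s \<le> dist y (x + (3 * s) *\<^sub>R b) + dist y x"
      using norm_triangle_ineq4[of "x + (3 * s) *\<^sub>R b - y" "x - y"] by (simp add: dist_norm norm_minus_commute)
    then show "x + (3 * s) *\<^sub>R b \<notin> cball y s" using True s by auto
  qed
  let ?g = "\<lambda>t. (norm (Dv (t *\<^sub>R b)))\<^sup>2"
  have iD: "integrable lborel (\<lambda>x. (norm (Dv x))\<^sup>2)"
    by (rule integrable_compact_support[OF continuous_norm_sq[OF cD], of y s]) (use zD in simp)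
  have mD: "(\<lambda>x. (norm (Dv x))\<^sup>2) \<in> borel_measurable borel"
    by (intro borel_measurable_continuous_onI continuous_norm_sq cD)
  have ig: "integrable lborel ?g"
    using integrable_distr_eq[of "\<lambda>t. t *\<^sub>R b" lborel borel "\<lambda>x. (norm (Dv x))\<^sup>2"] mD iD
    by (simp add: lborel_one_dim[OF b, symmetric])
  have Ig: "(LINT t|lborel. ?g t) = sq_int y s Dv"
  proof -
    have "sq_int y s Dv = (LINT x|lborel. (norm (Dv x))\<^sup>2)"
      unfolding sq_int_def set_lebesgue_integral_def
      by (rule Bochner_Integration.integral_cong) (use zD in \<open>auto simp: indicator_def\<close>)
    also have "\<dots> = (LINT x|distr lborel borel (\<lambda>t::real. t *\<^sub>R b). (norm (Dv x))\<^sup>2)"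
      by (simp only: lborel_one_dim[OF b, symmetric])
    also have "\<dots> = (LINT t|lborel. ?g t)" by (rule integral_distr) (use mD in auto)
    finally show ?thesis ..
  qed
  have "(LINT l:{0..1::real}|lborel. (norm (Dv (x + l *\<^sub>R ((3 * s) *\<^sub>R b))))\<^sup>2) \<le> (LINT l|lborel. ?g (x \<bullet> b + (3 * s) * l))"
  proof -
    have eq: "x + l *\<^sub>R ((3 * s) *\<^sub>R b) = (x \<bullet> b + (3 * s) * l) *\<^sub>R b" for l
      using rep[of x] by (simp add: algebra_simps)
    have i: "integrable lborel (\<lambda>l. ?g (x \<bullet> b + (3 * s) * l))"
      using lborel_integrable_real_affine[OF ig] s by simp
    have i': "integrable lborel (\<lambda>l. indicat_real {0..1} l *\<^sub>R ?g (x \<bullet> b + (3 * s) * l))"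
      by (rule integrable_mult_indicator[OF _ i]) simp
    show ?thesis unfolding set_lebesgue_integral_def eq
      by (rule Bochner_Integration.integral_mono[OF i' i]) (simp add: indicator_def)
  qed
  also have "(LINT l|lborel. ?g (x \<bullet> b + (3 * s) * l)) = sq_int y s Dv / (3 * s)"
    using lborel_integral_real_affine[of "3 * s" ?g "x \<bullet> b"] s Ig by simp
  finally have line: "(LINT l:{0..1::real}|lborel. (norm (Dv (x + l *\<^sub>R ((3 * s) *\<^sub>R b))))\<^sup>2) \<le> sq_int y s Dv / (3 * s)" .
  have "(v x)\<^sup>2 = (v (x + (3 * s) *\<^sub>R b) - v x)\<^sup>2" using far by simp
  also have "\<dots> \<le> (norm ((3 * s) *\<^sub>R b))\<^sup>2 * (LINT l:{0..1::real}|lborel. (norm (Dv (x + l *\<^sub>R ((3 * s) *\<^sub>R b))))\<^sup>2)"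
    by (rule C1_increment_sq_le[OF v])
  also have "\<dots> \<le> (norm ((3 * s) *\<^sub>R b))\<^sup>2 * (sq_int y s Dv / (3 * s))"
    by (intro mult_left_mono line) simp
  also have "(norm ((3 * s) *\<^sub>R b))\<^sup>2 * (sq_int y s Dv / (3 * s)) = 3 * s * sq_int y s Dv"
    using nb s by (simp add: power2_eq_square)
  also have "\<dots> = 3 * s * (s * (L2n y s Dv)\<^sup>2)" using sq_int_eq[OF s, of y Dv] d by simp
  also have "\<dots> \<le> (2 * s * L2n y s Dv)\<^sup>2"
  proof -
    have "(2 * s * L2n y s Dv)\<^sup>2 = 4 * (s * L2n y s Dv)\<^sup>2" "3 * s * (s * (L2n y s Dv)\<^sup>2) = 3 * (s * L2n y s Dv)\<^sup>2"
      by (simp_all add: power2_eq_square)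
    then show ?thesis using zero_le_power2[of "s * L2n y s Dv"] by linarith
  qed
  finally show ?thesis using L2n_nonneg[of s y Dv] s by (intro power2_le_imp_le[of "\<bar>v x\<bar>"]) auto
qed

text \<open>Exponents \<open>p < 2\<close> only occur for \<open>d = 1\<close>, where test functions are bounded by their gradient.\<close>

lemma forcing_bound:
  assumes p: "p > real DIM('a::euclidean_space)"
  shows "\<exists>C>0. \<forall>f (y::'a) s v Dv m. integrable lborel (\<lambda>x. \<bar>f x\<bar> powr p) \<longrightarrow> f \<in> borel_measurable borel \<longrightarrow> 0 < m \<longrightarrow> 0 < s \<longrightarrow>
    (LINT x:cball y s|lborel. \<bar>f x\<bar> powr p) \<le> m powr p * s ^ DIM('a) \<longrightarrow> C1 v Dv \<longrightarrow> (\<forall>x. x \<notin> cball y s \<longrightarrow> v x = 0) \<longrightarrow>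
    \<bar>LINT x:cball y s|lborel. f x * v x\<bar> \<le> C * m * s * s ^ DIM('a) * L2n y s Dv"
proof -
  let ?d = "DIM('a)" let ?w = "unit_ball_vol (real ?d)"
  have w0: "0 < ?w" by simp
  have p1: "1 < p" using p DIM_positive[where 'a='a] by linarith
  define C where "C = 3 * sqrt (?w + 1) + 2 * (?w + 1)"
  have C: "0 < C" unfolding C_def using w0 by (intro add_pos_pos mult_pos_pos real_sqrt_gt_zero) linarith+
  have "\<bar>LINT x:cball y s|lborel. f x * v x\<bar> \<le> C * m * s * s ^ ?d * L2n y s Dv"
    if fp: "integrable lborel (\<lambda>x. \<bar>f x\<bar> powr p)" and fm: "f \<in> borel_measurable borel" and m: "0 < m" and s: "0 < s"
      and le: "(LINT x:cball y s|lborel. \<bar>f x\<bar> powr p) \<le> m powr p * s ^ ?d" and v: "C1 v Dv" and z: "\<forall>x. x \<notin> cball y s \<longrightarrow> v x = 0"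
    for f and y :: 'a and s v Dv m
  proof -
    let ?B = "cball y s"
    have [measurable]: "f \<in> borel_measurable borel" "cball y s \<in> sets borel" using fm by auto
    have L: "0 \<le> L2n y s Dv" using s by (intro L2n_nonneg) simp
    have cv: "continuous_on UNIV v" by (rule C1_continuous(1)[OF v])
    have mv: "v \<in> borel_measurable borel" by (rule borel_measurable_continuous_onI[OF cv])
    obtain Bv where Bv: "\<And>x. norm (v x) \<le> Bv" using bounded_compact_support[OF cv] z by metis
    have fpB: "set_integrable lborel ?B (\<lambda>x. \<bar>f x\<bar> powr p)"
      unfolding set_integrable_def using integrable_mult_indicator[OF _ fp, of ?B] by simp
    have c1: "set_integrable lborel ?B (\<lambda>_. c::real)" for c by (intro set_integrable_cball_continuous continuous_intros)
    text \<open>\<open>(|f| / m)\<^sup>q \<le> 1 + (|f| / m)\<^sup>p\<close> for \<open>0 \<le> q \<le> p\<close> replaces Hoelder's inequality.\<close>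
    have pw: "(\<bar>f x\<bar>) powr q \<le> m powr q + m powr (q - p) * \<bar>f x\<bar> powr p" if q: "0 < q" "q \<le> p" for x q
    proof (cases "\<bar>f x\<bar> \<le> m")
      case True
      then have "\<bar>f x\<bar> powr q \<le> m powr q" using q by (intro powr_mono2) auto
      then show ?thesis by (simp add: add_increasing2)
    next
      case False
      then have "\<bar>f x\<bar> powr q = \<bar>f x\<bar> powr (q - p) * \<bar>f x\<bar> powr p" using m by (simp add: powr_add[symmetric])
      also have "\<dots> \<le> m powr (q - p) * \<bar>f x\<bar> powr p" using False q m by (intro mult_right_mono powr_mono2') auto
      finally show ?thesis by (simp add: add_increasing)
    qed
    have fq: "set_integrable lborel ?B (\<lambda>x. \<bar>f x\<bar> powr q)" and fq_le: "(LINT x:?B|lborel. \<bar>f x\<bar> powr q) \<le> m powr q * ((?w + 1) * s ^ ?d)"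
      if q: "0 < q" "q \<le> p" for q
    proof -
      have i: "set_integrable lborel ?B (\<lambda>x. m powr q + m powr (q - p) * \<bar>f x\<bar> powr p)"
        by (intro set_integral_add set_integrable_mult_right c1 fpB)
      show 1: "set_integrable lborel ?B (\<lambda>x. \<bar>f x\<bar> powr q)"
        unfolding set_integrable_def
      proof (rule Bochner_Integration.integrable_bound[OF i[unfolded set_integrable_def]])
        show "(\<lambda>x. indicat_real ?B x *\<^sub>R \<bar>f x\<bar> powr q) \<in> borel_measurable lborel" by measurable
        show "AE x in lborel. norm (indicat_real ?B x *\<^sub>R \<bar>f x\<bar> powr q) \<le> norm (indicat_real ?B x *\<^sub>R (m powr q + m powr (q - p) * \<bar>f x\<bar> powr p))"
          using pw[OF q] by (intro AE_I2) (auto simp: indicator_def)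
      qed
      have "(LINT x:?B|lborel. \<bar>f x\<bar> powr q) \<le> (LINT x:?B|lborel. m powr q + m powr (q - p) * \<bar>f x\<bar> powr p)"
        by (intro set_integral_mono 1 i pw q)
      also have "\<dots> = m powr q * (?w * s ^ ?d) + m powr (q - p) * (LINT x:?B|lborel. \<bar>f x\<bar> powr p)"
        using s by (subst set_integral_add) (auto intro!: c1 set_integrable_mult_right fpB simp: set_integral_const_cball)
      also have "\<dots> \<le> m powr q * (?w * s ^ ?d) + m powr (q - p) * (m powr p * s ^ ?d)"
        by (intro add_left_mono mult_left_mono le) auto
      also have "\<dots> = m powr q * ((?w + 1) * s ^ ?d)"
        using m by (simp add: mult.assoc[symmetric] powr_add[symmetric]) (simp add: algebra_simps)
      finally show "(LINT x:?B|lborel. \<bar>f x\<bar> powr q) \<le> m powr q * ((?w + 1) * s ^ ?d)" .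
    qed
    have if1: "set_integrable lborel ?B (\<lambda>x. \<bar>f x\<bar>)" using fq[of 1] p1 by simp
    have ifv: "set_integrable lborel ?B (\<lambda>x. f x * v x)"
      unfolding set_integrable_def
    proof (rule Bochner_Integration.integrable_bound[OF integrable_mult_right[OF if1[unfolded set_integrable_def], of Bv]])
      show "(\<lambda>x. indicat_real ?B x *\<^sub>R (f x * v x)) \<in> borel_measurable lborel" using mv by measurable
      have "\<bar>f x\<bar> * \<bar>v x\<bar> \<le> \<bar>f x\<bar> * \<bar>Bv\<bar>" for x using Bv[of x] by (intro mult_left_mono) auto
      then show "AE x in lborel. norm (indicat_real ?B x *\<^sub>R (f x * v x)) \<le> norm (Bv * (indicat_real ?B x *\<^sub>R \<bar>f x\<bar>))"
        by (intro AE_I2) (auto simp: indicator_def abs_mult mult.commute)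
    qed
    show ?thesis
    proof (cases "?d = 1")
      case True
      have sup: "\<bar>v x\<bar> \<le> 2 * s * L2n y s Dv" for x
        by (rule sup_le_gradient_one_dim[OF True v _ s]) (use z in auto)
      have "\<bar>LINT x:?B|lborel. f x * v x\<bar> \<le> (LINT x:?B|lborel. \<bar>f x * v x\<bar>)"
        using set_integral_norm_bound[OF ifv] by simp
      also have "\<dots> \<le> (LINT x:?B|lborel. (2 * s * L2n y s Dv) * \<bar>f x\<bar>)"
      proof (rule set_integral_mono)
        show "set_integrable lborel ?B (\<lambda>x. \<bar>f x * v x\<bar>)" using set_integrable_norm[OF ifv] by simp
        show "\<bar>f x * v x\<bar> \<le> 2 * s * L2n y s Dv * \<bar>f x\<bar>" for x
          unfolding abs_mult using mult_right_mono[OF sup[of x], of "\<bar>f x\<bar>"] by (simp add: mult.commute)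
      qed (intro set_integrable_mult_right if1)
      also have "\<dots> \<le> (2 * s * L2n y s Dv) * (m * ((?w + 1) * s ^ ?d))"
        using fq_le[of 1] p1 m s L by simp (intro mult_left_mono, auto)
      also have "\<dots> = (2 * (?w + 1)) * (m * s * s ^ ?d * L2n y s Dv)" by (simp add: mult_ac)
      also have "\<dots> \<le> C * (m * s * s ^ ?d * L2n y s Dv)"
        unfolding C_def using w0 m s L by (intro mult_right_mono) auto
      finally show ?thesis by (simp add: mult_ac)
    next
      case False
      then have "2 \<le> ?d" using DIM_positive[where 'a='a] by linarith
      then have p2: "2 \<le> p" using p by linarith
      have f2: "\<bar>f x\<bar> powr 2 = (f x)\<^sup>2" for x by (simp add: powr_numeral)
      have if2: "set_integrable lborel ?B (\<lambda>x. (f x)\<^sup>2)" using fq[of 2] p2 by (simp add: f2)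
      have lf2: "(LINT x:?B|lborel. (f x)\<^sup>2) \<le> m\<^sup>2 * ((?w + 1) * s ^ ?d)" using fq_le[of 2] p2 m by (simp add: f2)
      have "(LINT x:?B|lborel. f x * v x)\<^sup>2 \<le> (LINT x:?B|lborel. (f x)\<^sup>2) * (LINT x:?B|lborel. (v x)\<^sup>2)"
        by (rule set_integral_Cauchy_Schwarz) (auto intro!: if2 ifv set_integrable_cball_continuous continuous_intros cv)
      also have "\<dots> \<le> (m\<^sup>2 * ((?w + 1) * s ^ ?d)) * (s ^ ?d * (3 * s * L2n y s Dv)\<^sup>2)"
      proof (intro mult_mono lf2)
        have "(LINT x:?B|lborel. (v x)\<^sup>2) = s ^ ?d * (L2n y s v)\<^sup>2"
          using sq_int_eq[OF s, of y v] unfolding sq_int_def by simp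
        also have "\<dots> \<le> s ^ ?d * (3 * s * L2n y s Dv)\<^sup>2"
          using s by (intro mult_left_mono power_mono L2n_le_gradient[OF v _ s] L2n_nonneg) (use z in auto)
        finally show "(LINT x:?B|lborel. (v x)\<^sup>2) \<le> s ^ ?d * (3 * s * L2n y s Dv)\<^sup>2" .
        show "0 \<le> (LINT x:?B|lborel. (v x)\<^sup>2)" by (rule set_integral_nonneg') auto
      qed (use s w0 in auto)
      also have "\<dots> = (3 * sqrt (?w + 1) * (m * s * s ^ ?d * L2n y s Dv))\<^sup>2"
        using w0 by (simp add: power_mult_distrib power2_eq_square)
      finally have "\<bar>LINT x:?B|lborel. f x * v x\<bar> \<le> 3 * sqrt (?w + 1) * (m * s * s ^ ?d * L2n y s Dv)"
        using m s L w0 by (intro power2_le_imp_le[of "\<bar>LINT x:?B|lborel. f x * v x\<bar>"]) auto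
      also have "\<dots> \<le> C * (m * s * s ^ ?d * L2n y s Dv)"
        unfolding C_def using w0 m s L by (intro mult_right_mono) auto
      finally show ?thesis by (simp add: mult_ac)
    qed
  qed
  then show ?thesis using C by blast
qed

subsection \<open>Mollification of weak solutions\<close>

text \<open>Borel data on the whole space make all convolutions meaningful without cutoffs, while
  the two equations are tested only inside \<open>U\<close>.\<close>

definition weak_data :: "(real^'d \<Rightarrow> real^'d \<Rightarrow> real^'d) \<Rightarrow> (real^'d) set \<Rightarrow> (real^'d \<Rightarrow> real) \<Rightarrow> (real^'d \<Rightarrow> real^'d) \<Rightarrow> (real^'d \<Rightarrow> real) \<Rightarrow> bool" where
  "weak_data a U u G f \<longleftrightarrow> integrable lborel u \<and> integrable lborel G \<and> integrable lborel (\<lambda>x. (norm (G x))\<^sup>2) \<and> f \<in> borel_measurable borel \<and>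
     (\<forall>\<phi> i. test_fun U \<phi> \<longrightarrow> (LINT x|lborel. u x * partial i \<phi> x) = - (LINT x|lborel. G x $ i * \<phi> x)) \<and>
     (\<forall>\<phi>. test_fun U \<phi> \<longrightarrow> (LINT x|lborel. a x (G x) \<bullet> grad \<phi> x) = (LINT x|lborel. f x * \<phi> x))"

definition mollifier :: "real \<Rightarrow> (('d::finite \<Rightarrow> nat) \<Rightarrow> real^'d \<Rightarrow> real) \<Rightarrow> bool" where
  "mollifier h \<Phi> \<longleftrightarrow> smooth_family \<Phi> \<and> (\<forall>n x. x \<notin> cball 0 h \<longrightarrow> \<Phi> n x = 0) \<and>
     (\<forall>x. 0 \<le> \<Phi> (\<lambda>_. 0) x) \<and> (\<forall>x. \<Phi> (\<lambda>_. 0) (- x) = \<Phi> (\<lambda>_. 0) x) \<and> (LINT x|lborel. \<Phi> (\<lambda>_. 0) x) = 1"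

abbreviation base :: "(('d::finite \<Rightarrow> nat) \<Rightarrow> real^'d \<Rightarrow> real) \<Rightarrow> real^'d \<Rightarrow> real" where
  "base \<Phi> \<equiv> \<Phi> (\<lambda>_. 0)"

text \<open>The classical gradient of the mollified function on the whole space. It is identified
  with the mollified weak gradient only where the ball of radius \<open>h\<close> fits into
  \<open>U\<close>.\<close>

definition mollified_grad :: "(('d::finite \<Rightarrow> nat) \<Rightarrow> real^'d \<Rightarrow> real) \<Rightarrow> (real^'d \<Rightarrow> real) \<Rightarrow> real^'d \<Rightarrow> real^'d" where
  "mollified_grad \<Phi> u x = (\<chi> i. conv (\<Phi> ((\<lambda>_. 0)(i := 1))) u x)"

lemma mollifierD:
  fixes \<Phi> :: "('d::finite \<Rightarrow> nat) \<Rightarrow> real^'d \<Rightarrow> real"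
  assumes "mollifier h \<Phi>"
  shows "smooth_family \<Phi>" "\<And>n x. x \<notin> cball 0 h \<Longrightarrow> \<Phi> n x = 0" "\<And>x. 0 \<le> base \<Phi> x" "\<And>x. base \<Phi> (- x) = base \<Phi> x"
    "(LINT x|lborel. base \<Phi> x) = 1" "continuous_on UNIV (\<Phi> n)" "integrable lborel (\<Phi> n)" "\<exists>B. \<forall>x. norm (\<Phi> n x) \<le> B"
    "C1 (base \<Phi>) (\<lambda>x. \<chi> i. \<Phi> ((\<lambda>_. 0)(i := 1)) x)"
proof -
  show s: "smooth_family \<Phi>" and z: "\<And>n x. x \<notin> cball 0 h \<Longrightarrow> \<Phi> n x = 0" and "\<And>x. 0 \<le> base \<Phi> x" "\<And>x. base \<Phi> (- x) = base \<Phi> x"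
    "(LINT x|lborel. base \<Phi> x) = 1"
    using assms unfolding mollifier_def by blast+
  have C: "C1 (\<Phi> n) (\<lambda>x. \<chi> i. \<Phi> (n(i := Suc (n i))) x)" for n using s unfolding smooth_family_def by blast
  show c: "continuous_on UNIV (\<Phi> n)" by (rule C1_continuous(1)[OF C])
  show "integrable lborel (\<Phi> n)" by (rule integrable_compact_support[OF c z])
  show "\<exists>B. \<forall>x. norm (\<Phi> n x) \<le> B" using bounded_compact_support[OF c z] .
  show "C1 (base \<Phi>) (\<lambda>x. \<chi> i. \<Phi> ((\<lambda>_. 0)(i := 1)) x)" using C[of "\<lambda>_. 0"] by simp
qed

lemma C1_mollified:
  fixes u :: "real^'d \<Rightarrow> real"
  assumes m: "mollifier h \<Phi>" and u: "integrable lborel u"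
  shows "C1 (conv (base \<Phi>) u) (mollified_grad \<Phi> u)"
proof -
  have "smooth_family (\<lambda>n. conv (\<Phi> n) u)"
    by (rule smooth_family_conv[OF mollifierD(1)[OF m] _ u, of 0 h]) (use mollifierD(2)[OF m] in blast)
  then have "C1 (conv (base \<Phi>) u) (\<lambda>x. \<chi> i. conv (\<Phi> ((\<lambda>_. 0)(i := Suc 0))) u x)" unfolding smooth_family_def by fastforce
  then show ?thesis unfolding mollified_grad_def[abs_def] by simp
qed

lemma mollifier_deriv_odd:
  fixes \<Phi> :: "('d::finite \<Rightarrow> nat) \<Rightarrow> real^'d \<Rightarrow> real"
  assumes m: "mollifier h \<Phi>"
  shows "\<Phi> ((\<lambda>_. 0)(i := 1)) (- x) = - \<Phi> ((\<lambda>_. 0)(i := 1)) x"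
proof -
  let ?D = "\<lambda>x. \<chi> i. \<Phi> ((\<lambda>_. 0)(i := 1)) x"
  note C = mollifierD(9)[OF m]
  have "((base \<Phi> \<circ> uminus) has_derivative ((\<lambda>k. ?D (- x) \<bullet> k) \<circ> uminus)) (at x)"
    by (rule diff_chain_at) (use C in \<open>auto simp: C1_def intro!: derivative_eq_intros\<close>)
  moreover have "base \<Phi> \<circ> uminus = base \<Phi>" using mollifierD(4)[OF m] by auto
  moreover have "(base \<Phi> has_derivative (\<lambda>k. ?D x \<bullet> k)) (at x)" using C unfolding C1_def by blast
  ultimately have "(\<lambda>k. ?D x \<bullet> k) = (\<lambda>k. ?D (- x) \<bullet> k) \<circ> uminus" using has_derivative_unique by metis
  then have "?D x \<bullet> axis i 1 = ?D (- x) \<bullet> (- axis i 1)" by (metis comp_apply)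
  then show ?thesis by (simp add: inner_axis)
qed

text \<open>The weak derivative is tested with the kernel centred at \<open>x\<close>; oddness of
  the kernel's partial derivatives cancels the sign in the definition.\<close>

lemma mollified_grad_eq:
  fixes u :: "real^'d \<Rightarrow> real"
  assumes m: "mollifier h \<Phi>" and wd: "weak_data a U u G f" and x: "cball x h \<subseteq> U"
  shows "mollified_grad \<Phi> u x = conv (base \<Phi>) G x"
proof -
  note M = mollifierD[OF m]
  have u: "integrable lborel u" and G: "integrable lborel G" using wd unfolding weak_data_def by auto
  define \<psi> where "\<psi> = (\<lambda>z. base \<Phi> (z + (- x)))"
  have test: "test_fun U \<psi>"
  proof (rule test_funI[OF _ _ x])
    have "smooth_family (\<lambda>n z. \<Phi> n (z + (- x)))" by (rule smooth_family_shift[OF M(1)])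
    from smooth_family_smooth_fun[OF this, of "\<lambda>_. 0"] show "smooth_fun \<psi>" unfolding \<psi>_def .
    fix z assume "z \<notin> cball x h"
    then show "\<psi> z = 0" unfolding \<psi>_def using M(2)[of "z + (- x)" "\<lambda>_. 0"] by (simp add: dist_norm norm_minus_commute)
  qed
  have C\<psi>: "C1 \<psi> (\<lambda>z. \<chi> i. \<Phi> ((\<lambda>_. 0)(i := 1)) (z + (- x)))" unfolding \<psi>_def by (rule C1_shift[OF M(9)])
  have "mollified_grad \<Phi> u x $ i = conv (base \<Phi>) G x $ i" for i
  proof -
    obtain B where B: "\<And>x. norm (base \<Phi> x) \<le> B" using M(8) by blast
    have mb: "base \<Phi> \<in> borel_measurable borel" by (rule borel_measurable_continuous_onI[OF M(6)])
    have "(LINT z|lborel. u z * partial i \<psi> z) = - (LINT z|lborel. G z $ i * \<psi> z)"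
      using wd test unfolding weak_data_def by blast
    moreover have "partial i \<psi> z = - \<Phi> ((\<lambda>_. 0)(i := 1)) (x - z)" for z
      using C1_partial(2)[OF C\<psi>, of i z] mollifier_deriv_odd[OF m, of i "x - z"] by simp
    moreover have "\<psi> z = base \<Phi> (x - z)" for z using M(4)[of "x - z"] unfolding \<psi>_def by simp
    ultimately have "(LINT z|lborel. u z * \<Phi> ((\<lambda>_. 0)(i := 1)) (x - z)) = (LINT z|lborel. G z $ i * base \<Phi> (x - z))"
      by simp
    moreover have "conv (base \<Phi>) G x $ i = (LINT z|lborel. (base \<Phi> (x - z) *\<^sub>R G z) $ i)"
      unfolding conv_def
      using integral_bounded_linear[OF bounded_linear_vec_nth[of i] integrable_conv_integrand[OF mb B G, of x]] by simp
    ultimately show ?thesis unfolding mollified_grad_def conv_def by (simp add: mult.commute)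
  qed
  then show ?thesis by (simp add: vec_eq_iff)
qed

lemma measurable_flux:
  fixes a :: "'a::euclidean_space \<Rightarrow> 'a \<Rightarrow> 'a"
  assumes ell: "elliptic a \<mu> \<Lambda>" and La: "0 \<le> \<Lambda>" and G: "integrable lborel G"
  shows "integrable lborel (\<lambda>x. a x (G x))"
proof (rule Bochner_Integration.integrable_bound[OF integrable_scaleR_right[OF G, of \<Lambda>]])
  have mG: "G \<in> borel_measurable borel" using borel_measurable_integrable[OF G] by simp
  have ma: "(\<lambda>(x, \<xi>). a x \<xi>) \<in> borel_measurable borel"
    using ell unfolding elliptic_def by (intro borel_measurable_continuous_onI) auto
  have "(\<lambda>x. (x, G x)) \<in> borel \<rightarrow>\<^sub>M (borel \<Otimes>\<^sub>M borel)" using mG by measurable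
  then have "(\<lambda>x. (x, G x)) \<in> borel \<rightarrow>\<^sub>M borel" by (simp only: borel_prod)
  from measurable_compose[OF this ma] show "(\<lambda>x. a x (G x)) \<in> borel_measurable lborel" by simp
  show "AE x in lborel. norm (a x (G x)) \<le> norm (\<Lambda> *\<^sub>R G x)"
    using elliptic_simps(4)[OF ell] La by (auto intro!: AE_I2)
qed

text \<open>The commutator of the flux with mollification is small because the coefficients are uniformly continuous.\<close>

lemma mollified_Sol:
  fixes u :: "real^'d \<Rightarrow> real"
  assumes m: "mollifier h \<Phi>" and wd: "weak_data a U u G f" and ell: "elliptic a \<mu> \<Lambda>" and La: "0 \<le> \<Lambda>"
    and h: "0 < h" "h \<le> t" and sub: "cball y (2 * t) \<subseteq> U" and del: "0 \<le> \<delta>"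
    and osc: "\<And>x z \<xi>. norm z \<le> h \<Longrightarrow> norm (a (x + z) \<xi> - a x \<xi>) \<le> \<delta> * norm \<xi>"
    and F: "0 \<le> F" and forc: "\<And>v Dv. C1 v Dv \<Longrightarrow> (\<And>x. x \<notin> cball y (2 * t) \<Longrightarrow> v x = 0) \<Longrightarrow>
       \<bar>LINT x:cball y (2 * t)|lborel. f x * v x\<bar> \<le> F * (2 * t) ^ CARD('d) * L2n y (2 * t) Dv"
  shows "Sol a y t (2 ^ CARD('d) * F + \<delta> * sqrt ((LINT x|lborel. (norm (G x))\<^sup>2) / t ^ CARD('d))) (mollified_grad \<Phi> u)"
  unfolding Sol_def
proof (intro allI impI)
  let ?d = "CARD('d)" let ?k = "base \<Phi>"
  have d: "DIM(real^'d) = ?d" by simp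
  fix v :: "real^'d \<Rightarrow> real" and Dv assume v: "C1 v Dv" and vz': "\<forall>x. x \<notin> cball y t \<longrightarrow> v x = 0"
  have t: "0 < t" using h by simp
  note M = mollifierD[OF m]
  have u: "integrable lborel u" and G: "integrable lborel G" and G2: "integrable lborel (\<lambda>x. (norm (G x))\<^sup>2)"
    using wd unfolding weak_data_def by auto
  define IG where "IG = (LINT x|lborel. (norm (G x))\<^sup>2)"
  have IG: "0 \<le> IG" unfolding IG_def by (rule Bochner_Integration.integral_nonneg) simp
  have vz: "v x = 0" if "x \<notin> cball y t" for x using vz' that by blast
  have Dz: "Dv x = 0" if "x \<notin> cball y t" for x by (rule C1_zero_outside[OF v vz that])
  have cv: "continuous_on UNIV v" and cD: "continuous_on UNIV Dv" using C1_continuous[OF v] by auto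
  obtain BD where BD: "\<And>x. norm (Dv x) \<le> BD" using bounded_compact_support[OF cD Dz] by blast
  have iD: "integrable lborel Dv" by (rule integrable_compact_support[OF cD Dz])
  have iv: "integrable lborel v" by (rule integrable_compact_support[OF cv vz])
  obtain B where B: "\<And>x. norm (?k x) \<le> B" using M(8) by blast
  have mb: "?k \<in> borel_measurable borel" by (rule borel_measurable_continuous_onI[OF M(6)])
  define aG where "aG = (\<lambda>x. a x (G x))"
  have aG: "integrable lborel aG" unfolding aG_def by (rule measurable_flux[OF ell La G])
  have zk: "?k x = 0" if "x \<notin> cball 0 h" for x by (rule M(2)[OF that])
  have cG: "continuous_on UNIV (conv ?k G)" by (rule continuous_conv[OF M(6) zk G])
  have caG: "continuous_on UNIV (conv ?k aG)" by (rule continuous_conv[OF M(6) zk aG])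
  have cnG: "continuous_on UNIV (conv ?k (\<lambda>x. norm (G x)))" by (rule continuous_conv[OF M(6) zk integrable_norm[OF G]])
  have cacG: "continuous_on UNIV (\<lambda>x. a x (conv ?k G x))" by (rule elliptic_continuous[OF ell cG])
  note int = set_integrable_cball_continuous
  have Du: "mollified_grad \<Phi> u x = conv ?k G x" if "x \<in> cball y t" for x
  proof (rule mollified_grad_eq[OF m wd])
    show "cball x h \<subseteq> U"
    proof
      fix q assume "q \<in> cball x h"
      then have "q \<in> cball y (2 * t)" using that h dist_triangle[of y q x] by simp
      then show "q \<in> U" using sub by blast
    qed
  qed
  \<comment> \<open>By linearity \<open>a x\<close> passes under the integral with its coefficients
    frozen at \<open>x\<close>; what remains compares coefficients at distance at most
    \<open>h\<close>.\<close>
  have comm: "norm (a x (conv ?k G x) - conv ?k aG x) \<le> \<delta> * conv ?k (\<lambda>x. norm (G x)) x" for x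
  proof -
    have bl: "bounded_linear (a x)" using ell unfolding elliptic_def by (simp add: linear_conv_bounded_linear)
    note i = integrable_conv_integrand[OF mb B]
    have "a x (conv ?k G x) = (LINT z|lborel. a x (?k (x - z) *\<^sub>R G z))"
      unfolding conv_def using integral_bounded_linear[OF bl i[OF G], of x] by simp
    also have "\<dots> - conv ?k aG x = (LINT z|lborel. a x (?k (x - z) *\<^sub>R G z) - ?k (x - z) *\<^sub>R aG z)"
      unfolding conv_def by (rule Bochner_Integration.integral_diff[symmetric]) (intro integrable_bounded_linear[OF bl] i G aG)+
    also have "norm \<dots> \<le> (LINT z|lborel. \<delta> * (?k (x - z) *\<^sub>R norm (G z)))"
    proof (rule Bochner_Integration.integral_norm_bound_integral)
      fix z
      show "norm (a x (?k (x - z) *\<^sub>R G z) - ?k (x - z) *\<^sub>R aG z) \<le> \<delta> * (?k (x - z) *\<^sub>R norm (G z))"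
      proof (cases "x - z \<in> cball 0 h")
        case True
        have "a x (?k (x - z) *\<^sub>R G z) - ?k (x - z) *\<^sub>R aG z = ?k (x - z) *\<^sub>R (a (z + (x - z)) (G z) - a z (G z))"
          unfolding aG_def using linear_cmul[OF bounded_linear.linear[OF bl]] by (simp add: scaleR_diff_right)
        also have "norm \<dots> = ?k (x - z) * norm (a (z + (x - z)) (G z) - a z (G z))" using M(3) by simp
        also have "\<dots> \<le> ?k (x - z) * (\<delta> * norm (G z))"
          by (intro mult_left_mono osc M(3)) (use True in simp)
        finally show ?thesis by (simp add: mult_ac)
      next
        case False
        then show ?thesis using zk[OF False] linear_0[OF bounded_linear.linear[OF bl]] by simp
      qed
    qed (intro Bochner_Integration.integrable_diff integrable_bounded_linear[OF bl] integrable_mult_right i G aG integrable_norm)+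
    also have "\<dots> = \<delta> * conv ?k (\<lambda>x. norm (G x)) x" unfolding conv_def by simp
    finally show ?thesis .
  qed
  \<comment> \<open>The mollifier is moved onto the test function, whose support grows to radius at
    most \<open>2 * t\<close>; hence the hypothesis \<open>forc\<close> at the doubled radius and
    the factor \<open>2 ^ d\<close>.\<close>
  have A: "\<bar>LINT x:cball y t|lborel. conv ?k aG x \<bullet> Dv x\<bar> \<le> t ^ ?d * (2 ^ ?d * F) * L2n y t Dv"
  proof -
    have C1kv: "C1 (conv ?k v) (conv ?k Dv)" by (rule C1_conv_grad[OF v vz M(7)])
    have kvz: "conv ?k v x = 0" if "x \<notin> cball y (2 * t)" for x
    proof (rule conv_zero_outside[OF zk vz])
      show "x \<notin> cball y (t + h)" using that h by simp
    qed
    have test: "test_fun U (conv ?k v)"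
    proof (rule test_funI[OF _ kvz sub])
      have "smooth_family (\<lambda>n. conv (\<Phi> n) v)" by (rule smooth_family_conv[OF M(1) _ iv, of 0 h]) (use M(2) in blast)
      from smooth_family_smooth_fun[OF this, of "\<lambda>_. 0"] show "smooth_fun (conv ?k v)" .
    qed
    have "(LINT x:cball y t|lborel. conv ?k aG x \<bullet> Dv x) = (LINT x|lborel. conv ?k aG x \<bullet> Dv x)"
      unfolding set_lebesgue_integral_def by (rule Bochner_Integration.integral_cong) (use Dz in \<open>auto simp: indicator_def\<close>)
    also have "\<dots> = (LINT x|lborel. aG x \<bullet> conv ?k Dv x)"
      by (rule integral_conv_inner[OF M(7) B M(4) aG iD BD])
    also have "\<dots> = (LINT x|lborel. a x (G x) \<bullet> grad (conv ?k v) x)" unfolding aG_def using C1_grad[OF C1kv] by simp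
    also have "\<dots> = (LINT x|lborel. f x * conv ?k v x)" using wd test unfolding weak_data_def by blast
    also have "\<dots> = (LINT x:cball y (2 * t)|lborel. f x * conv ?k v x)"
      unfolding set_lebesgue_integral_def by (rule Bochner_Integration.integral_cong) (use kvz in \<open>auto simp: indicator_def\<close>)
    also have "\<bar>\<dots>\<bar> \<le> F * (2 * t) ^ ?d * L2n y (2 * t) (conv ?k Dv)" by (rule forc[OF C1kv kvz])
    also have "\<dots> \<le> F * (2 * t) ^ ?d * L2n y t Dv"
    proof (intro mult_left_mono)
      have D2: "integrable lborel (\<lambda>x. (norm (Dv x))\<^sup>2)"
        by (rule integrable_compact_support[OF continuous_norm_sq[OF cD], of y t]) (use Dz in simp)
      have "sq_int y (2 * t) (conv ?k Dv) \<le> (LINT x|lborel. (norm (Dv x))\<^sup>2)"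
        by (rule sq_int_conv_le(2)[OF M(6) zk M(3) M(5) iD D2])
      also have "\<dots> = sq_int y t Dv" unfolding sq_int_def set_lebesgue_integral_def
        by (rule Bochner_Integration.integral_cong) (use Dz in \<open>auto simp: indicator_def\<close>)
      finally have "sq_int y (2 * t) (conv ?k Dv) / (2 * t) ^ ?d \<le> sq_int y t Dv / t ^ ?d"
        using t by (intro frac_le sq_int_nonneg power_mono) auto
      then show "L2n y (2 * t) (conv ?k Dv) \<le> L2n y t Dv" unfolding L2n_def d by simp
    qed (use F t in auto)
    also have "\<dots> = t ^ ?d * (2 ^ ?d * F) * L2n y t Dv" by (simp add: power_mult_distrib)
    finally show ?thesis .
  qed
  have Bb: "\<bar>LINT x:cball y t|lborel. (a x (conv ?k G x) - conv ?k aG x) \<bullet> Dv x\<bar> \<le> t ^ ?d * (\<delta> * sqrt (IG / t ^ ?d)) * L2n y t Dv"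
  proof -
    have "\<bar>LINT x:cball y t|lborel. (a x (conv ?k G x) - conv ?k aG x) \<bullet> Dv x\<bar> \<le> t ^ ?d * L2n y t (\<lambda>x. a x (conv ?k G x) - conv ?k aG x) * L2n y t Dv"
      using set_integral_inner_le[OF continuous_on_diff[OF cacG caG] cD t, of y] by simp
    also have "L2n y t (\<lambda>x. a x (conv ?k G x) - conv ?k aG x) \<le> L2n y t (\<lambda>x. \<delta> *\<^sub>R conv ?k (\<lambda>x. norm (G x)) x)"
    proof (rule L2n_mono)
      fix x
      show "norm (a x (conv ?k G x) - conv ?k aG x) \<le> norm (\<delta> *\<^sub>R conv ?k (\<lambda>x. norm (G x)) x)"
        using order_trans[OF comm[of x] mult_left_mono[OF abs_ge_self del]] del by simp
    qed (intro continuous_intros cacG caG cnG t)+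
    also have "\<dots> = \<delta> * L2n y t (conv ?k (\<lambda>x. norm (G x)))" using t del by (simp add: L2n_scaleR del: real_scaleR_def)
    also have "\<dots> \<le> \<delta> * sqrt (IG / t ^ ?d)"
    proof (rule mult_left_mono[OF _ del])
      have "sq_int y t (conv ?k (\<lambda>x. norm (G x))) \<le> IG"
        unfolding IG_def by (rule sq_int_conv_le(1)[OF M(6) zk M(3) M(5) G G2])
      then show "L2n y t (conv ?k (\<lambda>x. norm (G x))) \<le> sqrt (IG / t ^ ?d)"
        unfolding L2n_def d using t by (simp add: divide_right_mono)
    qed
    finally show ?thesis using t L2n_nonneg[of t y Dv] by (simp add: mult_left_mono mult_right_mono)
  qed
  have "(LINT x:cball y t|lborel. a x (mollified_grad \<Phi> u x) \<bullet> Dv x) = (LINT x:cball y t|lborel. conv ?k aG x \<bullet> Dv x + (a x (conv ?k G x) - conv ?k aG x) \<bullet> Dv x)"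
    by (rule set_lebesgue_integral_cong) (auto simp: Du inner_diff_left)
  also have "\<dots> = (LINT x:cball y t|lborel. conv ?k aG x \<bullet> Dv x) + (LINT x:cball y t|lborel. (a x (conv ?k G x) - conv ?k aG x) \<bullet> Dv x)"
    by (rule set_integral_add) (intro int continuous_intros caG cacG cD)+
  finally show "\<bar>LINT x:cball y t|lborel. a x (mollified_grad \<Phi> u x) \<bullet> Dv x\<bar>
     \<le> t ^ DIM(real^'d) * (2 ^ ?d * F + \<delta> * sqrt ((LINT x|lborel. (norm (G x))\<^sup>2) / t ^ ?d)) * L2n y t Dv"
    using A Bb unfolding IG_def d by (simp add: algebra_simps)
qed

section \<open>From mean-square bounds on small balls to bounds almost everywhere\<close>

lemma conv_close:
  fixes v :: "'a::euclidean_space \<Rightarrow> real"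
  assumes k: "integrable lborel \<kappa>" and k0: "\<And>x. 0 \<le> \<kappa> x" and k1: "(LINT x|lborel. \<kappa> x) = 1" and kz: "\<And>x. x \<notin> cball 0 h \<Longrightarrow> \<kappa> x = 0"
    and b: "\<And>x. norm (\<kappa> x) \<le> B" and w: "integrable lborel w" and close: "\<And>x z. norm z \<le> h \<Longrightarrow> \<bar>w (x + z) - v x\<bar> \<le> e"
  shows "\<bar>conv \<kappa> w x - v x\<bar> \<le> e"
proof -
  have m: "\<kappa> \<in> borel_measurable borel" using borel_measurable_integrable[OF k] by simp
  have i: "integrable lborel (\<lambda>z. \<kappa> (x - z))" by (rule integrable_reflect[OF k])
  have I: "(LINT z|lborel. \<kappa> (x - z)) = 1" using integral_reflect[OF m, of x] k1 by simp
  note iw = integrable_conv_integrand[OF m b w, of x]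
  have "conv \<kappa> w x - v x = (LINT z|lborel. \<kappa> (x - z) *\<^sub>R w z - \<kappa> (x - z) * v x)"
    unfolding conv_def using iw i I by simp
  also have "\<bar>\<dots>\<bar> \<le> (LINT z|lborel. \<kappa> (x - z) * e)"
    unfolding real_norm_def[symmetric]
  proof (rule Bochner_Integration.integral_norm_bound_integral)
    fix z
    show "norm (\<kappa> (x - z) *\<^sub>R w z - \<kappa> (x - z) * v x) \<le> \<kappa> (x - z) * e"
    proof (cases "x - z \<in> cball 0 h")
      case True
      then have "\<bar>w (x + (z - x)) - v x\<bar> \<le> e" by (intro close) (simp add: norm_minus_commute)
      then have "\<kappa> (x - z) * \<bar>w z - v x\<bar> \<le> \<kappa> (x - z) * e" using k0 by (intro mult_left_mono) auto
      moreover have "norm (\<kappa> (x - z) *\<^sub>R w z - \<kappa> (x - z) * v x) = \<kappa> (x - z) * \<bar>w z - v x\<bar>"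
        using k0[of "x - z"] by (simp add: right_diff_distrib[symmetric] abs_mult)
      ultimately show ?thesis by simp
    qed (use kz in simp)
  qed (use iw i in \<open>auto intro!: Bochner_Integration.integrable_diff\<close>)
  also have "\<dots> = e" using I by simp
  finally show ?thesis .
qed

text \<open>Used in place of the Lebesgue differentiation theorem.\<close>

lemma AE_le_from_test:
  fixes g :: "'a::euclidean_space \<Rightarrow> real"
  assumes g: "integrable lborel g" and O: "open O'" "bounded O'" and B: "0 \<le> B"
    and test: "\<And>v. continuous_on UNIV v \<Longrightarrow> (\<And>x. 0 \<le> v x) \<Longrightarrow> (\<And>x. x \<notin> O' \<Longrightarrow> v x = 0) \<Longrightarrow>
       (LINT x|lborel. g x * v x) \<le> B * (LINT x|lborel. v x)"
  shows "AE x in lborel. x \<in> O' \<longrightarrow> g x \<le> B"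
proof -
  have mg [measurable]: "g \<in> borel_measurable borel" using borel_measurable_integrable[OF g] by simp
  have compact_le: "(LINT x:K|lborel. g x) \<le> B * measure lborel K" if K: "compact K" "K \<subseteq> O'" "K \<noteq> {}" for K
  proof -
    obtain r where r: "0 < r" and "(\<Union>x\<in>K. ball x r) \<subseteq> O'"
      using compact_subset_open_imp_ball_epsilon_subset[OF K(1) O(1) K(2)] by blast
    then have rK: "ball x r \<subseteq> O'" if "x \<in> K" for x using that by blast
    \<comment> \<open>Continuous functions decreasing to the indicator of \<open>K\<close>; the
      slope \<open>2 / r\<close> makes all of them vanish off \<open>O'\<close>, which is at
      distance at least \<open>r\<close> from \<open>K\<close>.\<close>
    define v where "v = (\<lambda>n::nat. \<lambda>x. max 0 (1 - (2 / r + real n) * infdist x K))"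
    have cv: "continuous_on UNIV (v n)" for n unfolding v_def by (intro continuous_intros continuous_on_infdist)
    have v01: "0 \<le> v n x" "v n x \<le> 1" for n x
      unfolding v_def using r infdist_nonneg[of x K] by (auto intro!: mult_nonneg_nonneg)
    have vz: "v n x = 0" if x: "x \<notin> O'" for n x
    proof -
      have "r \<le> infdist x K" unfolding infdist_notempty[OF K(3)]
        by (rule cINF_greatest[OF K(3)]) (use rK x in \<open>force simp: dist_commute not_less[symmetric]\<close>)
      then have "2 \<le> (2 / r) * infdist x K" using r by (simp add: field_simps)
      also have "\<dots> \<le> (2 / r + real n) * infdist x K" using infdist_nonneg[of x K] by (intro mult_right_mono) auto
      finally show ?thesis unfolding v_def by simp
    qed
    have vlim: "(\<lambda>n. v n x) \<longlonglongrightarrow> indicator K x" for x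
    proof (cases "x \<in> K")
      case True
      then show ?thesis unfolding v_def by simp
    next
      case False
      then have pos: "0 < infdist x K" using in_closed_iff_infdist_zero[OF compact_imp_closed[OF K(1)] K(3)] infdist_nonneg[of x K] by fastforce
      obtain N :: nat where N: "1 / infdist x K \<le> real N" using real_arch_simple by blast
      have "v n x = 0" if "N \<le> n" for n
      proof -
        have "1 \<le> real N * infdist x K" using N pos by (simp add: field_simps)
        also have "\<dots> \<le> (2 / r + real n) * infdist x K" using pos that r by (intro mult_right_mono) (auto intro: add_increasing)
        finally show ?thesis unfolding v_def by simp
      qed
      then show ?thesis using False by (auto intro!: tendsto_eventually eventually_sequentiallyI[of N])
    qed
    have Kb [measurable]: "K \<in> sets borel" using K(1) by (simp add: borel_compact)
    have Ob [measurable]: "O' \<in> sets borel" using O by simp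
    have mv [measurable]: "v n \<in> borel_measurable borel" for n by (rule borel_measurable_continuous_onI[OF cv])
    have "(\<lambda>n. LINT x|lborel. g x * v n x) \<longlonglongrightarrow> (LINT x|lborel. g x * indicator K x)"
    proof (rule integral_dominated_convergence)
      show "integrable lborel (\<lambda>x. \<bar>g x\<bar>)" using g by simp
      show "AE x in lborel. (\<lambda>n. g x * v n x) \<longlonglongrightarrow> g x * indicator K x" by (intro AE_I2 tendsto_intros vlim)
      show "AE x in lborel. norm (g x * v n x) \<le> \<bar>g x\<bar>" for n
        using v01 by (auto intro!: AE_I2 simp: abs_mult mult_left_le)
    qed measurable
    moreover have "(\<lambda>n. LINT x|lborel. v n x) \<longlonglongrightarrow> (LINT x|lborel. indicat_real K x)"
    proof (rule integral_dominated_convergence)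
      show "integrable lborel (indicat_real O')"
        using emeasure_bounded_finite[OF O(2)] by simp
      show "AE x in lborel. norm (v n x) \<le> indicat_real O' x" for n
        using v01 vz by (intro AE_I2) (auto simp: indicator_def)
    qed (use vlim in auto)
    then have "(\<lambda>n. B * (LINT x|lborel. v n x)) \<longlonglongrightarrow> B * (LINT x|lborel. indicat_real K x)" by (rule tendsto_mult_left)
    ultimately have "(LINT x|lborel. g x * indicator K x) \<le> B * (LINT x|lborel. indicat_real K x)"
      by (rule LIMSEQ_le) (use test[OF cv v01(1) vz] in blast)
    then show ?thesis unfolding set_lebesgue_integral_def by (simp add: mult.commute)
  qed
  define N where "N = {x \<in> O'. B < g x}"
  have Nb: "N \<in> sets borel" unfolding N_def using O by measurable
  have "emeasure lborel N = 0"
  proof (rule ccontr)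
    assume n0: "emeasure lborel N \<noteq> 0"
    have fin: "emeasure lborel N < \<infinity>"
      using emeasure_bounded_finite[of N] O(2) bounded_subset[of O' N] unfolding N_def by auto
    define c where "c = measure lborel N"
    have c: "emeasure lborel N = ennreal c" unfolding c_def using fin by (simp add: emeasure_eq_ennreal_measure less_top)
    have c0: "0 < c" using n0 c by (metis ennreal_eq_0_iff not_le)
    have NL: "N \<in> sets lebesgue" using Nb by simp
    \<comment> \<open>The part of the bad set left out has less than its full measure, so
      \<open>K\<close> has positive measure; there \<open>B < g x\<close> contradicts the inequality
      for compact sets.\<close>
    obtain K where K: "closed K" "K \<subseteq> N" "N - K \<in> lmeasurable" "emeasure lebesgue (N - K) < ennreal c"
      by (rule sets_lebesgue_inner_closed[OF NL c0])
    have Kc: "compact K" using K(1,2) O(2) bounded_subset[of O' K] unfolding N_def by (auto simp: compact_eq_bounded_closed)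
    have Kb: "K \<in> sets borel" using K(1) by simp
    have "emeasure lborel N \<le> emeasure lborel K + emeasure lborel (N - K)"
      using emeasure_subadditive[of K lborel "N - K"] Kb Nb K(2) by (simp add: Un_absorb1)
    moreover have "emeasure lborel (N - K) < ennreal c" using K(4) Kb Nb by simp
    ultimately have K0: "emeasure lborel K \<noteq> 0" using c by auto
    then have Kne: "K \<noteq> {}" by auto
    have finK: "emeasure lborel K < \<infinity>" using emeasure_bounded_finite[OF compact_imp_bounded[OF Kc]] .
    have "(LINT x:K|lborel. g x) \<le> B * measure lborel K" by (rule compact_le[OF Kc _ Kne]) (use K(2) in \<open>auto simp: N_def\<close>)
    moreover have iK: "integrable lborel (\<lambda>x. indicat_real K x *\<^sub>R g x)" by (rule integrable_mult_indicator[OF _ g]) (use Kb in simp)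
    moreover have iB: "integrable lborel (\<lambda>x. indicat_real K x *\<^sub>R B)" using finK Kb by simp
    moreover have "(LINT x|lborel. indicat_real K x *\<^sub>R B) = B * measure lborel K" by simp
    ultimately have "(LINT x|lborel. indicat_real K x *\<^sub>R g x - indicat_real K x *\<^sub>R B) \<le> 0"
      unfolding set_lebesgue_integral_def by (subst Bochner_Integration.integral_diff) (auto simp: mult.commute[of B])
    moreover have nn: "0 \<le> indicat_real K x *\<^sub>R g x - indicat_real K x *\<^sub>R B" for x
      using K(2) unfolding N_def indicator_def by auto
    ultimately have "(LINT x|lborel. indicat_real K x *\<^sub>R g x - indicat_real K x *\<^sub>R B) = 0"
      using Bochner_Integration.integral_nonneg[of lborel "\<lambda>x. indicat_real K x *\<^sub>R g x - indicat_real K x *\<^sub>R B"]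
      by (meson antisym)
    then have "AE x in lborel. indicat_real K x *\<^sub>R g x - indicat_real K x *\<^sub>R B = 0"
      using integral_nonneg_eq_0_iff_AE[OF Bochner_Integration.integrable_diff[OF iK iB]] nn by simp
    then have "AE x in lborel. x \<notin> K"
      by eventually_elim (use K(2) in \<open>auto simp: N_def indicator_def split: if_splits\<close>)
    then have "K \<in> null_sets lborel" using Kb by (simp add: AE_iff_null_sets)
    then show False using K0 by auto
  qed
  then have "N \<in> null_sets lborel" using Nb by auto
  then have "AE x in lborel. x \<notin> N" by (rule AE_not_in)
  then show ?thesis by eventually_elim (auto simp: N_def)
qed

text \<open>Averaging over balls becomes convolution with an even kernel, so that
  \<open>integral_conv_inner\<close> can move it onto a test function.\<close>

definition ball_kernel :: "real \<Rightarrow> 'a::euclidean_space \<Rightarrow> real" where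
  "ball_kernel t x = indicator (cball 0 t) x / measure lborel (cball (0::'a) t)"

lemma ball_kernel:
  assumes t: "0 < t"
  shows "integrable lborel (ball_kernel t :: 'a::euclidean_space \<Rightarrow> real)" "\<And>x::'a. 0 \<le> ball_kernel t x" "(LINT x|lborel. ball_kernel t (x::'a)) = 1"
    "\<And>x::'a. x \<notin> cball 0 t \<Longrightarrow> ball_kernel t x = 0" "\<And>x::'a. norm (ball_kernel t x) \<le> 1 / measure lborel (cball (0::'a) t)" "\<And>x::'a. ball_kernel t (- x) = ball_kernel t x"
    "\<And>F x. conv (ball_kernel t) F (x::'a) = avg x t F"
proof -
  let ?m = "measure lborel (cball (0::'a) t)"
  have m: "0 < ?m" by (rule measure_cball_pos[OF t])
  have fin: "emeasure lborel (cball (0::'a) t) < \<infinity>" using emeasure_lborel_cball_finite[of "0::'a" t] by (simp add: less_top)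
  show "integrable lborel (ball_kernel t :: 'a \<Rightarrow> real)"
    unfolding ball_kernel_def[abs_def] using fin by (intro integrable_divide) auto
  show "0 \<le> ball_kernel t x" for x :: 'a unfolding ball_kernel_def using m by simp
  show "(LINT x|lborel. ball_kernel t (x::'a)) = 1" unfolding ball_kernel_def using m fin by simp
  show "x \<notin> cball 0 t \<Longrightarrow> ball_kernel t x = 0" for x :: 'a unfolding ball_kernel_def by simp
  show "norm (ball_kernel t x) \<le> 1 / ?m" for x :: 'a unfolding ball_kernel_def using m by (auto simp: indicator_def)
  show "ball_kernel t (- x) = ball_kernel t x" for x :: 'a unfolding ball_kernel_def by (simp add: indicator_def)
  show "conv (ball_kernel t) F x = avg x t F" for F and x :: 'a
  proof -
    have "conv (ball_kernel t) F x = (LINT z|lborel. (indicator (cball x t) z *\<^sub>R F z) / ?m)"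
      unfolding conv_def ball_kernel_def
      by (rule Bochner_Integration.integral_cong) (auto simp: indicator_def dist_norm norm_minus_commute)
    then show ?thesis unfolding avg_def set_lebesgue_integral_def using t by (simp add: measure_cball)
  qed
qed

lemma conv_vec_nth:
  fixes F :: "'a::euclidean_space \<Rightarrow> real^'d"
  assumes k: "\<kappa> \<in> borel_measurable borel" and b: "\<And>x. norm (\<kappa> x) \<le> B" and F: "integrable lborel F"
  shows "conv \<kappa> (\<lambda>x. s * F x $ j) x = s * conv \<kappa> F x $ j"
proof -
  have bl: "bounded_linear (\<lambda>v::real^'d. s * v $ j)" by (intro bounded_linear_mult_right[THEN bounded_linear_compose] bounded_linear_vec_nth)
  have "(LINT z|lborel. s * (\<kappa> (x - z) *\<^sub>R F z) $ j) = s * (LINT z|lborel. \<kappa> (x - z) *\<^sub>R F z) $ j"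
    by (rule integral_bounded_linear[OF bl integrable_conv_integrand[OF k b F]])
  then show ?thesis unfolding conv_def by (simp add: mult_ac)
qed

text \<open>The iteration bounds the mollified gradient on balls of radius \<open>t L\<close>,
  uniformly in the centre and in \<open>L\<close>. Paired with a continuous test function these
  bounds persist as kernel width and radius tend to 0, and they yield a bound for each component of
  \<open>G\<close>.\<close>

theorem weak_lipschitz:
  fixes \<mu> \<Lambda> p :: real
  assumes mu: "0 < \<mu>" and La: "0 \<le> \<Lambda>" and p: "p > real CARD('d::finite)"
  shows "\<exists>m::nat\<ge>2. \<exists>C>0. \<forall>(a::real^'d \<Rightarrow> real^'d \<Rightarrow> real^'d) x0 R u G f \<omega> e S.
    elliptic a \<mu> \<Lambda> \<longrightarrow> 0 < R \<longrightarrow> weak_data a (ball x0 (3 * R / 4)) u G f \<longrightarrow> integrable lborel (\<lambda>x. \<bar>f x\<bar> powr p) \<longrightarrow>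
    (\<forall>\<epsilon>>0. \<exists>\<delta>>0. \<forall>x z \<xi>. norm z < \<delta> \<longrightarrow> norm (a (x + z) \<xi> - a x \<xi>) \<le> \<epsilon> * norm \<xi>) \<longrightarrow>
    (\<forall>y\<in>ball x0 (R / 2). \<forall>k. almost_periodic a y (R / 16 / real m ^ k) (\<omega> k) (e k)) \<longrightarrow> (\<forall>k. 0 \<le> \<omega> k \<and> 0 \<le> e k) \<longrightarrow>
    (\<forall>n. (\<Sum>k<n. \<omega> k + e k / (R / 16 / real m ^ k)) \<le> S) \<longrightarrow>
    (AE x in lborel. x \<in> ball x0 (R / 2) \<longrightarrow> norm (G x) \<le> C * exp (C * S) *
       (sqrt ((LINT x|lborel. (norm (G x))\<^sup>2) / R ^ CARD('d)) + R * ((LINT x|lborel. \<bar>f x\<bar> powr p) / R ^ CARD('d)) powr (1 / p)))"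
proof -
  let ?d = "CARD('d)"
  have d: "DIM(real^'d) = ?d" by simp
  have d1: "1 \<le> ?d" by (simp add: Suc_leI)
  have "1 \<le> real ?d" using d1 by simp
  then have p0: "1 < p" "0 < p" using p by linarith+
  obtain m :: nat and C0 where m: "2 \<le> m" and C0: "C0 > 0" and H: "\<And>a (y::real^'d) t0 u Du K \<omega> e L.
    elliptic a \<mu> \<Lambda> \<Longrightarrow> C1 u Du \<Longrightarrow> 0 < t0 \<Longrightarrow>
    (\<forall>k<L. Sol a y (t0 / real m ^ k) (K k) Du \<and> almost_periodic a y (t0 / real m ^ k) (\<omega> k) (e k) \<and> 0 \<le> K k \<and> 0 \<le> \<omega> k \<and> 0 \<le> e k) \<Longrightarrow>
    L2n y (t0 / real m ^ L) Du \<le> C0 * exp (C0 * (\<Sum>k<L. \<omega> k + e k / (t0 / real m ^ k))) * (L2n y t0 Du + (\<Sum>k<L. K k))"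
    using lipschitz_iteration[OF mu La, where 'a="real^'d"] by blast
  obtain Cf where Cf: "Cf > 0" and Hf: "\<And>f (y::real^'d) s v Dv m. integrable lborel (\<lambda>x. \<bar>f x\<bar> powr p) \<Longrightarrow> f \<in> borel_measurable borel \<Longrightarrow> 0 < m \<Longrightarrow> 0 < s \<Longrightarrow>
    (LINT x:cball y s|lborel. \<bar>f x\<bar> powr p) \<le> m powr p * s ^ ?d \<Longrightarrow> C1 v Dv \<Longrightarrow> (\<forall>x. x \<notin> cball y s \<longrightarrow> v x = 0) \<Longrightarrow>
    \<bar>LINT x:cball y s|lborel. f x * v x\<bar> \<le> Cf * m * s * s ^ ?d * L2n y s Dv"
    using forcing_bound[of p, where 'a="real^'d"] p unfolding d by blast
  \<comment> \<open>At radius \<open>t\<close> the right-hand side contributes \<open>t\<close>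
    times a p-mean of \<open>f\<close>, at most of order \<open>t powr q\<close>; as
    \<open>q\<close> is positive, the contributions of all radii form a geometric series with ratio
    \<open>r\<close>.\<close>
  define q where "q = 1 - real ?d / p"
  have q: "0 < q" unfolding q_def using p p0 by simp
  define N where "N = real m"
  have N: "2 \<le> N" unfolding N_def using m by simp
  define r where "r = N powr (- q)"
  have r: "0 < r" "r < 1" unfolding r_def using N q by (auto simp: powr_less_one)
  define Q where "Q = 1 / (1 - r)"
  have Q: "0 < Q" unfolding Q_def using r by simp
  define w where "w = unit_ball_vol (real ?d)"
  have w: "0 < w" unfolding w_def by simp
  define E where "E = 4 ^ ?d + 2 ^ ?d * Cf * Q * 2 + 1"
  have E: "0 < E" unfolding E_def using Cf Q by (intro add_pos_pos mult_pos_pos) auto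
  define C where "C = C0 + real ?d / sqrt w * C0 * E"
  have CC: "C0 \<le> C" "real ?d / sqrt w * C0 * E \<le> C" "0 < C" unfolding C_def using C0 E w by (auto intro: add_pos_nonneg)
  have "AE x in lborel. x \<in> ball x0 (R / 2) \<longrightarrow> norm (G x) \<le> C * exp (C * S) *
       (sqrt ((LINT x|lborel. (norm (G x))\<^sup>2) / R ^ ?d) + R * ((LINT x|lborel. \<bar>f x\<bar> powr p) / R ^ ?d) powr (1 / p))"
    if ell: "elliptic a \<mu> \<Lambda>" and R: "0 < R" and wd: "weak_data a (ball x0 (3 * R / 4)) u G f" and fp: "integrable lborel (\<lambda>x. \<bar>f x\<bar> powr p)"
      and uc: "\<forall>\<epsilon>>0. \<exists>\<delta>>0. \<forall>x z \<xi>. norm z < \<delta> \<longrightarrow> norm (a (x + z) \<xi> - a x \<xi>) \<le> \<epsilon> * norm \<xi>"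
      and ap: "\<forall>y\<in>ball x0 (R / 2). \<forall>k. almost_periodic a y (R / 16 / N ^ k) (\<omega> k) (e k)" and oe: "\<forall>k. 0 \<le> \<omega> k \<and> 0 \<le> e k"
      and S: "\<forall>n. (\<Sum>k<n. \<omega> k + e k / (R / 16 / N ^ k)) \<le> S"
    for a :: "real^'d \<Rightarrow> real^'d \<Rightarrow> real^'d" and x0 R u G f \<omega> e S
  proof -
    define t where "t = (\<lambda>k::nat. R / 16 / N ^ k)"
    have t: "0 < t k" for k unfolding t_def using R N by simp
    have tmono: "t L \<le> t k" if "k \<le> L" for k L
      unfolding t_def using R N that by (intro divide_left_mono power_increasing) auto
    have t16: "t k \<le> R / 16" for k using tmono[of 0 k] by (simp add: t_def)
    have S0: "0 \<le> S" using S[rule_format, of 0] by simp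
    have u: "integrable lborel u" and G: "integrable lborel G" and G2: "integrable lborel (\<lambda>x. (norm (G x))\<^sup>2)" and fm: "f \<in> borel_measurable borel"
      using wd unfolding weak_data_def by auto
    define M2 where "M2 = (LINT x|lborel. (norm (G x))\<^sup>2)"
    define Fp where "Fp = (LINT x|lborel. \<bar>f x\<bar> powr p)"
    have M2: "0 \<le> M2" and Fp: "0 \<le> Fp" unfolding M2_def Fp_def by (auto intro: Bochner_Integration.integral_nonneg)
    define A1 where "A1 = sqrt (M2 / R ^ ?d)"
    have A1: "0 \<le> A1" unfolding A1_def using M2 R by simp
    \<comment> \<open>The slack \<open>\<iota>\<close> serves twice: it makes the mean of
      \<open>f\<close> positive, as \<open>forcing_bound\<close> asks, and it dominates the total
      commutator error.\<close>
    define BB where "BB = (\<lambda>\<iota>. C0 * exp (C0 * S) * (4 ^ ?d * A1 + 2 ^ ?d * Cf * Q * (R * ((Fp + \<iota>) / R ^ ?d) powr (1 / p)) + \<iota>))"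
    have inU: "cball y s \<subseteq> ball x0 (3 * R / 4)" if "y \<in> ball x0 (R / 2)" "s \<le> R / 8" for y s
    proof
      fix z assume "z \<in> cball y s"
      then show "z \<in> ball x0 (3 * R / 4)" using that R dist_triangle[of x0 z y] by simp
    qed
    have claim1: "\<exists>h \<Phi>. 0 < h \<and> h \<le> \<eta> \<and> h \<le> t L \<and> mollifier h \<Phi> \<and> (\<forall>y\<in>ball x0 (R / 2). L2n y (t L) (mollified_grad \<Phi> u) \<le> BB \<iota>)"
      if iota: "0 < \<iota>" and eta: "0 < \<eta>" for \<iota> \<eta> L
    proof -
      \<comment> \<open>Sized so that the commutator errors of all \<open>L\<close> radii together
        stay below \<open>\<iota>\<close>; the factor with \<open>t L\<close> is the largest of
        them. The kernel width \<open>h\<close> is fixed only after this.\<close>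
      define \<delta> where "\<delta> = \<iota> / ((real L + 1) * (sqrt (M2 / t L ^ ?d) + 1))"
      have sq0: "0 \<le> sqrt (M2 / t L ^ ?d)" using M2 t[of L] by simp
      have del: "0 < \<delta>" unfolding \<delta>_def using iota sq0 by (intro divide_pos_pos mult_pos_pos add_nonneg_pos) auto
      obtain d0 where d0: "0 < d0" and D0: "\<And>x z \<xi>. norm z < d0 \<Longrightarrow> norm (a (x + z) \<xi> - a x \<xi>) \<le> \<delta> * norm \<xi>"
        using uc del by blast
      define h where "h = min (d0 / 2) (min (t L) \<eta>)"
      have h: "0 < h" "h < d0" "h \<le> t L" "h \<le> \<eta>" unfolding h_def using d0 t[of L] eta by auto
      obtain \<Phi> :: "('d \<Rightarrow> nat) \<Rightarrow> real^'d \<Rightarrow> real" where mo: "mollifier h \<Phi>"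
        using mollifier_exists[OF h(1)] unfolding mollifier_def by blast
      note M = mollifierD[OF mo]
      define mk where "mk = (\<lambda>k. ((Fp + \<iota>) / (2 * t k) ^ ?d) powr (1 / p))"
      have mk: "0 < mk k" "mk k powr p * (2 * t k) ^ ?d = Fp + \<iota>" for k
        unfolding mk_def using Fp iota t[of k] p0 by (auto simp: powr_powr)
      define F where "F = (\<lambda>k. Cf * mk k * (2 * t k))"
      have F0: "0 \<le> F k" for k unfolding F_def using Cf mk(1)[of k] t[of k] by simp
      define K where "K = (\<lambda>k. 2 ^ ?d * F k + \<delta> * sqrt (M2 / t k ^ ?d))"
      have K0: "0 \<le> K k" for k unfolding K_def using F0[of k] del M2 t[of k] by simp
      have sol: "Sol a y (t k) (K k) (mollified_grad \<Phi> u)" if y: "y \<in> ball x0 (R / 2)" and k: "k \<le> L" for y k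
        unfolding K_def M2_def
      proof (rule mollified_Sol[OF mo wd ell La h(1)])
        show "h \<le> t k" using h(3) tmono[OF k] by linarith
        show "cball y (2 * t k) \<subseteq> ball x0 (3 * R / 4)" by (rule inU[OF y]) (use t16[of k] in linarith)
        show "0 \<le> \<delta>" using del by simp
        show "norm (a (x + z) \<xi> - a x \<xi>) \<le> \<delta> * norm \<xi>" if "norm z \<le> h" for x z \<xi> by (rule D0) (use that h in linarith)
        show "0 \<le> F k" by (rule F0)
        fix v :: "real^'d \<Rightarrow> real" and Dv assume v: "C1 v Dv" "\<And>x. x \<notin> cball y (2 * t k) \<Longrightarrow> v x = 0"
        have le: "(LINT x:cball y (2 * t k)|lborel. \<bar>f x\<bar> powr p) \<le> mk k powr p * (2 * t k) ^ ?d"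
        proof -
          have "(LINT x:cball y (2 * t k)|lborel. \<bar>f x\<bar> powr p) \<le> Fp"
            unfolding Fp_def set_lebesgue_integral_def
            by (rule Bochner_Integration.integral_mono[OF integrable_mult_indicator[OF _ fp] fp]) (auto simp: indicator_def)
          then show ?thesis using mk(2)[of k] iota by linarith
        qed
        have "\<bar>LINT x:cball y (2 * t k)|lborel. f x * v x\<bar> \<le> Cf * mk k * (2 * t k) * (2 * t k) ^ ?d * L2n y (2 * t k) Dv"
          by (rule Hf[OF fp fm mk(1) _ le v(1)]) (use t[of k] v(2) in auto)
        then show "\<bar>LINT x:cball y (2 * t k)|lborel. f x * v x\<bar> \<le> F k * (2 * t k) ^ ?d * L2n y (2 * t k) Dv"
          unfolding F_def .
      qed
      have sumK: "(\<Sum>k<L. K k) \<le> 2 ^ ?d * Cf * Q * (R * ((Fp + \<iota>) / R ^ ?d) powr (1 / p)) + \<iota>"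
      proof -
        have 1: "(\<Sum>k<L. \<delta> * sqrt (M2 / t k ^ ?d)) \<le> \<iota>"
        proof -
          have "(\<Sum>k<L. \<delta> * sqrt (M2 / t k ^ ?d)) \<le> (\<Sum>k<L. \<delta> * (sqrt (M2 / t L ^ ?d) + 1))"
          proof (intro sum_mono mult_left_mono)
            fix k assume "k \<in> {..<L}"
            then have "sqrt (M2 / t k ^ ?d) \<le> sqrt (M2 / t L ^ ?d)"
              using M2 t tmono[of k L] by (intro real_sqrt_le_mono divide_left_mono power_mono) (auto simp: less_imp_le)
            then show "sqrt (M2 / t k ^ ?d) \<le> sqrt (M2 / t L ^ ?d) + 1" by linarith
          qed (use del in auto)
          also have "\<dots> = real L * (\<iota> / (real L + 1))"
          proof -
            have "\<iota> / (a * b) * b = \<iota> / a" if "b \<noteq> 0" for a b :: real using that by simp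
            moreover have "sqrt (M2 / t L ^ ?d) + 1 \<noteq> 0" using sq0 by linarith
            ultimately show ?thesis unfolding \<delta>_def by simp
          qed
          also have "\<dots> \<le> \<iota>" using iota by (simp add: field_simps)
          finally show ?thesis .
        qed
        have Fk: "F k \<le> Cf * (R * ((Fp + \<iota>) / R ^ ?d) powr (1 / p)) * r ^ k" for k
        proof -
          have tk: "0 < 2 * t k" using t[of k] by simp
          have "mk k * (2 * t k) = (Fp + \<iota>) powr (1 / p) * (2 * t k) powr q"
          proof -
            have "mk k = (Fp + \<iota>) powr (1 / p) / ((2 * t k) powr real ?d) powr (1 / p)"
              unfolding mk_def using Fp iota tk by (simp add: powr_divide powr_realpow)
            also have "((2 * t k) powr real ?d) powr (1 / p) = (2 * t k) powr (real ?d / p)" by (simp add: powr_powr)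
            finally have "mk k * (2 * t k) = (Fp + \<iota>) powr (1 / p) * ((2 * t k) powr 1 / (2 * t k) powr (real ?d / p))" using tk by simp
            also have "(2 * t k) powr 1 / (2 * t k) powr (real ?d / p) = (2 * t k) powr q" unfolding q_def by (rule powr_diff[symmetric])
            finally show ?thesis .
          qed
          also have "(2 * t k) powr q \<le> R powr q * r ^ k"
          proof -
            have "(2 * t k) = (R / 8) * N powr (- real k)" unfolding t_def using N by (simp add: powr_minus_divide powr_realpow)
            then have "(2 * t k) powr q = (R / 8 * N powr (- real k)) powr q" by (rule arg_cong)
            also have "\<dots> = (R / 8) powr q * (N powr (- real k)) powr q" by (rule powr_mult)
            finally have "(2 * t k) powr q = (R / 8) powr q * (N powr (- real k)) powr q" .
            also have "(N powr (- real k)) powr q = r ^ k"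
              unfolding r_def using N by (simp add: powr_powr powr_realpow[symmetric] mult.commute)
            also have "(R / 8) powr q * r ^ k \<le> R powr q * r ^ k" using R q r by (intro mult_right_mono powr_mono2) auto
            finally show ?thesis .
          qed
          finally have "mk k * (2 * t k) \<le> (Fp + \<iota>) powr (1 / p) * (R powr q * r ^ k)" by (simp add: mult_left_mono)
          also have "(Fp + \<iota>) powr (1 / p) * (R powr q * r ^ k) = (R * ((Fp + \<iota>) / R ^ ?d) powr (1 / p)) * r ^ k"
          proof -
            have "((Fp + \<iota>) / R ^ ?d) powr (1 / p) = (Fp + \<iota>) powr (1 / p) / R powr (real ?d / p)"
              using Fp iota R by (simp add: powr_divide powr_realpow[symmetric] powr_powr)
            moreover have "R powr q = R / R powr (real ?d / p)" unfolding q_def using R by (simp add: powr_diff)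
            ultimately show ?thesis by simp
          qed
          finally show ?thesis unfolding F_def using Cf by (simp add: mult.assoc mult_left_mono)
        qed
        have X0: "0 \<le> R * ((Fp + \<iota>) / R ^ ?d) powr (1 / p)" using R by simp
        have "(\<Sum>k<L. F k) \<le> (\<Sum>k<L. Cf * (R * ((Fp + \<iota>) / R ^ ?d) powr (1 / p)) * r ^ k)" by (intro sum_mono Fk)
        also have "\<dots> = Cf * (R * ((Fp + \<iota>) / R ^ ?d) powr (1 / p)) * (\<Sum>k<L. r ^ k)" by (simp add: sum_distrib_left)
        also have "(\<Sum>k<L. r ^ k) \<le> Q"
        proof -
          have "(\<Sum>k<L. r ^ k) \<le> (\<Sum>k. r ^ k)" using r by (intro sum_le_suminf summable_geometric) auto
          then show ?thesis unfolding Q_def using suminf_geometric[of r] r by simp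
        qed
        finally have 2: "(\<Sum>k<L. F k) \<le> Cf * (R * ((Fp + \<iota>) / R ^ ?d) powr (1 / p)) * Q" using Cf X0 by (simp add: mult_left_mono)
        have "(\<Sum>k<L. K k) = 2 ^ ?d * (\<Sum>k<L. F k) + (\<Sum>k<L. \<delta> * sqrt (M2 / t k ^ ?d))"
          unfolding K_def by (simp add: sum.distrib sum_distrib_left)
        also have "\<dots> \<le> 2 ^ ?d * (Cf * (R * ((Fp + \<iota>) / R ^ ?d) powr (1 / p)) * Q) + \<iota>"
          by (intro add_mono 1 mult_left_mono 2) auto
        finally show ?thesis by (simp add: mult_ac)
      qed
      have "L2n y (t L) (mollified_grad \<Phi> u) \<le> BB \<iota>" if y: "y \<in> ball x0 (R / 2)" for y
      proof -
        have init: "L2n y (t 0) (mollified_grad \<Phi> u) \<le> 4 ^ ?d * A1"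
        proof -
          have "L2n y (t 0) (mollified_grad \<Phi> u) = L2n y (t 0) (conv (base \<Phi>) G)"
          proof (rule L2n_cong)
            fix x assume x: "x \<in> cball y (t 0)"
            have "cball x h \<subseteq> cball y (R / 8)"
            proof
              fix z assume "z \<in> cball x h"
              then show "z \<in> cball y (R / 8)" using x h(3) t16[of L] t16[of 0] dist_triangle[of y z x] by simp
            qed
            then have "cball x h \<subseteq> ball x0 (3 * R / 4)" using inU[OF y, of "R / 8"] by auto
            then show "norm (mollified_grad \<Phi> u x) = norm (conv (base \<Phi>) G x)"
              using mollified_grad_eq[OF mo wd] by simp
          qed
          also have "\<dots> \<le> sqrt (M2 / t 0 ^ ?d)"
          proof -
            have "sq_int y (t 0) (conv (base \<Phi>) G) \<le> M2"
              unfolding M2_def by (rule sq_int_conv_le(2)[OF M(6) M(2) M(3) M(5) G G2])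
            then show ?thesis unfolding L2n_def d using t[of 0] by (simp add: divide_right_mono)
          qed
          also have "M2 / t 0 ^ ?d = (4 ^ ?d)\<^sup>2 * (M2 / R ^ ?d)"
          proof -
            have "((4::real) ^ ?d)\<^sup>2 = 16 ^ ?d" by (simp add: power2_eq_square power_mult_distrib[symmetric])
            then show ?thesis unfolding t_def using R by (simp add: power_divide)
          qed
          also have "sqrt \<dots> = 4 ^ ?d * A1"
            unfolding A1_def real_sqrt_mult[of "(4 ^ ?d)\<^sup>2"] by simp
          finally show ?thesis .
        qed
        have t0t: "t 0 / real m ^ k = t k" for k unfolding t_def N_def by simp
        have "L2n y (t 0 / real m ^ L) (mollified_grad \<Phi> u) \<le> C0 * exp (C0 * (\<Sum>k<L. \<omega> k + e k / (t 0 / real m ^ k))) * (L2n y (t 0) (mollified_grad \<Phi> u) + (\<Sum>k<L. K k))"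
        proof (rule H[OF ell C1_mollified[OF mo u] t])
          show "\<forall>k<L. Sol a y (t 0 / real m ^ k) (K k) (mollified_grad \<Phi> u) \<and> almost_periodic a y (t 0 / real m ^ k) (\<omega> k) (e k) \<and> 0 \<le> K k \<and> 0 \<le> \<omega> k \<and> 0 \<le> e k"
            unfolding t0t using sol[OF y] ap y oe K0 unfolding t_def by auto
        qed
        also have "\<dots> \<le> C0 * exp (C0 * S) * (4 ^ ?d * A1 + (2 ^ ?d * Cf * Q * (R * ((Fp + \<iota>) / R ^ ?d) powr (1 / p)) + \<iota>))"
        proof (intro mult_mono add_mono init sumK order_refl)
          have "(\<Sum>k<L. \<omega> k + e k / (t 0 / real m ^ k)) \<le> S" unfolding t0t using S unfolding t_def by blast
          then show "exp (C0 * (\<Sum>k<L. \<omega> k + e k / (t 0 / real m ^ k))) \<le> exp (C0 * S)" using C0 by simp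
          show "0 \<le> L2n y (t 0) (mollified_grad \<Phi> u) + (\<Sum>k<L. K k)"
            using t[of 0] K0 by (intro add_nonneg_nonneg L2n_nonneg sum_nonneg) auto
        qed (use C0 in auto)
        finally show ?thesis unfolding t0t BB_def by (simp add: add.assoc)
      qed
      then show ?thesis using h mo by blast
    qed
    have claim2: "AE x in lborel. x \<in> ball x0 (R / 2) \<longrightarrow> s * G x $ j \<le> BB \<iota> / sqrt w"
      if iota: "0 < \<iota>" and s: "\<bar>s\<bar> = 1" for \<iota> s j
    proof (rule AE_le_from_test)
      let ?O = "ball x0 (R / 2)"
      define g where "g = (\<lambda>x. s * G x $ j)"
      have gi: "integrable lborel g"
        unfolding g_def using integrable_bounded_linear[OF bounded_linear_vec_nth[of j] G] by simp
      then show "integrable lborel (\<lambda>x. s * G x $ j)" unfolding g_def .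
      show "open ?O" "bounded ?O" by auto
      have BB0: "0 \<le> BB \<iota>" unfolding BB_def using C0 A1 Cf Q R iota by (intro mult_nonneg_nonneg add_nonneg_nonneg) auto
      then show B0: "0 \<le> BB \<iota> / sqrt w" using w by simp
      fix v :: "real^'d \<Rightarrow> real" assume cv: "continuous_on UNIV v" and v0: "\<And>x. 0 \<le> v x" and vz: "\<And>x. x \<notin> ?O \<Longrightarrow> v x = 0"
      have vz': "v x = 0" if "x \<notin> cball x0 (R / 2)" for x by (rule vz) (use that in auto)
      have iv: "integrable lborel v" by (rule integrable_compact_support[OF cv vz'])
      obtain Bv where Bv: "\<And>x. norm (v x) \<le> Bv" using bounded_compact_support[OF cv vz'] by blast
      define I where "I = (LINT x|lborel. \<bar>g x\<bar>)"
      have I0: "0 \<le> I" unfolding I_def by (rule Bochner_Integration.integral_nonneg) simp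
      have "(LINT x|lborel. g x * v x) \<le> BB \<iota> / sqrt w * (LINT x|lborel. v x) + \<eta>" if eta: "0 < \<eta>" for \<eta>
      proof -
        define \<epsilon> where "\<epsilon> = \<eta> / (2 * (I + 1))"
        have eps: "0 < \<epsilon>" "2 * \<epsilon> * I \<le> \<eta>" unfolding \<epsilon>_def using eta I0 by (auto simp: field_simps)
        obtain dv where dv: "0 < dv" and DV: "\<And>x k. norm k < dv \<Longrightarrow> norm (v (x + k) - v x) < \<epsilon>"
          using uniformly_continuous_compact_support[OF cv vz' eps(1)] by blast
        obtain L where L: "t L < dv"
        proof -
          obtain L where "(1 / N) ^ L < dv / R" using real_arch_pow_inv[of "dv / R" "1 / N"] dv R N by auto
          then have "R / N ^ L < dv" using R N by (simp add: power_divide field_simps)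
          moreover have "t L \<le> R / N ^ L" unfolding t_def using R N by (intro divide_right_mono) auto
          ultimately show ?thesis using that[of L] by linarith
        qed
        obtain h \<Phi> where h: "0 < h" "h \<le> dv / 2" "h \<le> t L" and mo: "mollifier h \<Phi>"
          and bd: "\<And>y. y \<in> ?O \<Longrightarrow> L2n y (t L) (mollified_grad \<Phi> u) \<le> BB \<iota>"
          using claim1[OF iota, of "dv / 2" L] dv by auto
        note M = mollifierD[OF mo] and Kt = ball_kernel[OF t[of L], where 'a="real^'d"]
        let ?k = "base \<Phi>" and ?kt = "ball_kernel (t L) :: real^'d \<Rightarrow> real"
        obtain B where B: "\<And>x. norm (?k x) \<le> B" using M(8) by blast
        have mb: "?k \<in> borel_measurable borel" by (rule borel_measurable_continuous_onI[OF M(6)])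
        have ikv: "integrable lborel (conv ?kt v)" by (rule integrable_conv[OF Kt(1) iv])
        have close1: "\<bar>conv ?kt v x - v x\<bar> \<le> \<epsilon>" for x
        proof (rule conv_close[OF Kt(1) Kt(2) Kt(3) Kt(4) Kt(5) iv])
          fix x z :: "real^'d" assume "norm z \<le> t L"
          then show "\<bar>v (x + z) - v x\<bar> \<le> \<epsilon>" using DV[of z x] L by simp
        qed
        have kvb: "norm (conv ?kt v x) \<le> Bv + \<epsilon>" for x
          using close1[of x] Bv[of x] by simp
        \<comment> \<open>Averaging and mollification are both applied to the test function; by
          self-adjointness they then act on \<open>g\<close>, where the bound of the iteration is
          available.\<close>
        define W where "W = conv ?k (conv ?kt v)"
        have iW: "integrable lborel W" unfolding W_def by (rule integrable_conv[OF M(7) ikv])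
        have close2: "\<bar>W x - v x\<bar> \<le> 2 * \<epsilon>" for x
          unfolding W_def
        proof (rule conv_close[OF M(7) M(3) M(5) M(2) B ikv])
          fix x z :: "real^'d" assume "norm z \<le> h"
          then have "\<bar>v (x + z) - v x\<bar> < \<epsilon>" using DV[of z x] h dv by simp
          then show "\<bar>conv ?kt v (x + z) - v x\<bar> \<le> 2 * \<epsilon>" using close1[of "x + z"] by linarith
        qed
        have mW: "W \<in> borel_measurable borel" and mg: "g \<in> borel_measurable borel" and mv: "v \<in> borel_measurable borel"
          using borel_measurable_integrable[OF iW] borel_measurable_integrable[OF gi] borel_measurable_integrable[OF iv] by auto
        have igb: "integrable lborel (\<lambda>x. g x * F x)" if "F \<in> borel_measurable borel" "\<And>x. \<bar>F x\<bar> \<le> b" for F b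
        proof (rule Bochner_Integration.integrable_bound[OF integrable_mult_right[OF gi, of b]])
          show "(\<lambda>x. g x * F x) \<in> borel_measurable lborel" using that mg by measurable
          have "0 \<le> b" using that(2)[of 0] by linarith
          then show "AE x in lborel. norm (g x * F x) \<le> norm (b * g x)"
            using that(2) by (auto intro!: AE_I2 simp: abs_mult mult.commute[of b] intro: mult_left_mono)
        qed
        have igv: "integrable lborel (\<lambda>x. g x * v x)" by (rule igb[OF mv, of Bv]) (use Bv in auto)
        have igW: "integrable lborel (\<lambda>x. g x * W x)"
        proof (rule igb[OF mW])
          show "\<bar>W x\<bar> \<le> Bv + 2 * \<epsilon>" for x using close2[of x] Bv[of x] by simp
        qed
        have "(LINT x|lborel. g x * v x) - (LINT x|lborel. g x * W x) = (LINT x|lborel. g x * v x - g x * W x)"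
          using igv igW by simp
        also have "\<dots> \<le> (LINT x|lborel. (2 * \<epsilon>) * \<bar>g x\<bar>)"
        proof (rule Bochner_Integration.integral_mono)
          fix x
          have "g x * v x - g x * W x \<le> \<bar>g x\<bar> * \<bar>W x - v x\<bar>"
            by (metis abs_ge_self abs_minus_commute abs_mult right_diff_distrib)
          also have "\<dots> \<le> \<bar>g x\<bar> * (2 * \<epsilon>)" by (intro mult_left_mono close2) auto
          finally show "g x * v x - g x * W x \<le> 2 * \<epsilon> * \<bar>g x\<bar>" by (simp add: mult.commute)
        qed (use igv igW gi in auto)
        also have "\<dots> = 2 * \<epsilon> * I" unfolding I_def by simp
        finally have 1: "(LINT x|lborel. g x * v x) \<le> (LINT x|lborel. g x * W x) + \<eta>" using eps by linarith
        have ikg: "integrable lborel (conv ?k g)" by (rule integrable_conv[OF M(7) gi])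
        have "(LINT x|lborel. g x * W x) = (LINT x|lborel. conv ?k g x \<bullet> conv ?kt v x)"
          unfolding W_def using integral_conv_inner[OF M(7) B M(4) gi ikv kvb] by simp
        also have "\<dots> = (LINT x|lborel. conv ?kt (conv ?k g) x \<bullet> v x)"
          by (rule integral_conv_inner[OF Kt(1) Kt(5) Kt(6) ikg iv Bv, symmetric])
        also have "\<dots> \<le> (LINT x|lborel. (BB \<iota> / sqrt w) * v x)"
        proof (rule Bochner_Integration.integral_mono)
          show "integrable lborel (\<lambda>x. conv ?kt (conv ?k g) x \<bullet> v x)"
          proof (rule Bochner_Integration.integrable_bound[OF integrable_mult_right[OF integrable_conv[OF Kt(1) ikg], of Bv]])
            show "(\<lambda>x. conv ?kt (conv ?k g) x \<bullet> v x) \<in> borel_measurable lborel"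
              using borel_measurable_integrable[OF integrable_conv[OF Kt(1) ikg]] mv by measurable
            have "0 \<le> Bv" using Bv[of 0] by (meson norm_ge_zero order_trans)
            then show "AE x in lborel. norm (conv ?kt (conv ?k g) x \<bullet> v x) \<le> norm (Bv * conv ?kt (conv ?k g) x)"
              using Bv by (auto intro!: AE_I2 simp: abs_mult mult.commute[of Bv] intro: mult_left_mono)
          qed
          show "integrable lborel (\<lambda>x. BB \<iota> / sqrt w * v x)" using iv by simp
          fix x
          show "conv ?kt (conv ?k g) x \<bullet> v x \<le> BB \<iota> / sqrt w * v x"
          proof (cases "x \<in> ?O")
            case True
            define H where "H = (\<lambda>z. s * mollified_grad \<Phi> u z $ j)"
            have cDu: "continuous_on UNIV (mollified_grad \<Phi> u)" by (rule C1_continuous(2)[OF C1_mollified[OF mo u]])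
            have cH: "continuous_on UNIV H" unfolding H_def by (intro continuous_intros cDu)
            have "conv ?kt (conv ?k g) x = avg x (t L) (conv ?k g)" by (rule Kt(7))
            also have "\<dots> = avg x (t L) H"
              unfolding avg_def
            proof (intro arg_cong2[where f="(/)"] set_lebesgue_integral_cong refl allI impI)
              fix z assume z: "z \<in> cball x (t L)"
              have "cball z h \<subseteq> cball x (R / 8)"
              proof
                fix z' assume "z' \<in> cball z h"
                then show "z' \<in> cball x (R / 8)" using z h(3) t16[of L] dist_triangle[of x z' z] by simp
              qed
              then have "cball z h \<subseteq> ball x0 (3 * R / 4)" using inU[OF True, of "R / 8"] by auto
              then show "conv ?k g z = H z"
                unfolding g_def H_def conv_vec_nth[OF mb B G] using mollified_grad_eq[OF mo wd] by simp
            qed simp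
            also have "\<dots> \<le> BB \<iota> / sqrt w"
            proof -
              \<comment> \<open>Cauchy-Schwarz passes from the mean-square norm to the average; the
                two normalisations differ by the volume \<open>w\<close>.\<close>
              have "(avg x (t L) H)\<^sup>2 \<le> sq_int x (t L) H / measure lborel (cball x (t L))"
                by (rule avg_sq_le[OF cH t])
              also have "\<dots> = (L2n x (t L) H)\<^sup>2 / w"
                using t[of L] by (simp add: L2n_sq measure_cball w_def d)
              also have "\<dots> \<le> (BB \<iota>)\<^sup>2 / w"
              proof (intro divide_right_mono power_mono)
                have "L2n x (t L) H \<le> L2n x (t L) (mollified_grad \<Phi> u)"
                  by (rule L2n_mono[OF cH cDu t]) (use s in \<open>simp add: H_def abs_mult component_le_norm_cart\<close>)
                then show "L2n x (t L) H \<le> BB \<iota>" using bd[OF True] by linarith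
              qed (use w t[of L] in \<open>auto intro: L2n_nonneg\<close>)
              also have "\<dots> = (BB \<iota> / sqrt w)\<^sup>2" using w by (simp add: power_divide)
              finally show ?thesis by (rule power2_le_imp_le[OF _ B0])
            qed
            finally show ?thesis unfolding inner_real_def by (rule mult_right_mono[OF _ v0])
          qed (use vz in simp)
        qed
        also have "\<dots> = BB \<iota> / sqrt w * (LINT x|lborel. v x)" by simp
        finally show ?thesis using 1 by linarith
      qed
      then show "(LINT x|lborel. (s * G x $ j) * v x) \<le> BB \<iota> / sqrt w * (LINT x|lborel. v x)"
        unfolding g_def by (rule field_le_epsilon)
    qed
    have claim3: "AE x in lborel. x \<in> ball x0 (R / 2) \<longrightarrow> norm (G x) \<le> real ?d * (BB \<iota> / sqrt w)" if iota: "0 < \<iota>" for \<iota>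
    proof -
      have "AE x in lborel. \<forall>j. (x \<in> ball x0 (R / 2) \<longrightarrow> 1 * G x $ j \<le> BB \<iota> / sqrt w) \<and> (x \<in> ball x0 (R / 2) \<longrightarrow> (-1) * G x $ j \<le> BB \<iota> / sqrt w)"
        using claim2[OF iota, of 1] claim2[OF iota, of "-1"] by (auto simp: AE_all_countable)
      then show ?thesis
      proof eventually_elim
        case (elim x)
        show ?case
        proof
          assume x: "x \<in> ball x0 (R / 2)"
          have "norm (G x) \<le> (\<Sum>j\<in>UNIV. \<bar>G x $ j\<bar>)" by (rule norm_le_l1_cart)
          also have "\<dots> \<le> (\<Sum>j\<in>(UNIV::'d set). BB \<iota> / sqrt w)"
          proof (rule sum_mono)
            fix j show "\<bar>G x $ j\<bar> \<le> BB \<iota> / sqrt w" using elim[rule_format, of j] x by auto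
          qed
          finally show "norm (G x) \<le> real ?d * (BB \<iota> / sqrt w)" by simp
        qed
      qed
    qed
    define T where "T = A1 + R * (Fp / R ^ ?d) powr (1 / p)"
    have T0: "0 \<le> T" "A1 \<le> T" unfolding T_def using A1 R by auto
    show ?thesis
    proof (cases "T = 0")
      \<comment> \<open>The slack has to be proportional to the desired bound, so a vanishing bound
        is separate; then the mean square of \<open>G\<close> is zero.\<close>
      case True
      then have "M2 = 0" using A1 T0 unfolding A1_def using R by simp
      then have "AE x in lborel. (norm (G x))\<^sup>2 = 0"
        using integral_nonneg_eq_0_iff_AE[OF G2] unfolding M2_def by simp
      then show ?thesis
      proof eventually_elim
        case (elim x)
        have "0 \<le> C * exp (C * S) * T" using CC T0 by simp
        then show ?case using elim unfolding T_def A1_def M2_def Fp_def by simp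
      qed
    next
      case False
      then have T: "0 < T" using T0 by simp
      \<comment> \<open>The first bound pays for the commutators; the second keeps the p-mean of
        \<open>f\<close>, enlarged by the slack, within \<open>2 * T\<close>.\<close>
      define \<iota> where "\<iota> = min T (R ^ ?d * (T / R) powr p)"
      have iota: "0 < \<iota>" "\<iota> \<le> T" unfolding \<iota>_def using T R by auto
      have pw: "R * ((Fp + \<iota>) / R ^ ?d) powr (1 / p) \<le> 2 * T"
      proof -
        have "(Fp / R ^ ?d) powr (1 / p) \<le> T / R" unfolding T_def using R A1 by (simp add: field_simps)
        then have "((Fp / R ^ ?d) powr (1 / p)) powr p \<le> (T / R) powr p" using p0 by (intro powr_mono2) auto
        then have "Fp / R ^ ?d \<le> (T / R) powr p" using p0 Fp R by (simp add: powr_powr)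
        moreover have "\<iota> / R ^ ?d \<le> (T / R) powr p" using R unfolding \<iota>_def by (simp add: field_simps)
        ultimately have "(Fp + \<iota>) / R ^ ?d \<le> 2 * (T / R) powr p" by (simp add: add_divide_distrib)
        then have "((Fp + \<iota>) / R ^ ?d) powr (1 / p) \<le> (2 * (T / R) powr p) powr (1 / p)"
          using p0 Fp iota R by (intro powr_mono2) auto
        also have "\<dots> = 2 powr (1 / p) * (T / R)" using p0 T R by (simp add: powr_mult powr_powr)
        also have "\<dots> \<le> 2 * (T / R)"
        proof (rule mult_right_mono)
          have "(2::real) powr (1 / p) \<le> 2 powr 1" using p0 by (intro powr_mono) auto
          then show "(2::real) powr (1 / p) \<le> 2" by simp
        qed (use T R in auto)
        finally show ?thesis using R by (simp add: field_simps)
      qed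
      have BBle: "real ?d * (BB \<iota> / sqrt w) \<le> C * exp (C * S) * T"
      proof -
        have "4 ^ ?d * A1 + 2 ^ ?d * Cf * Q * (R * ((Fp + \<iota>) / R ^ ?d) powr (1 / p)) + \<iota> \<le> 4 ^ ?d * T + 2 ^ ?d * Cf * Q * (2 * T) + T"
          using T0 iota Cf Q by (intro add_mono mult_left_mono pw) auto
        also have "\<dots> = E * T" unfolding E_def by (simp add: algebra_simps)
        finally have "BB \<iota> \<le> C0 * exp (C0 * S) * (E * T)" unfolding BB_def using C0 by (intro mult_left_mono) auto
        then have "real ?d * (BB \<iota> / sqrt w) \<le> real ?d * ((C0 * exp (C0 * S) * (E * T)) / sqrt w)"
          using w by (intro mult_left_mono divide_right_mono) auto
        also have "\<dots> = (real ?d / sqrt w * C0 * E) * exp (C0 * S) * T" by simp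
        also have "\<dots> \<le> C * exp (C * S) * T"
          using CC T0 S0 by (intro mult_right_mono mult_mono) (auto intro: mult_right_mono)
        finally show ?thesis .
      qed
      show ?thesis using claim3[OF iota(1)]
      proof eventually_elim
        case (elim x)
        then show ?case using BBle unfolding T_def A1_def M2_def Fp_def by linarith
      qed
    qed
  qed
  then show ?thesis using m CC(3) unfolding N_def by blast
qed

subsection \<open>Summation over the scales\<close>

lemma scales_antimono: "scales eps \<Longrightarrow> j \<le> k \<Longrightarrow> eps k \<le> eps j"
  unfolding scales_def by (metis decseq_Suc_iff decseqD less_imp_le)

lemma scalesD: assumes "scales eps" shows "eps 0 = 1" "0 < eps n" "eps n \<le> 1"
  using assms scales_antimono[OF assms, of 0 n] unfolding scales_def by auto

lemma scale_index_exists: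
  assumes sc: "scales eps" and t: "0 < t" "t \<le> 1"
  shows "\<exists>k. eps (Suc k) < t \<and> t \<le> eps k"
proof -
  have "\<forall>\<^sub>F n in sequentially. eps n < t" using sc t unfolding scales_def by (auto intro: order_tendstoD)
  then obtain n where n: "eps n < t" by (auto simp: eventually_sequentially)
  define q where "q = (LEAST n. eps n < t)"
  have q: "eps q < t" unfolding q_def using n by (rule LeastI)
  have "q \<noteq> 0" using q scalesD(1)[OF sc] t by (metis not_less)
  then obtain k where k: "q = Suc k" by (cases q) auto
  have "\<not> eps k < t" using k unfolding q_def by (metis lessI not_less_Least)
  then show ?thesis using q k by auto
qed

text \<open>Every ratio is compared with the first one, which is \<open>eps 1\<close> because
  \<open>eps 0 = 1\<close>; taking powers and roots inverts the two inequalities of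
  \<open>ratio_cond\<close>.\<close>

lemma ratio_bounds:
  assumes sc: "scales eps" and rc: "ratio_cond eps N" and N: "1 \<le> N"
  shows "eps (Suc k) / eps k \<le> eps 1 powr (1 / N)" "eps 1 powr N \<le> eps (Suc k) / eps k"
proof -
  have e1: "0 < eps 1" "eps 1 \<le> 1" and e0: "eps 0 = 1" using scalesD[OF sc] by auto
  have r0: "0 < eps (Suc k) / eps k" using scalesD(2)[OF sc] by simp
  have "eps (Suc k) / eps k \<le> eps 1 powr (1 / N) \<and> eps 1 powr N \<le> eps (Suc k) / eps k"
  proof (cases "k = 0")
    case True
    have "eps 1 powr 1 \<le> eps 1 powr (1 / N)" "eps 1 powr N \<le> eps 1 powr 1"
      using e1 N by (intro powr_mono'; simp)+
    then show ?thesis using True e0 e1 unfolding One_nat_def by simp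
  next
    case False
    then have 1: "(eps (Suc k) / eps k) powr N \<le> eps 1" and 2: "eps 1 \<le> (eps (Suc k) / eps k) powr (1 / N)"
      using rc e0 unfolding ratio_cond_def by force+
    have "((eps (Suc k) / eps k) powr N) powr (1 / N) \<le> eps 1 powr (1 / N)" using 1 N by (intro powr_mono2) auto
    moreover have "eps 1 powr N \<le> ((eps (Suc k) / eps k) powr (1 / N)) powr N" using 2 N e1 by (intro powr_mono2) auto
    moreover have "((eps (Suc k) / eps k) powr N) powr (1 / N) = eps (Suc k) / eps k" "((eps (Suc k) / eps k) powr (1 / N)) powr N = eps (Suc k) / eps k"
      using scalesD(2)[OF sc, of k] scalesD(2)[OF sc, of "Suc k"] N by (auto simp: powr_powr)
    ultimately show ?thesis by simp
  qed
  then show "eps (Suc k) / eps k \<le> eps 1 powr (1 / N)" "eps 1 powr N \<le> eps (Suc k) / eps k" by auto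
qed

lemma sum_geometric_inj:
  fixes y :: real
  assumes y: "0 \<le> y" "y < 1" and I: "finite I" "inj_on g I"
  shows "(\<Sum>i\<in>I. y ^ g i) \<le> 1 / (1 - y)"
proof -
  have "(\<Sum>i\<in>I. y ^ g i) = (\<Sum>j\<in>g ` I. y ^ j)" using I(2) by (simp add: sum.reindex)
  also have "\<dots> \<le> (\<Sum>j. y ^ j)" using y I by (intro sum_le_suminf summable_geometric) auto
  finally show ?thesis using suminf_geometric[of y] y by simp
qed

text \<open>A minimum lies below every weighted geometric mean, which inherits part of the decay of
  both arguments.\<close>

lemma min_interpolate:
  fixes a b :: real
  assumes "0 \<le> a" "0 \<le> b" "0 < s" "s < 1"
  shows "min a b \<le> a powr (1 - s) * b powr s"
proof (cases "min a b = 0")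
  case False
  define c where "c = min a b"
  have c: "0 < c" "c \<le> a" "c \<le> b" unfolding c_def using assms False by auto
  have "c = c powr (1 - s) * c powr s" using c by (simp add: powr_add[symmetric])
  also have "\<dots> \<le> a powr (1 - s) * b powr s" using c assms by (intro mult_mono powr_mono2) auto
  finally show ?thesis unfolding c_def .
qed auto

text \<open>\<open>k i\<close> locates the radius \<open>t0 / real m ^ i\<close> among the scales:
  levels up to \<open>k i\<close> are slow, their scale being at least the radius, and all later
  levels are fast.\<close>

locale multiscale =
  fixes eps \<delta> :: "nat \<Rightarrow> real" and N \<rho> t0 :: real and m :: nat and k :: "nat \<Rightarrow> nat"
  assumes sc: "scales eps" and rc: "ratio_cond eps N" and N: "1 \<le> N" and rho: "0 < \<rho>"
    and m: "2 \<le> m" and t0: "0 < t0" "t0 \<le> 1"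
    and \<delta>: "\<And>l. 0 \<le> \<delta> l" "summable \<delta>" "summable (\<lambda>l. real l * \<delta> l)" "summable (\<lambda>l. real l powr (1 + \<rho>) * \<delta> l)"
    and k: "\<And>i. eps (Suc (k i)) < t0 / real m ^ i" "\<And>i. t0 / real m ^ i \<le> eps (k i)"
begin

definition "t i = t0 / real m ^ i"

text \<open>A shift of length \<open>t i\<close> moves the variable of level \<open>j\<close> by
  \<open>t i / eps j\<close>; the sum runs over the slow levels on which \<open>B l\<close>
  depends.\<close>

definition "slow l i = (\<Sum>j | j \<le> l \<and> j \<le> k i. t i / eps j)"

definition "r = eps 1 powr (1 / N)"

text \<open>Bound for the number of radii between two consecutive scales, proved in
  \<open>card_scale\<close>; \<open>ln 2\<close> is there because \<open>m\<close> is at least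
  2.\<close>

definition "L = 1 + N * ln (1 / eps 1) / ln 2"

lemma t_pos: "0 < t i" unfolding t_def using t0 m by simp

lemma k_t: "eps (Suc (k i)) < t i" "t i \<le> eps (k i)" using k unfolding t_def by auto

lemma t_ratio: assumes "a \<le> b" shows "t b \<le> t a / 2 ^ (b - a)"
proof -
  have "real m ^ b = real m ^ a * real m ^ (b - a)" using assms by (simp add: power_add[symmetric])
  then have "t b = t a / real m ^ (b - a)" unfolding t_def by simp
  also have "\<dots> \<le> t a / 2 ^ (b - a)" using t_pos[of a] m by (intro divide_left_mono power_mono mult_pos_pos) auto
  finally show ?thesis .
qed

lemma eps_pos: "0 < eps j" by (rule scalesD(2)[OF sc])

lemma slow_nonneg: "0 \<le> slow l i" unfolding slow_def using t_pos[of i] eps_pos by (intro sum_nonneg) (simp add: less_imp_le)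

lemma slow_le: "slow l i \<le> real l + 1"
proof -
  have "slow l i \<le> (\<Sum>j | j \<le> l \<and> j \<le> k i. 1)" unfolding slow_def
  proof (rule sum_mono)
    fix j assume "j \<in> {j. j \<le> l \<and> j \<le> k i}"
    then have "t i \<le> eps j" using k_t(2)[of i] scales_antimono[OF sc, of j "k i"] by simp
    then show "t i / eps j \<le> 1" using eps_pos[of j] by simp
  qed
  also have "\<dots> = real (card {j. j \<le> l \<and> j \<le> k i})" by simp
  also have "\<dots> \<le> real (card {..l})" by (intro of_nat_mono card_mono) auto
  finally show ?thesis by simp
qed

text \<open>For a fixed level the terms are at most 1 at the first radius where it is slow and decay
  geometrically from there; each of the \<open>l + 1\<close> levels gives at most 2, uniformly in
  \<open>n\<close>.\<close>

lemma sum_slow: "(\<Sum>i<n. slow l i) \<le> 2 * (real l + 1)"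
proof -
  have 1: "(\<Sum>i<n. if j \<le> k i then t i / eps j else 0) \<le> 2" for j
  proof -
    define I where "I = {i. i < n \<and> j \<le> k i}"
    have fin: "finite I" unfolding I_def by simp
    have "(\<Sum>i<n. if j \<le> k i then t i / eps j else 0) = (\<Sum>i\<in>I. t i / eps j)"
      unfolding I_def by (rule sum.mono_neutral_cong_right) auto
    also have "\<dots> \<le> 2"
    proof (cases "I = {}")
      case False
      define a where "a = Min I"
      have a: "a \<in> I" "\<And>i. i \<in> I \<Longrightarrow> a \<le> i" unfolding a_def using False fin by auto
      have ta: "t a \<le> eps j" using a(1) k_t(2)[of a] scales_antimono[OF sc, of j "k a"] unfolding I_def by simp
      have "(\<Sum>i\<in>I. t i / eps j) \<le> (\<Sum>i\<in>I. (1 / 2) ^ (i - a))"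
      proof (rule sum_mono)
        fix i assume i: "i \<in> I"
        have "t i \<le> eps j / 2 ^ (i - a)" using t_ratio[OF a(2)[OF i]] ta by (smt (verit) divide_right_mono zero_le_power)
        then show "t i / eps j \<le> (1 / 2) ^ (i - a)" using eps_pos[of j] by (simp add: field_simps power_divide)
      qed
      also have "\<dots> \<le> 1 / (1 - 1 / 2)"
      proof (rule sum_geometric_inj[OF _ _ fin])
        show "inj_on (\<lambda>i. i - a) I" using a(2) by (intro inj_onI) (metis eq_diff_iff)
      qed auto
      finally show ?thesis by simp
    qed simp
    finally show ?thesis .
  qed
  have s: "slow l i = (\<Sum>j\<le>l. if j \<le> k i then t i / eps j else 0)" for i
    unfolding slow_def by (rule sum.mono_neutral_cong_left) auto
  have "(\<Sum>i<n. slow l i) = (\<Sum>j\<le>l. \<Sum>i<n. if j \<le> k i then t i / eps j else 0)"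
    unfolding s by (rule sum.swap)
  also have "\<dots> \<le> (\<Sum>j\<le>l. 2)" by (intro sum_mono 1)
  finally show ?thesis by simp
qed

lemma L_ge: "1 \<le> L"
  unfolding L_def using scalesD(2,3)[OF sc, of 1] N by (auto intro!: divide_nonneg_pos mult_nonneg_nonneg ln_ge_zero)

text \<open>Inside one gap between scales every step at least halves the radius, while the gap as a
  whole spans a ratio that \<open>ratio_bounds\<close> keeps above
  \<open>eps 1 powr N\<close>.\<close>

lemma card_scale: "real (card {i. i < n \<and> k i = q}) \<le> L"
proof (cases "{i. i < n \<and> k i = q} = {}")
  case False
  define I where "I = {i. i < n \<and> k i = q}"
  have fin: "finite I" unfolding I_def by simp
  define a b where "a = Min I" and "b = Max I"
  have ab: "a \<in> I" "b \<in> I" "\<And>i. i \<in> I \<Longrightarrow> a \<le> i \<and> i \<le> b"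
    unfolding a_def b_def using Min_in[OF fin] Max_in[OF fin] False fin by (auto simp: I_def)
  have "card I \<le> card {a..b}" using ab(3) by (intro card_mono) auto
  then have cI: "real (card I) \<le> 1 + real (b - a)" using ab(3)[OF ab(1)] by simp
  have le: "t b \<le> t a / 2 ^ (b - a)" using ab by (intro t_ratio) auto
  have "eps (Suc q) < t b" "t a \<le> eps q" using k_t[of a] k_t[of b] ab unfolding I_def by auto
  then have "2 ^ (b - a) * eps (Suc q) \<le> 2 ^ (b - a) * t b" "t a \<le> eps q" by auto
  moreover have "2 ^ (b - a) * t b \<le> t a" using le by (simp add: field_simps)
  ultimately have "2 ^ (b - a) * eps (Suc q) \<le> eps q" by linarith
  then have "2 ^ (b - a) * (eps (Suc q) / eps q) \<le> 1" using eps_pos[of q] by (simp add: field_simps)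
  moreover have "2 ^ (b - a) * eps 1 powr N \<le> 2 ^ (b - a) * (eps (Suc q) / eps q)"
    by (intro mult_left_mono ratio_bounds(2)[OF sc rc N]) auto
  ultimately have "2 ^ (b - a) * eps 1 powr N \<le> 1" by linarith
  then have "ln (2 ^ (b - a) * eps 1 powr N) \<le> ln 1" using eps_pos[of 1] by (intro ln_mono) auto
  then have "real (b - a) * ln 2 + N * ln (eps 1) \<le> 0" using eps_pos[of 1] by (simp add: ln_mult ln_realpow ln_powr)
  then have "real (b - a) \<le> N * ln (1 / eps 1) / ln 2" using eps_pos[of 1] by (simp add: ln_div field_simps)
  then show ?thesis using cI unfolding L_def I_def by linarith
next
  case True
  show ?thesis unfolding True using L_ge by simp
qed

lemma sum_scales:
  assumes g: "\<And>q. 0 \<le> g q"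
  shows "(\<Sum>i<n. if k i < l then g (k i) else 0) \<le> L * (\<Sum>q<l. g q)"
proof -
  have "(\<Sum>i<n. if k i < l then g (k i) else 0) = (\<Sum>i<n. \<Sum>q<l. if k i = q then g q else 0)"
    by (intro sum.cong refl) auto
  also have "\<dots> = (\<Sum>q<l. \<Sum>i<n. if k i = q then g q else 0)" by (rule sum.swap)
  also have "\<dots> = (\<Sum>q<l. real (card {i. i < n \<and> k i = q}) * g q)"
  proof (rule sum.cong[OF refl])
    fix q
    have "(\<Sum>i<n. if k i = q then g q else 0) = (\<Sum>i\<in>{i. i < n \<and> k i = q}. g q)"
      by (rule sum.mono_neutral_cong_right) auto
    then show "(\<Sum>i<n. if k i = q then g q else 0) = real (card {i. i < n \<and> k i = q}) * g q" by simp
  qed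
  also have "\<dots> \<le> (\<Sum>q<l. L * g q)" by (intro sum_mono mult_right_mono card_scale g)
  finally show ?thesis by (simp add: sum_distrib_left)
qed

lemma summable_slow: "summable (\<lambda>l. \<delta> l * (C * slow l i + h l))" if "0 \<le> C" "\<And>l. 0 \<le> h l" "\<And>l. h l \<le> 2"
proof (rule summable_comparison_test'[of "\<lambda>l. (C + 2) * \<delta> l + C * (real l * \<delta> l)"])
  show "summable (\<lambda>l. (C + 2) * \<delta> l + C * (real l * \<delta> l))" by (intro summable_add summable_mult \<delta>)
  fix l
  have "C * slow l i + h l \<le> C * (real l + 1) + 2" using that slow_le[of l i] by (intro add_mono mult_left_mono) auto
  then have "\<delta> l * (C * slow l i + h l) \<le> \<delta> l * (C * (real l + 1) + 2)" using \<delta>(1) by (rule mult_left_mono)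
  then show "norm (\<delta> l * (C * slow l i + h l)) \<le> (C + 2) * \<delta> l + C * (real l * \<delta> l)"
    using that \<delta>(1)[of l] slow_nonneg[of l i] by (simp add: abs_of_nonneg algebra_simps)
qed

text \<open>Summing first over the radii and then over the levels.\<close>

lemma sum_modulus_le:
  assumes C: "0 \<le> C" and h: "\<And>l i. 0 \<le> h l i" "\<And>l i. h l i \<le> 2" and H: "\<And>l. (\<Sum>i<n. h l i) \<le> H * b l"
    and b: "summable (\<lambda>l. b l * \<delta> l)"
  shows "(\<Sum>i<n. \<Sum>l. \<delta> l * (C * slow l i + h l i)) \<le> 2 * C * ((\<Sum>l. \<delta> l) + (\<Sum>l. real l * \<delta> l)) + H * (\<Sum>l. b l * \<delta> l)"
proof -
  have sm: "summable (\<lambda>l. \<delta> l * (C * slow l i + h l i))" for i by (rule summable_slow[OF C h])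
  have "(\<Sum>i<n. \<Sum>l. \<delta> l * (C * slow l i + h l i)) = (\<Sum>l. \<Sum>i<n. \<delta> l * (C * slow l i + h l i))"
    by (rule suminf_sum[symmetric, OF sm])
  also have "\<dots> \<le> (\<Sum>l. 2 * C * (\<delta> l + real l * \<delta> l) + H * (b l * \<delta> l))"
  proof (rule suminf_le)
    fix l
    have "(\<Sum>i<n. \<delta> l * (C * slow l i + h l i)) = \<delta> l * (C * (\<Sum>i<n. slow l i) + (\<Sum>i<n. h l i))"
      unfolding sum_distrib_left[symmetric] sum.distrib ..
    also have "\<dots> \<le> \<delta> l * (C * (2 * (real l + 1)) + H * b l)"
      using C \<delta>(1) sum_slow H by (intro mult_left_mono add_mono) auto
    finally show "(\<Sum>i<n. \<delta> l * (C * slow l i + h l i)) \<le> 2 * C * (\<delta> l + real l * \<delta> l) + H * (b l * \<delta> l)"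
      by (simp add: algebra_simps)
  qed (intro summable_sum sm summable_add summable_mult \<delta> b)+
  also have "\<dots> = 2 * C * ((\<Sum>l. \<delta> l) + (\<Sum>l. real l * \<delta> l)) + H * (\<Sum>l. b l * \<delta> l)"
    using \<delta> b by (simp add: suminf_add[symmetric] suminf_mult summable_add summable_mult)
  finally show ?thesis .
qed

text \<open>With \<open>r\<close> bounded from below, \<open>L\<close> is at most
  \<open>1 + N\<^sup>2\<close>. Level \<open>l\<close> is fast only at radii in the first
  \<open>l\<close> gaps, which gives the weight \<open>real l\<close>.\<close>

lemma sum_modulus_large:
  assumes e1: "1 / 2 \<le> r" and C: "0 \<le> C"
  shows "(\<Sum>i<n. \<Sum>l. \<delta> l * (C * slow l i + (if k i < l then 2 else 0)))
    \<le> 2 * C * ((\<Sum>l. \<delta> l) + (\<Sum>l. real l * \<delta> l)) + 2 * (1 + N\<^sup>2) * (\<Sum>l. real l * \<delta> l)"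
proof (rule sum_modulus_le[OF C])
  fix l
  have "ln (1 / 2) \<le> ln r" using e1 by (intro ln_mono) auto
  also have "ln r = ln (eps 1) / N" unfolding r_def using eps_pos[of 1] by (simp add: ln_powr)
  finally have "ln (1 / eps 1) \<le> N * ln 2" using eps_pos[of 1] N by (simp add: ln_div field_simps)
  then have "N * ln (1 / eps 1) / ln 2 \<le> N * (N * ln 2) / ln 2" using N by (intro divide_right_mono mult_left_mono) auto
  then have L: "L \<le> 1 + N\<^sup>2" unfolding L_def by (simp add: power2_eq_square)
  have "(\<Sum>i<n. if k i < l then 2 else 0) \<le> L * (\<Sum>q<l. 2)" by (rule sum_scales[of "\<lambda>_. 2"]) simp
  also have "\<dots> \<le> (1 + N\<^sup>2) * (\<Sum>q<l. 2)" by (intro mult_right_mono L) auto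
  finally show "(\<Sum>i<n. if k i < l then 2 else 0) \<le> 2 * (1 + N\<^sup>2) * real l" by (simp add: algebra_simps)
qed (use \<delta> in auto)

text \<open>A logarithm against a positive power: \<open>ln y \<le> y powr s / s\<close> at
  \<open>y = 1 / r\<close>.\<close>

lemma L_r_bound:
  assumes s: "0 < s"
  shows "L * r powr s \<le> 1 + N\<^sup>2 / (s * ln 2)"
proof -
  have e1: "0 < eps 1" "eps 1 \<le> 1" using scalesD[OF sc] by auto
  have r: "0 < r" "r \<le> 1" unfolding r_def using e1 N by (auto intro: powr_le1)
  have lr: "ln (1 / eps 1) = N * ln (1 / r)" unfolding r_def using e1 N by (simp add: ln_div ln_powr)
  have "ln (1 / r) * r powr s \<le> 1 / s"
  proof -
    have "ln ((1 / r) powr s) \<le> (1 / r) powr s" using r ln_le_minus_one[of "(1 / r) powr s"] by simp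
    then have "s * ln (1 / r) \<le> (1 / r) powr s" using r by (simp add: ln_powr)
    then have "s * ln (1 / r) * r powr s \<le> (1 / r) powr s * r powr s" by (intro mult_right_mono) auto
    also have "\<dots> = 1" using r by (simp add: powr_mult[symmetric])
    finally show ?thesis using s by (simp add: field_simps)
  qed
  then have "N\<^sup>2 / ln 2 * (ln (1 / r) * r powr s) \<le> N\<^sup>2 / ln 2 * (1 / s)" by (intro mult_left_mono) auto
  moreover have "r powr s \<le> 1" using r s by (intro powr_le1) auto
  moreover have "L * r powr s = r powr s + N\<^sup>2 / ln 2 * (ln (1 / r) * r powr s)"
    unfolding L_def lr by (simp add: field_simps power2_eq_square)
  ultimately show ?thesis by (simp add: mult.commute)
qed

text \<open>The cost \<open>min 2 y\<close> of a rounded level is at most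
  \<open>2 * y powr s\<close> with \<open>s = min \<rho> 1\<close>. Its factor
  \<open>r powr s\<close> absorbs the count \<open>L\<close>; the powers of \<open>l\<close> that
  remain are at most \<open>real l powr (1 + \<rho>)\<close>.\<close>

lemma sum_modulus_small:
  assumes C: "1 \<le> C"
  shows "(\<Sum>i<n. \<Sum>l. \<delta> l * (C * slow l i + (if k i < l then min 2 (C * real (l - k i) * r) else 0)))
    \<le> 2 * C * ((\<Sum>l. \<delta> l) + (\<Sum>l. real l * \<delta> l)) + 2 * C * (1 + N\<^sup>2 / (min \<rho> 1 * ln 2)) * (\<Sum>l. real l powr (1 + \<rho>) * \<delta> l)"
proof (rule sum_modulus_le)
  define s where "s = min \<rho> 1"
  have s: "0 < s" "s \<le> 1" "s \<le> \<rho>" unfolding s_def using rho by auto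
  have r: "0 < r" unfolding r_def using eps_pos[of 1] by simp
  define K where "K = 1 + N\<^sup>2 / (s * ln 2)"
  fix l
  have "(\<Sum>i<n. if k i < l then min 2 (C * real (l - k i) * r) else 0) \<le> L * (\<Sum>q<l. min 2 (C * real (l - q) * r))"
    by (rule sum_scales) (use C r in auto)
  also have "\<dots> \<le> L * (\<Sum>q<l. 2 * C * real l powr s * r powr s)"
  proof (intro mult_left_mono sum_mono)
    fix q assume "q \<in> {..<l}"
    then have l: "0 < l" "q < l" by auto
    define y where "y = C * real (l - q) * r"
    have y: "0 < y" unfolding y_def using C r l by simp
    have "min 2 y \<le> 2 * y powr s"
    proof (cases "y \<le> 1")
      case True
      have "y powr 1 \<le> y powr s" using True y s by (intro powr_mono') auto
      then have "y \<le> y powr s" using y by simp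
      then show ?thesis using y by linarith
    next
      case False
      then have "1 \<le> y powr s" using s by (intro ge_one_powr_ge_zero) auto
      then show ?thesis by linarith
    qed
    also have "y powr s = C powr s * real (l - q) powr s * r powr s" unfolding y_def by (simp add: powr_mult)
    also have "\<dots> \<le> C * real l powr s * r powr s"
    proof (intro mult_right_mono mult_mono powr_mono2)
      have "C powr s \<le> C powr 1" using C s by (intro powr_mono) auto
      then show "C powr s \<le> C" using C by simp
    qed (use s C in auto)
    finally show "min 2 (C * real (l - q) * r) \<le> 2 * C * real l powr s * r powr s" unfolding y_def by simp
  qed (use L_ge in simp)
  also have "\<dots> = (L * r powr s) * (2 * C * (real l * real l powr s))" by simp
  also have "\<dots> \<le> K * (2 * C * (real l * real l powr s))"
    unfolding K_def using C by (intro mult_right_mono L_r_bound[OF s(1)]) auto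
  also have "\<dots> \<le> K * (2 * C * real l powr (1 + \<rho>))"
  proof (intro mult_left_mono)
    show "real l * real l powr s \<le> real l powr (1 + \<rho>)"
    proof (cases "l = 0")
      case False
      then have "real l * real l powr s = real l powr (1 + s)" by (simp add: powr_add)
      also have "\<dots> \<le> real l powr (1 + \<rho>)" using s False by (intro powr_mono) auto
      finally show ?thesis .
    qed simp
  qed (use C s in \<open>auto simp: K_def\<close>)
  finally show "(\<Sum>i<n. if k i < l then min 2 (C * real (l - k i) * r) else 0) \<le> 2 * C * (1 + N\<^sup>2 / (min \<rho> 1 * ln 2)) * real l powr (1 + \<rho>)"
    unfolding K_def s_def by (simp only: mult_ac)
qed (use C \<delta> in \<open>auto simp: r_def\<close>)

text \<open>Half the price of leaving the levels above \<open>q\<close> unrounded, each of which can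
  change by at most \<open>2 * \<delta> l\<close>.\<close>

definition "tail q = (\<Sum>l. if q < l then \<delta> l else 0)"

lemma summable_tail: "summable (\<lambda>l. if q < l then \<delta> l else 0)"
  by (rule summable_comparison_test'[OF \<delta>(2)]) (use \<delta>(1) in auto)

lemma tail_nonneg: "0 \<le> tail q"
  unfolding tail_def using \<delta>(1) by (intro suminf_nonneg summable_tail) auto

text \<open>Markov's inequality with the weight \<open>real l powr (1 + \<rho>)\<close>, since
  \<open>l\<close> is at least \<open>q + 1\<close> in the tail.\<close>

lemma tail_le: "tail q \<le> (\<Sum>l. real l powr (1 + \<rho>) * \<delta> l) * (real q + 1) powr (- (1 + \<rho>))"
proof -
  have "tail q \<le> (\<Sum>l. (real q + 1) powr (- (1 + \<rho>)) * (real l powr (1 + \<rho>) * \<delta> l))"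
    unfolding tail_def
  proof (intro suminf_le summable_tail summable_mult \<delta>)
    fix l
    show "(if q < l then \<delta> l else 0) \<le> (real q + 1) powr (- (1 + \<rho>)) * (real l powr (1 + \<rho>) * \<delta> l)"
    proof (cases "q < l")
      case True
      have "1 = (real q + 1) powr (- (1 + \<rho>)) * (real q + 1) powr (1 + \<rho>)" by (simp add: powr_add[symmetric])
      also have "\<dots> \<le> (real q + 1) powr (- (1 + \<rho>)) * real l powr (1 + \<rho>)"
        using True rho by (intro mult_left_mono powr_mono2) auto
      finally have "1 * \<delta> l \<le> ((real q + 1) powr (- (1 + \<rho>)) * real l powr (1 + \<rho>)) * \<delta> l" using \<delta>(1) by (rule mult_right_mono)
      then show ?thesis using True by (simp add: mult.assoc)
    qed (use \<delta>(1) in auto)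
  qed
  also have "\<dots> = (\<Sum>l. real l powr (1 + \<rho>) * \<delta> l) * (real q + 1) powr (- (1 + \<rho>))"
    unfolding suminf_mult[OF \<delta>(4)] by (rule mult.commute)
  finally show ?thesis .
qed

text \<open>The tail alone would be counted once per radius, up to \<open>L\<close> times in a gap;
  the rounding cost alone can contribute order one in each of infinitely many gaps. Their geometric
  mean decays both ways: geometrically in the radius inside a gap and, since
  \<open>(1 + \<rho>) * (1 - s) = 1 + \<rho> / 2\<close>, summably over the gaps.\<close>

lemma sum_min_tail:
  assumes C: "0 < C" and s: "s = \<rho> / (2 * (1 + \<rho>))"
  shows "(\<Sum>i<n. min (2 * tail (k i)) (C * eps (Suc (k i)) / t i))
    \<le> (2 * (\<Sum>l. real l powr (1 + \<rho>) * \<delta> l)) powr (1 - s) * C powr s / (1 - (1 / 2) powr s) * (\<Sum>q. (real q + 1) powr (- (1 + \<rho> / 2)))"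
proof -
  define D where "D = (\<Sum>l. real l powr (1 + \<rho>) * \<delta> l)"
  have D: "0 \<le> D" unfolding D_def using \<delta> by (intro suminf_nonneg) auto
  have s01: "0 < s" "s < 1" unfolding s using rho by (auto simp: divide_less_eq)
  define y where "y = (1 / 2 :: real) powr s"
  have y: "0 < y" "y < 1" unfolding y_def using s01 powr_less_mono2[of s "1 / 2" 1] by auto
  define F where "F = (\<lambda>q. (2 * D) powr (1 - s) * (real q + 1) powr (- (1 + \<rho> / 2)) * C powr s)"
  have F0: "0 \<le> F q" for q unfolding F_def by simp
  have pw: "- (1 + \<rho>) * (1 - s) = - (1 + \<rho> / 2)" unfolding s using rho by (simp add: field_simps)
  have A: "min (2 * tail (k i)) (C * eps (Suc (k i)) / t i) \<le> F (k i) * (eps (Suc (k i)) / t i) powr s" for i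
  proof -
    have e: "0 \<le> eps (Suc (k i)) / t i" using eps_pos[of "Suc (k i)"] t_pos[of i] by simp
    have "min (2 * tail (k i)) (C * eps (Suc (k i)) / t i) \<le> (2 * tail (k i)) powr (1 - s) * (C * (eps (Suc (k i)) / t i)) powr s"
      using min_interpolate[of "2 * tail (k i)" "C * (eps (Suc (k i)) / t i)" s] tail_nonneg[of "k i"] C e s01
      unfolding times_divide_eq_right[symmetric] by (metis mult_nonneg_nonneg less_imp_le zero_le_numeral)
    also have "\<dots> \<le> ((2 * D) powr (1 - s) * (real (k i) + 1) powr (- (1 + \<rho> / 2))) * (C * (eps (Suc (k i)) / t i)) powr s"
    proof (rule mult_right_mono)
      have "(2 * tail (k i)) powr (1 - s) \<le> ((2 * D) * (real (k i) + 1) powr (- (1 + \<rho>))) powr (1 - s)"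
        using tail_le[of "k i"] tail_nonneg[of "k i"] s01 unfolding D_def by (intro powr_mono2) auto
      also have "\<dots> = (2 * D) powr (1 - s) * (real (k i) + 1) powr (- (1 + \<rho> / 2))"
        unfolding powr_mult powr_powr pw ..
      finally show "(2 * tail (k i)) powr (1 - s) \<le> (2 * D) powr (1 - s) * (real (k i) + 1) powr (- (1 + \<rho> / 2))" .
    qed simp
    also have "\<dots> = F (k i) * (eps (Suc (k i)) / t i) powr s" unfolding F_def powr_mult[of C] by simp
    finally show ?thesis .
  qed
  have B: "(\<Sum>i | i < n \<and> k i = q. (eps (Suc (k i)) / t i) powr s) \<le> 1 / (1 - y)" for q
  proof (cases "{i. i < n \<and> k i = q} = {}")
    case False
    define I where "I = {i. i < n \<and> k i = q}"
    have fin: "finite I" unfolding I_def by simp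
    define b where "b = Max I"
    have b: "b \<in> I" "\<And>i. i \<in> I \<Longrightarrow> i \<le> b" unfolding b_def using Max_in[OF fin] False fin by (auto simp: I_def)
    have "(\<Sum>i\<in>I. (eps (Suc (k i)) / t i) powr s) \<le> (\<Sum>i\<in>I. y ^ (b - i))"
    proof (rule sum_mono)
      fix i assume i: "i \<in> I"
      have "eps (Suc (k i)) < t b" using k_t(1)[of b] b(1) i unfolding I_def by simp
      also have "t b \<le> t i / 2 ^ (b - i)" using b(2)[OF i] by (rule t_ratio)
      finally have "eps (Suc (k i)) / t i \<le> (1 / 2) ^ (b - i)" using t_pos[of i] by (simp add: field_simps power_divide)
      then have "(eps (Suc (k i)) / t i) powr s \<le> ((1 / 2) ^ (b - i)) powr s"
        using eps_pos[of "Suc (k i)"] t_pos[of i] s01 by (intro powr_mono2) auto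
      also have "\<dots> = y ^ (b - i)" unfolding y_def by (simp add: powr_realpow[symmetric] powr_powr mult.commute)
      finally show "(eps (Suc (k i)) / t i) powr s \<le> y ^ (b - i)" .
    qed
    also have "\<dots> \<le> 1 / (1 - y)"
    proof (rule sum_geometric_inj[OF _ _ fin])
      show "inj_on (\<lambda>i. b - i) I" using b(2) by (intro inj_onI) (metis diff_diff_cancel)
    qed (use y in auto)
    finally show ?thesis unfolding I_def .
  next
    case True
    show ?thesis unfolding True using y by simp
  qed
  define Q where "Q = Suc (Max (k ` {..n}))"
  have kQ: "k i < Q" if "i < n" for i unfolding Q_def using that by (simp add: le_imp_less_Suc)
  have sP: "summable (\<lambda>q. (real q + 1) powr (- (1 + \<rho> / 2)))"
  proof -
    have "summable (\<lambda>q. real (q + 1) powr (- (1 + \<rho> / 2)))"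
      using summable_iff_shift[of "\<lambda>q. real q powr (- (1 + \<rho> / 2))" 1] summable_real_powr_iff[of "- (1 + \<rho> / 2)"] rho by simp
    then show ?thesis by (simp add: add.commute)
  qed
  have "(\<Sum>i<n. min (2 * tail (k i)) (C * eps (Suc (k i)) / t i)) \<le> (\<Sum>i<n. F (k i) * (eps (Suc (k i)) / t i) powr s)"
    by (intro sum_mono A)
  also have "\<dots> = (\<Sum>q<Q. \<Sum>i | i < n \<and> k i = q. F (k i) * (eps (Suc (k i)) / t i) powr s)"
  proof -
    have "k ` {..<n} \<subseteq> {..<Q}" using kQ by auto
    from sum.group[OF _ _ this, of "\<lambda>i. F (k i) * (eps (Suc (k i)) / t i) powr s"]
    show ?thesis by (simp only: finite_lessThan lessThan_iff simp_thms)
  qed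
  also have "\<dots> = (\<Sum>q<Q. F q * (\<Sum>i | i < n \<and> k i = q. (eps (Suc (k i)) / t i) powr s))"
    by (intro sum.cong refl) (auto simp: sum_distrib_left intro: sum.cong)
  also have "\<dots> \<le> (\<Sum>q<Q. F q * (1 / (1 - y)))" by (intro sum_mono mult_left_mono B F0)
  also have "\<dots> = (2 * D) powr (1 - s) * C powr s / (1 - y) * (\<Sum>q<Q. (real q + 1) powr (- (1 + \<rho> / 2)))"
    unfolding F_def sum_distrib_left by (intro sum.cong refl) simp
  also have "\<dots> \<le> (2 * D) powr (1 - s) * C powr s / (1 - y) * (\<Sum>q. (real q + 1) powr (- (1 + \<rho> / 2)))"
    using y by (intro mult_left_mono sum_le_suminf sP) auto
  finally show ?thesis unfolding D_def y_def .
qed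

end

subsection \<open>Coefficients oscillating on many scales\<close>

lemma bounded_linear_matrix: "bounded_linear (\<lambda>v. (M::real^'d^'d) *v v)"
  by (simp add: linear_conv_bounded_linear[symmetric])

lemma norm_matrix_vector_le: "norm ((M::real^'d^'d) *v \<xi>) \<le> mat_opnorm M * norm \<xi>"
  unfolding mat_opnorm_def by (rule onorm[OF bounded_linear_matrix])

lemma mat_opnorm_add: "mat_opnorm (M + M') \<le> mat_opnorm M + mat_opnorm (M'::real^'d^'d)"
  unfolding mat_opnorm_def matrix_vector_mult_add_rdistrib
  by (rule onorm_triangle[OF bounded_linear_matrix bounded_linear_matrix])

lemma mat_opnorm_minus: "mat_opnorm (M - M') \<le> mat_opnorm M + mat_opnorm (M'::real^'d^'d)"
proof -
  have "(\<lambda>v. (- M') *v v) = (\<lambda>v. - (M' *v v))" by (auto simp: matrix_vector_mult_def vec_eq_iff sum_negf)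
  then have "mat_opnorm (- M') = mat_opnorm M'" unfolding mat_opnorm_def by (simp add: onorm_neg)
  then show ?thesis using mat_opnorm_add[of M "- M'"] by simp
qed

text \<open>Connects the operator norm of the hypotheses with the norm of the matrix type, in which
  convergence and continuity are understood.\<close>

lemma norm_le_mat_opnorm: "norm (M::real^'d^'d) \<le> real CARD('d) * (real CARD('d) * mat_opnorm M)"
proof -
  have "\<bar>M $ i $ j\<bar> \<le> mat_opnorm M" for i j
  proof -
    have "\<bar>M $ i $ j\<bar> = \<bar>(M *v axis j 1) $ i\<bar>" by (simp add: matrix_vector_mult_basis column_def)
    also have "\<dots> \<le> norm (M *v axis j 1)" by (rule component_le_norm_cart)
    also have "\<dots> \<le> mat_opnorm M" using norm_matrix_vector_le[of M "axis j 1"] by simp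
    finally show ?thesis .
  qed
  then have row: "norm (M $ i) \<le> real CARD('d) * mat_opnorm M" for i
    using norm_le_l1_cart[of "M $ i"] sum_bounded_above[of UNIV "\<lambda>j. \<bar>M $ i $ j\<bar>" "mat_opnorm M"] by (simp add: order_trans)
  have "norm M \<le> (\<Sum>i\<in>UNIV. norm (M $ i))" unfolding norm_vec_def by (rule L2_set_le_sum) simp
  also have "\<dots> \<le> real CARD('d) * (real CARD('d) * mat_opnorm M)"
    using sum_bounded_above[of UNIV "\<lambda>i. norm (M $ i)"] row by simp
  finally show ?thesis .
qed

lemma bounded_linear_matrix_left: "bounded_linear (\<lambda>M::real^'d^'d. M *v \<xi>)"
  unfolding linear_conv_bounded_linear[symmetric]
  by (intro linearI matrix_vector_mult_add_rdistrib) (simp add: scaleR_matrix_vector_assoc)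

section \<open>The coefficient series under the standing assumptions\<close>

context
  fixes B :: "nat \<Rightarrow> (nat \<Rightarrow> real^'d) \<Rightarrow> real^'d^'d" and Om \<mu> \<delta>
  assumes st: "standing_B B Om \<mu> \<delta>"
begin

text \<open>Periodicity is assumed for the partial sums, and each \<open>B l\<close> is a difference
  of two of them.\<close>

lemma B_periodic:
  assumes "y 0 \<in> Om" "z 0 = 0" "\<And>j. int_vec (z j)"
  shows "B l (\<lambda>j. y j + z j) = B l y"
proof -
  have An: "An B n (\<lambda>j. y j + z j) = An B n y" for n using st assms unfolding standing_B_def by blast
  show ?thesis
  proof (cases l)
    case 0
    then show ?thesis using An[of 0] by (simp add: An_def)
  next
    case (Suc n)
    then show ?thesis using An[of n] An[of "Suc n"] by (simp add: An_def)
  qed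
qed

lemma B_opnorm: "y 0 \<in> Om \<Longrightarrow> mat_opnorm (B l y) \<le> \<delta> l"
  and B_local: "(\<And>j. j \<le> l \<Longrightarrow> y j = y' j) \<Longrightarrow> B l y = B l y'"
  and delta_nonneg: "0 \<le> \<delta> l" and delta_summable: "summable \<delta>"
  using st unfolding standing_B_def by blast+

text \<open>By periodicity the increment in the j-th variable may be reduced by any integer vector; the variables are then
  changed one at a time.\<close>

lemma B_shift:
  assumes y: "y 0 \<in> Om" and seg: "closed_segment (y 0) (y 0 + w 0) \<subseteq> Om" and n: "n 0 = 0" "\<And>j. int_vec (n j)"
  shows "mat_opnorm (B l (\<lambda>j. y j + w j) - B l y) \<le> \<delta> l * min 2 (\<Sum>j\<le>l. norm (w j - n j))"
proof -
  \<comment> \<open>In \<open>h i\<close> the first \<open>i\<close> variables have received their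
    reduced increments. As \<open>n 0 = 0\<close>, the macroscopic variable moves by
    \<open>w 0\<close> along the given segment.\<close>
  define h where "h = (\<lambda>i j. if j < i then y j + (w j - n j) else y j)"
  have yw: "y 0 + w 0 \<in> Om" using seg by auto
  have h0: "h i 0 \<in> Om" for i unfolding h_def using y yw n by simp
  have step: "mat_opnorm (B l (h (Suc i)) - B l (h i)) \<le> \<delta> l * norm (w i - n i)" if i: "i \<le> l" for i
  proof -
    have u: "h (Suc i) = (h i)(i := y i + (w i - n i))" unfolding h_def by (auto simp: less_Suc_eq)
    have hi: "h i i = y i" unfolding h_def by simp
    show ?thesis
    proof (cases "i = 0")
      case True
      have "closed_segment (h i 0) (y 0 + w 0) \<subseteq> Om" using seg hi True by simp
      then have "mat_opnorm (B l ((h i)(0 := y 0 + w 0)) - B l (h i)) \<le> \<delta> l * norm (y 0 + w 0 - h i 0)"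
        using st h0[of i] unfolding standing_B_def by blast
      then show ?thesis unfolding u using True n hi by simp
    next
      case False
      then have "mat_opnorm (B l ((h i)(i := y i + (w i - n i))) - B l (h i)) \<le> \<delta> l * norm (y i + (w i - n i) - h i i)"
        using st h0[of i] i unfolding standing_B_def by (simp add: Suc_le_eq)
      then show ?thesis unfolding u hi by simp
    qed
  qed
  have tele: "mat_opnorm (B l (h i) - B l (h 0)) \<le> (\<Sum>j<i. \<delta> l * norm (w j - n j))" if "i \<le> Suc l" for i
    using that
  proof (induction i)
    case 0
    have "(\<lambda>v. (0::real^'d^'d) *v v) = (\<lambda>v. 0)" by (auto simp: matrix_vector_mult_def vec_eq_iff)
    then show ?case by (simp add: mat_opnorm_def onorm_zero)
  next
    case (Suc i)
    have "mat_opnorm (B l (h (Suc i)) - B l (h 0)) = mat_opnorm ((B l (h i) - B l (h 0)) + (B l (h (Suc i)) - B l (h i)))" by simp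
    also have "\<dots> \<le> mat_opnorm (B l (h i) - B l (h 0)) + mat_opnorm (B l (h (Suc i)) - B l (h i))" by (rule mat_opnorm_add)
    also have "\<dots> \<le> (\<Sum>j<Suc i. \<delta> l * norm (w j - n j))" using Suc step[of i] by simp
    finally show ?case .
  qed
  have e0: "B l (h 0) = B l y" by (rule B_local) (simp add: h_def)
  \<comment> \<open>Once all variables have moved, subtracting the integer vectors changes
    nothing.\<close>
  have e1: "B l (h (Suc l)) = B l (\<lambda>j. y j + w j)"
  proof -
    have "B l (\<lambda>j. y j + w j) = B l (\<lambda>j. (y j + w j) + (- n j))"
      using yw n by (intro B_periodic[symmetric]) (auto simp: int_vec_def)
    also have "\<dots> = B l (h (Suc l))" by (rule B_local) (simp add: h_def)
    finally show ?thesis by simp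
  qed
  have "mat_opnorm (B l (\<lambda>j. y j + w j) - B l y) \<le> \<delta> l * (\<Sum>j\<le>l. norm (w j - n j))"
    using tele[of "Suc l"] unfolding e0 e1 by (simp add: sum_distrib_left lessThan_Suc_atMost)
  moreover have "mat_opnorm (B l (\<lambda>j. y j + w j) - B l y) \<le> \<delta> l * 2"
    using mat_opnorm_minus[of "B l (\<lambda>j. y j + w j)" "B l y"] B_opnorm[of y l] B_opnorm[of "\<lambda>j. y j + w j" l] y yw by linarith
  ultimately show ?thesis by (simp add: min_def)
qed

lemma summable_B: assumes "y 0 \<in> Om" shows "summable (\<lambda>l. B l y)"
proof (rule summable_comparison_test'[of "\<lambda>l. real CARD('d) * (real CARD('d) * \<delta> l)"])
  show "summable (\<lambda>l. real CARD('d) * (real CARD('d) * \<delta> l))" by (intro summable_mult delta_summable)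
  fix l
  have "norm (B l y) \<le> real CARD('d) * (real CARD('d) * mat_opnorm (B l y))" by (rule norm_le_mat_opnorm)
  also have "\<dots> \<le> real CARD('d) * (real CARD('d) * \<delta> l)" using B_opnorm[of y l] assms by (intro mult_left_mono) auto
  finally show "norm (B l y) \<le> real CARD('d) * (real CARD('d) * \<delta> l)" .
qed

lemma Aeps_sums: assumes "x \<in> Om" shows "(\<lambda>l. B l (scaled_args eps x) *v \<xi>) sums (Aeps B eps x *v \<xi>)"
  unfolding Aeps_def using assms
  by (intro bounded_linear.sums[OF bounded_linear_matrix_left] summable_sums summable_B) (simp add: scaled_args_def)

text \<open>The lower bound passes to the limit from the partial sums \<open>An\<close>; the upper
  bound comes from summing \<open>\<delta>\<close>.\<close>

lemma Aeps_elliptic: assumes x: "x \<in> Om" shows "\<mu> * (norm \<xi>)\<^sup>2 \<le> (Aeps B eps x *v \<xi>) \<bullet> \<xi>" "norm (Aeps B eps x *v \<xi>) \<le> (\<Sum>l. \<delta> l) * norm \<xi>"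
proof -
  let ?y = "scaled_args eps x"
  have y: "?y 0 \<in> Om" using x by (simp add: scaled_args_def)
  have "(\<lambda>n. \<Sum>l\<le>n. B l ?y *v \<xi>) \<longlonglongrightarrow> Aeps B eps x *v \<xi>" using Aeps_sums[OF x] by (simp add: sums_def_le)
  then have lim: "(\<lambda>n. (\<Sum>l\<le>n. B l ?y *v \<xi>) \<bullet> \<xi>) \<longlonglongrightarrow> (Aeps B eps x *v \<xi>) \<bullet> \<xi>" by (intro tendsto_intros)
  show "\<mu> * (norm \<xi>)\<^sup>2 \<le> (Aeps B eps x *v \<xi>) \<bullet> \<xi>"
  proof (rule LIMSEQ_le_const[OF lim], intro exI allI impI)
    fix n
    have "(\<Sum>l\<le>n. B l ?y *v \<xi>) = An B n ?y *v \<xi>" unfolding An_def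
      using linear_sum[OF bounded_linear.linear[OF bounded_linear_matrix_left], of "\<lambda>l. B l ?y" "{..n}" \<xi>] by simp
    moreover have "\<mu> * (norm \<xi>)\<^sup>2 \<le> \<xi> \<bullet> (An B n ?y *v \<xi>)" using st y unfolding standing_B_def by blast
    ultimately show "\<mu> * (norm \<xi>)\<^sup>2 \<le> (\<Sum>l\<le>n. B l ?y *v \<xi>) \<bullet> \<xi>" by (simp add: inner_commute)
  qed
  have le: "norm (B l ?y *v \<xi>) \<le> \<delta> l * norm \<xi>" for l
    using norm_matrix_vector_le[of "B l ?y" \<xi>] B_opnorm[of ?y l] y by (meson mult_right_mono norm_ge_zero order_trans)
  have "norm (\<Sum>l. B l ?y *v \<xi>) \<le> (\<Sum>l. \<delta> l * norm \<xi>)"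
    by (intro norm_suminf_le le summable_mult2 delta_summable)
  then show "norm (Aeps B eps x *v \<xi>) \<le> (\<Sum>l. \<delta> l) * norm \<xi>"
    using sums_unique[OF Aeps_sums[OF x]] suminf_mult2[OF delta_summable, of "norm \<xi>"] by metis
qed

lemma Aeps_continuous: "continuous_on Om (Aeps B eps)"
proof -
  have "uniform_limit Om (\<lambda>n x. \<Sum>l<n. B l (scaled_args eps x)) (\<lambda>x. \<Sum>l. B l (scaled_args eps x)) sequentially"
  proof (rule Weierstrass_m_test)
    fix l x assume x: "x \<in> Om"
    have "norm (B l (scaled_args eps x)) \<le> real CARD('d) * (real CARD('d) * mat_opnorm (B l (scaled_args eps x)))" by (rule norm_le_mat_opnorm)
    also have "\<dots> \<le> real CARD('d) * (real CARD('d) * \<delta> l)" using B_opnorm[of "scaled_args eps x" l] x by (intro mult_left_mono) (auto simp: scaled_args_def)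
    finally show "norm (B l (scaled_args eps x)) \<le> real CARD('d) * (real CARD('d) * \<delta> l)" .
  qed (intro summable_mult delta_summable)
  moreover have "continuous_on Om (\<lambda>x. \<Sum>l<n. B l (scaled_args eps x))" for n
  proof (intro continuous_intros)
    fix l
    have "continuous_on {y. y 0 \<in> Om} (B l)" using st unfolding standing_B_def by blast
    \<comment> \<open>The arguments of \<open>B l\<close> are sequences with the product topology,
      so continuity is checked in each coordinate.\<close>
    moreover have "continuous_on Om (scaled_args eps)"
      unfolding scaled_args_def[abs_def]
    proof (rule continuous_on_coordinatewise_then_product)
      fix i show "continuous_on Om (\<lambda>x. if i = 0 then x else (1 / eps i) *\<^sub>R x)"
        by (cases "i = 0") (auto intro!: continuous_intros)
    qed
    ultimately show "continuous_on Om (\<lambda>x. B l (scaled_args eps x))"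
      by (rule continuous_on_compose2) (auto simp: scaled_args_def)
  qed
  ultimately show ?thesis unfolding Aeps_def[abs_def]
    by (intro uniform_limit_theorem[OF always_eventually]) auto
qed

text \<open>\<open>n\<close> collects integer vectors near the scaled shift, one per level; the
  majorant \<open>h\<close> is left free so that slow and fast levels can be estimated
  differently.\<close>

lemma Aeps_shift:
  assumes seg: "closed_segment x (x + \<tau>) \<subseteq> Om" and n: "n 0 = 0" "\<And>j. int_vec (n j)"
    and h: "\<And>l. min 2 (\<Sum>j\<le>l. norm (scaled_args eps \<tau> j - n j)) \<le> h l" and sm: "summable (\<lambda>l. \<delta> l * h l)"
  shows "norm (Aeps B eps (x + \<tau>) *v \<xi> - Aeps B eps x *v \<xi>) \<le> (\<Sum>l. \<delta> l * h l) * norm \<xi>"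
proof -
  let ?y = "scaled_args eps x" and ?w = "scaled_args eps \<tau>"
  have x: "x \<in> Om" "x + \<tau> \<in> Om" using seg by auto
  have yw: "scaled_args eps (x + \<tau>) = (\<lambda>j. ?y j + ?w j)" by (auto simp: scaled_args_def scaleR_add_right)
  have le: "norm (B l (scaled_args eps (x + \<tau>)) *v \<xi> - B l ?y *v \<xi>) \<le> \<delta> l * h l * norm \<xi>" for l
  proof -
    have "norm (B l (scaled_args eps (x + \<tau>)) *v \<xi> - B l ?y *v \<xi>) \<le> mat_opnorm (B l (\<lambda>j. ?y j + ?w j) - B l ?y) * norm \<xi>"
      using norm_matrix_vector_le[of "B l (\<lambda>j. ?y j + ?w j) - B l ?y" \<xi>] unfolding yw by (simp add: matrix_vector_mult_diff_rdistrib)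
    also have "mat_opnorm (B l (\<lambda>j. ?y j + ?w j) - B l ?y) \<le> \<delta> l * min 2 (\<Sum>j\<le>l. norm (?w j - n j))"
      by (rule B_shift) (use seg x n in \<open>auto simp: scaled_args_def\<close>)
    also have "\<dots> \<le> \<delta> l * h l" by (intro mult_left_mono h delta_nonneg)
    finally show ?thesis by (simp add: mult_right_mono)
  qed
  have "(\<lambda>l. B l (scaled_args eps (x + \<tau>)) *v \<xi> - B l ?y *v \<xi>) sums (Aeps B eps (x + \<tau>) *v \<xi> - Aeps B eps x *v \<xi>)"
    by (intro sums_diff Aeps_sums x)
  then have "norm (Aeps B eps (x + \<tau>) *v \<xi> - Aeps B eps x *v \<xi>) = norm (\<Sum>l. B l (scaled_args eps (x + \<tau>)) *v \<xi> - B l ?y *v \<xi>)"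
    by (rule arg_cong[OF sums_unique])
  also have "\<dots> \<le> (\<Sum>l. \<delta> l * h l * norm \<xi>)" by (intro norm_suminf_le le summable_mult2 sm)
  also have "\<dots> = (\<Sum>l. \<delta> l * h l) * norm \<xi>" by (rule suminf_mult2[OF sm, symmetric])
  finally show ?thesis .
qed

end

lemma round_to_lattice:
  fixes v :: "real^'d"
  assumes e: "0 < e"
  shows "\<exists>n. int_vec n \<and> norm (e *\<^sub>R n - v) \<le> real CARD('d) * e"
proof (intro exI conjI)
  let ?n = "\<chi> i. of_int \<lfloor>v $ i / e\<rfloor> :: real^'d"
  show "int_vec ?n" by (simp add: int_vec_def)
  have "\<bar>(e *\<^sub>R ?n - v) $ i\<bar> \<le> e" for i
  proof -
    have "of_int \<lfloor>v $ i / e\<rfloor> \<le> v $ i / e" "v $ i / e \<le> of_int \<lfloor>v $ i / e\<rfloor> + 1" by linarith+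
    then have "e * of_int \<lfloor>v $ i / e\<rfloor> \<le> e * (v $ i / e)" "e * (v $ i / e) \<le> e * (of_int \<lfloor>v $ i / e\<rfloor> + 1)"
      using e by (auto intro!: mult_left_mono simp del: times_divide_eq_right)
    then show ?thesis using e by (simp add: distrib_left)
  qed
  then have "(\<Sum>i\<in>UNIV. \<bar>(e *\<^sub>R ?n - v) $ i\<bar>) \<le> real CARD('d) * e" using sum_bounded_above[of UNIV "\<lambda>i. \<bar>(e *\<^sub>R ?n - v) $ i\<bar>" e] by simp
  then show "norm (e *\<^sub>R ?n - v) \<le> real CARD('d) * e" using norm_le_l1_cart order_trans by blast
qed

text \<open>Rounding successively to the lattices of the finer and finer scales produces a vector that is close to all of them.\<close>

lemma simultaneous_rounding:
  fixes z :: "real^'d"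
  assumes sc: "scales eps" and half: "\<And>j. eps (Suc j) \<le> eps j / 2"
  shows "\<exists>\<tau> n. norm (\<tau> - z) \<le> 2 * real CARD('d) * eps (Suc q) \<and>
    (\<forall>j>q. int_vec (n j) \<and> norm ((1 / eps j) *\<^sub>R \<tau> - n j) \<le> 2 * real CARD('d) * (eps (Suc j) / eps j))"
proof -
  let ?c = "real CARD('d)"
  have pos: "0 < eps j" for j by (rule scalesD(2)[OF sc])
  obtain rd where rd: "\<And>e v::real^'d. 0 < e \<Longrightarrow> int_vec (rd e v) \<and> norm (e *\<^sub>R rd e v - v) \<le> ?c * e"
    using round_to_lattice by metis
  \<comment> \<open>Step \<open>p\<close> rounds to the lattice of period
    \<open>eps (Suc q + p)\<close>. All later steps together spoil this only by an amount of the
    order of the next scale, as the scales at least halve.\<close>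
  define T where "T = rec_nat z (\<lambda>p v. eps (Suc q + p) *\<^sub>R rd (eps (Suc q + p)) v)"
  have T: "T 0 = z" "\<And>p. T (Suc p) = eps (Suc q + p) *\<^sub>R rd (eps (Suc q + p)) (T p)" unfolding T_def by simp_all
  define D where "D = (\<lambda>p. T (Suc p) - T p)"
  have dec: "eps (a + b) \<le> eps a * (1 / 2) ^ b" for a b
  proof (induction b)
    case (Suc b)
    then show ?case using half[of "a + b"] by simp
  qed simp
  have D: "norm (D (i + p)) \<le> ?c * eps (Suc q + p) * (1 / 2) ^ i" for i p
  proof -
    have "norm (D (i + p)) \<le> ?c * eps (Suc q + p + i)" unfolding D_def T(2) using rd[OF pos] by (simp add: add_ac)
    also have "\<dots> \<le> ?c * (eps (Suc q + p) * (1 / 2) ^ i)" by (intro mult_left_mono dec) auto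
    finally show ?thesis by simp
  qed
  have sm: "summable (\<lambda>i. ?c * eps (Suc q + p) * (1 / 2) ^ i)" for p by (intro summable_mult summable_geometric) simp
  have smD: "summable D" by (rule summable_comparison_test'[OF sm[of 0]]) (use D[of _ 0] in simp)
  define \<tau> where "\<tau> = z + (\<Sum>i. D i)"
  have close: "norm (\<tau> - T p) \<le> 2 * ?c * eps (Suc q + p)" for p
  proof -
    have "T p = z + (\<Sum>i<p. D i)" unfolding D_def using sum_lessThan_telescope[of T p] T(1) by simp
    then have "\<tau> - T p = (\<Sum>i. D (i + p))" unfolding \<tau>_def using suminf_split_initial_segment[OF smD, of p] by simp
    also have "norm \<dots> \<le> (\<Sum>i. ?c * eps (Suc q + p) * (1 / 2) ^ i)" by (intro norm_suminf_le D sm)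
    also have "\<dots> = 2 * ?c * eps (Suc q + p)" by (simp add: suminf_mult suminf_geometric)
    finally show ?thesis .
  qed
  define n where "n = (\<lambda>j. rd (eps j) (T (j - Suc q)))"
  have "int_vec (n j) \<and> norm ((1 / eps j) *\<^sub>R \<tau> - n j) \<le> 2 * ?c * (eps (Suc j) / eps j)" if j: "q < j" for j
  proof
    show "int_vec (n j)" unfolding n_def using rd[OF pos] by blast
    have jj: "j = Suc q + (j - Suc q)" using j by simp
    have "T (Suc (j - Suc q)) = eps j *\<^sub>R n j" unfolding n_def T(2) using jj by simp
    then have "norm (\<tau> - eps j *\<^sub>R n j) \<le> 2 * ?c * eps (Suc j)" using close[of "Suc (j - Suc q)"] jj by simp
    moreover have "norm ((1 / eps j) *\<^sub>R \<tau> - n j) = norm (\<tau> - eps j *\<^sub>R n j) / eps j"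
    proof -
      have "(1 / eps j) *\<^sub>R \<tau> - n j = (1 / eps j) *\<^sub>R (\<tau> - eps j *\<^sub>R n j)" using pos[of j] by (simp add: scaleR_diff_right)
      then show ?thesis using pos[of j] by simp
    qed
    ultimately show "norm ((1 / eps j) *\<^sub>R \<tau> - n j) \<le> 2 * ?c * (eps (Suc j) / eps j)" using pos[of j] by (simp add: divide_right_mono)
  qed
  then show ?thesis using close[of 0] T(1) by (intro exI[of _ \<tau>] exI[of _ n]) simp
qed

text \<open>The bounds of \<open>sum_modulus_large\<close>, \<open>sum_modulus_small\<close> and
  \<open>sum_min_tail\<close> added up, so that one formula serves both ranges of \<open>r\<close>;
  \<open>D0\<close>, \<open>D1\<close>, \<open>D2\<close> stand for the three sums of
  \<open>\<delta>\<close>.\<close>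

definition eta_bound :: "real \<Rightarrow> real \<Rightarrow> real \<Rightarrow> real \<Rightarrow> real \<Rightarrow> real \<Rightarrow> real" where
  "eta_bound D0 D1 D2 N \<rho> C = (let s = \<rho> / (2 * (1 + \<rho>)) in
     2 * C * (D0 + D1) + 2 * (1 + N\<^sup>2) * D1 + 2 * C * (1 + N\<^sup>2 / (min \<rho> 1 * ln 2)) * D2
     + (2 * D2) powr (1 - s) * C powr s / (1 - (1 / 2) powr s) * (\<Sum>q. (real q + 1) powr (- (1 + \<rho> / 2))))"

context multiscale
begin

text \<open>Either all the fast scales are ignored, or the shift is rounded to all of them at once; the cheaper choice
  is summable over the radii.\<close>

lemma almost_periods_Aeps:
  fixes B :: "nat \<Rightarrow> (nat \<Rightarrow> real^'d) \<Rightarrow> real^'d^'d" and a :: "real^'d \<Rightarrow> real^'d \<Rightarrow> real^'d"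
  assumes st: "standing_B B Om \<mu> \<delta>" and V: "V \<subseteq> Om" and a: "\<And>x \<xi>. x \<in> V \<Longrightarrow> a x \<xi> = Aeps B eps x *v \<xi>"
  shows "\<exists>\<omega> e. (\<forall>i. 0 \<le> \<omega> i \<and> 0 \<le> e i) \<and>
    (\<forall>y i. cball y (t i) \<subseteq> V \<longrightarrow> almost_periodic a y (t i) (\<omega> i) (e i)) \<and>
    (\<forall>n. (\<Sum>i<n. \<omega> i + e i / t i) \<le> eta_bound (\<Sum>l. \<delta> l) (\<Sum>l. real l * \<delta> l) (\<Sum>l. real l powr (1 + \<rho>) * \<delta> l) N \<rho> (1 + 2 * real CARD('d)))"
proof -
  let ?c = "real CARD('d)"
  \<comment> \<open>A rounded shift has length at most \<open>C * t i\<close>, namely the shift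
    itself plus \<open>2 * CARD('d)\<close> times the next scale; \<open>C\<close> also dominates
    the rounding constant.\<close>
  define C where "C = 1 + 2 * ?c"
  have C: "1 \<le> C" "0 < C" unfolding C_def by auto
  \<comment> \<open>The cost of ignoring the fast levels, each at the trivial price 2;
    \<open>Q\<close> below is the cost of rounding to them. The slow levels enter both through
    \<open>slow\<close>.\<close>
  define P where "P = (\<lambda>i. \<Sum>l. \<delta> l * (1 * slow l i + (if k i < l then 2 else 0)))"
  define h where "h = (\<lambda>l i. if k i < l then min 2 (C * real (l - k i) * r) else 0)"
  define Q where "Q = (\<lambda>i. \<Sum>l. \<delta> l * (C * slow l i + h l i))"
  have r0: "0 < r" unfolding r_def using eps_pos[of 1] by simp
  have h: "0 \<le> h l i" "h l i \<le> 2" for l i unfolding h_def using C r0 by auto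
  have smP: "summable (\<lambda>l. \<delta> l * (1 * slow l i + (if k i < l then 2 else 0)))" for i by (rule summable_slow) auto
  have smQ: "summable (\<lambda>l. \<delta> l * (C * slow l i + h l i))" for i by (rule summable_slow) (use C h in auto)
  have P0: "0 \<le> P i" for i unfolding P_def using \<delta>(1) slow_nonneg[of _ i] by (intro suminf_nonneg smP) auto
  have Q0: "0 \<le> Q i" for i unfolding Q_def using \<delta>(1) slow_nonneg[of _ i] h C by (intro suminf_nonneg smQ) auto
  have sT: "norm (scaled_args eps \<tau> j) = norm \<tau> / eps j" for \<tau> :: "real^'d" and j
    using eps_pos[of j] scalesD(1)[OF sc] unfolding scaled_args_def by (simp add: abs_of_pos)
  have per: "near_period a y (t i) (\<Sum>l. \<delta> l * g l) \<tau>"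
    if cb: "cball y (t i) \<subseteq> V" and n: "n 0 = 0" "\<And>j. int_vec (n j)"
      and g: "\<And>l. min 2 (\<Sum>j\<le>l. norm (scaled_args eps \<tau> j - n j)) \<le> g l" and sm: "summable (\<lambda>l. \<delta> l * g l)"
    for y i g n and \<tau> :: "real^'d"
    unfolding near_period_def
  proof (intro allI impI)
    fix x \<xi> assume x: "x \<in> cball y (t i)" "x + \<tau> \<in> cball y (t i)"
    have "closed_segment x (x + \<tau>) \<subseteq> cball y (t i)" using x by (intro closed_segment_subset) auto
    then have "closed_segment x (x + \<tau>) \<subseteq> Om" using cb V by blast
    from Aeps_shift[OF st this n g sm, of \<xi>]
    show "norm (a (x + \<tau>) \<xi> - a x \<xi>) \<le> (\<Sum>l. \<delta> l * g l) * norm \<xi>" using a x cb by (simp add: subset_iff)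
  qed
  have apP: "almost_periodic a y (t i) (P i) 0" if cb: "cball y (t i) \<subseteq> V" for y i
    unfolding almost_periodic_def
  proof (intro allI impI exI conjI)
    fix z :: "real^'d" assume z: "norm z \<le> t i / 2"
    show "norm (z - z) \<le> 0" by simp
    show "near_period a y (t i) (P i) z" unfolding P_def
    proof (rule per[OF cb _ _ _ smP, of "\<lambda>_. 0"])
      fix l
      have le: "norm (scaled_args eps z j) \<le> t i / eps j" for j
        unfolding sT using z t_pos[of i] eps_pos[of j] by (intro divide_right_mono) auto
      have "min 2 (\<Sum>j\<le>l. norm (scaled_args eps z j)) \<le> slow l i + (if k i < l then 2 else 0)"
      proof (cases "k i < l")
        case False
        have "(\<Sum>j\<le>l. norm (scaled_args eps z j)) \<le> (\<Sum>j\<le>l. t i / eps j)" by (intro sum_mono le)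
        also have "\<dots> = slow l i" unfolding slow_def using False by (intro sum.cong) auto
        finally show ?thesis using False by simp
      qed (use slow_nonneg[of l i] in simp)
      then show "min 2 (\<Sum>j\<le>l. norm (scaled_args eps z j - 0)) \<le> 1 * slow l i + (if k i < l then 2 else 0)" by simp
    qed (simp_all add: int_vec_def)
  qed
  have apQ: "almost_periodic a y (t i) (Q i) (2 * ?c * eps (Suc (k i)))" if half: "r \<le> 1 / 2" and cb: "cball y (t i) \<subseteq> V" for y i
    unfolding almost_periodic_def
  proof (intro allI impI)
    fix z :: "real^'d" assume z: "norm z \<le> t i / 2"
    have rr: "eps (Suc j) / eps j \<le> r" for j unfolding r_def by (rule ratio_bounds(1)[OF sc rc N])
    have "eps (Suc j) \<le> eps j / 2" for j
    proof -
      have "eps (Suc j) / eps j \<le> 1 / 2" using rr[of j] half by linarith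
      then show ?thesis using eps_pos[of j] by (simp add: divide_le_eq)
    qed
    from simultaneous_rounding[OF sc this, of z "k i"]
    obtain \<tau> n where tau: "norm (\<tau> - z) \<le> 2 * ?c * eps (Suc (k i))"
      and n: "\<And>j. k i < j \<Longrightarrow> int_vec (n j)" "\<And>j. k i < j \<Longrightarrow> norm ((1 / eps j) *\<^sub>R \<tau> - n j) \<le> 2 * ?c * (eps (Suc j) / eps j)"
      by blast
    define n' where "n' = (\<lambda>j. if k i < j then n j else 0)"
    have nt: "norm \<tau> \<le> C * t i"
    proof -
      have "norm \<tau> \<le> norm (\<tau> - z) + norm z" using norm_triangle_ineq[of "\<tau> - z" z] by simp
      also have "\<dots> \<le> 2 * ?c * t i + t i" using tau z k_t(1)[of i] t_pos[of i]
        by (intro add_mono order_trans[OF tau] mult_left_mono) auto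
      finally show ?thesis unfolding C_def by (simp add: algebra_simps)
    qed
    have "near_period a y (t i) (Q i) \<tau>" unfolding Q_def
    proof (rule per[OF cb _ _ _ smQ, of n'])
      show "n' 0 = 0" "int_vec (n' j)" for j unfolding n'_def using n(1) by (auto simp: int_vec_def)
      fix l
      have s1: "norm (scaled_args eps \<tau> j - n' j) \<le> C * (t i / eps j)" if "j \<le> k i" for j
        using that nt eps_pos[of j] unfolding n'_def by (simp add: sT divide_right_mono)
      have s2: "norm (scaled_args eps \<tau> j - n' j) \<le> C * r" if "k i < j" for j
      proof -
        have "norm (scaled_args eps \<tau> j - n' j) \<le> 2 * ?c * (eps (Suc j) / eps j)"
          using n(2)[OF that] that unfolding n'_def scaled_args_def by simp
        also have "\<dots> \<le> 2 * ?c * r" by (intro mult_left_mono rr) auto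
        also have "\<dots> \<le> C * r" unfolding C_def using r0 by (intro mult_right_mono) auto
        finally show ?thesis .
      qed
      have "{..l} = {j. j \<le> l \<and> j \<le> k i} \<union> {k i<..l}" by auto
      then have "(\<Sum>j\<le>l. norm (scaled_args eps \<tau> j - n' j)) = (\<Sum>j | j \<le> l \<and> j \<le> k i. norm (scaled_args eps \<tau> j - n' j)) + (\<Sum>j\<in>{k i<..l}. norm (scaled_args eps \<tau> j - n' j))"
        by (simp only:) (rule sum.union_disjoint, auto)
      also have "\<dots> \<le> (\<Sum>j | j \<le> l \<and> j \<le> k i. C * (t i / eps j)) + (\<Sum>j\<in>{k i<..l}. C * r)"
        by (intro add_mono sum_mono s1 s2) auto
      also have "\<dots> = C * slow l i + C * real (l - k i) * r" unfolding slow_def by (simp add: sum_distrib_left)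
      finally have "min 2 (\<Sum>j\<le>l. norm (scaled_args eps \<tau> j - n' j)) \<le> min 2 (C * slow l i + C * real (l - k i) * r)" by simp
      also have "\<dots> \<le> C * slow l i + h l i"
      proof (cases "k i < l")
        case True
        have "0 \<le> C * slow l i" using C slow_nonneg[of l i] by simp
        then show ?thesis unfolding h_def using True by simp
      qed (simp add: h_def)
      finally show "min 2 (\<Sum>j\<le>l. norm (scaled_args eps \<tau> j - n' j)) \<le> C * slow l i + h l i" .
    qed
    then show "\<exists>\<tau>. norm (\<tau> - z) \<le> 2 * ?c * eps (Suc (k i)) \<and> near_period a y (t i) (Q i) \<tau>" using tau by blast
  qed
  let ?D0 = "\<Sum>l. \<delta> l" and ?D1 = "\<Sum>l. real l * \<delta> l" and ?D2 = "\<Sum>l. real l powr (1 + \<rho>) * \<delta> l"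
  define s where "s = \<rho> / (2 * (1 + \<rho>))"
  define X1 where "X1 = 2 * (1 + N\<^sup>2) * ?D1"
  define X2 where "X2 = 2 * C * (1 + N\<^sup>2 / (min \<rho> 1 * ln 2)) * ?D2"
  define X3 where "X3 = (2 * ?D2) powr (1 - s) * C powr s / (1 - (1 / 2) powr s) * (\<Sum>q. (real q + 1) powr (- (1 + \<rho> / 2)))"
  have Dpos: "0 \<le> ?D0" "0 \<le> ?D1" "0 \<le> ?D2" using \<delta> by (auto intro!: suminf_nonneg)
  have bound: "eta_bound ?D0 ?D1 ?D2 N \<rho> C = 2 * C * (?D0 + ?D1) + X1 + X2 + X3"
    unfolding eta_bound_def Let_def X1_def X2_def X3_def s_def ..
  have X: "0 \<le> X1" "0 \<le> X2" unfolding X1_def X2_def using Dpos C rho by (auto intro!: mult_nonneg_nonneg add_nonneg_nonneg)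
  have X3s: "(\<Sum>i<n. min (2 * tail (k i)) (C * eps (Suc (k i)) / t i)) \<le> X3" for n
    unfolding X3_def by (rule sum_min_tail[OF C(2) s_def])
  then have X3: "0 \<le> X3" using X3s[of 0] by simp
  show ?thesis
  proof (cases "1 / 2 \<le> r")
    \<comment> \<open>Scales that are not well separated: the fast levels are ignored at every
      radius, with \<open>e = 0\<close>.\<close>
    case True
    have "(\<Sum>i<n. P i + 0 / t i) \<le> eta_bound ?D0 ?D1 ?D2 N \<rho> C" for n
    proof -
      have "(\<Sum>i<n. P i) \<le> 2 * 1 * (?D0 + ?D1) + X1" unfolding P_def X1_def by (rule sum_modulus_large[OF True]) simp
      also have "\<dots> \<le> 2 * C * (?D0 + ?D1) + X1" using C Dpos by (intro add_right_mono mult_right_mono) auto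
      finally show ?thesis unfolding bound using X X3 by simp
    qed
    then show ?thesis using P0 apP unfolding C_def by (intro exI[of _ P] exI[of _ "\<lambda>_. 0"]) auto
  next
    case False
    \<comment> \<open>The cheaper choice at each radius; either way the cost exceeds
      \<open>Q i\<close> by at most the minimum of the tail and the rounding price.\<close>
    define b where "b = (\<lambda>i. 2 * tail (k i) \<le> C * eps (Suc (k i)) / t i)"
    define \<omega> where "\<omega> = (\<lambda>i. if b i then P i else Q i)"
    define e where "e = (\<lambda>i. if b i then 0 else 2 * ?c * eps (Suc (k i)))"
    have eta: "\<omega> i + e i / t i \<le> Q i + min (2 * tail (k i)) (C * eps (Suc (k i)) / t i)" for i
    proof (cases "b i")
      case True
      have "P i \<le> (\<Sum>l. \<delta> l * (C * slow l i + h l i) + 2 * (if k i < l then \<delta> l else 0))"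
        unfolding P_def
      proof (intro suminf_le smP summable_add smQ summable_mult summable_tail)
        fix l
        have "1 * slow l i \<le> C * slow l i" using C slow_nonneg[of l i] by (intro mult_right_mono) auto
        then have "\<delta> l * (1 * slow l i + (if k i < l then 2 else 0)) \<le> \<delta> l * (C * slow l i + h l i + (if k i < l then 2 else 0))"
          using h(1)[of l i] \<delta>(1)[of l] by (intro mult_left_mono) auto
        then show "\<delta> l * (1 * slow l i + (if k i < l then 2 else 0)) \<le> \<delta> l * (C * slow l i + h l i) + 2 * (if k i < l then \<delta> l else 0)"
          by (simp add: algebra_simps split: if_splits)
      qed
      also have "\<dots> = Q i + 2 * tail (k i)"
        unfolding Q_def tail_def by (subst suminf_add[symmetric, OF smQ summable_mult[OF summable_tail]]) (simp add: suminf_mult[OF summable_tail])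
      finally show ?thesis using True unfolding \<omega>_def e_def b_def by simp
    next
      case False
      have "2 * ?c * eps (Suc (k i)) / t i \<le> C * eps (Suc (k i)) / t i"
        unfolding C_def using eps_pos[of "Suc (k i)"] t_pos[of i] by (intro divide_right_mono mult_right_mono) auto
      then show ?thesis using False unfolding \<omega>_def e_def b_def by simp
    qed
    have "(\<Sum>i<n. \<omega> i + e i / t i) \<le> eta_bound ?D0 ?D1 ?D2 N \<rho> C" for n
    proof -
      have "(\<Sum>i<n. \<omega> i + e i / t i) \<le> (\<Sum>i<n. Q i) + (\<Sum>i<n. min (2 * tail (k i)) (C * eps (Suc (k i)) / t i))"
        unfolding sum.distrib[symmetric] by (intro sum_mono eta)
      also have "\<dots> \<le> (2 * C * (?D0 + ?D1) + X2) + X3"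
        unfolding X2_def Q_def h_def by (intro add_mono sum_modulus_small X3s C)
      finally show ?thesis unfolding bound using X by simp
    qed
    moreover have "almost_periodic a y (t i) (\<omega> i) (e i)" if "cball y (t i) \<subseteq> V" for y i
      unfolding \<omega>_def e_def using apP[OF that] apQ[OF _ that] False by simp
    moreover have "0 \<le> \<omega> i \<and> 0 \<le> e i" for i unfolding \<omega>_def e_def using P0 Q0 eps_pos[of "Suc (k i)"] by simp
    ultimately show ?thesis unfolding C_def by (intro exI[of _ \<omega>] exI[of _ e]) auto
  qed
qed

end

subsection \<open>From the weak formulation to Borel data on the whole space\<close>

text \<open>The problem is posed with Lebesgue measurable functions, convolution needs Borel ones.
  Letting \<open>H\<close> see \<open>x\<close> as well covers integrands that contain coefficients
  or test functions.\<close>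

lemma lborel_version:
  fixes g g' :: "'a::euclidean_space \<Rightarrow> 'b::euclidean_space" and H :: "'a \<times> 'b \<Rightarrow> 'c::euclidean_space"
  assumes g: "g \<in> borel_measurable lebesgue" and g': "g' \<in> borel_measurable borel" and ae: "AE x in lborel. g x = g' x"
    and H: "H \<in> borel_measurable borel"
  shows "(LINT x|lebesgue. H (x, g x)) = (LINT x|lborel. H (x, g' x))"
    "integrable lebesgue (\<lambda>x. H (x, g x)) \<longleftrightarrow> integrable lborel (\<lambda>x. H (x, g' x))"
proof -
  have m: "(\<lambda>x. H (x, h x)) \<in> borel_measurable M" if "h \<in> borel_measurable M" "(\<lambda>x. x) \<in> M \<rightarrow>\<^sub>M borel" for h and M :: "'a measure"
  proof (rule measurable_compose[OF _ H])
    show "(\<lambda>x. (x, h x)) \<in> M \<rightarrow>\<^sub>M borel" unfolding borel_prod[symmetric] using that by (intro measurable_Pair)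
  qed
  have id: "(\<lambda>x::'a. x) \<in> lborel \<rightarrow>\<^sub>M borel" "(\<lambda>x::'a. x) \<in> lebesgue \<rightarrow>\<^sub>M borel" by (auto intro: measurable_completion)
  have 1: "(\<lambda>x. H (x, g x)) \<in> borel_measurable lebesgue" by (rule m[OF g id(2)])
  have 2: "(\<lambda>x. H (x, g' x)) \<in> borel_measurable lborel" by (rule m) (use g' in auto)
  have 3: "(\<lambda>x. H (x, g' x)) \<in> borel_measurable lebesgue" by (rule measurable_completion[OF 2])
  have eq: "AE x in lebesgue. H (x, g x) = H (x, g' x)" by (rule AE_completion) (use ae in auto)
  show "(LINT x|lebesgue. H (x, g x)) = (LINT x|lborel. H (x, g' x))"
    using integral_cong_AE[OF 1 3 eq] integral_completion[OF 2] by simp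
  show "integrable lebesgue (\<lambda>x. H (x, g x)) \<longleftrightarrow> integrable lborel (\<lambda>x. H (x, g' x))"
    using integrable_cong_AE[OF 1 3 eq] integrable_completion[OF 2] by simp
qed

lemma borel_version_exists:
  fixes g :: "'a::euclidean_space \<Rightarrow> real^'d"
  assumes g: "g \<in> borel_measurable lebesgue"
  shows "\<exists>g'\<in>borel_measurable borel. AE x in lborel. g x = g' x"
proof -
  have "\<exists>h\<in>borel_measurable lborel. AE x in lborel. g x $ i = h x" for i
    by (rule completion_ex_borel_measurable_real)
      (rule measurable_compose[OF g borel_measurable_continuous_onI], intro continuous_intros)
  then obtain h where h: "\<And>i. h i \<in> borel_measurable lborel" "\<And>i. AE x in lborel. g x $ i = h i x" by metis
  have "(\<lambda>x. \<chi> i. h i x) \<in> borel_measurable borel"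
  proof (subst borel_measurable_euclidean_space, intro ballI)
    fix b :: "real^'d" assume "b \<in> Basis"
    then obtain i where "b = axis i 1" by (auto simp: Basis_vec_def)
    then show "(\<lambda>x. (\<chi> i. h i x) \<bullet> b) \<in> borel_measurable borel" using h(1)[of i] by (simp add: inner_axis)
  qed
  moreover have "AE x in lborel. \<forall>i. g x $ i = h i x" using h(2) by (simp add: AE_all_countable)
  then have "AE x in lborel. g x = (\<chi> i. h i x)" by eventually_elim (simp add: vec_eq_iff)
  ultimately show ?thesis by (intro bexI[of _ "\<lambda>x. \<chi> i. h i x"])
qed

lemma bounded_bilinear_matrix: "bounded_bilinear (\<lambda>(M::real^'d^'d) v. M *v v)"
  unfolding bilinear_conv_bounded_bilinear[symmetric] bilinear_def
  by (auto intro: bounded_linear.linear[OF bounded_linear_matrix_left])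

text \<open>The complement of the closed support is open, so \<open>\<phi>\<close> vanishes near
  \<open>x\<close>; integrals with these gradients over \<open>U\<close> and over the space
  therefore agree.\<close>

lemma grad_zero_outside:
  assumes t: "test_fun U \<phi>" and x: "x \<notin> U"
  shows "partial i \<phi> x = 0" "grad \<phi> x = 0"
proof -
  have "partial i \<phi> x = 0" for i
  proof -
    have "open (- tsupport \<phi>)" "x \<in> - tsupport \<phi>" using t x unfolding test_fun_def tsupport_def by auto
    then obtain e where e: "0 < e" "ball x e \<subseteq> - tsupport \<phi>" unfolding open_contains_ball by blast
    have z: "\<phi> y = 0" if "y \<in> ball x e" for y using e(2) that closure_subset[of "{x. \<phi> x \<noteq> 0}"] unfolding tsupport_def by auto
    have "((\<lambda>t. \<phi> (x + t *\<^sub>R axis i 1)) has_real_derivative 0) (at 0)"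
    proof (rule has_field_derivative_transform_within[of "\<lambda>_. 0", OF _ e(1)])
      fix t :: real assume "dist t 0 < e"
      then show "0 = \<phi> (x + t *\<^sub>R axis i 1)" using z[of "x + t *\<^sub>R axis i 1"] by (simp add: dist_norm)
    qed auto
    then show ?thesis unfolding partial_def by (rule DERIV_imp_deriv)
  qed
  then show "partial i \<phi> x = 0" "grad \<phi> x = 0" unfolding grad_def by (simp_all add: vec_eq_iff)
qed

lemma test_fun_continuous:
  assumes "test_fun U \<phi>"
  shows "continuous_on UNIV \<phi>" "continuous_on UNIV (partial i \<phi>)" "continuous_on UNIV (grad \<phi>)"
proof -
  have c: "continuous_on UNIV (ipartial is \<phi>)" for "is" using assms unfolding test_fun_def smooth_fun_def by blast
  show "continuous_on UNIV \<phi>" using c[of "[]"] by simp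
  have p: "continuous_on UNIV (partial i \<phi>)" for i using c[of "[i]"] by simp
  show "continuous_on UNIV (partial i \<phi>)" by (rule p)
  show "continuous_on UNIV (grad \<phi>)" unfolding grad_def[abs_def] by (intro continuous_on_vec_lambda p)
qed

text \<open>The nearest-point projection onto a compact convex set extends the coefficients:
  ellipticity and the bound are inherited from the values in \<open>K\<close>, and uniform
  continuity holds because the projection is 1-Lipschitz.\<close>

lemma elliptic_extension:
  fixes B :: "nat \<Rightarrow> (nat \<Rightarrow> real^'d) \<Rightarrow> real^'d^'d" and eps :: "nat \<Rightarrow> real"
  assumes st: "standing_B B Om \<mu> \<delta>" and K: "convex K" "compact K" "K \<noteq> {}" "K \<subseteq> Om" and La: "(\<Sum>l. \<delta> l) \<le> \<Lambda>"
  defines "a \<equiv> \<lambda>x \<xi>. Aeps B eps (closest_point K x) *v \<xi>"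
  shows "elliptic a \<mu> \<Lambda>" "\<forall>\<epsilon>>0. \<exists>d>0. \<forall>x z \<xi>. norm z < d \<longrightarrow> norm (a (x + z) \<xi> - a x \<xi>) \<le> \<epsilon> * norm \<xi>"
proof -
  have cK: "closed K" using K by (simp add: compact_imp_closed)
  have in': "closest_point K x \<in> Om" "closest_point K x \<in> K" for x using closest_point_in_set[OF cK K(3)] K(4) by auto
  have cA: "continuous_on K (Aeps B eps)" using Aeps_continuous[OF st] K(4) by (rule continuous_on_subset)
  have cAc: "continuous_on UNIV (\<lambda>p::(real^'d) \<times> (real^'d). Aeps B eps (closest_point K (fst p)))"
    by (rule continuous_on_compose2[OF cA]) (auto intro!: continuous_on_compose2[OF continuous_on_closest_point[OF K(1) cK K(3), of UNIV]] continuous_intros in'(2))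
  have cont: "continuous_on UNIV (\<lambda>(x, \<xi>). a x \<xi>)"
    unfolding a_def case_prod_unfold
    by (rule bounded_bilinear.continuous_on[OF bounded_bilinear_matrix cAc]) (intro continuous_intros)
  have "norm (a x \<xi>) \<le> \<Lambda> * norm \<xi>" for x \<xi>
  proof -
    have "norm (a x \<xi>) \<le> (\<Sum>l. \<delta> l) * norm \<xi>" unfolding a_def by (rule Aeps_elliptic(2)[OF st in'(1)])
    also have "\<dots> \<le> \<Lambda> * norm \<xi>" by (intro mult_right_mono La) auto
    finally show ?thesis .
  qed
  then show "elliptic a \<mu> \<Lambda>"
    unfolding elliptic_def using cont Aeps_elliptic(1)[OF st in'(1)] by (auto simp: a_def)
  obtain c where c: "0 < c" "\<And>(M::real^'d^'d) v. norm (M *v v) \<le> norm M * norm v * c"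
    using bounded_bilinear.pos_bounded[OF bounded_bilinear_matrix] by blast
  show "\<forall>\<epsilon>>0. \<exists>d>0. \<forall>x z \<xi>. norm z < d \<longrightarrow> norm (a (x + z) \<xi> - a x \<xi>) \<le> \<epsilon> * norm \<xi>"
  proof (intro allI impI)
    fix \<epsilon> :: real assume eps: "0 < \<epsilon>"
    have "uniformly_continuous_on K (Aeps B eps)" using cA K(2) by (rule compact_uniformly_continuous)
    then obtain d where d: "0 < d" "\<And>x x'. x \<in> K \<Longrightarrow> x' \<in> K \<Longrightarrow> dist x' x < d \<Longrightarrow> dist (Aeps B eps x') (Aeps B eps x) < \<epsilon> / c"
      unfolding uniformly_continuous_on_def using eps c by (metis divide_pos_pos)
    have "norm (a (x + z) \<xi> - a x \<xi>) \<le> \<epsilon> * norm \<xi>" if z: "norm z < d" for x z \<xi>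
    proof -
      let ?M = "Aeps B eps (closest_point K (x + z)) - Aeps B eps (closest_point K x)"
      have "dist (closest_point K (x + z)) (closest_point K x) \<le> dist (x + z) x" by (rule closest_point_lipschitz[OF K(1) cK K(3)])
      then have "norm ?M \<le> \<epsilon> / c" using d(2)[OF in'(2) in'(2), of "x + z" x] z by (simp add: dist_norm)
      then have "norm ?M * norm \<xi> * c \<le> \<epsilon> / c * norm \<xi> * c" using c by (intro mult_right_mono) auto
      also have "\<dots> = \<epsilon> * norm \<xi>" using c by simp
      finally show ?thesis using c(2)[of ?M \<xi>] unfolding a_def by (simp add: matrix_vector_mult_diff_rdistrib)
    qed
    then show "\<exists>d>0. \<forall>x z \<xi>. norm z < d \<longrightarrow> norm (a (x + z) \<xi> - a x \<xi>) \<le> \<epsilon> * norm \<xi>" using d(1) by blast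
  qed
qed

text \<open>Extension by zero and passage to Borel versions. The integrals over \<open>U\<close> are
  unchanged, and test functions supported in \<open>V\<close> see only points where \<open>a\<close>
  and \<open>A\<close> agree.\<close>

lemma weak_solution_weak_data:
  fixes A :: "real^'d \<Rightarrow> real^'d^'d" and f u :: "real^'d \<Rightarrow> real"
  assumes ws: "weak_solution A f U u G" and f: "Lp_on p U f" and p: "0 < p" and U: "open U" "bounded U"
    and V: "V \<subseteq> U" and ell: "elliptic a \<mu> \<Lambda>" and a: "\<And>x \<xi>. x \<in> V \<Longrightarrow> a x \<xi> = A x *v \<xi>"
  shows "\<exists>u' G' f'. weak_data a V u' G' f' \<and> integrable lborel (\<lambda>x. \<bar>f' x\<bar> powr p) \<and>
    (LINT x|lborel. (norm (G' x))\<^sup>2) = (LINT x:U|lebesgue. (norm (G x))\<^sup>2) \<and>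
    (LINT x|lborel. \<bar>f' x\<bar> powr p) = (LINT x:U|lebesgue. \<bar>f x\<bar> powr p) \<and>
    (AE x in lebesgue. x \<in> U \<longrightarrow> G' x = G x)"
proof -
  define uU gU fU where "uU = (\<lambda>x. indicator U x *\<^sub>R u x)" and "gU = (\<lambda>x. indicator U x *\<^sub>R G x)" and "fU = (\<lambda>x. indicator U x *\<^sub>R f x)"
  have H1: "H1_with_grad U u G" using ws unfolding weak_solution_def by blast
  have m: "uU \<in> borel_measurable lebesgue" "gU \<in> borel_measurable lebesgue" "fU \<in> borel_measurable lebesgue"
    using H1 f unfolding H1_with_grad_def Lp_on_def set_borel_measurable_def uU_def gU_def fU_def by auto
  obtain u' where u': "u' \<in> borel_measurable lborel" "AE x in lborel. uU x = u' x" using completion_ex_borel_measurable_real[OF m(1)] by blast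
  obtain f' where f': "f' \<in> borel_measurable lborel" "AE x in lborel. fU x = f' x" using completion_ex_borel_measurable_real[OF m(3)] by blast
  obtain G' where G': "G' \<in> borel_measurable borel" "AE x in lborel. gU x = G' x" using borel_version_exists[OF m(2)] by blast
  have ub: "u' \<in> borel_measurable borel" and fb: "f' \<in> borel_measurable borel" using u' f' by auto
  note Lu = lborel_version[OF m(1) ub u'(2)] and Lf = lborel_version[OF m(3) fb f'(2)] and LG = lborel_version[OF m(2) G']
  have iU: "integrable lebesgue (indicator U :: _ \<Rightarrow> real)"
    using U emeasure_bounded_finite[OF U(2)] by (auto intro!: integrable_real_indicator)
  \<comment> \<open>On a set of finite measure square integrability implies integrability through
    \<open>2 * y \<le> 1 + y\<^sup>2\<close>.\<close>
  have L1: "integrable lebesgue F" if F: "F \<in> borel_measurable lebesgue" "\<And>x. x \<notin> U \<Longrightarrow> F x = 0" "integrable lebesgue (\<lambda>x. (norm (F x))\<^sup>2)" for F :: "real^'d \<Rightarrow> 'b::euclidean_space"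
  proof (rule Bochner_Integration.integrable_bound[OF Bochner_Integration.integrable_add[OF iU F(3)] F(1)])
    have "norm (F x) \<le> norm (indicator U x + (norm (F x))\<^sup>2)" for x
    proof (cases "x \<in> U")
      case True
      have "2 * norm (F x) \<le> 1 + (norm (F x))\<^sup>2" using sum_power2_ge_zero[of "norm (F x) - 1" 0] by (simp add: power2_diff)
      moreover have "0 \<le> norm (F x)" by simp
      ultimately show ?thesis using True by (simp del: norm_ge_zero)
    qed (use F(2) in simp)
    then show "AE x in lebesgue. norm (F x) \<le> norm (indicator U x + (norm (F x))\<^sup>2)" by simp
  qed
  have u2: "integrable lebesgue (\<lambda>x. (norm (uU x))\<^sup>2)"
  proof -
    have "(norm (uU x))\<^sup>2 = indicator U x *\<^sub>R (u x)\<^sup>2" for x unfolding uU_def by (simp add: indicator_def)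
    then show ?thesis using H1 unfolding H1_with_grad_def set_integrable_def by simp
  qed
  have gn: "(norm (gU x))\<^sup>2 = indicator U x *\<^sub>R (norm (G x))\<^sup>2" for x unfolding gU_def by (simp add: indicator_def)
  have G2: "integrable lebesgue (\<lambda>x. (norm (gU x))\<^sup>2)"
    using H1 unfolding H1_with_grad_def set_integrable_def gn by simp
  have iu: "integrable lborel u'"
    using Lu(2)[of snd] L1[OF m(1) _ u2] by (simp add: uU_def borel_measurable_continuous_onI continuous_on_snd)
  have iG: "integrable lborel G'"
    using LG(2)[of snd] L1[OF m(2) _ G2] by (simp add: gU_def borel_measurable_continuous_onI continuous_on_snd)
  have nb: "(\<lambda>p::(real^'d) \<times> (real^'d). (norm (snd p))\<^sup>2) \<in> borel_measurable borel"
    by (intro borel_measurable_continuous_onI continuous_intros)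
  have iG2: "integrable lborel (\<lambda>x. (norm (G' x))\<^sup>2)" "(LINT x|lborel. (norm (G' x))\<^sup>2) = (LINT x:U|lebesgue. (norm (G x))\<^sup>2)"
    using LG(2)[OF nb] LG(1)[OF nb] G2 unfolding set_lebesgue_integral_def by (auto simp: gn)
  have pb: "(\<lambda>q::(real^'d) \<times> real. \<bar>snd q\<bar> powr p) \<in> borel_measurable borel"
  proof -
    have "(\<lambda>v::real. \<bar>v\<bar> powr p) \<in> borel_measurable borel" by measurable
    moreover have "(snd :: (real^'d) \<times> real \<Rightarrow> real) \<in> borel \<rightarrow>\<^sub>M borel" by (intro borel_measurable_continuous_onI continuous_intros)
    ultimately show ?thesis by (rule measurable_compose[rotated])
  qed
  have fn: "\<bar>fU x\<bar> powr p = indicator U x *\<^sub>R \<bar>f x\<bar> powr p" for x unfolding fU_def using p by (simp add: indicator_def)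
  have ip: "integrable lborel (\<lambda>x. \<bar>f' x\<bar> powr p)" "(LINT x|lborel. \<bar>f' x\<bar> powr p) = (LINT x:U|lebesgue. \<bar>f x\<bar> powr p)"
    using Lf(2)[OF pb] Lf(1)[OF pb] f unfolding set_lebesgue_integral_def Lp_on_def set_integrable_def by (auto simp: fn)
  have tU: "test_fun U \<phi>" if "test_fun V \<phi>" for \<phi> using that V unfolding test_fun_def by auto
  have w1: "(LINT x|lborel. u' x * partial i \<phi> x) = - (LINT x|lborel. G' x $ i * \<phi> x)" if t: "test_fun V \<phi>" for \<phi> i
  proof -
    note c = test_fun_continuous[OF t]
    have b1: "(\<lambda>q::(real^'d) \<times> real. snd q * partial i \<phi> (fst q)) \<in> borel_measurable borel"
      by (intro borel_measurable_continuous_onI continuous_intros continuous_on_compose2[OF c(2)]) auto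
    have b2: "(\<lambda>q::(real^'d) \<times> (real^'d). snd q $ i * \<phi> (fst q)) \<in> borel_measurable borel"
      by (intro borel_measurable_continuous_onI continuous_intros continuous_on_compose2[OF c(1)]) auto
    have "(LINT x|lborel. u' x * partial i \<phi> x) = (LINT x:U|lebesgue. u x * partial i \<phi> x)"
      using Lu(1)[OF b1] unfolding set_lebesgue_integral_def uU_def by (simp add: mult.assoc)
    also have "\<dots> = - (LINT x:U|lebesgue. G x $ i * \<phi> x)"
      using H1 tU[OF t] unfolding H1_with_grad_def by blast
    also have "(LINT x:U|lebesgue. G x $ i * \<phi> x) = (LINT x|lborel. G' x $ i * \<phi> x)"
      using LG(1)[OF b2] unfolding set_lebesgue_integral_def gU_def by (simp add: mult.assoc)
    finally show ?thesis .
  qed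
  have w2: "(LINT x|lborel. a x (G' x) \<bullet> grad \<phi> x) = (LINT x|lborel. f' x * \<phi> x)" if t: "test_fun V \<phi>" for \<phi>
  proof -
    note c = test_fun_continuous[OF t]
    have ca: "continuous_on UNIV (\<lambda>q. a (fst q) (snd q))" using ell unfolding elliptic_def case_prod_unfold by simp
    have b1: "(\<lambda>q::(real^'d) \<times> (real^'d). a (fst q) (snd q) \<bullet> grad \<phi> (fst q)) \<in> borel_measurable borel"
      by (intro borel_measurable_continuous_onI continuous_on_inner ca continuous_on_compose2[OF c(3)] continuous_intros) auto
    have b2: "(\<lambda>q::(real^'d) \<times> real. snd q * \<phi> (fst q)) \<in> borel_measurable borel"
      by (intro borel_measurable_continuous_onI continuous_intros continuous_on_compose2[OF c(1)]) auto
    have pt: "a x (gU x) \<bullet> grad \<phi> x = indicator U x *\<^sub>R ((A x *v G x) \<bullet> grad \<phi> x)" for x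
    proof (cases "x \<in> V")
      case True
      then show ?thesis using V a unfolding gU_def by auto
    qed (simp add: grad_zero_outside[OF t])
    have "(LINT x|lborel. a x (G' x) \<bullet> grad \<phi> x) = (LINT x:U|lebesgue. (A x *v G x) \<bullet> grad \<phi> x)"
      using LG(1)[OF b1] unfolding set_lebesgue_integral_def by (simp add: pt)
    also have "\<dots> = (LINT x:U|lebesgue. f x * \<phi> x)"
      using ws tU[OF t] unfolding weak_solution_def by blast
    also have "\<dots> = (LINT x|lborel. f' x * \<phi> x)"
      using Lf(1)[OF b2] unfolding set_lebesgue_integral_def fU_def by (simp add: mult.assoc)
    finally show ?thesis .
  qed
  have "AE x in lebesgue. x \<in> U \<longrightarrow> G' x = G x"
  proof (rule AE_completion)
    show "AE x in lborel. x \<in> U \<longrightarrow> G' x = G x" using G'(2) by eventually_elim (auto simp: gU_def)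
  qed
  moreover have "weak_data a V u' G' f'" unfolding weak_data_def using iu iG iG2 fb w1 w2 by blast
  ultimately show ?thesis using ip iG2 by blast
qed

theorem theorem4p14:
  fixes \<mu> p N \<rho> D0 D1 D1\<rho> :: real
  assumes "\<mu> > 0" and "p > real CARD('d)" and "N \<ge> 1" and "\<rho> > 0"
  shows "\<exists>C>0. \<forall>(B :: nat \<Rightarrow> (nat \<Rightarrow> real^'d) \<Rightarrow> real^'d^'d) Om \<delta> eps x0 R f u G.
     standing_B B Om \<mu> \<delta> \<and> 0 < R \<and> R \<le> 1 \<and> ball x0 R \<subseteq> Om \<and>
     (\<Sum>l. \<delta> l) = D0 \<and>
     summable (\<lambda>l. real l * \<delta> l) \<and> (\<Sum>l. real l * \<delta> l) = D1 \<and>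
     summable (\<lambda>l. real l powr (1 + \<rho>) * \<delta> l) \<and> (\<Sum>l. real l powr (1 + \<rho>) * \<delta> l) = D1\<rho> \<and>
     scales eps \<and> ratio_cond eps N \<and>
     Lp_on p (ball x0 R) f \<and>
     weak_solution (Aeps B eps) f (ball x0 R) u G
     \<longrightarrow> (AE x in lebesgue. x \<in> ball x0 (R / 2) \<longrightarrow>
           norm (G x) \<le> C * (sqrt (avg_int (ball x0 R) (\<lambda>y. (norm (G y))\<^sup>2))
                            + R * (avg_int (ball x0 R) (\<lambda>y. \<bar>f y\<bar> powr p)) powr (1 / p)))"
proof -
  have "1 \<le> real CARD('d)" by (simp add: Suc_leI)
  then have p: "0 < p" using assms(2) by linarith
  \<comment> \<open>\<open>D0\<close> is an arbitrary real number fixed before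
    \<open>\<delta>\<close>; its absolute value is a nonnegative bound for the coefficients.\<close>
  have La: "0 \<le> \<bar>D0\<bar>" by simp
  obtain m :: nat and C0 where m: "2 \<le> m" and C0: "0 < C0" and main: "\<And>(a::real^'d \<Rightarrow> real^'d \<Rightarrow> real^'d) x0 R u G f \<omega> e S.
    elliptic a \<mu> \<bar>D0\<bar> \<Longrightarrow> 0 < R \<Longrightarrow> weak_data a (ball x0 (3 * R / 4)) u G f \<Longrightarrow> integrable lborel (\<lambda>x. \<bar>f x\<bar> powr p) \<Longrightarrow>
    (\<forall>\<epsilon>>0. \<exists>\<delta>>0. \<forall>x z \<xi>. norm z < \<delta> \<longrightarrow> norm (a (x + z) \<xi> - a x \<xi>) \<le> \<epsilon> * norm \<xi>) \<Longrightarrow>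
    (\<forall>y\<in>ball x0 (R / 2). \<forall>k. almost_periodic a y (R / 16 / real m ^ k) (\<omega> k) (e k)) \<Longrightarrow> (\<forall>k. 0 \<le> \<omega> k \<and> 0 \<le> e k) \<Longrightarrow>
    (\<forall>n. (\<Sum>k<n. \<omega> k + e k / (R / 16 / real m ^ k)) \<le> S) \<Longrightarrow>
    (AE x in lborel. x \<in> ball x0 (R / 2) \<longrightarrow> norm (G x) \<le> C0 * exp (C0 * S) *
       (sqrt ((LINT x|lborel. (norm (G x))\<^sup>2) / R ^ CARD('d)) + R * ((LINT x|lborel. \<bar>f x\<bar> powr p) / R ^ CARD('d)) powr (1 / p)))"
    using weak_lipschitz[OF assms(1) La assms(2)] by blast
  define w where "w = unit_ball_vol (real CARD('d))"
  have w: "0 < w" unfolding w_def by simp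
  define S where "S = eta_bound D0 D1 D1\<rho> N \<rho> (1 + 2 * real CARD('d))"
  \<comment> \<open>Converts integrals divided by \<open>R ^ d\<close> into averages: the volume
    \<open>w\<close> comes out under a square root and under a p-th root.\<close>
  define M where "M = sqrt w + w powr (1 / p)"
  have M: "sqrt w \<le> M" "w powr (1 / p) \<le> M" "0 < M" unfolding M_def using w by (auto intro: add_pos_pos)
  define C where "C = C0 * exp (C0 * S) * M"
  have C: "0 < C" unfolding C_def using C0 M by simp
  have "AE x in lebesgue. x \<in> ball x0 (R / 2) \<longrightarrow>
           norm (G x) \<le> C * (sqrt (avg_int (ball x0 R) (\<lambda>y. (norm (G y))\<^sup>2))
                            + R * (avg_int (ball x0 R) (\<lambda>y. \<bar>f y\<bar> powr p)) powr (1 / p))"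
    if st: "standing_B B Om \<mu> \<delta>" and R: "0 < R" "R \<le> 1" and Om: "ball x0 R \<subseteq> Om" and D0: "(\<Sum>l. \<delta> l) = D0"
      and D1: "summable (\<lambda>l. real l * \<delta> l)" "(\<Sum>l. real l * \<delta> l) = D1"
      and D2: "summable (\<lambda>l. real l powr (1 + \<rho>) * \<delta> l)" "(\<Sum>l. real l powr (1 + \<rho>) * \<delta> l) = D1\<rho>"
      and sc: "scales eps" and rc: "ratio_cond eps N" and f: "Lp_on p (ball x0 R) f"
      and ws: "weak_solution (Aeps B eps) f (ball x0 R) u G"
    for B :: "nat \<Rightarrow> (nat \<Rightarrow> real^'d) \<Rightarrow> real^'d^'d" and Om \<delta> eps x0 R f u G
  proof -
    \<comment> \<open>The radius \<open>3 * R / 4\<close> leaves room: the closed ball is compact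
      inside the domain and contains all balls of radius \<open>R / 8\<close> around points of the
      half ball.\<close>
    let ?K = "cball x0 (3 * R / 4)" and ?V = "ball x0 (3 * R / 4)" and ?U = "ball x0 R"
    have KU: "?K \<subseteq> ?U" "?V \<subseteq> ?K" "?V \<subseteq> ?U" using R by auto
    define a where "a = (\<lambda>x \<xi>. Aeps B eps (closest_point ?K x) *v \<xi>)"
    have K: "convex ?K" "compact ?K" "?K \<noteq> {}" "?K \<subseteq> Om" using R KU Om by auto
    have "(\<Sum>l. \<delta> l) \<le> \<bar>D0\<bar>" using D0 by simp
    note ell = elliptic_extension[OF st K this, where eps = eps]
    have ell: "elliptic a \<mu> \<bar>D0\<bar>" "\<forall>\<epsilon>>0. \<exists>d>0. \<forall>x z \<xi>. norm z < d \<longrightarrow> norm (a (x + z) \<xi> - a x \<xi>) \<le> \<epsilon> * norm \<xi>"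
      unfolding a_def using ell by blast+
    have a: "a x \<xi> = Aeps B eps x *v \<xi>" if "x \<in> ?V" for x \<xi> unfolding a_def using that KU by (simp add: closest_point_self subset_iff)
    obtain u' G' f' where wd: "weak_data a ?V u' G' f'" "integrable lborel (\<lambda>x. \<bar>f' x\<bar> powr p)"
      "(LINT x|lborel. (norm (G' x))\<^sup>2) = (LINT x:?U|lebesgue. (norm (G x))\<^sup>2)"
      "(LINT x|lborel. \<bar>f' x\<bar> powr p) = (LINT x:?U|lebesgue. \<bar>f x\<bar> powr p)"
      and GG: "AE x in lebesgue. x \<in> ?U \<longrightarrow> G' x = G x"
      using weak_solution_weak_data[OF ws f p open_ball bounded_ball KU(3) ell(1) a] by blast
    have t: "0 < R / 16 / real m ^ i \<and> R / 16 / real m ^ i \<le> R / 16" for i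
    proof -
      have "1 \<le> real m ^ i" using m by (intro one_le_power) simp
      then show ?thesis using R m by (simp add: divide_le_eq)
    qed
    \<comment> \<open>Here \<open>R \<le> 1\<close> places all radii below \<open>eps 0 = 1\<close>,
      so each of them falls between two scales.\<close>
    have "\<exists>k. eps (Suc k) < R / 16 / real m ^ i \<and> R / 16 / real m ^ i \<le> eps k" for i
      by (rule scale_index_exists[OF sc]) (use t[of i] R in auto)
    then obtain k where k: "\<And>i. eps (Suc (k i)) < R / 16 / real m ^ i" "\<And>i. R / 16 / real m ^ i \<le> eps (k i)" by metis
    interpret multiscale eps \<delta> N \<rho> "R / 16" m k
      by unfold_locales (use sc rc assms m R D1 D2 k delta_nonneg[OF st] delta_summable[OF st] in auto)
    have VOm: "?V \<subseteq> Om" using KU K(4) by blast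
    obtain \<omega> e where oe: "\<forall>i. 0 \<le> \<omega> i \<and> 0 \<le> e i"
      and ap: "\<forall>y i. cball y (R / 16 / real m ^ i) \<subseteq> ?V \<longrightarrow> almost_periodic a y (R / 16 / real m ^ i) (\<omega> i) (e i)"
      and sum: "\<forall>n. (\<Sum>i<n. \<omega> i + e i / (R / 16 / real m ^ i)) \<le> S"
      using almost_periods_Aeps[where V = ?V and a = a, OF st VOm a] unfolding S_def D0 D1 D2 t_def by blast
    have ap': "\<forall>y\<in>ball x0 (R / 2). \<forall>k. almost_periodic a y (R / 16 / real m ^ k) (\<omega> k) (e k)"
    proof (intro ballI allI)
      fix y i assume y: "y \<in> ball x0 (R / 2)"
      have "cball y (R / 16 / real m ^ i) \<subseteq> ?V"
      proof
        fix x assume "x \<in> cball y (R / 16 / real m ^ i)"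
        then show "x \<in> ?V" using y t[of i] R dist_triangle[of x0 x y] by simp
      qed
      then show "almost_periodic a y (R / 16 / real m ^ i) (\<omega> i) (e i)" using ap by blast
    qed
    let ?I2 = "LINT x:?U|lebesgue. (norm (G x))\<^sup>2" and ?Ip = "LINT x:?U|lebesgue. \<bar>f x\<bar> powr p"
    have vol: "measure lebesgue ?U = w * R ^ CARD('d)" unfolding w_def using R by (simp add: content_ball)
    have nn: "0 \<le> ?I2" "0 \<le> ?Ip" unfolding set_lebesgue_integral_def by (auto intro!: Bochner_Integration.integral_nonneg)
    let ?A2 = "avg_int ?U (\<lambda>y. (norm (G y))\<^sup>2)" and ?Ap = "avg_int ?U (\<lambda>y. \<bar>f y\<bar> powr p)"
    have I2: "?I2 / R ^ CARD('d) = w * ?A2" and Ip: "?Ip / R ^ CARD('d) = w * ?Ap" unfolding avg_int_def vol using w by simp_all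
    have A0: "0 \<le> ?A2" "0 \<le> ?Ap" unfolding avg_int_def using nn by simp_all
    have "sqrt (w * ?A2) + R * (w * ?Ap) powr (1 / p) \<le> M * (sqrt ?A2 + R * ?Ap powr (1 / p))"
    proof -
      have "sqrt (w * ?A2) \<le> M * sqrt ?A2" unfolding real_sqrt_mult using M A0 by (intro mult_right_mono) auto
      moreover have "w powr (1 / p) * (R * ?Ap powr (1 / p)) \<le> M * (R * ?Ap powr (1 / p))" using M R by (intro mult_right_mono) auto
      ultimately show ?thesis unfolding powr_mult by (simp add: algebra_simps)
    qed
    then have le: "C0 * exp (C0 * S) * (sqrt (w * ?A2) + R * (w * ?Ap) powr (1 / p)) \<le> C * (sqrt ?A2 + R * ?Ap powr (1 / p))"
      unfolding C_def mult.assoc[of "C0 * exp (C0 * S)"] using C0 by (intro mult_left_mono) auto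
    have "AE x in lborel. x \<in> ball x0 (R / 2) \<longrightarrow> norm (G' x) \<le> C0 * exp (C0 * S) * (sqrt (w * ?A2) + R * (w * ?Ap) powr (1 / p))"
      using main[OF ell(1) R(1) wd(1,2) ell(2) ap' oe sum] unfolding wd(3,4) I2 Ip .
    then have "AE x in lebesgue. x \<in> ball x0 (R / 2) \<longrightarrow> norm (G' x) \<le> C0 * exp (C0 * S) * (sqrt (w * ?A2) + R * (w * ?Ap) powr (1 / p))"
      by (rule AE_completion)
    then show ?thesis using GG
    proof eventually_elim
      case (elim x)
      show ?case
      proof
        assume x: "x \<in> ball x0 (R / 2)"
        then have "x \<in> ?U" using R by simp
        then show "norm (G x) \<le> C * (sqrt ?A2 + R * ?Ap powr (1 / p))" using elim x le by simp
      qed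
    qed
  qed
  then show ?thesis using C by blast
qed

end
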